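(* Let $n\ge1$, let $\mathbf{n}=(n_1,\dots,n_r)$ be a partition $n=n_1+\dots+n_r$ with integers $n_i\ge1$, and let $\pi_1,\dots,\pi_r$ be representations of finite length of $G_{n_1},\dots,G_{n_r}$ respectively. Let $M$ be an $\mathfrak{o}$-module of finite length generated by at most $n$ elements. Then there exists an isomorphism of complex vector spaces $$(\pi_1\times\cdots\times\pi_r)^{\mathbb{K}_{n,[M]}}\cong\bigoplus_{\mathrm{F}_\bullet M}\pi_1^{\mathbb{K}_{n_1,[\mathrm{Gr}_1^{\mathrm{F}}M]}}\otimes\cdots\otimes\pi_r^{\mathbb{K}_{n_r,[\mathrm{Gr}_r^{\mathrm{F}}M]}},$$ where $\mathrm{F}_\bullet M$ runs over the set of $\mathbf{n}$-admissible filtrations of $M$, i.e. the increasing filtrations $0=\mathrm{F}_0M\subset\cdots\subset\mathrm{F}_rM=M$ by $\mathfrak{o}$-submodules such that for $i=1,\dots,r$ the $\mathfrak{o}$-module $\mathrm{Gr}_i^{\mathrm{F}}M=\mathrm{F}_iM/\mathrm{F}_{i-1}M$ is generated by at most $n_i$ elements.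
   Context: $F$ is a non-archimedean local field of characteristic zero with ring of integers $\mathfrak{o}$ and maximal ideal $\mathfrak{p}$; $G_k=\mathrm{GL}_k(F)$. Representations are smooth and complex; $\pi_1\times\dots\times\pi_r$ is the representation of $G_n$ parabolically induced from $\pi_1\boxtimes\dots\boxtimes\pi_r$ on the standard Levi subgroup $G_{n_1}\times\dots\times G_{n_r}$. $[M]$ denotes the isomorphism class of an $\mathfrak{o}$-module $M$. For $\mathfrak{o}$-lattices $L_1\supset L_2$ in $F^n$ (column vectors, $G_n$ acting on the left), $\mathbb{K}_{L_1,L_2}$ is the compact open subgroup of $g\in G_n$ with $gL_1=L_1$, $gL_2=L_2$ and such that $g$ induces the identity on $L_1/L_2$. The $G_n$-conjugacy class of $\mathbb{K}_{L_1,L_2}$ depends only on $n$ and on the isomorphism class of $L_1/L_2$; for $M$ of finite length generated by at most $n$ elements, $\mathbb{K}_{n,[M]}$ denotes $\mathbb{K}_{L_1,L_2}$ for any choice of $L_1\supset L_2$ in $F^n$ with $L_1/L_2\cong M$ (well defined up to conjugation). Concretely, if $M\cong\bigoplus_{i=1}^n\mathfrak{o}/\mathfrak{p}^{\lambda_i}$ with $0\le\lambda_1\le\dots\le\lambda_n$, then $\mathbb{K}_{n,[M]}$ is conjugate to $\{(k_{i,j})\in\mathrm{GL}_n(\mathfrak{o}):k_{i,j}\equiv\delta_{i,j}\bmod\mathfrak{p}^{\lambda_i}\}$. *)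

theory Defs
  imports Complex_Main "Jordan_Normal_Form.VS_Connect" "HOL-Algebra.QuotRing"
begin

hide_const (open) Modules.module_hom Module.submodule

section \<open>Non-archimedean local fields\<close>

text \<open>The field \<open>F\<close> is a type of class \<^class>\<open>field_char_0\<close> with its normalized discrete valuation
  \<open>v\<close>; the value \<open>v 0\<close> is irrelevant, as \<open>0\<close> is treated separately throughout.
  \<open>frac_ideal v m\<close> is \<open>\<pp>\<^sup>m\<close>.\<close>

definition frac_ideal :: "('f::field \<Rightarrow> int) \<Rightarrow> int \<Rightarrow> 'f set" where
  "frac_ideal v m = {x. x = 0 \<or> m \<le> v x}"

definition val_ring :: "('f::field \<Rightarrow> int) \<Rightarrow> 'f ring" where
  "val_ring v = class_ring\<lparr>carrier := frac_ideal v 0\<rparr>"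

definition max_ideal :: "('f::field \<Rightarrow> int) \<Rightarrow> 'f set" where
  "max_ideal v = frac_ideal v 1"

definition residue_field :: "('f::field \<Rightarrow> int) \<Rightarrow> 'f set ring" where
  "residue_field v = val_ring v Quot max_ideal v"

locale nonarch_local_field =
  fixes v :: "'f::field_char_0 \<Rightarrow> int"
  assumes v_mult: "x \<noteq> 0 \<Longrightarrow> y \<noteq> 0 \<Longrightarrow> v (x * y) = v x + v y"
    and v_add: "x \<noteq> 0 \<Longrightarrow> y \<noteq> 0 \<Longrightarrow> x + y \<noteq> 0 \<Longrightarrow> min (v x) (v y) \<le> v (x + y)"
    and uniformizer: "\<exists>x. x \<noteq> 0 \<and> v x = 1"
    and complete: "\<And>X :: nat \<Rightarrow> 'f. (\<And>m. \<exists>N. \<forall>i\<ge>N. \<forall>j\<ge>N. X i - X j \<in> frac_ideal v m) \<Longrightarrow>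
      \<exists>l. \<forall>m. \<exists>N. \<forall>i\<ge>N. X i - l \<in> frac_ideal v m"
    and finite_residue_field: "finite (carrier (residue_field v))"

text \<open>Normalized absolute value \<open>\<bar>x\<bar> = q\<^bsup>-v(x)\<^esup>\<close>, where \<open>q\<close> is the order of the residue field.\<close>

definition norm_abs :: "('f::field \<Rightarrow> int) \<Rightarrow> 'f \<Rightarrow> real" where
  "norm_abs v x = (if x = 0 then 0 else real (card (carrier (residue_field v))) powi (- v x))"


section \<open>Modules\<close>

definition modules_isomorphic ::
  "('r, 'c) ring_scheme \<Rightarrow> ('r, 'a, 'd) module_scheme \<Rightarrow> ('r, 'b, 'e) module_scheme \<Rightarrow> bool" where
  "modules_isomorphic R M N \<longleftrightarrow>
    (\<exists>\<phi>\<in>module_hom R M N. bij_betw \<phi> (carrier M) (carrier N))"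

text \<open>The quotient module \<open>M/N\<close>, on the set of cosets of \<open>N\<close>. The union in the scalar
  multiplication is over sets that all coincide.\<close>

definition quotient_module :: "('r, 'a, 'd) module_scheme \<Rightarrow> 'a set \<Rightarrow> ('r, 'a set) module" where
  "quotient_module M N = \<lparr>
    carrier = a_rcosets\<^bsub>M\<^esub> N,
    mult = undefined,
    one = undefined,
    zero = N,
    add = set_add M,
    smult = (\<lambda>r X. \<Union>x\<in>X. N +>\<^bsub>M\<^esub> (r \<odot>\<^bsub>M\<^esub> x))\<rparr>"

definition generated_by_at_most ::
  "('r, 'c) ring_scheme \<Rightarrow> ('r, 'a, 'd) module_scheme \<Rightarrow> nat \<Rightarrow> bool" where
  "generated_by_at_most R M n \<longleftrightarrow>
    (\<exists>S\<subseteq>carrier M. finite S \<and> card S \<le> n \<and> LinearCombinations.module.span R M S = carrier M)"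

text \<open>Length is the supremum of the lengths of strict chains of subobjects; it is finite iff the
  cardinality of chains is bounded.\<close>

definition bounded_chains :: "'a set set \<Rightarrow> bool" where
  "bounded_chains \<S> \<longleftrightarrow> (\<exists>N. \<forall>C\<subseteq>\<S>. chain\<^sub>\<subseteq> C \<longrightarrow> finite C \<and> card C \<le> N)"

definition finite_length_module ::
  "('r, 'c) ring_scheme \<Rightarrow> ('r, 'a, 'd) module_scheme \<Rightarrow> bool" where
  "finite_length_module R M \<longleftrightarrow> module R M \<and> bounded_chains {N. submodule R N M}"

definition direct_sum_family :: "'i set \<Rightarrow> ('i \<Rightarrow> ('r, 'a) module) \<Rightarrow> ('r, 'i \<Rightarrow> 'a) module" where
  "direct_sum_family I W = \<lparr>
    carrier = {f \<in> (\<Pi>\<^sub>E i\<in>I. carrier (W i)). finite {i \<in> I. f i \<noteq> \<zero>\<^bsub>W i\<^esub>}},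
    mult = undefined,
    one = undefined,
    zero = (\<lambda>i\<in>I. \<zero>\<^bsub>W i\<^esub>),
    add = (\<lambda>f g. \<lambda>i\<in>I. f i \<oplus>\<^bsub>W i\<^esub> g i),
    smult = (\<lambda>c f. \<lambda>i\<in>I. c \<odot>\<^bsub>W i\<^esub> f i)\<rparr>"


section \<open>Tensor products of complex vector spaces\<close>

text \<open>The tensor product of a family \<open>V\<close> indexed by \<open>I\<close> is the free vector space on the product set,
  modulo the multilinearity relations.\<close>

definition free_space :: "'a set \<Rightarrow> (complex, 'a \<Rightarrow> complex) module" where
  "free_space S = \<lparr>
    carrier = {f. finite {x. f x \<noteq> 0} \<and> {x. f x \<noteq> 0} \<subseteq> S},
    mult = undefined,
    one = undefined,
    zero = (\<lambda>x. 0),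
    add = (\<lambda>f g x. f x + g x),
    smult = (\<lambda>c f x. c * f x)\<rparr>"

definition delta :: "'a \<Rightarrow> 'a \<Rightarrow> complex" where
  "delta x y = (if y = x then 1 else 0)"

definition tensor_free ::
  "'i set \<Rightarrow> ('i \<Rightarrow> (complex, 'v) module) \<Rightarrow> (complex, ('i \<Rightarrow> 'v) \<Rightarrow> complex) module" where
  "tensor_free I V = free_space (\<Pi>\<^sub>E i\<in>I. carrier (V i))"

definition tensor_relations ::
  "'i set \<Rightarrow> ('i \<Rightarrow> (complex, 'v) module) \<Rightarrow> (('i \<Rightarrow> 'v) \<Rightarrow> complex) set" where
  "tensor_relations I V =
    {(\<lambda>y. delta (x(i := a \<oplus>\<^bsub>V i\<^esub> b)) y - delta (x(i := a)) y - delta (x(i := b)) y) | x i a b.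
      x \<in> (\<Pi>\<^sub>E i\<in>I. carrier (V i)) \<and> i \<in> I \<and> a \<in> carrier (V i) \<and> b \<in> carrier (V i)} \<union>
    {(\<lambda>y. delta (x(i := c \<odot>\<^bsub>V i\<^esub> a)) y - c * delta (x(i := a)) y) | x i c a.
      x \<in> (\<Pi>\<^sub>E i\<in>I. carrier (V i)) \<and> i \<in> I \<and> a \<in> carrier (V i)}"

definition tensor_null ::
  "'i set \<Rightarrow> ('i \<Rightarrow> (complex, 'v) module) \<Rightarrow> (('i \<Rightarrow> 'v) \<Rightarrow> complex) set" where
  "tensor_null I V = LinearCombinations.module.span class_ring (tensor_free I V) (tensor_relations I V)"

definition tensor_product ::
  "'i set \<Rightarrow> ('i \<Rightarrow> (complex, 'v) module) \<Rightarrow> (complex, (('i \<Rightarrow> 'v) \<Rightarrow> complex) set) module" where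
  "tensor_product I V = quotient_module (tensor_free I V) (tensor_null I V)"

text \<open>The endomorphism of the tensor product induced by endomorphisms \<open>\<phi> i\<close> of \<open>V i\<close>: the class of
  \<open>f\<close> is sent to the class of the push-forward of \<open>f\<close> along \<open>(x\<^sub>i)\<^sub>i \<mapsto> (\<phi> i x\<^sub>i)\<^sub>i\<close>. For linear
  \<open>\<phi> i\<close> the sets in the union all coincide.\<close>

definition tensor_push ::
  "'i set \<Rightarrow> ('i \<Rightarrow> 'v \<Rightarrow> 'v) \<Rightarrow> (('i \<Rightarrow> 'v) \<Rightarrow> complex) \<Rightarrow> (('i \<Rightarrow> 'v) \<Rightarrow> complex)" where
  "tensor_push I \<phi> f = (\<lambda>y. \<Sum>x | f x \<noteq> 0 \<and> (\<lambda>i\<in>I. \<phi> i (x i)) = y. f x)"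

definition tensor_map ::
  "'i set \<Rightarrow> ('i \<Rightarrow> (complex, 'v) module) \<Rightarrow> ('i \<Rightarrow> 'v \<Rightarrow> 'v) \<Rightarrow>
    (('i \<Rightarrow> 'v) \<Rightarrow> complex) set \<Rightarrow> (('i \<Rightarrow> 'v) \<Rightarrow> complex) set" where
  "tensor_map I V \<phi> X =
    (\<Union>f\<in>X. tensor_null I V +>\<^bsub>tensor_free I V\<^esub> tensor_push I \<phi> f)"


section \<open>Representations of the general linear group\<close>

definition GL :: "nat \<Rightarrow> 'f::field mat monoid" where
  "GL n = units_of (ring_mat TYPE('f) n ())"

text \<open>The topology of \<open>GL n\<close> is the subspace topology coming from the valuation topology on the
  entries of matrices; it agrees with the usual one, inversion being continuous for it.\<close>

definition GL_open :: "('f::field \<Rightarrow> int) \<Rightarrow> nat \<Rightarrow> 'f mat set \<Rightarrow> bool" where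
  "GL_open v n U \<longleftrightarrow> U \<subseteq> carrier (GL n) \<and>
    (\<forall>g\<in>U. \<exists>m. \<forall>h\<in>carrier (GL n).
      (\<forall>i<n. \<forall>j<n. h $$ (i, j) - g $$ (i, j) \<in> frac_ideal v m) \<longrightarrow> h \<in> U)"

definition GL_rep ::
  "nat \<Rightarrow> (complex, 'v) module \<Rightarrow> ('f::field mat \<Rightarrow> 'v \<Rightarrow> 'v) \<Rightarrow> bool" where
  "GL_rep n V \<rho> \<longleftrightarrow> vectorspace class_ring V \<and>
    (\<forall>g\<in>carrier (GL n). \<rho> g \<in> module_hom class_ring V V) \<and>
    (\<forall>x\<in>carrier V. \<rho> \<one>\<^bsub>GL n\<^esub> x = x) \<and>
    (\<forall>g\<in>carrier (GL n). \<forall>h\<in>carrier (GL n). \<forall>x\<in>carrier V.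
      \<rho> (g \<otimes>\<^bsub>GL n\<^esub> h) x = \<rho> g (\<rho> h x))"

definition smooth_rep ::
  "('f::field \<Rightarrow> int) \<Rightarrow> nat \<Rightarrow> (complex, 'v) module \<Rightarrow> ('f mat \<Rightarrow> 'v \<Rightarrow> 'v) \<Rightarrow> bool" where
  "smooth_rep v n V \<rho> \<longleftrightarrow> GL_rep n V \<rho> \<and>
    (\<forall>x\<in>carrier V. GL_open v n {g \<in> carrier (GL n). \<rho> g x = x})"

definition subrep ::
  "nat \<Rightarrow> (complex, 'v) module \<Rightarrow> ('f::field mat \<Rightarrow> 'v \<Rightarrow> 'v) \<Rightarrow> 'v set \<Rightarrow> bool" where
  "subrep n V \<rho> W \<longleftrightarrow> subspace class_ring W V \<and>
    (\<forall>g\<in>carrier (GL n). \<rho> g ` W \<subseteq> W)"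

definition finite_length_rep ::
  "('f::field \<Rightarrow> int) \<Rightarrow> nat \<Rightarrow> (complex, 'v) module \<Rightarrow> ('f mat \<Rightarrow> 'v \<Rightarrow> 'v) \<Rightarrow> bool" where
  "finite_length_rep v n V \<rho> \<longleftrightarrow> smooth_rep v n V \<rho> \<and> bounded_chains {W. subrep n V \<rho> W}"

definition invariants ::
  "(complex, 'v) module \<Rightarrow> ('g \<Rightarrow> 'v \<Rightarrow> 'v) \<Rightarrow> 'g set \<Rightarrow> (complex, 'v) module" where
  "invariants V \<rho> K = V\<lparr>carrier := {x \<in> carrier V. \<forall>k\<in>K. \<rho> k x = x}\<rparr>"


section \<open>Parabolic induction\<close>

text \<open>A partition \<open>n = n\<^sub>1 + \<dots> + n\<^sub>r\<close> is a list; blocks are counted from \<open>0\<close>, and block \<open>i\<close> starts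
  at row \<open>offset ns i\<close>. The standard parabolic subgroup is block upper triangular.\<close>

definition offset :: "nat list \<Rightarrow> nat \<Rightarrow> nat" where
  "offset ns i = sum_list (take i ns)"

definition std_parabolic :: "nat list \<Rightarrow> 'f::field mat set" where
  "std_parabolic ns = {p \<in> carrier (GL (sum_list ns)).
    \<forall>i<length ns. \<forall>a b. offset ns i \<le> a \<and> a < sum_list ns \<and> b < offset ns i \<longrightarrow> p $$ (a, b) = 0}"

definition levi_block :: "nat list \<Rightarrow> 'f mat \<Rightarrow> nat \<Rightarrow> 'f mat" where
  "levi_block ns p i =
    mat (ns ! i) (ns ! i) (\<lambda>(a, b). p $$ (offset ns i + a, offset ns i + b))"

text \<open>The modulus character, i.e. the absolute value of the determinant of the adjoint action on the
  Lie algebra of the unipotent radical: the block \<open>(i,j)\<close>, \<open>i < j\<close>, of the latter is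
  transformed by \<open>X \<mapsto> p\<^sub>i X p\<^sub>j\<^sup>-\<^sup>1\<close>.\<close>

definition modulus_char :: "('f::field \<Rightarrow> int) \<Rightarrow> nat list \<Rightarrow> 'f mat \<Rightarrow> real" where
  "modulus_char v ns p = (\<Prod>j<length ns. \<Prod>i<j.
    norm_abs v (det (levi_block ns p i)) ^ (ns ! j) /
    norm_abs v (det (levi_block ns p j)) ^ (ns ! i))"

text \<open>The representation induced from the external tensor product of the \<open>\<rho> i\<close>, twisted by
  \<open>\<delta>\<^sup>s\<close> with \<open>\<delta>\<close> the modulus character: \<open>s = 1/2\<close> is normalized and \<open>s = 0\<close> is
  unnormalized parabolic induction. The group acts by right translation.\<close>

definition par_ind ::
  "('f::field \<Rightarrow> int) \<Rightarrow> real \<Rightarrow> nat list \<Rightarrow> (nat \<Rightarrow> (complex, 'v) module) \<Rightarrow>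
    (nat \<Rightarrow> 'f mat \<Rightarrow> 'v \<Rightarrow> 'v) \<Rightarrow> (complex, 'f mat \<Rightarrow> ((nat \<Rightarrow> 'v) \<Rightarrow> complex) set) module" where
  "par_ind v s ns V \<rho> = (
    let I = {..<length ns}; T = tensor_product I V; G = GL (sum_list ns) in \<lparr>
      carrier = {f \<in> carrier G \<rightarrow>\<^sub>E carrier T.
        (\<forall>p\<in>std_parabolic ns. \<forall>g\<in>carrier G. f (p \<otimes>\<^bsub>G\<^esub> g) =
          complex_of_real (modulus_char v ns p powr s) \<odot>\<^bsub>T\<^esub>
            tensor_map I V (\<lambda>i. \<rho> i (levi_block ns p i)) (f g)) \<and>
        (\<exists>U. subgroup U G \<and> GL_open v (sum_list ns) U \<and>
          (\<forall>g\<in>carrier G. \<forall>k\<in>U. f (g \<otimes>\<^bsub>G\<^esub> k) = f g))},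
      mult = undefined,
      one = undefined,
      zero = (\<lambda>g\<in>carrier G. \<zero>\<^bsub>T\<^esub>),
      add = (\<lambda>f f'. \<lambda>g\<in>carrier G. f g \<oplus>\<^bsub>T\<^esub> f' g),
      smult = (\<lambda>c f. \<lambda>g\<in>carrier G. c \<odot>\<^bsub>T\<^esub> f g)\<rparr>)"

definition right_translation :: "nat \<Rightarrow> 'f::field mat \<Rightarrow> ('f mat \<Rightarrow> 'w) \<Rightarrow> 'f mat \<Rightarrow> 'w" where
  "right_translation n h f = (\<lambda>g\<in>carrier (GL n). f (g \<otimes>\<^bsub>GL n\<^esub> h))"


section \<open>Lattices and the groups attached to modules of finite length\<close>

definition is_lattice :: "('f::field \<Rightarrow> int) \<Rightarrow> nat \<Rightarrow> 'f vec set \<Rightarrow> bool" where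
  "is_lattice v n L \<longleftrightarrow> submodule (val_ring v) L (module_vec TYPE('f) n) \<and>
    (\<exists>B\<subseteq>L. finite B \<and> LinearCombinations.module.span (val_ring v) (module_vec TYPE('f) n) B = L) \<and>
    LinearCombinations.module.span class_ring (module_vec TYPE('f) n) L = carrier_vec n"

definition lattice_group :: "nat \<Rightarrow> 'f::field vec set \<Rightarrow> 'f vec set \<Rightarrow> 'f mat set" where
  "lattice_group n L1 L2 = {g \<in> carrier (GL n).
    (\<lambda>x. g *\<^sub>v x) ` L1 = L1 \<and> (\<lambda>x. g *\<^sub>v x) ` L2 = L2 \<and> (\<forall>x\<in>L1. g *\<^sub>v x - x \<in> L2)}"

text \<open>The groups \<open>K\<^bsub>L1,L2\<^esub>\<close> with \<open>L1/L2\<close> isomorphic to \<open>M\<close>, i.e. all the choices for the group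
  \<open>K\<^bsub>n,[M]\<^esub>\<close>, which is only well defined up to conjugation.\<close>

definition module_groups ::
  "('f::field \<Rightarrow> int) \<Rightarrow> nat \<Rightarrow> ('f, 'm) module \<Rightarrow> 'f mat set set" where
  "module_groups v n M = {lattice_group n L1 L2 | L1 L2.
    is_lattice v n L1 \<and> is_lattice v n L2 \<and> L2 \<subseteq> L1 \<and>
    modules_isomorphic (val_ring v)
      (quotient_module ((module_vec TYPE('f) n)\<lparr>carrier := L1\<rparr>) L2) M}"


section \<open>Admissible filtrations\<close>

text \<open>A filtration \<open>F\<^sub>0 \<subseteq> \<dots> \<subseteq> F\<^sub>r\<close> is the list of its members. \<open>graded_piece M F i\<close> is
  \<open>F\<^sub>i\<^sub>+\<^sub>1/F\<^sub>i\<close>, since blocks are counted from \<open>0\<close>. The inclusions need not be strict.\<close>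

definition graded_piece :: "('r, 'm) module \<Rightarrow> 'm set list \<Rightarrow> nat \<Rightarrow> ('r, 'm set) module" where
  "graded_piece M F i = quotient_module (M\<lparr>carrier := F ! Suc i\<rparr>) (F ! i)"

definition admissible_filtration ::
  "('f::field \<Rightarrow> int) \<Rightarrow> nat list \<Rightarrow> ('f, 'm) module \<Rightarrow> 'm set list \<Rightarrow> bool" where
  "admissible_filtration v ns M F \<longleftrightarrow>
    length F = Suc (length ns) \<and> F ! 0 = {\<zero>\<^bsub>M\<^esub>} \<and> F ! length ns = carrier M \<and>
    (\<forall>i\<le>length ns. submodule (val_ring v) (F ! i) M) \<and>
    (\<forall>i<length ns. F ! i \<subseteq> F ! Suc i \<and>
      generated_by_at_most (val_ring v) (graded_piece M F i) (ns ! i))"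

end

theory Submission
  imports Defs
begin

text \<open>
  A choice of a surjection \<open>\<O>\<^sup>n \<rightarrow> M\<close>, i.e. of a generating \<open>n\<close>-tuple \<open>z\<close> of \<open>M\<close>, makes
  \<open>K\<^bsub>n,[M]\<^esub>\<close> conjugate to the stabilizer of \<open>z\<close> in \<open>GL\<^sub>n(\<O>)\<close>, which acts
  transitively on the generating \<open>n\<close>-tuples by a Nakayama argument. By the Iwasawa decomposition the double cosets
  \<open>P \ G / K\<close> thus are the orbits of \<open>P \<inter> GL\<^sub>n(\<O>)\<close> on the generating tuples. These orbits are
  the admissible filtrations: a tuple is sent to the filtration by the spans of its initial
  segments, and two tuples with the same filtration are related first on the graded pieces (Nakayama again) and
  then, lifting blockwise, by an element of \<open>P \<inter> GL\<^sub>n(\<O>)\<close>. Hence evaluation of the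
  functions of the induced representation at representatives of the double cosets identifies the
  invariants of \<open>K\<close> with the sum, over the admissible filtrations, of the vectors of
  \<open>\<pi>\<^sub>1 \<otimes> \<dots> \<otimes> \<pi>\<^sub>r\<close> fixed by the stabilizer in \<open>P \<inter> GL\<^sub>n(\<O>)\<close> of an
  adapted tuple. The modulus character is trivial there, and the image of this stabilizer in the Levi
  subgroup is the full product of the stabilizers attached to the graded pieces, so that its
  invariants are the tensor product of the invariants.\<close>

section \<open>Finitely generated modules and their quotients\<close>

text \<open>The group \<open>K\<close> is given only up to conjugation, so the pair of lattices is
  traded at once for the tuple \<open>z\<close>; another basis or another isomorphism with
  \<open>M\<close> only moves \<open>z\<close> within its orbit. Nakayama's lemma appears in the
  elementary form for a module killed by a power of the uniformizer, and such a power is read off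
  the pair of lattices. The same transitivity statement serves for \<open>M\<close> and for each
  graded piece, since the groups \<open>KGr\<close> come from lattices as well. The representation
  spaces may have infinite dimension, and nothing is averaged over a group: each \<open>V i\<close>
  gets a basis that contains a basis of the invariants, and a tensor is invariant iff its
  coordinates are supported on products of the smaller bases. The hard direction of this needs
  operators that act in one slot only, which is why blocks prescribed in the Levi subgroup have to
  be lifted to the stabilizer. Finiteness of the residue field makes \<open>M\<close> finite, so
  that there are finitely many filtrations and the direct sum is a product.\<close>

lemma modules_isomorphic_trans:
  assumes "modules_isomorphic R A B" "modules_isomorphic R B C"
  shows "modules_isomorphic R A C"
proof -
  obtain f g where f: "f \<in> module_hom R A B" "bij_betw f (carrier A) (carrier B)"
    and g: "g \<in> module_hom R B C" "bij_betw g (carrier B) (carrier C)"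
    using assms unfolding modules_isomorphic_def by blast
  have "g \<circ> f \<in> module_hom R A C"
    using f(1) g(1) unfolding LinearCombinations.module_hom_def by (fastforce simp: Pi_iff)
  moreover have "bij_betw (g \<circ> f) (carrier A) (carrier C)"
    using f(2) g(2) by (rule bij_betw_trans)
  ultimately show ?thesis unfolding modules_isomorphic_def by blast
qed

text \<open>Closure of \<open>A\<close> under its operations carries the argument: sums and
  multiples in \<open>B\<close> are images of sums and multiples in \<open>A\<close>, so the inverse
  of \<open>f\<close> respects them.\<close>

lemma modules_isomorphic_sym:
  assumes "module R A" "modules_isomorphic R A B"
  shows "modules_isomorphic R B A"
proof -
  interpret A: Module.module R A by fact
  obtain f where f: "f \<in> module_hom R A B" "bij_betw f (carrier A) (carrier B)"
    using assms unfolding modules_isomorphic_def by blast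
  define g where "g = the_inv_into (carrier A) f"
  have inj: "inj_on f (carrier A)" and im: "f ` carrier A = carrier B"
    using f(2) by (auto simp: bij_betw_def)
  have gf: "g (f x) = x" if "x \<in> carrier A" for x
    using the_inv_into_f_f[OF inj that] by (simp add: g_def)
  have gB: "bij_betw g (carrier B) (carrier A)"
    unfolding g_def by (rule bij_betw_the_inv_into[OF f(2)])
  have "g \<in> module_hom R B A"
    unfolding LinearCombinations.module_hom_def
  proof (intro CollectI conjI allI impI)
    show "g \<in> carrier B \<rightarrow> carrier A" using gB by (auto simp: bij_betw_def)
    fix m1 m2 assume "m1 \<in> carrier B \<and> m2 \<in> carrier B"
    then obtain x y where x: "x \<in> carrier A" "m1 = f x" and y: "y \<in> carrier A" "m2 = f y"
      using im by (metis imageE)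
    have "m1 \<oplus>\<^bsub>B\<^esub> m2 = f (x \<oplus>\<^bsub>A\<^esub> y)"
      unfolding x(2) y(2) by (rule LinearCombinations.module_hom_add[OF f(1) x(1) y(1), symmetric])
    moreover have "g (f (x \<oplus>\<^bsub>A\<^esub> y)) = x \<oplus>\<^bsub>A\<^esub> y" using x y by (intro gf) simp
    ultimately show "g (m1 \<oplus>\<^bsub>B\<^esub> m2) = g m1 \<oplus>\<^bsub>A\<^esub> g m2" using x y gf by metis
  next
    fix r m assume rm: "r \<in> carrier R \<and> m \<in> carrier B"
    then obtain x where x: "x \<in> carrier A" "m = f x" using im by (metis imageE)
    have "r \<odot>\<^bsub>B\<^esub> m = f (r \<odot>\<^bsub>A\<^esub> x)"
      unfolding x(2) using rm x(1) by (intro LinearCombinations.module_hom_smult[OF f(1), symmetric]) auto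
    moreover have "g (f (r \<odot>\<^bsub>A\<^esub> x)) = r \<odot>\<^bsub>A\<^esub> x" using x rm by (intro gf) simp
    ultimately show "g (r \<odot>\<^bsub>B\<^esub> m) = r \<odot>\<^bsub>A\<^esub> g m" using x gf by metis
  qed
  with gB show ?thesis unfolding modules_isomorphic_def by blast
qed

section \<open>Submodules and quotient modules\<close>

context Module.module
begin

text \<open>The locale \<open>submodule\<close> asks for closure under sums and multiples; additive
  inverses are supplied by the scalar \<open>-1\<close>.\<close>

lemma submodule_abelian_subgroup:
  assumes "submodule R N M" shows "abelian_subgroup N M"
proof -
  interpret N: submodule R N M by fact
  show ?thesis
  proof (rule abelian_subgroupI3)
    show "additive_subgroup N M"
    proof (rule additive_subgroup.intro, rule subgroup.intro)
      fix x assume "x \<in> N"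
      then have x: "x \<in> carrier M" and "(\<ominus>\<^bsub>R\<^esub> \<one>\<^bsub>R\<^esub>) \<odot>\<^bsub>M\<^esub> x \<in> N" using N.subset by auto
      then have "\<ominus>\<^bsub>M\<^esub> x \<in> N" by (simp add: smult_l_minus)
      then show "inv\<^bsub>add_monoid M\<^esub> x \<in> N" by (simp add: a_inv_def)
    qed (use N.subset in auto)
  qed (rule M.abelian_group_axioms)
qed

lemma submodule_minus_closed:
  assumes "submodule R N M" "x \<in> N" "y \<in> N" shows "x \<ominus>\<^bsub>M\<^esub> y \<in> N"
proof -
  interpret A: abelian_subgroup N M by (rule submodule_abelian_subgroup[OF assms(1)])
  show ?thesis using assms(2,3) by (simp add: a_minus_def A.a_inv_closed)
qed

lemma coset_eq_iff:
  assumes "submodule R N M" "x \<in> carrier M" "y \<in> carrier M"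
  shows "N +>\<^bsub>M\<^esub> x = N +>\<^bsub>M\<^esub> y \<longleftrightarrow> x \<ominus>\<^bsub>M\<^esub> y \<in> N"
proof -
  interpret A: abelian_subgroup N M by (rule submodule_abelian_subgroup[OF assms(1)])
  show ?thesis
    using A.a_rcos_module[OF assms(3,2)] A.a_repr_independence'[of x y] A.a_rcos_self[OF assms(2)] assms
    unfolding a_minus_def by metis
qed

lemma coset_eq_self_iff:
  assumes "submodule R N M" "x \<in> carrier M"
  shows "N +>\<^bsub>M\<^esub> x = N \<longleftrightarrow> x \<in> N"
proof -
  interpret A: abelian_subgroup N M by (rule submodule_abelian_subgroup[OF assms(1)])
  show ?thesis using A.a_rcos_const A.a_rcos_self[OF assms(2)] by auto
qed

lemma carrier_quotient_module:
  "carrier (quotient_module M N) = (\<lambda>x. N +>\<^bsub>M\<^esub> x) ` carrier M"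
  unfolding quotient_module_def A_RCOSETS_defs a_r_coset_defs by auto

lemma quotient_zero: "\<zero>\<^bsub>quotient_module M N\<^esub> = N"
  by (simp add: quotient_module_def)

lemma quotient_add:
  assumes "submodule R N M" "x \<in> carrier M" "y \<in> carrier M"
  shows "(N +>\<^bsub>M\<^esub> x) \<oplus>\<^bsub>quotient_module M N\<^esub> (N +>\<^bsub>M\<^esub> y) = N +>\<^bsub>M\<^esub> (x \<oplus>\<^bsub>M\<^esub> y)"
proof -
  interpret A: abelian_subgroup N M by (rule submodule_abelian_subgroup[OF assms(1)])
  show ?thesis using A.a_rcos_sum[OF assms(2,3)] by (simp add: quotient_module_def)
qed

lemma mem_coset:
  assumes "submodule R N M" "x \<in> carrier M" "y \<in> N +>\<^bsub>M\<^esub> x"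
  shows "y \<in> carrier M" "y \<ominus>\<^bsub>M\<^esub> x \<in> N"
proof -
  interpret A: abelian_subgroup N M by (rule submodule_abelian_subgroup[OF assms(1)])
  show y: "y \<in> carrier M" using assms A.a_elemrcos_carrier by blast
  show "y \<ominus>\<^bsub>M\<^esub> x \<in> N" using A.a_rcos_module[OF assms(2) y] assms(3) by (simp add: a_minus_def)
qed

lemma quotient_smult:
  assumes "submodule R N M" "r \<in> carrier R" "x \<in> carrier M"
  shows "r \<odot>\<^bsub>quotient_module M N\<^esub> (N +>\<^bsub>M\<^esub> x) = N +>\<^bsub>M\<^esub> (r \<odot>\<^bsub>M\<^esub> x)"
proof -
  interpret A: abelian_subgroup N M by (rule submodule_abelian_subgroup[OF assms(1)])
  interpret N: submodule R N M by fact
  \<comment> \<open>The sets in the union that defines scalar multiplication of cosets coincide,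
    because \<open>r\<close> maps \<open>N\<close> into itself.\<close>
  have "N +>\<^bsub>M\<^esub> (r \<odot>\<^bsub>M\<^esub> y) = N +>\<^bsub>M\<^esub> (r \<odot>\<^bsub>M\<^esub> x)" if "y \<in> N +>\<^bsub>M\<^esub> x" for y
  proof -
    note y = mem_coset[OF assms(1,3) that]
    have "r \<odot>\<^bsub>M\<^esub> (y \<ominus>\<^bsub>M\<^esub> x) = r \<odot>\<^bsub>M\<^esub> y \<ominus>\<^bsub>M\<^esub> r \<odot>\<^bsub>M\<^esub> x"
      unfolding a_minus_def smult_r_distr[OF assms(2) y(1) M.a_inv_closed[OF assms(3)]]
        smult_r_minus[OF assms(2,3)] ..
    moreover have "r \<odot>\<^bsub>M\<^esub> (y \<ominus>\<^bsub>M\<^esub> x) \<in> N" using y(2) assms(2) by (rule N.smult_closed[rotated])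
    ultimately show ?thesis
      using coset_eq_iff[OF assms(1) smult_closed[OF assms(2) y(1)] smult_closed[OF assms(2,3)]] by metis
  qed
  moreover have "x \<in> N +>\<^bsub>M\<^esub> x" by (rule A.a_rcos_self[OF assms(3)])
  ultimately have "(\<Union>y\<in>N +>\<^bsub>M\<^esub> x. N +>\<^bsub>M\<^esub> (r \<odot>\<^bsub>M\<^esub> y)) = N +>\<^bsub>M\<^esub> (r \<odot>\<^bsub>M\<^esub> x)" by blast
  then show ?thesis by (simp add: quotient_module_def)
qed

lemma quotient_hom:
  assumes "submodule R N M"
  shows "(\<lambda>x. N +>\<^bsub>M\<^esub> x) \<in> module_hom R M (quotient_module M N)"
  unfolding LinearCombinations.module_hom_def
  using quotient_add[OF assms] quotient_smult[OF assms] carrier_quotient_module by auto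

lemma quotient_module_is_module:
  assumes "submodule R N M"
  shows "module R (quotient_module M N)"
proof -
  interpret N: submodule R N M by fact
  note simps = quotient_add[OF assms] quotient_smult[OF assms]
  have z: "\<zero>\<^bsub>quotient_module M N\<^esub> = N +>\<^bsub>M\<^esub> \<zero>\<^bsub>M\<^esub>"
    using coset_eq_self_iff[OF assms, of "\<zero>\<^bsub>M\<^esub>"] by (simp add: quotient_zero)
  show ?thesis
  proof (rule module_criteria)
    show "cring R" ..
    show "\<forall>X\<in>carrier (quotient_module M N). \<exists>Y\<in>carrier (quotient_module M N).
        X \<oplus>\<^bsub>quotient_module M N\<^esub> Y = \<zero>\<^bsub>quotient_module M N\<^esub>"
    proof
      fix X assume "X \<in> carrier (quotient_module M N)"
      then obtain x where "x \<in> carrier M" "X = N +>\<^bsub>M\<^esub> x" by (auto simp: carrier_quotient_module)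
      then show "\<exists>Y\<in>carrier (quotient_module M N). X \<oplus>\<^bsub>quotient_module M N\<^esub> Y = \<zero>\<^bsub>quotient_module M N\<^esub>"
        by (intro bexI[of _ "N +>\<^bsub>M\<^esub> (\<ominus>\<^bsub>M\<^esub> x)"])
          (auto simp: carrier_quotient_module simps M.r_neg z)
    qed
    show "\<forall>X Y. X \<in> carrier (quotient_module M N) \<and> Y \<in> carrier (quotient_module M N) \<longrightarrow>
        X \<oplus>\<^bsub>quotient_module M N\<^esub> Y = Y \<oplus>\<^bsub>quotient_module M N\<^esub> X"
      unfolding carrier_quotient_module using M.a_comm by (auto simp: simps)
  qed (auto simp: carrier_quotient_module simps z M.a_assoc smult_l_distr smult_r_distr smult_assoc1)
qed

section \<open>Linear combinations of tuples\<close>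

text \<open>Tuples indexed by \<open>{..<n}\<close> rather than sets of vectors: repeated entries
  keep separate coefficients, and square matrices can act on the tuples.\<close>

definition comb :: "nat \<Rightarrow> (nat \<Rightarrow> 'a) \<Rightarrow> (nat \<Rightarrow> 'c) \<Rightarrow> 'c" where
  "comb n c x = (\<Oplus>\<^bsub>M\<^esub>a\<in>{..<n}. c a \<odot>\<^bsub>M\<^esub> x a)"

lemma comb_closed [simp, intro]:
  "c \<in> {..<n} \<rightarrow> carrier R \<Longrightarrow> x \<in> {..<n} \<rightarrow> carrier M \<Longrightarrow> comb n c x \<in> carrier M"
  unfolding comb_def by (intro M.finsum_closed) auto

lemma comb_cong:
  assumes "n = n'" "\<And>a. a < n' \<Longrightarrow> c a = c' a" "\<And>a. a < n' \<Longrightarrow> x a = x' a"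
    "c' \<in> {..<n} \<rightarrow> carrier R" "x' \<in> {..<n} \<rightarrow> carrier M"
  shows "comb n c x = comb n' c' x'"
  unfolding comb_def using assms by (intro M.finsum_cong') auto

lemma finsum_in_submodule:
  assumes "submodule R N M" "f \<in> A \<rightarrow> N"
  shows "finsum M f A \<in> N"
proof -
  interpret N: submodule R N M by fact
  from assms(2) show ?thesis
  proof (induction A rule: infinite_finite_induct)
    case (insert a A)
    have "f \<in> A \<rightarrow> carrier M" "f a \<in> carrier M" using insert.prems N.subset by auto
    with insert show ?case by (auto simp: M.finsum_insert)
  qed auto
qed

lemma comb_in_submodule:
  assumes "submodule R N M" "c \<in> {..<n} \<rightarrow> carrier R" "x \<in> {..<n} \<rightarrow> N"
  shows "comb n c x \<in> N"
proof -
  interpret N: submodule R N M by fact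
  show ?thesis unfolding comb_def using assms by (intro finsum_in_submodule) auto
qed

lemma comb_add_left:
  assumes "c \<in> {..<n} \<rightarrow> carrier R" "d \<in> {..<n} \<rightarrow> carrier R" "x \<in> {..<n} \<rightarrow> carrier M"
  shows "comb n (\<lambda>a. c a \<oplus>\<^bsub>R\<^esub> d a) x = comb n c x \<oplus>\<^bsub>M\<^esub> comb n d x"
proof -
  have "comb n (\<lambda>a. c a \<oplus>\<^bsub>R\<^esub> d a) x = (\<Oplus>\<^bsub>M\<^esub>a\<in>{..<n}. c a \<odot>\<^bsub>M\<^esub> x a \<oplus>\<^bsub>M\<^esub> d a \<odot>\<^bsub>M\<^esub> x a)"
    unfolding comb_def using assms by (intro M.finsum_cong') (auto simp: smult_l_distr Pi_iff)
  also have "\<dots> = comb n c x \<oplus>\<^bsub>M\<^esub> comb n d x"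
    unfolding comb_def using assms by (intro M.finsum_addf) auto
  finally show ?thesis .
qed

lemma comb_smult_left:
  assumes "c \<in> {..<n} \<rightarrow> carrier R" "r \<in> carrier R" "x \<in> {..<n} \<rightarrow> carrier M"
  shows "comb n (\<lambda>a. r \<otimes>\<^bsub>R\<^esub> c a) x = r \<odot>\<^bsub>M\<^esub> comb n c x"
proof -
  have "comb n (\<lambda>a. r \<otimes>\<^bsub>R\<^esub> c a) x = (\<Oplus>\<^bsub>M\<^esub>a\<in>{..<n}. r \<odot>\<^bsub>M\<^esub> (c a \<odot>\<^bsub>M\<^esub> x a))"
    unfolding comb_def using assms by (intro M.finsum_cong') (auto simp: smult_assoc1 Pi_iff)
  also have "\<dots> = r \<odot>\<^bsub>M\<^esub> comb n c x"
    unfolding comb_def using assms by (subst finsum_smult_ldistr) auto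
  finally show ?thesis .
qed

lemma comb_unit:
  assumes "b < n" "x \<in> {..<n} \<rightarrow> carrier M"
  shows "comb n (\<lambda>a. if a = b then \<one>\<^bsub>R\<^esub> else \<zero>\<^bsub>R\<^esub>) x = x b"
proof -
  have "comb n (\<lambda>a. if a = b then \<one>\<^bsub>R\<^esub> else \<zero>\<^bsub>R\<^esub>) x = (\<Oplus>\<^bsub>M\<^esub>a\<in>{..<n}. if b = a then x a else \<zero>\<^bsub>M\<^esub>)"
    unfolding comb_def using assms by (intro M.finsum_cong') (auto simp: Pi_iff)
  also have "\<dots> = x b" using assms by (intro M.finsum_singleton) auto
  finally show ?thesis .
qed

lemma comb_Suc:
  assumes "c \<in> {..<Suc n} \<rightarrow> carrier R" "x \<in> {..<Suc n} \<rightarrow> carrier M"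
  shows "comb (Suc n) c x = c n \<odot>\<^bsub>M\<^esub> x n \<oplus>\<^bsub>M\<^esub> comb n c x"
  unfolding comb_def lessThan_Suc using assms by (intro M.finsum_insert) (auto simp: Pi_iff)

lemma comb_hom:
  assumes "module R N" "f \<in> module_hom R M N" "c \<in> {..<n} \<rightarrow> carrier R" "x \<in> {..<n} \<rightarrow> carrier M"
  shows "f (comb n c x) = module.comb N n c (\<lambda>a. f (x a))"
proof -
  interpret N: Module.module R N by fact
  interpret f: mod_hom R M N f
    by (intro mod_hom.intro mod_hom_axioms.intro assms(2) assms(1)) (rule module_axioms)
  have sum: "f (finsum M g A) = (\<Oplus>\<^bsub>N\<^esub>a\<in>A. f (g a))" if "finite A" "g \<in> A \<rightarrow> carrier M" for g and A :: "nat set"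
    using that
  proof (induction A rule: finite_induct)
    case (insert a A)
    then have "f (finsum M g (insert a A)) = f (g a) \<oplus>\<^bsub>N\<^esub> f (finsum M g A)"
      by (simp add: Pi_iff)
    with insert show ?case by (simp add: N.M.finsum_insert Pi_iff)
  qed simp
  have "f (comb n c x) = (\<Oplus>\<^bsub>N\<^esub>a\<in>{..<n}. f (c a \<odot>\<^bsub>M\<^esub> x a))"
    unfolding comb_def using assms by (intro sum) (auto simp: Pi_iff)
  also have "\<dots> = N.comb n c (\<lambda>a. f (x a))"
    unfolding N.comb_def using assms by (intro N.M.finsum_cong') (auto simp: Pi_iff)
  finally show ?thesis .
qed

definition generates :: "nat \<Rightarrow> (nat \<Rightarrow> 'c) \<Rightarrow> bool" where
  "generates n x \<longleftrightarrow> (\<forall>m\<in>carrier M. \<exists>c\<in>{..<n} \<rightarrow> carrier R. m = comb n c x)"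

definition comb_span :: "nat \<Rightarrow> (nat \<Rightarrow> 'c) \<Rightarrow> 'c set" where
  "comb_span n x = {comb n c x | c. c \<in> {..<n} \<rightarrow> carrier R}"

lemma comb_spanI: "c \<in> {..<n} \<rightarrow> carrier R \<Longrightarrow> comb n c x \<in> comb_span n x"
  unfolding comb_span_def by blast

lemma comb_span_mem:
  assumes "x \<in> {..<n} \<rightarrow> carrier M" "b < n"
  shows "x b \<in> comb_span n x"
  using comb_spanI[of "\<lambda>a. if a = b then \<one>\<^bsub>R\<^esub> else \<zero>\<^bsub>R\<^esub>" n x] comb_unit[OF assms(2,1)] by auto

lemma comb_zero_left:
  assumes "x \<in> {..<n} \<rightarrow> carrier M"
  shows "comb n (\<lambda>_. \<zero>\<^bsub>R\<^esub>) x = \<zero>\<^bsub>M\<^esub>"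
proof -
  have "comb n (\<lambda>_. \<zero>\<^bsub>R\<^esub>) x = (\<Oplus>\<^bsub>M\<^esub>a\<in>{..<n}. \<zero>\<^bsub>M\<^esub>)"
    unfolding comb_def using assms by (intro M.finsum_cong') (auto simp: Pi_iff)
  then show ?thesis by (simp add: M.finsum_zero)
qed

lemma comb_span_submodule:
  assumes x: "x \<in> {..<n} \<rightarrow> carrier M"
  shows "submodule R (comb_span n x) M"
proof (rule submodule.intro)
  show "Module.module R M" by (rule module_axioms)
  show "comb_span n x \<subseteq> carrier M" unfolding comb_span_def using x by auto
  show "\<zero>\<^bsub>M\<^esub> \<in> comb_span n x"
    using comb_spanI[of "\<lambda>_. \<zero>\<^bsub>R\<^esub>" n x] comb_zero_left[OF x] by auto
next
  fix v w assume "v \<in> comb_span n x" "w \<in> comb_span n x"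
  then obtain c d where "c \<in> {..<n} \<rightarrow> carrier R" "v = comb n c x" "d \<in> {..<n} \<rightarrow> carrier R" "w = comb n d x"
    unfolding comb_span_def by blast
  then show "v \<oplus>\<^bsub>M\<^esub> w \<in> comb_span n x"
    using comb_add_left[of c n d x] comb_spanI[of "\<lambda>a. c a \<oplus>\<^bsub>R\<^esub> d a" n x] x by (auto simp: Pi_iff)
next
  fix r v assume "r \<in> carrier R" "v \<in> comb_span n x"
  then obtain c where "c \<in> {..<n} \<rightarrow> carrier R" "v = comb n c x"
    unfolding comb_span_def by blast
  then show "r \<odot>\<^bsub>M\<^esub> v \<in> comb_span n x"
    using comb_smult_left[of c n r x] comb_spanI[of "\<lambda>a. r \<otimes>\<^bsub>R\<^esub> c a" n x] x \<open>r \<in> carrier R\<close> by (auto simp: Pi_iff)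
qed

lemma comb_span_subset:
  assumes "submodule R N M" "x \<in> {..<n} \<rightarrow> N"
  shows "comb_span n x \<subseteq> N"
  unfolding comb_span_def using comb_in_submodule[OF assms(1) _ assms(2)] by auto

lemma span_eq_comb_span:
  assumes x: "x \<in> {..<n} \<rightarrow> carrier M"
  shows "span (x ` {..<n}) = comb_span n x"
proof
  have xc: "x ` {..<n} \<subseteq> carrier M" using x by auto
  show "span (x ` {..<n}) \<subseteq> comb_span n x"
    using comb_span_mem[OF x] by (intro span_is_subset comb_span_submodule x) auto
  have "x \<in> {..<n} \<rightarrow> span (x ` {..<n})" using in_own_span[OF xc] by auto
  then show "comb_span n x \<subseteq> span (x ` {..<n})"
    by (rule comb_span_subset[OF span_is_submodule[OF xc]])
qed

lemma generates_iff_comb_span: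
  assumes "x \<in> {..<n} \<rightarrow> carrier M"
  shows "generates n x \<longleftrightarrow> comb_span n x = carrier M"
proof -
  have "comb_span n x \<subseteq> carrier M" using comb_span_submodule[OF assms] by (simp add: submodule_def)
  then show ?thesis unfolding generates_def by (auto simp: comb_span_def)
qed

text \<open>Tuples of exact length \<open>n\<close> replace sets of at most \<open>n\<close>
  elements: an enumeration of a smaller set is padded by zeros, and conversely the set of entries of
  a tuple has at most \<open>n\<close> elements.\<close>

lemma generated_by_at_most_iff:
  "generated_by_at_most R M n \<longleftrightarrow> (\<exists>x\<in>{..<n} \<rightarrow> carrier M. generates n x)"
proof
  assume "generated_by_at_most R M n"
  then obtain S where S: "S \<subseteq> carrier M" "finite S" "card S \<le> n" "span S = carrier M"
    unfolding generated_by_at_most_def by blast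
  obtain f where f: "bij_betw f {..<card S} S" using S(2) by (metis atLeast0LessThan ex_bij_betw_nat_finite)
  define x where "x a = (if a < card S then f a else \<zero>\<^bsub>M\<^esub>)" for a
  have fS: "f a \<in> S" if "a < card S" for a using f that by (auto simp: bij_betw_def)
  have x: "x \<in> {..<n} \<rightarrow> carrier M" using fS S(1) by (force simp: x_def)
  have "S \<subseteq> comb_span n x"
  proof
    fix s assume "s \<in> S"
    then obtain a where "a < card S" "s = f a" using f by (auto simp: bij_betw_def)
    then show "s \<in> comb_span n x" using comb_span_mem[OF x, of a] S(3) by (simp add: x_def)
  qed
  then have "span S \<subseteq> comb_span n x" by (rule span_is_subset[OF _ comb_span_submodule[OF x]])
  then have "comb_span n x = carrier M" using S(4) comb_span_submodule[OF x] by (auto simp: submodule_def)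
  then show "\<exists>x\<in>{..<n} \<rightarrow> carrier M. generates n x" using x generates_iff_comb_span by blast
next
  assume "\<exists>x\<in>{..<n} \<rightarrow> carrier M. generates n x"
  then obtain x where x: "x \<in> {..<n} \<rightarrow> carrier M" "generates n x" by blast
  then have "span (x ` {..<n}) = carrier M" using span_eq_comb_span generates_iff_comb_span by simp
  moreover have "card (x ` {..<n}) \<le> n" using card_image_le[of "{..<n}" x] by simp
  ultimately show "generated_by_at_most R M n" unfolding generated_by_at_most_def using x
    by (intro exI[of _ "x ` {..<n}"]) auto
qed

text \<open>The inclusion of \<open>N\<close> into \<open>M\<close> is linear, so
  \<open>comb_hom\<close> identifies the combinations formed in the two records.\<close>

lemma comb_md:
  assumes "submodule R N M" "c \<in> {..<n} \<rightarrow> carrier R" "x \<in> {..<n} \<rightarrow> N"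
  shows "module.comb (md N) n c x = comb n c x"
proof -
  interpret N: submodule R N M by fact
  interpret MN: Module.module R "md N" by (rule submodule_is_module[OF assms(1)])
  show ?thesis
    using MN.comb_hom[OF module_axioms, of "\<lambda>x. x" c n x] assms N.subset
    by (auto simp: LinearCombinations.module_hom_def)
qed

end

section \<open>Integral matrices over a local field\<close>

lemma mult_carrier_square [simp]:
  "A \<in> carrier_mat n n \<Longrightarrow> B \<in> carrier_mat n n \<Longrightarrow> A * B \<in> carrier_mat n n"
  by (rule mult_carrier_mat)


lemma GL_simps [simp]:
  "mult (GL n :: 'f::field mat monoid) = (*)" "one (GL n :: 'f mat monoid) = 1\<^sub>m n"
  by (auto simp: GL_def units_of_def ring_mat_simps)

lemma GL_carrier:
  "carrier (GL n) = {A \<in> carrier_mat n n. \<exists>B\<in>carrier_mat n n. A * B = 1\<^sub>m n \<and> B * A = (1\<^sub>m n :: 'f::field mat)}"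
  by (auto simp: GL_def units_of_def Units_def ring_mat_simps)

lemma GL_carrier_mat: "A \<in> carrier (GL n) \<Longrightarrow> A \<in> carrier_mat n n"
  by (simp add: GL_carrier)

lemma GL_group: "group (GL n :: 'f::field mat monoid)"
proof -
  interpret ring "ring_mat TYPE('f) n ()" by (rule ring_mat)
  show ?thesis unfolding GL_def by (rule units_group)
qed

lemma GL_det: "A \<in> carrier (GL n) \<longleftrightarrow> A \<in> carrier_mat n n \<and> det (A :: 'f::field mat) \<noteq> 0"
  using unit_imp_det_non_zero[of A n "()"] det_non_zero_imp_unit[of A n "()"] GL_carrier_mat[of A n]
  by (auto simp: GL_def units_of_def)

text \<open>Over a field a one-sided inverse of a square matrix is two-sided, so a single product
  has to be computed.\<close>

lemma GL_I:
  assumes "A \<in> carrier_mat n n" "B \<in> carrier_mat n n" "A * B = (1\<^sub>m n :: 'f::field mat)"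
  shows "A \<in> carrier (GL n)" "inv\<^bsub>GL n\<^esub> A = B" "B \<in> carrier (GL n)"
proof -
  interpret G: group "GL n :: 'f mat monoid" by (rule GL_group)
  have BA: "B * A = 1\<^sub>m n" by (rule mat_mult_left_right_inverse[OF assms])
  show A: "A \<in> carrier (GL n)" "B \<in> carrier (GL n)" using assms BA by (auto simp: GL_carrier)
  show "inv\<^bsub>GL n\<^esub> A = B"
    using G.inv_equality[of B A] A BA by simp
qed

lemma GL_inv:
  assumes "A \<in> carrier (GL n)"
  shows "inv\<^bsub>GL n\<^esub> A \<in> carrier (GL n)" "inv\<^bsub>GL n\<^esub> A * A = (1\<^sub>m n :: 'f::field mat)" "A * inv\<^bsub>GL n\<^esub> A = 1\<^sub>m n"
proof -
  interpret G: group "GL n :: 'f mat monoid" by (rule GL_group)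
  show "inv\<^bsub>GL n\<^esub> A \<in> carrier (GL n)" using assms by simp
  show "inv\<^bsub>GL n\<^esub> A * A = 1\<^sub>m n" "A * inv\<^bsub>GL n\<^esub> A = 1\<^sub>m n"
    using G.l_inv[OF assms] G.r_inv[OF assms] by simp_all
qed

lemma GL_mult_closed:
  "A \<in> carrier (GL n) \<Longrightarrow> B \<in> carrier (GL n) \<Longrightarrow> A * B \<in> carrier (GL n :: 'f::field mat monoid)"
  using monoid.m_closed[OF group.is_monoid[OF GL_group]] by fastforce

lemma GL_one_closed: "1\<^sub>m n \<in> carrier (GL n :: 'f::field mat monoid)"
  using monoid.one_closed[OF group.is_monoid[OF GL_group]] by fastforce

lemma val_ring_simps [simp]:
  "carrier (val_ring v) = frac_ideal v 0" "mult (val_ring v) = (*)" "one (val_ring v) = 1"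
  "zero (val_ring v) = 0" "add (val_ring v) = (+)"
  by (simp_all add: val_ring_def)

lemma frac_ideal_mono: "x \<in> frac_ideal v m \<Longrightarrow> m' \<le> m \<Longrightarrow> x \<in> frac_ideal v m'"
  by (auto simp: frac_ideal_def)

lemma zero_in_frac [simp]: "0 \<in> frac_ideal v m" by (simp add: frac_ideal_def)

section \<open>Arithmetic of the valuation\<close>

context nonarch_local_field
begin

abbreviation "\<O> \<equiv> frac_ideal v 0"

lemma v_one [simp]: "v 1 = 0" using v_mult[of 1 1] by simp

lemma v_uminus [simp]: "v (- x) = v x"
proof (cases "x = 0")
  case False
  have "v (-1) + v (-1) = v 1" using v_mult[of "-1" "-1"] by simp
  then have "v (-1) = 0" by simp
  then show ?thesis using v_mult[of "-1" x] False by simp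
qed simp

lemma v_inverse: "x \<noteq> 0 \<Longrightarrow> v (inverse x) = - v x"
  using v_mult[of x "inverse x"] by simp

lemma frac_add: "x \<in> frac_ideal v m \<Longrightarrow> y \<in> frac_ideal v m \<Longrightarrow> x + y \<in> frac_ideal v m"
  unfolding frac_ideal_def using v_add[of x y] by (smt (verit) add_0_left add_0_right mem_Collect_eq min_def)

lemma frac_uminus: "x \<in> frac_ideal v m \<Longrightarrow> - x \<in> frac_ideal v m"
  by (auto simp: frac_ideal_def)

lemma frac_diff: "x \<in> frac_ideal v m \<Longrightarrow> y \<in> frac_ideal v m \<Longrightarrow> x - y \<in> frac_ideal v m"
  using frac_add[of x m "- y"] frac_uminus[of y m] by simp

lemma frac_mult: "x \<in> frac_ideal v m \<Longrightarrow> y \<in> frac_ideal v k \<Longrightarrow> x * y \<in> frac_ideal v (m + k)"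
  unfolding frac_ideal_def using v_mult[of x y] by (smt (verit) mem_Collect_eq mult_eq_0_iff)

lemma frac_mult_int: "x \<in> \<O> \<Longrightarrow> y \<in> frac_ideal v k \<Longrightarrow> x * y \<in> frac_ideal v k"
  using frac_mult[of x 0 y k] by simp

lemma int_mult: "x \<in> \<O> \<Longrightarrow> y \<in> \<O> \<Longrightarrow> x * y \<in> \<O>" by (rule frac_mult_int)

lemma frac_sum: "(\<And>i. i \<in> A \<Longrightarrow> f i \<in> frac_ideal v m) \<Longrightarrow> sum f A \<in> frac_ideal v m"
  by (induction A rule: infinite_finite_induct) (auto intro: frac_add)

lemma one_int [simp]: "1 \<in> \<O>" by (simp add: frac_ideal_def)

lemma cring_val_ring: "cring (val_ring v)"
proof (rule cringI)
  show "abelian_group (val_ring v)"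
    by (rule abelian_groupI) (auto simp: frac_add algebra_simps intro!: bexI[of _ "- x" for x] frac_uminus)
  show "Group.comm_monoid (val_ring v)"
    by (rule comm_monoidI) (auto simp: int_mult)
qed (auto simp: algebra_simps)

lemma vec_module_val_ring: "Module.module (val_ring v) (module_vec TYPE('f) n)"
proof -
  interpret V: Module.module "class_ring :: 'f ring" "module_vec TYPE('f) n" by (rule vec_module)
  show ?thesis
  proof (rule module_criteria)
    show "cring (val_ring v)" by (rule cring_val_ring)
    show "\<forall>x\<in>carrier (module_vec TYPE('f) n). \<exists>y\<in>carrier (module_vec TYPE('f) n).
        x \<oplus>\<^bsub>module_vec TYPE('f) n\<^esub> y = \<zero>\<^bsub>module_vec TYPE('f) n\<^esub>"
      by (intro ballI bexI[of _ "\<ominus>\<^bsub>module_vec TYPE('f) n\<^esub> x" for x]) (auto simp: V.M.r_neg)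
  qed (auto simp: module_vec_simps algebra_simps add_smult_distrib_vec smult_add_distrib_vec smult_smult_assoc intro: comm_add_vec assoc_add_vec)
qed

section \<open>Integral matrices\<close>

text \<open>Negative values of \<open>m\<close> bound denominators, which is how the effect of
  conjugation by a matrix with non-integral entries is controlled.\<close>

definition mat_in :: "int \<Rightarrow> nat \<Rightarrow> nat \<Rightarrow> 'f mat \<Rightarrow> bool" where
  "mat_in m nr nc A \<longleftrightarrow> A \<in> carrier_mat nr nc \<and> (\<forall>i<nr. \<forall>j<nc. A $$ (i, j) \<in> frac_ideal v m)"

lemma mat_in_mult:
  assumes "mat_in m nr k A" "mat_in m' k nc B" shows "mat_in (m + m') nr nc (A * B)"
  using assms unfolding mat_in_def
  by (auto simp: scalar_prod_def intro!: frac_sum frac_mult)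

lemma mat_in_one: "mat_in 0 n n (1\<^sub>m n)" by (auto simp: mat_in_def one_mat_def)

lemma mat_in_mono: "mat_in m nr nc A \<Longrightarrow> m' \<le> m \<Longrightarrow> mat_in m' nr nc A"
  unfolding mat_in_def using frac_ideal_mono by blast

lemma mat_in_exists:
  assumes "A \<in> carrier_mat nr nc" shows "\<exists>m\<le>0. mat_in m nr nc A"
proof -
  let ?S = "(\<lambda>(i,j). v (A $$ (i,j))) ` ({..<nr} \<times> {..<nc})"
  \<comment> \<open>Inserting \<open>0\<close> keeps the minimum meaningful for empty matrices and
    forces \<open>m \<le> 0\<close>. The arbitrary value \<open>v 0\<close> at zero entries can only
    lower the minimum, which does no harm.\<close>
  have "finite (insert 0 ?S)" by auto
  then have m: "Min (insert 0 ?S) \<le> x" if "x \<in> insert 0 ?S" for x using that by (rule Min_le)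
  have "A $$ (i,j) \<in> frac_ideal v (Min (insert 0 ?S))" if "i < nr" "j < nc" for i j
    using m[of "v (A $$ (i,j))"] that by (force simp: frac_ideal_def)
  then show ?thesis using assms m[of 0] unfolding mat_in_def by blast
qed

text \<open>This is the group of invertible matrices over the valuation ring, described without
  determinants; \<open>GLint_det\<close> and \<open>GLint_det_I\<close> relate it to the determinant
  being a unit.\<close>

definition GLint :: "nat \<Rightarrow> 'f mat set" where
  "GLint n = {A \<in> carrier (GL n). mat_in 0 n n A \<and> mat_in 0 n n (inv\<^bsub>GL n\<^esub> A)}"

lemma GLint_I:
  assumes "mat_in 0 n n A" "mat_in 0 n n B" "A * B = 1\<^sub>m n"
  shows "A \<in> GLint n" "B \<in> GLint n" "inv\<^bsub>GL n\<^esub> A = B"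
proof -
  have c: "A \<in> carrier_mat n n" "B \<in> carrier_mat n n" using assms by (auto simp: mat_in_def)
  show "A \<in> GLint n" "inv\<^bsub>GL n\<^esub> A = B" using GL_I[OF c assms(3)] assms by (auto simp: GLint_def)
  show "B \<in> GLint n" using GL_I[OF c(2,1) mat_mult_left_right_inverse[OF c assms(3)]] assms
    by (auto simp: GLint_def)
qed

lemma GLint_D: "A \<in> GLint n \<Longrightarrow> A \<in> carrier (GL n)" "A \<in> GLint n \<Longrightarrow> mat_in 0 n n A"
    "A \<in> GLint n \<Longrightarrow> mat_in 0 n n (inv\<^bsub>GL n\<^esub> A)" "A \<in> GLint n \<Longrightarrow> A \<in> carrier_mat n n"
  by (auto simp: GLint_def mat_in_def)

lemma GLint_inv: "A \<in> GLint n \<Longrightarrow> inv\<^bsub>GL n\<^esub> A \<in> GLint n"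
  using GLint_I(2)[of n A "inv\<^bsub>GL n\<^esub> A"] GL_inv(3)[of A n] by (simp add: GLint_def)

lemma GLint_mult: assumes "A \<in> GLint n" "B \<in> GLint n" shows "A * B \<in> GLint n"
proof -
  interpret G: group "GL n :: 'f mat monoid" by (rule GL_group)
  have "inv\<^bsub>GL n\<^esub> (A * B) = inv\<^bsub>GL n\<^esub> B * inv\<^bsub>GL n\<^esub> A"
    using G.inv_mult_group[of A B] assms by (simp add: GLint_def)
  then show ?thesis using assms mat_in_mult[of 0 n n _ 0 n] GL_mult_closed
    by (force simp: GLint_def)
qed

lemma GLint_one: "1\<^sub>m n \<in> GLint n"
  using GLint_I(1)[OF mat_in_one mat_in_one, of n] by simp

lemma GLint_subgroup: "subgroup (GLint n) (GL n)"
  by (rule subgroup.intro) (auto simp: GLint_D GLint_mult GLint_one GLint_inv)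

text \<open>The Leibniz formula involves only sums and products of entries and signs.\<close>

lemma det_int:
  assumes "mat_in 0 n n A" shows "det A \<in> \<O>"
proof -
  have prod: "prod f S \<in> \<O>" if "\<And>i. i \<in> S \<Longrightarrow> f i \<in> \<O>" for f :: "nat \<Rightarrow> 'f" and S
    using that by (induction S rule: infinite_finite_induct) (auto intro: int_mult)
  have "A \<in> carrier_mat n n" using assms by (simp add: mat_in_def)
  moreover have "signof p * (\<Prod>i = 0..<n. A $$ (i, p i)) \<in> \<O>" if "p permutes {0..<n}" for p
  proof -
    have "p i < n" if "i < n" for i using permutes_in_image[OF \<open>p permutes {0..<n}\<close>, of i] that by simp
    then have "(\<Prod>i = 0..<n. A $$ (i, p i)) \<in> \<O>" using assms by (intro prod) (auto simp: mat_in_def)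
    moreover have "signof p \<in> \<O>" by (auto simp: sign_def frac_uminus)
    ultimately show ?thesis by (rule int_mult[rotated])
  qed
  ultimately show ?thesis by (auto simp: det_def' intro!: frac_sum)
qed

text \<open>The determinants of the matrix and of its inverse are both integral and have product
  \<open>1\<close>, so neither can have positive valuation.\<close>

lemma GLint_det: assumes "A \<in> GLint n" shows "v (det A) = 0" "det A \<noteq> 0"
proof -
  have "det A * det (inv\<^bsub>GL n\<^esub> A) = det (1\<^sub>m n)"
    using det_mult[of A n "inv\<^bsub>GL n\<^esub> A"] GL_inv(3)[of A n] assms by (auto simp: GLint_def mat_in_def)
  then have p: "det A * det (inv\<^bsub>GL n\<^esub> A) = 1" by simp
  then show nz: "det A \<noteq> 0" by auto
  have "det A \<in> \<O>" "det (inv\<^bsub>GL n\<^esub> A) \<in> \<O>" using assms det_int by (auto simp: GLint_def)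
  moreover have "det (inv\<^bsub>GL n\<^esub> A) \<noteq> 0" using p by auto
  ultimately show "v (det A) = 0" using v_mult[of "det A" "det (inv\<^bsub>GL n\<^esub> A)"] p nz
    by (auto simp: frac_ideal_def)
qed

text \<open>A representative is chosen in each of the finitely many cosets that form the residue
  field.\<close>

lemma finite_residues: "\<exists>R. finite R \<and> R \<subseteq> \<O> \<and> (\<forall>x\<in>\<O>. \<exists>r\<in>R. x - r \<in> frac_ideal v 1)"
proof -
  define C where "C = carrier (residue_field v)"
  have C: "C = (\<lambda>x. frac_ideal v 1 +>\<^bsub>val_ring v\<^esub> x) ` \<O>"
    unfolding C_def residue_field_def FactRing_def max_ideal_def A_RCOSETS_defs a_r_coset_defs by auto
  have "\<forall>X\<in>C. \<exists>x\<in>\<O>. X = frac_ideal v 1 +>\<^bsub>val_ring v\<^esub> x" using C by auto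
  then obtain r where r: "\<And>X. X \<in> C \<Longrightarrow> r X \<in> \<O> \<and> X = frac_ideal v 1 +>\<^bsub>val_ring v\<^esub> r X" by metis
  have "\<exists>y\<in>r ` C. x - y \<in> frac_ideal v 1" if "x \<in> \<O>" for x
  proof -
    have X: "frac_ideal v 1 +>\<^bsub>val_ring v\<^esub> x \<in> C" using that C by auto
    have "x \<in> frac_ideal v 1 +>\<^bsub>val_ring v\<^esub> x" by (force simp: a_r_coset_defs)
    then have "x \<in> frac_ideal v 1 +>\<^bsub>val_ring v\<^esub> r (frac_ideal v 1 +>\<^bsub>val_ring v\<^esub> x)" using r[OF X] by simp
    then obtain h where "h \<in> frac_ideal v 1" "x = h + r (frac_ideal v 1 +>\<^bsub>val_ring v\<^esub> x)"
      unfolding a_r_coset_defs by auto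
    then have "x - r (frac_ideal v 1 +>\<^bsub>val_ring v\<^esub> x) \<in> frac_ideal v 1" by (metis add_diff_cancel_right')
    then show ?thesis using X by blast
  qed
  moreover have "finite (r ` C)" using finite_residue_field C_def by simp
  moreover have "r ` C \<subseteq> \<O>" using r by auto
  ultimately show ?thesis by blast
qed

text \<open>The order of the residue field is the base of the normalized absolute value; its
  positivity enters the multiplicativity and positivity of \<open>norm_abs\<close>.\<close>

lemma card_residue_field: "0 < card (carrier (residue_field v))"
proof -
  have "frac_ideal v 1 +>\<^bsub>val_ring v\<^esub> 0 \<in> carrier (residue_field v)"
    unfolding residue_field_def FactRing_def max_ideal_def A_RCOSETS_defs a_r_coset_defs by force
  then show ?thesis using finite_residue_field card_gt_0_iff by blast
qed

definition ufz :: 'f where "ufz = (SOME x. x \<noteq> 0 \<and> v x = 1)"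

lemma ufz: "ufz \<noteq> 0" "v ufz = 1"
  using someI_ex[OF uniformizer] unfolding ufz_def by auto

lemma ufz_pow: "v (ufz ^ k) = int k" "ufz ^ k \<noteq> 0"
  using ufz by (induction k) (simp_all add: v_mult)

lemma ufz_int [simp]: "ufz \<in> \<O>" "ufz ^ k \<in> \<O>" using ufz ufz_pow[of k] by (auto simp: frac_ideal_def)

lemma ufz_div: "x \<in> frac_ideal v (int k + m) \<Longrightarrow> \<exists>y\<in>frac_ideal v m. x = ufz ^ k * y"
proof -
  assume x: "x \<in> frac_ideal v (int k + m)"
  have "x / ufz ^ k \<in> frac_ideal v m"
    using x v_mult[of x "inverse (ufz ^ k)"] v_inverse[of "ufz ^ k"] ufz_pow[of k]
    by (auto simp: frac_ideal_def divide_inverse)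
  then show ?thesis using ufz_pow[of k] by (intro bexI[of _ "x / ufz ^ k"]) auto
qed

text \<open>Digit expansion: a representative modulo the \<open>k\<close>-th power of the maximal
  ideal is corrected by one further digit \<open>s\<close> multiplied by
  \<open>ufz ^ k\<close>.\<close>

lemma finite_residues_power: "\<exists>R. finite R \<and> R \<subseteq> \<O> \<and> (\<forall>x\<in>\<O>. \<exists>r\<in>R. x - r \<in> frac_ideal v (int k))"
proof (induction k)
  case 0
  then show ?case by (intro exI[of _ "{0}"]) auto
next
  case (Suc k)
  then obtain R where R: "finite R" "R \<subseteq> \<O>" "\<And>x. x \<in> \<O> \<Longrightarrow> \<exists>r\<in>R. x - r \<in> frac_ideal v (int k)" by blast
  obtain R1 where R1: "finite R1" "R1 \<subseteq> \<O>" "\<And>x. x \<in> \<O> \<Longrightarrow> \<exists>r\<in>R1. x - r \<in> frac_ideal v 1"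
    using finite_residues by blast
  let ?R = "(\<lambda>(r, s). r + ufz ^ k * s) ` (R \<times> R1)"
  have "\<exists>t\<in>?R. x - t \<in> frac_ideal v (int (Suc k))" if x: "x \<in> \<O>" for x
  proof -
    obtain r where r: "r \<in> R" "x - r \<in> frac_ideal v (int k)" using R(3)[OF x] by blast
    then obtain y where y: "y \<in> \<O>" "x - r = ufz ^ k * y" using ufz_div[of "x - r" k 0] by auto
    obtain s where s: "s \<in> R1" "y - s \<in> frac_ideal v 1" using R1(3)[OF y(1)] by blast
    have "x - (r + ufz ^ k * s) = ufz ^ k * (y - s)" using y by (simp add: algebra_simps)
    moreover have "ufz ^ k * (y - s) \<in> frac_ideal v (int k + 1)"
      using ufz_pow[of k] s by (intro frac_mult) (auto simp: frac_ideal_def)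
    ultimately show ?thesis using r s by (intro bexI[of _ "r + ufz ^ k * s"]) (auto simp: add.commute)
  qed
  moreover have "?R \<subseteq> \<O>" using R R1 by (auto intro!: frac_add int_mult)
  moreover have "finite ?R" using R R1 by auto
  ultimately show ?case by blast
qed

end

section \<open>Generating tuples\<close>

text \<open>The locale is instantiated by \<open>M\<close> and again by every graded piece of a
  filtration, so that the results on tuples are available for both.\<close>

locale val_module = nonarch_local_field v + Module.module "val_ring v" M
  for v :: "'f::field_char_0 \<Rightarrow> int" and M :: "('f, 'm) module" (structure)
begin

lemmas comb_add = comb_add_left[unfolded val_ring_simps]
lemmas smult_0 [simp] = smult_l_null[unfolded val_ring_simps]
lemmas smult_1 [simp] = smult_one[unfolded val_ring_simps]
lemmas comb_smult = comb_smult_left[unfolded val_ring_simps]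

text \<open>Substituting combinations into a combination multiplies the coefficient arrays; this is
  what makes \<open>act\<close> compatible with matrix products.\<close>

lemma comb_comb:
  assumes "x \<in> {..<n} \<rightarrow> carrier M" "c \<in> {..<m} \<rightarrow> \<O>" "\<And>b. b < m \<Longrightarrow> d b \<in> {..<n} \<rightarrow> \<O>"
  shows "comb m c (\<lambda>b. comb n (d b) x) = comb n (\<lambda>a. \<Sum>b<m. c b * d b a) x"
  using assms(2,3)
proof (induction m)
  case 0
  then show ?case using comb_zero_left[OF assms(1)] by (simp add: comb_def)
next
  case (Suc m)
  have d: "d b a \<in> \<O>" if "b < Suc m" "a < n" for b a using Suc.prems(2)[OF that(1)] that(2) by auto
  have c: "c b \<in> \<O>" if "b < Suc m" for b using Suc.prems(1) that by auto
  have "comb (Suc m) c (\<lambda>b. comb n (d b) x) = c m \<odot>\<^bsub>M\<^esub> comb n (d m) x \<oplus>\<^bsub>M\<^esub> comb m c (\<lambda>b. comb n (d b) x)"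
    using Suc.prems assms(1) by (intro comb_Suc) auto
  also have "\<dots> = comb n (\<lambda>a. c m * d m a) x \<oplus>\<^bsub>M\<^esub> comb n (\<lambda>a. \<Sum>b<m. c b * d b a) x"
    using Suc comb_smult_left[of "d m" n "c m" x] assms(1) c by auto
  also have "\<dots> = comb n (\<lambda>a. c m * d m a + (\<Sum>b<m. c b * d b a)) x"
  proof (subst comb_add_left[symmetric])
    show "(\<lambda>a. c m * d m a) \<in> {..<n} \<rightarrow> carrier (val_ring v)"
      "(\<lambda>a. \<Sum>b<m. c b * d b a) \<in> {..<n} \<rightarrow> carrier (val_ring v)"
      using c d by (auto intro!: frac_sum int_mult)
  qed (use assms(1) in simp_all)
  also have "\<dots> = comb n (\<lambda>a. \<Sum>b<Suc m. c b * d b a) x" by (simp add: add.commute)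
  finally show ?case .
qed

text \<open>A tuple is a row vector with entries in \<open>M\<close>, and the matrix multiplies it
  from the right. The result is kept extensional so that equality of tuples is equality of
  functions.\<close>

definition act :: "nat \<Rightarrow> (nat \<Rightarrow> 'm) \<Rightarrow> 'f mat \<Rightarrow> nat \<Rightarrow> 'm" where
  "act n x g = (\<lambda>b\<in>{..<n}. comb n (\<lambda>a. g $$ (a, b)) x)"

lemma act_closed:
  assumes "x \<in> {..<n} \<rightarrow> carrier M" "mat_in 0 n n g"
  shows "act n x g \<in> {..<n} \<rightarrow>\<^sub>E carrier M"
  using assms unfolding act_def by (auto simp: mat_in_def)

lemma comb_act:
  assumes "x \<in> {..<n} \<rightarrow> carrier M" "mat_in 0 n n g" "c \<in> {..<n} \<rightarrow> \<O>"
  shows "comb n c (act n x g) = comb n (\<lambda>a. \<Sum>b<n. g $$ (a, b) * c b) x"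
proof -
  have "comb n c (act n x g) = comb n c (\<lambda>b. comb n (\<lambda>a. g $$ (a, b)) x)"
    using assms by (intro comb_cong) (auto simp: act_def mat_in_def)
  also have "\<dots> = comb n (\<lambda>a. \<Sum>b<n. c b * g $$ (a, b)) x"
    using assms by (intro comb_comb) (auto simp: mat_in_def)
  finally show ?thesis by (simp add: mult.commute)
qed

lemma act_mult:
  assumes "x \<in> {..<n} \<rightarrow> carrier M" "mat_in 0 n n g" "mat_in 0 n n h"
  shows "act n (act n x g) h = act n x (g * h)"
proof
  fix c show "act n (act n x g) h c = act n x (g * h) c"
  proof (cases "c < n")
    case True
    have "act n (act n x g) h c = comb n (\<lambda>a. \<Sum>b<n. g $$ (a, b) * h $$ (b, c)) x"
      using True assms comb_act[of x n g "\<lambda>b. h $$ (b, c)"] by (auto simp: act_def mat_in_def)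
    also have "\<dots> = comb n (\<lambda>a. (g * h) $$ (a, c)) x"
      using assms True mat_in_mult[OF assms(2,3)]
      by (intro comb_cong) (auto simp: mat_in_def scalar_prod_def atLeast0LessThan)
    finally show ?thesis using True by (simp add: act_def)
  qed (simp add: act_def)
qed

lemma act_one:
  assumes "x \<in> {..<n} \<rightarrow>\<^sub>E carrier M" shows "act n x (1\<^sub>m n) = x"
proof
  fix c
  have "comb n (\<lambda>a. 1\<^sub>m n $$ (a, c)) x = x c" if c: "c < n"
  proof -
    have "comb n (\<lambda>a. 1\<^sub>m n $$ (a, c)) x = comb n (\<lambda>a. if a = c then \<one>\<^bsub>val_ring v\<^esub> else \<zero>\<^bsub>val_ring v\<^esub>) x"
      using assms c by (intro comb_cong) auto
    then show ?thesis using comb_unit[of c n x] assms c by auto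
  qed
  then show "act n x (1\<^sub>m n) c = x c" using assms by (auto simp: act_def PiE_def extensional_def)
qed

definition tuples :: "nat \<Rightarrow> (nat \<Rightarrow> 'm) set" where
  "tuples n = {x \<in> {..<n} \<rightarrow>\<^sub>E carrier M. generates n x}"

lemma tuples_D: "x \<in> tuples n \<Longrightarrow> x \<in> {..<n} \<rightarrow>\<^sub>E carrier M" "x \<in> tuples n \<Longrightarrow> x \<in> {..<n} \<rightarrow> carrier M"
  by (auto simp: tuples_def)

lemma act_inverse:
  assumes "x \<in> {..<n} \<rightarrow>\<^sub>E carrier M" "mat_in 0 n n g" "mat_in 0 n n h" "g * h = 1\<^sub>m n"
  shows "act n (act n x g) h = x"
  using act_mult[of x n g h] assms act_one by auto

text \<open>The old tuple is the image of the new one under the inverse of \<open>g\<close>, which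
  is integral as well, so every combination of the old entries is one of the new entries.\<close>

lemma act_tuples:
  assumes x: "x \<in> tuples n" and g: "g \<in> GLint n"
  shows "act n x g \<in> tuples n"
proof -
  note xD = tuples_D[OF x] note gD = GLint_D[OF g]
  have "act n (act n x g) (inv\<^bsub>GL n\<^esub> g) = x"
    using GL_inv(3)[OF gD(1)] by (intro act_inverse xD gD) auto
  have "\<exists>c\<in>{..<n} \<rightarrow> carrier (val_ring v). m = comb n c (act n x g)" if m: "m \<in> carrier M" for m
  proof -
    obtain c where c: "c \<in> {..<n} \<rightarrow> \<O>" "m = comb n c x"
      using x m unfolding tuples_def generates_def by auto
    have "m = comb n c (act n (act n x g) (inv\<^bsub>GL n\<^esub> g))" using c \<open>act n _ _ = x\<close> by simp
    also have "\<dots> = comb n (\<lambda>a. \<Sum>b<n. (inv\<^bsub>GL n\<^esub> g) $$ (a, b) * c b) (act n x g)"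
      using act_closed[OF xD(2) gD(2)] c gD by (intro comb_act) auto
    finally show ?thesis using c gD
      by (intro bexI[of _ "\<lambda>a. \<Sum>b<n. (inv\<^bsub>GL n\<^esub> g) $$ (a, b) * c b"])
        (auto simp: mat_in_def intro!: frac_sum int_mult)
  qed
  then show ?thesis using act_closed[OF xD(2) gD(2)] by (auto simp: tuples_def generates_def)
qed

section \<open>Orbits of integral invertible matrices on tuples\<close>

definition tuple_equiv :: "nat \<Rightarrow> (nat \<Rightarrow> 'm) \<Rightarrow> (nat \<Rightarrow> 'm) \<Rightarrow> bool" where
  "tuple_equiv n x y \<longleftrightarrow> (\<exists>g\<in>GLint n. act n x g = y)"

lemma tuple_equiv_trans:
  assumes "x \<in> {..<n} \<rightarrow>\<^sub>E carrier M" "tuple_equiv n x y" "tuple_equiv n y z"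
  shows "tuple_equiv n x z"
proof -
  obtain g h where gh: "g \<in> GLint n" "act n x g = y" "h \<in> GLint n" "act n y h = z"
    using assms unfolding tuple_equiv_def by blast
  have "x \<in> {..<n} \<rightarrow> carrier M" using assms(1) by auto
  then have "act n x (g * h) = act n (act n x g) h" by (rule act_mult[symmetric]) (simp_all add: gh GLint_D)
  then have "act n x (g * h) = z" by (simp only: gh)
  then show ?thesis unfolding tuple_equiv_def using GLint_mult[OF gh(1,3)] by blast
qed

lemma tuple_equiv_sym:
  assumes "x \<in> {..<n} \<rightarrow>\<^sub>E carrier M" "tuple_equiv n x y"
  shows "tuple_equiv n y x"
proof -
  obtain g where g: "g \<in> GLint n" "act n x g = y" using assms unfolding tuple_equiv_def by blast
  have "act n y (inv\<^bsub>GL n\<^esub> g) = x"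
    unfolding g(2)[symmetric] using assms(1) GLint_D[OF g(1)] GL_inv(3)[of g n]
    by (intro act_inverse) auto
  then show ?thesis unfolding tuple_equiv_def using g GLint_inv by blast
qed

text \<open>Acting with this elementary matrix exchanges the single entry \<open>x k\<close> for the
  combination of \<open>x\<close> with coefficients \<open>c\<close>. It is invertible over the
  valuation ring when the pivot \<open>c k\<close> is a unit.\<close>

definition col_mat :: "nat \<Rightarrow> nat \<Rightarrow> (nat \<Rightarrow> 'f) \<Rightarrow> 'f mat" where
  "col_mat n k c = mat n n (\<lambda>(i, j). if j = k then c i else if i = j then 1 else 0)"

lemma col_mat_GLint:
  assumes k: "k < n" and c: "c \<in> {..<n} \<rightarrow> \<O>" and u: "v (c k) = 0" "c k \<noteq> 0"
  shows "col_mat n k c \<in> GLint n"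
proof -
  \<comment> \<open>The inverse has the same shape: in the special column the pivot is inverted and
    the other coefficients are divided by the negative of the pivot.\<close>
  define d where "d i = (if i = k then inverse (c k) else - c i * inverse (c k))" for i
  have "inverse (c k) \<in> \<O>" using u v_inverse[of "c k"] by (simp add: frac_ideal_def)
  then have d: "d i \<in> \<O>" if "i < n" for i
    using that c by (auto simp: d_def intro!: int_mult frac_uminus)
  have "col_mat n k c * col_mat n k d = 1\<^sub>m n"
  proof (rule eq_matI)
    fix i j assume "i < dim_row (1\<^sub>m n :: 'f mat)" "j < dim_col (1\<^sub>m n :: 'f mat)"
    then have ij: "i < n" "j < n" by auto
    have *: "(col_mat n k c * col_mat n k d) $$ (i, j) =
      (\<Sum>l<n. (if l = k then c i else if i = l then 1 else 0) * (if j = k then d l else if l = j then 1 else 0))"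
      using ij by (simp add: col_mat_def scalar_prod_def atLeast0LessThan)
    have s: "(\<Sum>l<n. f l) = f k + (\<Sum>l\<in>{..<n}-{k}. f l)" for f :: "nat \<Rightarrow> 'f"
      using k by (simp add: sum.remove)
    show "(col_mat n k c * col_mat n k d) $$ (i, j) = 1\<^sub>m n $$ (i, j)"
    proof (cases "j = k")
      case True
      have "(\<Sum>l\<in>{..<n}-{k}. (if l = k then c i else if i = l then 1 else 0) * (if j = k then d l else if l = j then 1 else 0))
          = (\<Sum>l\<in>{..<n}-{k}. if l = i then d l else 0)"
        using True by (intro sum.cong) auto
      then show ?thesis unfolding * s using True ij u(2) by (auto simp: d_def)
    next
      case False
      have "(\<Sum>l\<in>{..<n}-{k}. (if l = k then c i else if i = l then 1 else 0) * (if j = k then d l else if l = j then 1 else 0))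
          = (\<Sum>l\<in>{..<n}-{k}. if l = j then (if i = j then 1 else 0) else 0)"
        using False by (intro sum.cong) auto
      then show ?thesis unfolding * s using False ij by auto
    qed
  qed (auto simp: col_mat_def)
  moreover have "mat_in 0 n n (col_mat n k c)" "mat_in 0 n n (col_mat n k d)"
    using c d by (auto simp: col_mat_def mat_in_def)
  ultimately show ?thesis using GLint_I(1) by blast
qed

lemma act_col_mat:
  assumes "k < n" "c \<in> {..<n} \<rightarrow> \<O>" "x \<in> {..<n} \<rightarrow>\<^sub>E carrier M"
  shows "act n x (col_mat n k c) = x(k := comb n c x)"
proof
  fix b
  consider "b = k" | "b < n" "b \<noteq> k" | "\<not> b < n" by linarith
  then show "act n x (col_mat n k c) b = (x(k := comb n c x)) b"
  proof cases
    case 1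
    have "comb n (\<lambda>a. col_mat n k c $$ (a, b)) x = comb n c x"
      using assms 1 by (intro comb_cong) (auto simp: col_mat_def)
    then show ?thesis using 1 assms by (simp add: act_def)
  next
    case 2
    have "comb n (\<lambda>a. col_mat n k c $$ (a, b)) x = comb n (\<lambda>a. if a = b then \<one>\<^bsub>val_ring v\<^esub> else \<zero>\<^bsub>val_ring v\<^esub>) x"
      using assms 2 by (intro comb_cong) (auto simp: col_mat_def)
    then show ?thesis using 2 assms comb_unit[of b n x] by (auto simp: act_def)
  next
    case 3
    then show ?thesis using assms by (auto simp: act_def PiE_def extensional_def)
  qed
qed

lemma tuple_equiv_replace:
  assumes "k < n" "c \<in> {..<n} \<rightarrow> \<O>" "x \<in> {..<n} \<rightarrow>\<^sub>E carrier M" "v (c k) = 0" "c k \<noteq> 0"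
  shows "tuple_equiv n x (x(k := comb n c x))"
  unfolding tuple_equiv_def using act_col_mat[OF assms(1-3)] col_mat_GLint[OF assms(1,2,4,5)] by blast

text \<open>The permutation matrix of a transposition is integral and its own inverse.\<close>

lemma tuple_equiv_swap:
  assumes ab: "a < n" "b < n" and x: "x \<in> {..<n} \<rightarrow>\<^sub>E carrier M"
  shows "tuple_equiv n x (x \<circ> transpose a b)"
proof -
  let ?t = "transpose a b"
  define P :: "'f mat" where "P = mat n n (\<lambda>(i, j). if i = ?t j then 1 else 0)"
  have t: "?t j < n \<longleftrightarrow> j < n" for j using ab by (auto simp: transpose_def)
  have "P * P = 1\<^sub>m n"
  proof (rule eq_matI)
    fix i j assume "i < dim_row (1\<^sub>m n :: 'f mat)" "j < dim_col (1\<^sub>m n :: 'f mat)"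
    then have ij: "i < n" "j < n" by auto
    have "(P * P) $$ (i, j) = (\<Sum>l<n. (if i = ?t l then 1 else 0) * (if l = ?t j then 1 else 0))"
      using ij by (simp add: P_def scalar_prod_def atLeast0LessThan)
    also have "\<dots> = (\<Sum>l<n. if l = ?t j then (if i = j then 1 else 0) else 0)"
      by (intro sum.cong) auto
    also have "\<dots> = 1\<^sub>m n $$ (i, j)" using ij t by simp
    finally show "(P * P) $$ (i, j) = 1\<^sub>m n $$ (i, j)" .
  qed (auto simp: P_def)
  moreover have Pin: "mat_in 0 n n P" by (auto simp: P_def mat_in_def)
  ultimately have "P \<in> GLint n" by (intro GLint_I(1)[of n P P])
  moreover have "act n x P = x \<circ> ?t"
  proof
    fix c show "act n x P c = (x \<circ> ?t) c"
    proof (cases "c < n")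
      case True
      have "comb n (\<lambda>i. P $$ (i, c)) x = comb n (\<lambda>i. if i = ?t c then \<one>\<^bsub>val_ring v\<^esub> else \<zero>\<^bsub>val_ring v\<^esub>) x"
        using x True by (intro comb_cong) (auto simp: P_def)
      moreover have "\<dots> = x (?t c)" using True t x by (intro comb_unit) auto
      ultimately show ?thesis using True by (simp add: act_def)
    next
      case False
      then have tc: "?t c = c" using ab by (auto simp: transpose_def)
      have "x c = undefined" using False x by (auto simp: PiE_def extensional_def)
      then show ?thesis using False tc by (simp add: act_def)
    qed
  qed
  ultimately show ?thesis unfolding tuple_equiv_def by (intro bexI[of _ P])
qed

text \<open>The matrix used here is the identity plus a square-zero matrix.\<close>

lemma tuple_equiv_mask:
  assumes x: "x \<in> {..<n} \<rightarrow>\<^sub>E carrier M" and S: "S \<subseteq> {..<n}"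
    and y: "y = (\<lambda>a\<in>{..<n}. if a \<in> S then x a else \<zero>\<^bsub>M\<^esub>)"
    and sp: "\<And>b. b < n \<Longrightarrow> b \<notin> S \<Longrightarrow> x b \<in> comb_span n y"
  shows "tuple_equiv n y x"
proof -
  have yc: "y \<in> {..<n} \<rightarrow>\<^sub>E carrier M" unfolding y using x by (simp add: PiE_iff)
  have "\<forall>b. \<exists>d. b < n \<longrightarrow> b \<notin> S \<longrightarrow> d \<in> {..<n} \<rightarrow> \<O> \<and> x b = comb n d y"
  proof
    fix b
    show "\<exists>d. b < n \<longrightarrow> b \<notin> S \<longrightarrow> d \<in> {..<n} \<rightarrow> \<O> \<and> x b = comb n d y"
    proof (cases "b < n \<and> b \<notin> S")
      case True
      then have "x b \<in> comb_span n y" using sp by blast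
      then show ?thesis by (simp add: comb_span_def) blast
    qed blast
  qed
  then obtain d where d: "\<And>b. b < n \<Longrightarrow> b \<notin> S \<Longrightarrow> d b \<in> {..<n} \<rightarrow> \<O>"
    "\<And>b. b < n \<Longrightarrow> b \<notin> S \<Longrightarrow> x b = comb n (d b) y" by metis
  \<comment> \<open>The part off the diagonal has its rows in \<open>S\<close> and its columns
    outside \<open>S\<close>, so the inverse is obtained by replacing \<open>d\<close> by its
    negative.\<close>
  define E where "E e = mat n n (\<lambda>(i, j). if i = j then 1 else if i \<in> S \<and> j \<notin> S then e j i else 0)" for e :: "nat \<Rightarrow> nat \<Rightarrow> 'f"
  have dO: "d j i \<in> \<O>" if "i < n" "j < n" "j \<notin> S" for i j using d(1)[OF that(2,3)] that(1) by auto
  have Ein: "mat_in 0 n n (E d)" "mat_in 0 n n (E (\<lambda>j i. - d j i))"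
    using dO by (auto simp: E_def mat_in_def intro!: frac_uminus)
  have "E d * E (\<lambda>j i. - d j i) = 1\<^sub>m n"
  proof (rule eq_matI)
    fix i j assume "i < dim_row (1\<^sub>m n :: 'f mat)" "j < dim_col (1\<^sub>m n :: 'f mat)"
    then have ij: "i < n" "j < n" by auto
    have "(E d * E (\<lambda>j i. - d j i)) $$ (i, j) = (\<Sum>l<n. (if i = l then 1 else if i \<in> S \<and> l \<notin> S then d l i else 0) *
        (if l = j then 1 else if l \<in> S \<and> j \<notin> S then - d j l else 0))"
      using ij by (simp add: E_def scalar_prod_def atLeast0LessThan)
    also have "\<dots> = (\<Sum>l<n. (if l = i then (if i = j then 1 else if i \<in> S \<and> j \<notin> S then - d j i else 0) else 0) +
        (if l = j then (if i = j then 0 else if i \<in> S \<and> j \<notin> S then d j i else 0) else 0))"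
      by (intro sum.cong) auto
    also have "\<dots> = 1\<^sub>m n $$ (i, j)" using ij by (simp add: sum.distrib)
    finally show "(E d * E (\<lambda>j i. - d j i)) $$ (i, j) = 1\<^sub>m n $$ (i, j)" .
  qed (auto simp: E_def)
  then have "E d \<in> GLint n" using Ein GLint_I(1) by blast
  moreover have "act n y (E d) = x"
  proof
    fix b
    consider "b < n" "b \<in> S" | "b < n" "b \<notin> S" | "\<not> b < n" by blast
    then show "act n y (E d) b = x b"
    proof cases
      case 1
      have "comb n (\<lambda>a. E d $$ (a, b)) y = comb n (\<lambda>a. if a = b then \<one>\<^bsub>val_ring v\<^esub> else \<zero>\<^bsub>val_ring v\<^esub>) y"
        using 1 yc by (intro comb_cong) (auto simp: E_def)
      also have "\<dots> = y b" using 1 yc by (intro comb_unit) auto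
      finally show ?thesis using 1 by (simp add: act_def y)
    next
      case 2
      \<comment> \<open>Only rows in \<open>S\<close> contribute, since \<open>y\<close> vanishes at
        the other indices; in particular the diagonal entry of column \<open>b\<close> has no
        effect.\<close>
      have "comb n (\<lambda>a. E d $$ (a, b)) y = comb n (d b) y"
        unfolding comb_def
      proof (rule M.finsum_cong')
        fix a assume "a \<in> {..<n}"
        then show "E d $$ (a, b) \<odot> y a = d b a \<odot> y a"
          using 2 dO[of a b] by (cases "a \<in> S") (auto simp: E_def y)
      qed (use dO 2 yc in auto)
      then show ?thesis using 2 d(2)[of b] by (simp add: act_def)
    next
      case 3 then show ?thesis using x by (auto simp: act_def PiE_def extensional_def)
    qed
  qed
  ultimately show ?thesis unfolding tuple_equiv_def by (intro bexI[of _ "E d"])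
qed

text \<open>The exponent is kept explicit because it also controls the neighbourhoods in
  \<open>stab_open_step\<close> and the number of residues in \<open>finite_carrier\<close>.\<close>

definition torsion :: "nat \<Rightarrow> bool" where
  "torsion k \<longleftrightarrow> (\<forall>c\<in>frac_ideal v (int k). \<forall>m\<in>carrier M. c \<odot>\<^bsub>M\<^esub> m = \<zero>\<^bsub>M\<^esub>)"

text \<open>Iterating the hypothesis writes every \<open>m\<close> as an element of \<open>N\<close>
  plus a multiple of \<open>ufz ^ j\<close>, for each \<open>j\<close>; at \<open>j = k\<close> the
  second term is zero.\<close>

lemma nakayama:
  assumes "torsion k" "submodule (val_ring v) N M"
    and h: "\<And>m. m \<in> carrier M \<Longrightarrow> \<exists>y\<in>N. \<exists>m'\<in>carrier M. m = y \<oplus>\<^bsub>M\<^esub> ufz \<odot>\<^bsub>M\<^esub> m'"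
  shows "N = carrier M"
proof -
  interpret N: submodule "val_ring v" N M by fact
  have "\<exists>y\<in>N. \<exists>m'\<in>carrier M. m = y \<oplus>\<^bsub>M\<^esub> (ufz ^ j) \<odot>\<^bsub>M\<^esub> m'" if "m \<in> carrier M" for m j
    using that
  proof (induction j arbitrary: m)
    case 0 then show ?case using smult_one[of m] by (intro bexI[of _ "\<zero>\<^bsub>M\<^esub>"] bexI[of _ m]) auto
  next
    case (Suc j)
    obtain y m' where y: "y \<in> N" "m' \<in> carrier M" "m = y \<oplus>\<^bsub>M\<^esub> ufz \<odot>\<^bsub>M\<^esub> m'" using h[OF Suc.prems] by blast
    obtain y' m'' where y': "y' \<in> N" "m'' \<in> carrier M" "m' = y' \<oplus>\<^bsub>M\<^esub> (ufz ^ j) \<odot>\<^bsub>M\<^esub> m''" using Suc.IH[OF y(2)] by blast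
    have yc: "y \<in> carrier M" "y' \<in> carrier M" using y y' N.subset by auto
    have "m = (y \<oplus>\<^bsub>M\<^esub> ufz \<odot>\<^bsub>M\<^esub> y') \<oplus>\<^bsub>M\<^esub> (ufz ^ Suc j) \<odot>\<^bsub>M\<^esub> m''"
      using y y' yc smult_assoc1[of ufz "ufz ^ j" m''] by (simp add: smult_r_distr M.a_assoc)
    moreover have "y \<oplus>\<^bsub>M\<^esub> ufz \<odot>\<^bsub>M\<^esub> y' \<in> N" using y(1) y'(1) by simp
    ultimately show ?case using y'(2) by blast
  qed
  moreover have "(ufz ^ k) \<odot>\<^bsub>M\<^esub> m = \<zero>\<^bsub>M\<^esub>" if "m \<in> carrier M" for m
    using assms(1) that ufz_pow[of k] by (auto simp: torsion_def frac_ideal_def)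
  ultimately have "m \<in> N" if "m \<in> carrier M" for m
    using that N.subset by (metis M.r_zero subsetD)
  then show ?thesis using N.subset by blast
qed

text \<open>Induction on the number of positions outside the set \<open>S\<close> on which the
  tuples agree. If some \<open>y b\<close> with \<open>b\<close> outside \<open>S\<close> has, as a
  combination of \<open>x\<close>, a unit coefficient at a position \<open>a\<close> outside
  \<open>S\<close>, then \<open>y b\<close> can be brought into the tuple and \<open>S\<close>
  grows. Otherwise Nakayama shows that the common entries in \<open>S\<close> already generate
  \<open>M\<close>, and both tuples are equivalent to the one that is zero outside
  \<open>S\<close>.\<close>

lemma tuple_equiv_agree:
  assumes tor: "torsion k"
  shows "S \<subseteq> {..<n} \<Longrightarrow> x \<in> tuples n \<Longrightarrow> y \<in> tuples n \<Longrightarrow> (\<And>a. a \<in> S \<Longrightarrow> x a = y a) \<Longrightarrow> tuple_equiv n x y"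
proof (induction "n - card S" arbitrary: S x rule: less_induct)
  case less
  note xD = tuples_D[OF less.prems(2)] note yD = tuples_D[OF less.prems(3)]
  have "\<exists>c\<in>{..<n} \<rightarrow> \<O>. y b = comb n c x" if "b < n" for b
    using less.prems(2) yD that unfolding tuples_def generates_def by auto
  then obtain c where c: "\<And>b. b < n \<Longrightarrow> c b \<in> {..<n} \<rightarrow> \<O>" "\<And>b. b < n \<Longrightarrow> y b = comb n (c b) x" by metis
  show ?case
  proof (cases "\<exists>a b. a < n \<and> b < n \<and> a \<notin> S \<and> b \<notin> S \<and> c b a \<noteq> 0 \<and> v (c b a) = 0")
    case True
    then obtain a b where ab: "a < n" "b < n" "a \<notin> S" "b \<notin> S" "c b a \<noteq> 0" "v (c b a) = 0" by blast
    \<comment> \<open>The unit coefficient lets \<open>y b\<close> take the place of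
      \<open>x a\<close>, and the transposition moves it to its own position \<open>b\<close>.
      Entries in \<open>S\<close> stay where they are, as \<open>a\<close> and \<open>b\<close> lie
      outside \<open>S\<close>.\<close>
    define x' where "x' = x(a := y b)"
    have e1: "tuple_equiv n x x'" using tuple_equiv_replace[of a n "c b" x] ab c xD by (simp add: x'_def)
    have x': "x' \<in> {..<n} \<rightarrow>\<^sub>E carrier M" using xD(1) yD(2) ab by (auto simp: x'_def)
    define x'' where "x'' = x' \<circ> transpose a b"
    have "tuple_equiv n x' x''" unfolding x''_def using ab x' by (intro tuple_equiv_swap)
    then have e2: "tuple_equiv n x x''" using tuple_equiv_trans[OF xD(1) e1] by blast
    then have t: "x'' \<in> tuples n" using act_tuples less.prems(2) unfolding tuple_equiv_def by blast
    have agree: "x'' i = y i" if "i \<in> insert b S" for i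
      using that ab less.prems(4)[of i] by (auto simp: x''_def x'_def transpose_def)
    have fS: "finite S" using less.prems(1) finite_subset by blast
    have sub: "insert b S \<subseteq> {..<n}" using ab less.prems(1) by auto
    \<comment> \<open>The bound by \<open>n\<close> ensures that the truncated difference used as
      induction measure strictly decreases.\<close>
    have "card (insert b S) \<le> n" using card_mono[OF _ sub] by simp
    then have "n - card (insert b S) < n - card S" using ab fS by simp
    then have "tuple_equiv n x'' y" by (rule less.hyps[OF _ sub t less.prems(3) agree])
    then show ?thesis using tuple_equiv_trans[OF xD(1) e2] by blast
  next
    case False
    \<comment> \<open>Since \<open>x\<close> and \<open>y\<close> agree on \<open>S\<close>, masking
      the other entries yields one and the same tuple for both. It remains to see that this tuple
      generates \<open>M\<close>.\<close>
    define z where "z = (\<lambda>a\<in>{..<n}. if a \<in> S then x a else \<zero>\<^bsub>M\<^esub>)"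
    have zy: "z = (\<lambda>a\<in>{..<n}. if a \<in> S then y a else \<zero>\<^bsub>M\<^esub>)" using less.prems(4) by (auto simp: z_def)
    have z: "z \<in> {..<n} \<rightarrow>\<^sub>E carrier M"  unfolding z_def using xD(1) by (simp add: PiE_iff)
    then have z': "z \<in> {..<n} \<rightarrow> carrier M" by auto
    define N where "N = comb_span n z"
    interpret N: submodule "val_ring v" N M unfolding N_def by (rule comb_span_submodule[OF z'])
    have yN: "\<exists>w\<in>N. \<exists>m'\<in>carrier M. y b = w \<oplus>\<^bsub>M\<^esub> ufz \<odot>\<^bsub>M\<^esub> m'" if b: "b < n" for b
    proof (cases "b \<in> S")
      case True
      then have "y b = z b" using b zy by simp
      then have "y b \<in> N" using comb_span_mem[OF z' b] by (simp add: N_def)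
      moreover have "y b = y b \<oplus>\<^bsub>M\<^esub> ufz \<odot>\<^bsub>M\<^esub> \<zero>\<^bsub>M\<^esub>" using yD(2) b by (auto simp: Pi_iff)
      ultimately show ?thesis using M.zero_closed by blast
    next
      case bS: False
      have cO: "c b a \<in> \<O>" if "a < n" for a using c(1)[OF b] that by auto
      have "\<exists>e\<in>\<O>. c b a = ufz * e" if "a < n" "a \<notin> S" for a
      proof -
        have "c b a \<in> frac_ideal v (int 1 + 0)" using cO[OF that(1)] False that b bS by (force simp: frac_ideal_def)
        then show ?thesis using ufz_div[of "c b a" 1 0] by auto
      qed
      then obtain e where e: "\<And>a. a < n \<Longrightarrow> a \<notin> S \<Longrightarrow> e a \<in> \<O> \<and> c b a = ufz * e a" by metis
      \<comment> \<open>Outside \<open>S\<close> no coefficient is a unit, so each is the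
        uniformizer times an integral quotient: \<open>c1\<close> keeps the coefficients on
        \<open>S\<close>, and \<open>c2\<close> collects the quotients.\<close>
      define c1 c2 where "c1 a = (if a \<in> S then c b a else 0)" and "c2 a = (if a \<in> S then 0 else e a)" for a
      have cc: "c1 \<in> {..<n} \<rightarrow> \<O>" "c2 \<in> {..<n} \<rightarrow> \<O>" using cO e by (auto simp: c1_def c2_def)
      have "y b = comb n (\<lambda>a. c1 a + ufz * c2 a) x"
        unfolding c(2)[OF b]
      proof (rule comb_cong)
        show "(\<lambda>a. c1 a + ufz * c2 a) \<in> {..<n} \<rightarrow> carrier (val_ring v)"
          using cc by (auto intro!: frac_add int_mult)
      qed (use e xD(2) in \<open>auto simp: c1_def c2_def\<close>)
      also have "\<dots> = comb n c1 x \<oplus>\<^bsub>M\<^esub> comb n (\<lambda>a. ufz * c2 a) x"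
        using cc xD(2) by (intro comb_add) (auto intro!: int_mult)
      also have "comb n (\<lambda>a. ufz * c2 a) x = ufz \<odot>\<^bsub>M\<^esub> comb n c2 x"
        using xD(2) cc by (intro comb_smult) auto
      also have "comb n c1 x = comb n c1 z"
        unfolding comb_def using xD(2) cc(1) z' by (intro M.finsum_cong') (auto simp: c1_def z_def Pi_iff)
      finally have eq: "y b = comb n c1 z \<oplus>\<^bsub>M\<^esub> ufz \<odot>\<^bsub>M\<^esub> comb n c2 x" .
      have w: "comb n c1 z \<in> N" using comb_spanI[of c1 n z] cc by (simp add: N_def)
      have "comb n c2 x \<in> carrier M" using cc xD(2) by simp
      then show ?thesis using eq w by blast
    qed
    \<comment> \<open>The elements of the form required by \<open>nakayama\<close> form a submodule,
      so it is enough that the generators \<open>y b\<close> have this form.\<close>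
    define Q where "Q = {m \<in> carrier M. \<exists>w\<in>N. \<exists>m'\<in>carrier M. m = w \<oplus>\<^bsub>M\<^esub> ufz \<odot>\<^bsub>M\<^esub> m'}"
    have "submodule (val_ring v) Q M"
    proof (rule submodule.intro)
      show "Q \<subseteq> carrier M" by (auto simp: Q_def)
      show "\<zero>\<^bsub>M\<^esub> \<in> Q" unfolding Q_def by (auto intro!: bexI[of _ "\<zero>\<^bsub>M\<^esub>"])
      show "Module.module (val_ring v) M" by (rule module_axioms)
    next
      fix p q assume "p \<in> Q" "q \<in> Q"
      then obtain w m w' m' where *: "w \<in> N" "m \<in> carrier M" "p = w \<oplus>\<^bsub>M\<^esub> ufz \<odot>\<^bsub>M\<^esub> m"
          "w' \<in> N" "m' \<in> carrier M" "q = w' \<oplus>\<^bsub>M\<^esub> ufz \<odot>\<^bsub>M\<^esub> m'" unfolding Q_def by blast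
      then have ww: "w \<in> carrier M" "w' \<in> carrier M" using N.subset by auto
      have "p \<oplus>\<^bsub>M\<^esub> q = (w \<oplus>\<^bsub>M\<^esub> w') \<oplus>\<^bsub>M\<^esub> ufz \<odot>\<^bsub>M\<^esub> (m \<oplus>\<^bsub>M\<^esub> m')"
        using * ww by (simp add: smult_r_distr M.a_ac)
      moreover have "w \<oplus>\<^bsub>M\<^esub> w' \<in> N" "m \<oplus>\<^bsub>M\<^esub> m' \<in> carrier M" using * by simp_all
      moreover have "p \<oplus>\<^bsub>M\<^esub> q \<in> carrier M" using * ww by simp
      ultimately show "p \<oplus>\<^bsub>M\<^esub> q \<in> Q" unfolding Q_def by blast
    next
      fix r p assume r: "r \<in> carrier (val_ring v)" and "p \<in> Q"
      then obtain w m where *: "w \<in> N" "m \<in> carrier M" "p = w \<oplus>\<^bsub>M\<^esub> ufz \<odot>\<^bsub>M\<^esub> m" unfolding Q_def by blast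
      then have ww: "w \<in> carrier M" using N.subset by auto
      have "r \<odot>\<^bsub>M\<^esub> (ufz \<odot>\<^bsub>M\<^esub> m) = ufz \<odot>\<^bsub>M\<^esub> (r \<odot>\<^bsub>M\<^esub> m)"
        using smult_assoc1[of r ufz m] smult_assoc1[of ufz r m] * r mult.commute[of r ufz] by simp
      moreover have "r \<odot>\<^bsub>M\<^esub> p = r \<odot>\<^bsub>M\<^esub> w \<oplus>\<^bsub>M\<^esub> r \<odot>\<^bsub>M\<^esub> (ufz \<odot>\<^bsub>M\<^esub> m)"
        unfolding *(3) using * ww r by (intro smult_r_distr) auto
      ultimately have "r \<odot>\<^bsub>M\<^esub> p = r \<odot>\<^bsub>M\<^esub> w \<oplus>\<^bsub>M\<^esub> ufz \<odot>\<^bsub>M\<^esub> (r \<odot>\<^bsub>M\<^esub> m)"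
        by simp
      moreover have "r \<odot>\<^bsub>M\<^esub> w \<in> N" using * r by simp
      moreover have "r \<odot>\<^bsub>M\<^esub> p \<in> carrier M" "r \<odot>\<^bsub>M\<^esub> m \<in> carrier M" using * ww r by auto
      ultimately show "r \<odot>\<^bsub>M\<^esub> p \<in> Q" unfolding Q_def by blast
    qed
    moreover have "y \<in> {..<n} \<rightarrow> Q" using yN yD(2) by (auto simp: Q_def)
    ultimately have "comb_span n y \<subseteq> Q" by (rule comb_span_subset)
    then have "carrier M \<subseteq> Q"
      using less.prems(3) generates_iff_comb_span[OF yD(2)] by (simp add: tuples_def)
    then have NM: "N = carrier M"
      by (intro nakayama[OF tor]) (unfold Q_def, auto intro: N.submodule_axioms)
    have mem: "w b \<in> comb_span n z" if "w \<in> {..<n} \<rightarrow> carrier M" "b < n" for w b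
      using that NM unfolding N_def by blast
    have "tuple_equiv n z x" by (rule tuple_equiv_mask[OF xD(1) less.prems(1) z_def mem[OF xD(2)]])
    moreover have "tuple_equiv n z y" by (rule tuple_equiv_mask[OF yD(1) less.prems(1) zy mem[OF yD(2)]])
    ultimately show ?thesis using tuple_equiv_trans[OF xD(1)] tuple_equiv_sym[OF z] by blast
  qed
qed

text \<open>The case in which no agreement is prescribed. Together with \<open>stab_act\<close> it
  makes the conjugacy class of a stabilizer independent of the generating tuple.\<close>

theorem tuples_transitive:
  assumes "torsion k" "x \<in> tuples n" "y \<in> tuples n"
  obtains g where "g \<in> GLint n" "act n x g = y"
  using tuple_equiv_agree[OF assms(1), of "{}" n x y] assms unfolding tuple_equiv_def by auto

end

section \<open>The Iwasawa decomposition and bases of lattices\<close>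

context nonarch_local_field
begin

text \<open>Cramer's rule: the adjugate has integral entries, and dividing by a unit keeps them
  integral.\<close>

lemma GLint_det_I:
  assumes A: "mat_in 0 n n A" and d: "v (det A) = 0" "det A \<noteq> 0"
  shows "A \<in> GLint n"
proof -
  have Ac: "A \<in> carrier_mat n n" using A by (simp add: mat_in_def)
  define B where "B = inverse (det A) \<cdot>\<^sub>m adj_mat A"
  have "cofactor A j i \<in> \<O>" if ij: "i < n" "j < n" for i j
  proof -
    have "mat_in 0 (n - 1) (n - 1) (mat_delete A j i)"
      using A ij unfolding mat_in_def mat_delete_def by auto
    then have "det (mat_delete A j i) \<in> \<O>" by (rule det_int)
    moreover have "(- 1) ^ (j + i) \<in> \<O>" by (cases "even (j + i)") (simp_all add: frac_uminus)
    ultimately show ?thesis unfolding cofactor_def by (intro int_mult)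
  qed
  moreover have "inverse (det A) \<in> \<O>" using d v_inverse[of "det A"] by (simp add: frac_ideal_def)
  ultimately have "mat_in 0 n n B"
    using Ac unfolding mat_in_def B_def adj_mat_def by (auto intro!: int_mult)
  moreover have "A * B = 1\<^sub>m n"
  proof -
    have "A * B = inverse (det A) \<cdot>\<^sub>m (det A \<cdot>\<^sub>m 1\<^sub>m n)"
      unfolding B_def mult_smult_distrib[OF Ac adj_mat(1)[OF Ac]] adj_mat(2)[OF Ac] ..
    then show ?thesis using d(2) by (intro eq_matI) auto
  qed
  ultimately show ?thesis using GLint_I(1)[OF A] by blast
qed

lemma prod_one_plus:
  assumes "finite S" "\<And>i. i \<in> S \<Longrightarrow> f i - 1 \<in> frac_ideal v 1"
  shows "prod f S - 1 \<in> frac_ideal v 1"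
  using assms
proof (induction S rule: finite_induct)
  case (insert a S)
  have fa: "f a - 1 \<in> frac_ideal v 1" and fS: "prod f S - 1 \<in> frac_ideal v 1" using insert.prems insert.IH by blast+
  have "(f a - 1) + 1 \<in> \<O>" using frac_ideal_mono[OF fa, of 0] by (intro frac_add) simp_all
  then have "f a \<in> \<O>" by simp
  then have "f a * (prod f S - 1) + (f a - 1) \<in> frac_ideal v 1" using fa fS by (intro frac_add frac_mult_int)
  then show ?case using insert.hyps by (simp add: algebra_simps)
qed simp

lemma prod_int: "(\<And>i. i \<in> S \<Longrightarrow> f i \<in> \<O>) \<Longrightarrow> prod f S \<in> \<O>"
  by (induction S rule: infinite_finite_induct) (auto intro: int_mult)

text \<open>In the Leibniz formula the identity permutation contributes an element congruent to
  \<open>1\<close>, and all other permutations contribute elements of the maximal ideal. Hence the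
  determinant is a unit.\<close>

lemma one_plus_GLint:
  assumes Y: "mat_in 1 n n Y" shows "1\<^sub>m n + Y \<in> GLint n"
proof -
  let ?A = "1\<^sub>m n + Y"
  have Yc: "Y \<in> carrier_mat n n" and Ye: "\<And>i j. i < n \<Longrightarrow> j < n \<Longrightarrow> Y $$ (i, j) \<in> frac_ideal v 1"
    using Y by (auto simp: mat_in_def)
  have A: "?A $$ (i, j) = (if i = j then 1 else 0) + Y $$ (i, j)" if "i < n" "j < n" for i j
    using Yc that by auto
  have YO: "Y $$ (i, j) \<in> \<O>" if "i < n" "j < n" for i j using Ye[OF that] frac_ideal_mono by fastforce
  have Ain: "mat_in 0 n n ?A" unfolding mat_in_def using Yc A YO by (auto intro!: frac_add)
  let ?P = "{p. p permutes {0..<n}}"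
  let ?t = "\<lambda>p. signof p * (\<Prod>i = 0..<n. ?A $$ (i, p i))"
  have fin: "finite ?P" by (rule finite_permutations) simp
  have "?A \<in> carrier_mat n n" using Yc by simp
  then have "det ?A = sum ?t ?P" by (rule det_def')
  also have "\<dots> = ?t id + sum ?t (?P - {id})"
    using fin by (intro sum.remove) (auto simp: permutes_id)
  finally have det: "det ?A - 1 = (?t id - 1) + sum ?t (?P - {id})" by simp
  have "(\<Prod>i = 0..<n. ?A $$ (i, id i)) - 1 \<in> frac_ideal v 1"
    using A Ye by (intro prod_one_plus) auto
  then have 1: "?t id - 1 \<in> frac_ideal v 1" by (simp add: sign_id)
  \<comment> \<open>A permutation other than the identity moves some \<open>i\<close>, and the
    factor at \<open>(i, p i)\<close> then lies off the diagonal, where the entry is that of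
    \<open>Y\<close>.\<close>
  have "?t p \<in> frac_ideal v 1" if "p \<in> ?P - {id}" for p
  proof -
    have p: "p permutes {0..<n}" "p \<noteq> id" using that by auto
    have pn: "p i < n" if "i < n" for i using permutes_in_image[OF p(1), of i] that by simp
    obtain i where i: "p i \<noteq> i" using p(2) by (auto simp: fun_eq_iff)
    then have "i < n" using permutes_not_in[OF p(1), of i] by force
    have "(\<Prod>i = 0..<n. ?A $$ (i, p i)) = ?A $$ (i, p i) * (\<Prod>j\<in>{0..<n} - {i}. ?A $$ (j, p j))"
      using \<open>i < n\<close> by (intro prod.remove) auto
    moreover have "?A $$ (i, p i) \<in> frac_ideal v 1" using A[OF \<open>i < n\<close> pn[OF \<open>i < n\<close>]] Ye[OF \<open>i < n\<close> pn[OF \<open>i < n\<close>]] i by simp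
    moreover have "(\<Prod>j\<in>{0..<n} - {i}. ?A $$ (j, p j)) \<in> \<O>"
      using Ain pn unfolding mat_in_def by (intro prod_int) auto
    ultimately have "(\<Prod>i = 0..<n. ?A $$ (i, p i)) \<in> frac_ideal v 1"
      using frac_mult[of "?A $$ (i, p i)" 1 _ 0] by simp
    moreover have "signof p \<in> \<O>" by (auto simp: sign_def frac_uminus)
    ultimately show ?thesis by (intro frac_mult_int)
  qed
  then have d: "det ?A - 1 \<in> frac_ideal v 1" unfolding det using 1 by (intro frac_add frac_sum) auto
  have nz: "det ?A \<noteq> 0"
  proof
    assume "det ?A = 0"
    then have "- 1 \<in> frac_ideal v 1" using d by simp
    then show False by (simp add: frac_ideal_def)
  qed
  have "v (det ?A) \<ge> 0" using det_int[OF Ain] nz by (simp add: frac_ideal_def)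
  moreover have "\<not> v (det ?A) \<ge> 1"
  proof
    assume "v (det ?A) \<ge> 1"
    then have "det ?A \<in> frac_ideal v 1" by (simp add: frac_ideal_def)
    then have "det ?A - (det ?A - 1) \<in> frac_ideal v 1" using d by (rule frac_diff)
    then show False by (simp add: frac_ideal_def)
  qed
  ultimately have "v (det ?A) = 0" by linarith
  then show ?thesis using GLint_det_I[OF Ain _ nz] by blast
qed

section \<open>Lattices and triangular bases\<close>

definition int_vec :: "nat \<Rightarrow> 'f vec set" where
  "int_vec n = {c \<in> carrier_vec n. \<forall>i<n. c $ i \<in> \<O>}"

text \<open>The lattice that has the columns of \<open>\<phi>\<close> as a basis, when
  \<open>\<phi>\<close> is invertible.\<close>

definition lat :: "nat \<Rightarrow> 'f mat \<Rightarrow> 'f vec set" where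
  "lat n \<phi> = (\<lambda>c. \<phi> *\<^sub>v c) ` int_vec n"

text \<open>A submodule over the valuation ring, spelled out on vectors so that calculations do not
  pass through the module records.\<close>

definition o_closed :: "nat \<Rightarrow> 'f vec set \<Rightarrow> bool" where
  "o_closed n L \<longleftrightarrow> L \<subseteq> carrier_vec n \<and> 0\<^sub>v n \<in> L \<and> (\<forall>x\<in>L. \<forall>y\<in>L. x + y \<in> L) \<and> (\<forall>c\<in>\<O>. \<forall>x\<in>L. c \<cdot>\<^sub>v x \<in> L)"

lemma int_vec_mult: "mat_in 0 n n A \<Longrightarrow> c \<in> int_vec n \<Longrightarrow> A *\<^sub>v c \<in> int_vec n"
  unfolding int_vec_def mat_in_def by (auto simp: scalar_prod_def intro!: frac_sum int_mult)

lemma o_closed_int_vec: "o_closed n (int_vec n)"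
  unfolding o_closed_def int_vec_def by (auto intro!: frac_add int_mult)

lemma lat_o_closed: assumes "\<phi> \<in> carrier_mat n n" shows "o_closed n (lat n \<phi>)"
  unfolding o_closed_def
proof (intro conjI ballI)
  have iv: "c \<in> carrier_vec n" if "c \<in> int_vec n" for c using that by (simp add: int_vec_def)
  note cl = o_closed_int_vec[of n, unfolded o_closed_def]
  show "lat n \<phi> \<subseteq> carrier_vec n" unfolding lat_def using assms iv by auto
  have "0\<^sub>v n = \<phi> *\<^sub>v 0\<^sub>v n" using assms by auto
  then show "0\<^sub>v n \<in> lat n \<phi>" unfolding lat_def using cl by blast
  fix x assume "x \<in> lat n \<phi>"
  then obtain c where c: "c \<in> int_vec n" "x = \<phi> *\<^sub>v c" by (auto simp: lat_def)
  {
    fix y assume "y \<in> lat n \<phi>"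
    then obtain d where d: "d \<in> int_vec n" "y = \<phi> *\<^sub>v d" by (auto simp: lat_def)
    have "x + y = \<phi> *\<^sub>v (c + d)" using c d assms iv by (simp add: mult_add_distrib_mat_vec)
    then show "x + y \<in> lat n \<phi>" unfolding lat_def using cl c d by blast
  }
  {
    fix r assume "r \<in> \<O>"
    have "r \<cdot>\<^sub>v x = \<phi> *\<^sub>v (r \<cdot>\<^sub>v c)" using c assms iv by (simp add: mult_mat_vec)
    then show "r \<cdot>\<^sub>v x \<in> lat n \<phi>" unfolding lat_def using cl c \<open>r \<in> \<O>\<close> by blast
  }
qed

lemma mult_mat_unit_vec: "A \<in> carrier_mat nr n \<Longrightarrow> j < n \<Longrightarrow> A *\<^sub>v unit_vec n j = (col A j :: 'f vec)"
  by (intro eq_vecI) auto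

lemma unit_vec_int: "unit_vec n j \<in> int_vec n"
  by (auto simp: int_vec_def unit_vec_def)

text \<open>The combination is built up column by column, by induction on the index from which the
  coefficients vanish.\<close>

lemma lat_subset:
  assumes L: "o_closed n L" and \<phi>: "\<phi> \<in> carrier_mat n n" and col: "\<And>j. j < n \<Longrightarrow> col \<phi> j \<in> L"
  shows "lat n \<phi> \<subseteq> L"
proof -
  have Lc: "0\<^sub>v n \<in> L" "\<And>x y. x \<in> L \<Longrightarrow> y \<in> L \<Longrightarrow> x + y \<in> L" "\<And>c x. c \<in> \<O> \<Longrightarrow> x \<in> L \<Longrightarrow> c \<cdot>\<^sub>v x \<in> L"
    using L unfolding o_closed_def by auto
  have "\<phi> *\<^sub>v c \<in> L" if "m \<le> n" "c \<in> int_vec n" "\<And>j. j < n \<Longrightarrow> m \<le> j \<Longrightarrow> c $ j = 0" for m c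
    using that
  proof (induction m arbitrary: c)
    case 0
    then have "c = 0\<^sub>v n" by (intro eq_vecI) (auto simp: int_vec_def)
    then have "\<phi> *\<^sub>v c = 0\<^sub>v n" using \<phi> by auto
    then show ?case using Lc by simp
  next
    case (Suc m)
    define c' where "c' = vec n (\<lambda>j. if j = m then 0 else c $ j)"
    have c': "c' \<in> int_vec n" using Suc.prems by (auto simp: c'_def int_vec_def)
    have cc: "c \<in> carrier_vec n" "c $ m \<in> \<O>" "c' \<in> carrier_vec n" using Suc.prems c' by (auto simp: int_vec_def)
    have "c = c' + c $ m \<cdot>\<^sub>v unit_vec n m" using cc by (intro eq_vecI) (auto simp: c'_def unit_vec_def)
    then have "\<phi> *\<^sub>v c = \<phi> *\<^sub>v c' + c $ m \<cdot>\<^sub>v col \<phi> m"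
      using \<phi> cc Suc.prems(1) by (metis Suc_le_lessD mult_add_distrib_mat_vec mult_mat_unit_vec mult_mat_vec smult_carrier_vec unit_vec_carrier)
    moreover have "\<phi> *\<^sub>v c' \<in> L" using Suc.prems c' by (intro Suc.IH) (auto simp: c'_def)
    ultimately show ?case using Lc cc col Suc.prems(1) by simp
  qed
  from this[of n] show ?thesis unfolding lat_def by auto
qed

text \<open>A Hermite normal form. For each \<open>i\<close>, among the vectors of \<open>L\<close>
  whose last nonzero coordinate is the \<open>i\<close>-th, one is chosen for which this coordinate
  has minimal valuation. The hypothesis \<open>full\<close> makes the choice possible,
  \<open>bd\<close> bounds the valuations below, and the chosen vectors are the columns of
  \<open>b\<close>.\<close>

lemma lattice_triangular_basis:
  assumes L: "o_closed n L"
    and bd: "\<And>x i. x \<in> L \<Longrightarrow> i < n \<Longrightarrow> x $ i \<in> frac_ideal v m"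
    and full: "\<And>i. i < n \<Longrightarrow> ufz ^ k \<cdot>\<^sub>v unit_vec n i \<in> L"
  obtains b where "b \<in> carrier (GL n)" "upper_triangular b" "L = lat n b"
proof -
  have Lc: "L \<subseteq> carrier_vec n" "0\<^sub>v n \<in> L" "\<And>x y. x \<in> L \<Longrightarrow> y \<in> L \<Longrightarrow> x + y \<in> L" "\<And>c x. c \<in> \<O> \<Longrightarrow> x \<in> L \<Longrightarrow> c \<cdot>\<^sub>v x \<in> L"
    using L unfolding o_closed_def by auto
  define A where "A i = {x \<in> L. x $ i \<noteq> 0 \<and> (\<forall>j. i < j \<longrightarrow> j < n \<longrightarrow> x $ j = 0)}" for i
  have "\<exists>b. i < n \<longrightarrow> b \<in> A i \<and> (\<forall>x\<in>A i. v (b $ i) \<le> v (x $ i))" for i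
  proof (cases "i < n")
    case True
    have "ufz ^ k \<cdot>\<^sub>v unit_vec n i \<in> A i" using full[OF True] True ufz_pow[of k] by (auto simp: A_def)
    \<comment> \<open>Subtracting the lower bound \<open>m\<close> turns the valuations into natural
      numbers, among which a least one exists.\<close>
    then obtain b where b: "b \<in> A i" "\<And>x. x \<in> A i \<Longrightarrow> nat (v (b $ i) - m) \<le> nat (v (x $ i) - m)"
      using ex_has_least_nat[of "\<lambda>x. x \<in> A i" _ "\<lambda>x. nat (v (x $ i) - m)"] by blast
    have "v (x $ i) \<ge> m" if "x \<in> A i" for x using bd[of x i] that True by (auto simp: A_def frac_ideal_def)
    then have "v (b $ i) \<le> v (x $ i)" if "x \<in> A i" for x using b(2)[OF that] b(1) that by fastforce
    then show ?thesis using b(1) by blast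
  qed auto
  then obtain bb where bb: "\<And>i. i < n \<Longrightarrow> bb i \<in> A i" "\<And>i x. i < n \<Longrightarrow> x \<in> A i \<Longrightarrow> v (bb i $ i) \<le> v (x $ i)" by metis
  have bbL: "bb i \<in> L" "bb i \<in> carrier_vec n" "bb i $ i \<noteq> 0" "\<And>j. i < j \<Longrightarrow> j < n \<Longrightarrow> bb i $ j = 0" if "i < n" for i
    using bb(1)[OF that] Lc(1) by (auto simp: A_def)
  define b where "b = mat n n (\<lambda>(i, j). bb j $ i)"
  have bc: "b \<in> carrier_mat n n" by (simp add: b_def)
  have colb: "col b j = bb j" if "j < n" for j using bbL(2)[OF that] that by (intro eq_vecI) (auto simp: b_def)
  have ut: "upper_triangular b" using bbL by (auto simp: b_def upper_triangular_def)
  have "det b = prod_list (diag_mat b)" by (rule det_upper_triangular[OF ut bc])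
  then have "det b \<noteq> 0" using bbL(3) by (auto simp: diag_mat_def b_def prod_list_zero_iff)
  then have bGL: "b \<in> carrier (GL n)" using bc GL_det by blast
  have "\<exists>c\<in>int_vec n. x = b *\<^sub>v c" if "l \<le> n" "x \<in> L" "\<And>j. j < n \<Longrightarrow> l \<le> j \<Longrightarrow> x $ j = 0" for l x
    using that
  proof (induction l arbitrary: x)
    case 0
    have "x \<in> carrier_vec n" using 0 Lc by auto
    then have "x = 0\<^sub>v n" using 0 by (intro eq_vecI) auto
    then have "x = b *\<^sub>v 0\<^sub>v n" using bc by auto
    then show ?case by (intro bexI[of _ "0\<^sub>v n"]) (auto simp: int_vec_def)
  next
    case (Suc l)
    then have l: "l < n" and xc: "x \<in> carrier_vec n" using Lc by auto
    \<comment> \<open>The quotient is integral: either the coordinate of \<open>x\<close> vanishes,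
      or \<open>x\<close> itself was a candidate when \<open>bb l\<close> was chosen with minimal
      valuation. Subtracting \<open>t\<close> times \<open>bb l\<close> clears the coordinate
      \<open>l\<close>.\<close>
    define t where "t = x $ l / bb l $ l"
    have t: "t \<in> \<O>"
    proof (cases "x $ l = 0")
      case False
      then have "x \<in> A l" using Suc.prems l by (auto simp: A_def)
      then have "v (bb l $ l) \<le> v (x $ l)" using bb(2)[OF l] by blast
      then show ?thesis using False bbL(3)[OF l] v_mult[of "x $ l" "inverse (bb l $ l)"] v_inverse[of "bb l $ l"]
        by (simp add: t_def frac_ideal_def divide_inverse)
    qed (simp add: t_def)
    define x' where "x' = x + (- t) \<cdot>\<^sub>v bb l"
    have x'L: "x' \<in> L" unfolding x'_def using t Suc.prems bbL(1)[OF l] by (intro Lc frac_uminus)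
    have z: "x' $ j = 0" if "j < n" "l \<le> j" for j
    proof (cases "j = l")
      case True then show ?thesis using l xc bbL(2,3)[OF l] by (simp add: x'_def t_def)
    next
      case False then show ?thesis using that l xc bbL(2,4)[OF l] Suc.prems(3)[of j] by (simp add: x'_def)
    qed
    have "\<exists>c\<in>int_vec n. x' = b *\<^sub>v c" by (rule Suc.IH[OF _ x'L z]) (use l in auto)
    then obtain c where c: "c \<in> int_vec n" "x' = b *\<^sub>v c" by blast
    have cc: "c \<in> carrier_vec n" using c by (simp add: int_vec_def)
    have "b *\<^sub>v (c + t \<cdot>\<^sub>v unit_vec n l) = b *\<^sub>v c + t \<cdot>\<^sub>v (b *\<^sub>v unit_vec n l)"
      using cc bc by (metis mult_add_distrib_mat_vec mult_mat_vec smult_carrier_vec unit_vec_carrier)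
    also have "\<dots> = x' + t \<cdot>\<^sub>v bb l" using c colb[OF l] mult_mat_unit_vec[OF bc l] by simp
    also have "\<dots> = x" using xc bbL(2)[OF l] by (intro eq_vecI) (auto simp: x'_def)
    finally have eq: "x = b *\<^sub>v (c + t \<cdot>\<^sub>v unit_vec n l)" ..
    have "c + t \<cdot>\<^sub>v unit_vec n l \<in> int_vec n"
      using c(1) t unit_vec_int[of n l] o_closed_int_vec[of n] by (auto simp: o_closed_def)
    then show ?case using eq by blast
  qed
  from this[of n] have "L \<subseteq> lat n b" unfolding lat_def by auto
  moreover have "lat n b \<subseteq> L" using colb bbL(1) by (intro lat_subset L bc) auto
  ultimately show ?thesis using that[OF bGL ut] by blast
qed

text \<open>Each column of \<open>\<psi>\<close> has integral coordinates in the basis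
  \<open>\<phi>\<close>. For equal lattices this applies in both directions and puts the change of
  basis into \<open>GLint n\<close>.\<close>

lemma lat_eq_GLint:
  assumes "\<phi> \<in> carrier (GL n)" "\<psi> \<in> carrier (GL n)" "lat n \<psi> \<subseteq> lat n \<phi>"
  shows "mat_in 0 n n (inv\<^bsub>GL n\<^esub> \<phi> * \<psi>)"
proof -
  note i = GL_inv[OF assms(1)]
  have c: "\<phi> \<in> carrier_mat n n" "\<psi> \<in> carrier_mat n n" "inv\<^bsub>GL n\<^esub> \<phi> \<in> carrier_mat n n"
    using GL_carrier_mat[OF assms(1)] GL_carrier_mat[OF assms(2)] GL_carrier_mat[OF i(1)] by simp_all
  have "col (inv\<^bsub>GL n\<^esub> \<phi> * \<psi>) j \<in> int_vec n" if j: "j < n" for j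
  proof -
    have "col \<psi> j \<in> lat n \<psi>" 
      using imageI[OF unit_vec_int[of n j], of "\<lambda>c. \<psi> *\<^sub>v c"] mult_mat_unit_vec[OF c(2) j] by (simp add: lat_def)
    then have "col \<psi> j \<in> lat n \<phi>" using assms(3) by blast
    then obtain d where d: "d \<in> int_vec n" "col \<psi> j = \<phi> *\<^sub>v d" unfolding lat_def by (rule imageE)
    have "col (inv\<^bsub>GL n\<^esub> \<phi> * \<psi>) j = inv\<^bsub>GL n\<^esub> \<phi> *\<^sub>v (\<phi> *\<^sub>v d)"
      unfolding col_mult2[OF c(3,2) j] d(2) ..
    also have "\<dots> = (inv\<^bsub>GL n\<^esub> \<phi> * \<phi>) *\<^sub>v d" using c d(1) by (intro assoc_mult_mat_vec[symmetric]) (auto simp: int_vec_def)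
    also have "\<dots> = d" using i(2) d(1) by (simp add: int_vec_def)
    finally show ?thesis using d by simp
  qed
  then have "col (inv\<^bsub>GL n\<^esub> \<phi> * \<psi>) j $ l \<in> \<O>" if "j < n" "l < n" for j l using that by (auto simp: int_vec_def)
  then show ?thesis unfolding mat_in_def using c by auto
qed

lemma lat_bounded:
  assumes "\<phi> \<in> carrier_mat n n" shows "\<exists>m\<le>0. \<forall>x\<in>lat n \<phi>. \<forall>i<n. x $ i \<in> frac_ideal v m"
proof -
  obtain m where m: "m \<le> 0" "mat_in m n n \<phi>" using mat_in_exists[OF assms] by blast
  have "(\<phi> *\<^sub>v c) $ i \<in> frac_ideal v m" if "c \<in> int_vec n" "i < n" for c i
    using m that assms unfolding mat_in_def int_vec_def
    by (auto simp: scalar_prod_def intro!: frac_sum frac_mult[of _ m _ 0, simplified])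
  then show ?thesis unfolding lat_def using m(1) by blast
qed

text \<open>The valuations of the coordinates of \<open>x\<close> compensate the denominators of the
  inverse of \<open>\<phi>\<close>.\<close>

lemma lat_full:
  assumes "\<phi> \<in> carrier (GL n)" "\<And>i. i < n \<Longrightarrow> x $ i \<in> frac_ideal v m" "x \<in> carrier_vec n"
    "mat_in (- m) n n (inv\<^bsub>GL n\<^esub> \<phi>)"
  shows "x \<in> lat n \<phi>"
proof -
  note i = GL_inv[OF assms(1)]
  have c: "\<phi> \<in> carrier_mat n n" "inv\<^bsub>GL n\<^esub> \<phi> \<in> carrier_mat n n" using GL_carrier_mat[OF assms(1)] GL_carrier_mat[OF i(1)] by simp_all
  have "inv\<^bsub>GL n\<^esub> \<phi> *\<^sub>v x \<in> int_vec n"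
    using assms c unfolding mat_in_def int_vec_def
    by (auto simp: scalar_prod_def intro!: frac_sum frac_mult[of _ "- m" _ m, simplified])
  moreover have "x = \<phi> *\<^sub>v (inv\<^bsub>GL n\<^esub> \<phi> *\<^sub>v x)"
    using c assms(3) i(3) assoc_mult_mat_vec[OF c(1,2) assms(3)] by simp
  ultimately show ?thesis unfolding lat_def by blast
qed

text \<open>The lattice spanned by the columns of \<open>g\<close> also has a triangular basis
  \<open>b\<close>, and two bases of one lattice differ by an element of
  \<open>GLint n\<close>.\<close>

theorem iwasawa:
  assumes "g \<in> carrier (GL n)"
  obtains b k where "b \<in> carrier (GL n)" "upper_triangular b" "k \<in> GLint n" "g = b * k"
proof -
  have gc: "g \<in> carrier_mat n n" using GL_carrier_mat[OF assms] .
  obtain m where m: "\<And>x i. x \<in> lat n g \<Longrightarrow> i < n \<Longrightarrow> x $ i \<in> frac_ideal v m" using lat_bounded[OF gc] by blast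
  obtain m' where m': "m' \<le> 0" "mat_in m' n n (inv\<^bsub>GL n\<^esub> g)"
    using mat_in_exists[OF GL_carrier_mat[OF GL_inv(1)[OF assms]]] by blast
  \<comment> \<open>Chosen to clear the denominators of the inverse of \<open>g\<close>, so that the
    lattice contains \<open>ufz ^ k\<close> times the standard basis.\<close>
  define k where "k = nat (- m')"
  have full: "ufz ^ k \<cdot>\<^sub>v unit_vec n i \<in> lat n g" if "i < n" for i
  proof (rule lat_full[OF assms])
    show "mat_in (- int k) n n (inv\<^bsub>GL n\<^esub> g)" using m' by (simp add: k_def)
    fix j assume "j < n"
    then show "(ufz ^ k \<cdot>\<^sub>v unit_vec n i) $ j \<in> frac_ideal v (int k)"
      using that ufz_pow[of k] by (auto simp: frac_ideal_def)
  qed auto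
  obtain b where b: "b \<in> carrier (GL n)" "upper_triangular b" "lat n g = lat n b"
    using lattice_triangular_basis[OF lat_o_closed[OF gc] m full] by blast
  define k where "k = inv\<^bsub>GL n\<^esub> b * g"
  have bc: "b \<in> carrier_mat n n" using b GL_carrier_mat by blast
  have bi: "inv\<^bsub>GL n\<^esub> b \<in> carrier_mat n n" "inv\<^bsub>GL n\<^esub> g \<in> carrier_mat n n" using GL_carrier_mat[OF GL_inv(1)[OF b(1)]] GL_carrier_mat[OF GL_inv(1)[OF assms]] by simp_all
  have "k * (inv\<^bsub>GL n\<^esub> g * b) = inv\<^bsub>GL n\<^esub> b * (g * inv\<^bsub>GL n\<^esub> g) * b"
    unfolding k_def using bc bi gc by (simp add: assoc_mult_mat[of _ n n _ n _ n])
  also have "\<dots> = 1\<^sub>m n" using GL_inv[OF assms] GL_inv[OF b(1)] bi bc by simp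
  finally have "k \<in> GLint n"
    using lat_eq_GLint[OF b(1) assms] lat_eq_GLint[OF assms b(1)] b(3) GLint_I(1) unfolding k_def by blast
  moreover have "g = b * k"
    unfolding k_def using bc bi gc GL_inv(3)[OF b(1)] assoc_mult_mat[OF bc bi(1) gc] by simp
  ultimately show ?thesis using that b by blast
qed

text \<open>Finite generation bounds the denominators of \<open>L\<close>, and the spanning
  condition over the field puts a multiple of each standard basis vector into \<open>L\<close>.
  These are the hypotheses of \<open>lattice_triangular_basis\<close>.\<close>

lemma is_lattice_lat:
  assumes "is_lattice v n L"
  obtains \<phi> where "\<phi> \<in> carrier (GL n)" "L = lat n \<phi>"
proof -
  let ?V = "module_vec TYPE('f) n"
  interpret R: Module.module "val_ring v" ?V by (rule vec_module_val_ring)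
  interpret F: Module.module class_ring ?V by (rule vec_module)
  have sub: "submodule (val_ring v) L ?V"
    and fg: "\<exists>B\<subseteq>L. finite B \<and> R.span B = L"
    and sp: "F.span L = carrier_vec n"
    using assms unfolding is_lattice_def by auto
  interpret L: submodule "val_ring v" L ?V by fact
  have oc: "o_closed n L"
    unfolding o_closed_def using L.subset L.m_closed L.zero_closed L.smult_closed
    by (auto simp: module_vec_simps)
  obtain B where B: "B \<subseteq> L" "finite B" "R.span B = L" using fg by blast
  define m where "m = Min (insert 0 ((\<lambda>(x, i). v (x $ i)) ` (B \<times> {..<n})))"
  have mB: "x $ i \<in> frac_ideal v m" if "x \<in> B" "i < n" for x i
  proof -
    have "m \<le> v (x $ i)" unfolding m_def using B(2) that by (intro Min_le) auto
    then show ?thesis by (simp add: frac_ideal_def)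
  qed
  \<comment> \<open>The vectors whose coordinates obey the bound of the finitely many generators
    form a submodule, which therefore contains \<open>L\<close>.\<close>
  define Q where "Q = {x \<in> carrier_vec n. \<forall>i<n. x $ i \<in> frac_ideal v m}"
  have "submodule (val_ring v) Q ?V"
    by (rule submodule.intro[OF vec_module_val_ring])
      (auto simp: Q_def module_vec_simps intro!: frac_add frac_mult_int)
  moreover have "B \<subseteq> Q" using mB B(1) oc by (auto simp: Q_def o_closed_def)
  ultimately have "L \<subseteq> Q" using R.span_is_subset B(3) by blast
  then have bd: "\<And>x i. x \<in> L \<Longrightarrow> i < n \<Longrightarrow> x $ i \<in> frac_ideal v m" by (auto simp: Q_def)
  \<comment> \<open>The vectors that some power of the uniformizer multiplies into \<open>L\<close>
    form a subspace over the field. As it contains \<open>L\<close>, it is the whole space, in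
    particular it contains the standard basis.\<close>
  define W where "W = {x \<in> carrier_vec n. \<exists>k. ufz ^ k \<cdot>\<^sub>v x \<in> L}"
  have WI: "x \<in> W" if "x \<in> carrier_vec n" "ufz ^ k \<cdot>\<^sub>v x \<in> L" for x k
    unfolding W_def using that by auto
  have up: "ufz ^ (k + l) \<cdot>\<^sub>v x \<in> L" if "ufz ^ k \<cdot>\<^sub>v x \<in> L" for k l x
  proof -
    have "ufz ^ l \<cdot>\<^sub>v (ufz ^ k \<cdot>\<^sub>v x) \<in> L" using that oc by (auto simp: o_closed_def)
    then show ?thesis by (simp only: smult_smult_assoc power_add mult.commute)
  qed
  have "submodule class_ring W ?V"
  proof (rule submodule.intro[OF vec_module])
    show "W \<subseteq> carrier ?V" by (auto simp: W_def module_vec_simps)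
    have "ufz ^ 0 \<cdot>\<^sub>v 0\<^sub>v n \<in> L" using oc by (simp add: o_closed_def)
    then show "\<zero>\<^bsub>?V\<^esub> \<in> W" using WI[of "0\<^sub>v n" 0] by (simp add: module_vec_simps)
  next
    fix x y assume "x \<in> W" "y \<in> W"
    then obtain k l where k: "x \<in> carrier_vec n" "y \<in> carrier_vec n" "ufz ^ k \<cdot>\<^sub>v x \<in> L" "ufz ^ l \<cdot>\<^sub>v y \<in> L"
      by (auto simp: W_def)
    have "ufz ^ (k + l) \<cdot>\<^sub>v x \<in> L" "ufz ^ (k + l) \<cdot>\<^sub>v y \<in> L" using up[OF k(3), of l] up[OF k(4), of k] by (simp_all add: add.commute)
    then have "ufz ^ (k + l) \<cdot>\<^sub>v x + ufz ^ (k + l) \<cdot>\<^sub>v y \<in> L" using oc by (simp add: o_closed_def)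
    then have "ufz ^ (k + l) \<cdot>\<^sub>v (x + y) \<in> L" using k by (simp add: smult_add_distrib_vec)
    from WI[OF _ this] show "x \<oplus>\<^bsub>?V\<^esub> y \<in> W" unfolding module_vec_simps using k by simp
  next
    fix c x assume "x \<in> W"
    then obtain k where k: "x \<in> carrier_vec n" "ufz ^ k \<cdot>\<^sub>v x \<in> L" by (auto simp: W_def)
    \<comment> \<open>Clears the denominator of \<open>c\<close>. For \<open>c = 0\<close> any
      exponent will do, so the arbitrary value \<open>v 0\<close> is harmless.\<close>
    define l where "l = nat (- v c)"
    have "ufz ^ l * c \<in> \<O>"
    proof (cases "c = 0")
      case False
      have "- v c \<le> int l" by (simp add: l_def)
      then have "0 \<le> v (ufz ^ l * c)" using v_mult[of "ufz ^ l" c] ufz_pow[of l] False by linarith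
      then show ?thesis by (simp add: frac_ideal_def)
    qed simp
    then have "(ufz ^ l * c) \<cdot>\<^sub>v (ufz ^ k \<cdot>\<^sub>v x) \<in> L" using k oc by (simp add: o_closed_def)
    moreover have "(ufz ^ l * c) * ufz ^ k = ufz ^ (k + l) * c" by (simp add: power_add)
    ultimately have "ufz ^ (k + l) \<cdot>\<^sub>v (c \<cdot>\<^sub>v x) \<in> L" by (simp only: smult_smult_assoc)
    from WI[OF _ this] show "c \<odot>\<^bsub>?V\<^esub> x \<in> W" unfolding module_vec_simps using k by simp
  qed
  moreover have "L \<subseteq> W"
  proof
    fix x assume "x \<in> L"
    then have "ufz ^ 0 \<cdot>\<^sub>v x \<in> L" "x \<in> carrier_vec n" using oc by (auto simp: o_closed_def)
    then show "x \<in> W" using WI by blast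
  qed
  ultimately have "F.span L \<subseteq> W" by (intro F.span_is_subset)
  then have W: "carrier_vec n \<subseteq> W" by (simp only: sp)
  have "\<exists>k. ufz ^ k \<cdot>\<^sub>v unit_vec n i \<in> L" for i
  proof -
    have "unit_vec n i \<in> W" using W by (rule subsetD) simp
    then show ?thesis by (simp add: W_def)
  qed
  then obtain kk where kk: "\<And>i. i < n \<Longrightarrow> ufz ^ kk i \<cdot>\<^sub>v unit_vec n i \<in> L" by metis
  \<comment> \<open>One exponent for all standard basis vectors; inserting \<open>0\<close> covers
    \<open>n = 0\<close>.\<close>
  define k where "k = Max (insert 0 (kk ` {..<n}))"
  have "ufz ^ k \<cdot>\<^sub>v unit_vec n i \<in> L" if i: "i < n" for i
  proof -
    have "kk i \<le> k" unfolding k_def using i by (intro Max_ge) auto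
    then show ?thesis using up[OF kk[OF i], of "k - kk i"] by simp
  qed
  then show ?thesis using lattice_triangular_basis[OF oc bd] that by blast
qed

end

section \<open>The groups of pairs of lattices as stabilizers\<close>

context nonarch_local_field
begin

definition conj_set :: "nat \<Rightarrow> 'f mat \<Rightarrow> 'f mat set \<Rightarrow> 'f mat set" where
  "conj_set n \<phi> S = (\<lambda>s. \<phi> * s * inv\<^bsub>GL n\<^esub> \<phi>) ` S"

lemma conj_assoc:
  assumes "\<phi> \<in> carrier (GL n)" "s \<in> carrier_mat n n"
  shows "inv\<^bsub>GL n\<^esub> \<phi> * (\<phi> * s * inv\<^bsub>GL n\<^esub> \<phi>) * \<phi> = s"
    "\<phi> * (inv\<^bsub>GL n\<^esub> \<phi> * s * \<phi>) * inv\<^bsub>GL n\<^esub> \<phi> = s"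
proof -
  note i = GL_inv[OF assms(1)]
  have c: "\<phi> \<in> carrier_mat n n" "inv\<^bsub>GL n\<^esub> \<phi> \<in> carrier_mat n n"
    using GL_carrier_mat[OF assms(1)] GL_carrier_mat[OF i(1)] by simp_all
  have "inv\<^bsub>GL n\<^esub> \<phi> * (\<phi> * s * inv\<^bsub>GL n\<^esub> \<phi>) * \<phi> = (inv\<^bsub>GL n\<^esub> \<phi> * \<phi>) * s * (inv\<^bsub>GL n\<^esub> \<phi> * \<phi>)"
    using c assms(2) by (simp add: assoc_mult_mat[of _ n n _ n _ n])
  then show "inv\<^bsub>GL n\<^esub> \<phi> * (\<phi> * s * inv\<^bsub>GL n\<^esub> \<phi>) * \<phi> = s" using i assms(2) by simp
  have "\<phi> * (inv\<^bsub>GL n\<^esub> \<phi> * s * \<phi>) * inv\<^bsub>GL n\<^esub> \<phi> = (\<phi> * inv\<^bsub>GL n\<^esub> \<phi>) * s * (\<phi> * inv\<^bsub>GL n\<^esub> \<phi>)"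
    using c assms(2) by (simp add: assoc_mult_mat[of _ n n _ n _ n])
  then show "\<phi> * (inv\<^bsub>GL n\<^esub> \<phi> * s * \<phi>) * inv\<^bsub>GL n\<^esub> \<phi> = s" using i assms(2) by simp
qed

end

section \<open>Stabilizers of tuples\<close>

context val_module
begin

definition stab :: "nat \<Rightarrow> (nat \<Rightarrow> 'm) \<Rightarrow> 'f mat set" where
  "stab n z = {s \<in> GLint n. act n z s = z}"

lemma stab_subgroup:
  assumes z: "z \<in> {..<n} \<rightarrow>\<^sub>E carrier M"
  shows "subgroup (stab n z) (GL n)"
proof (rule subgroup.intro)
  have z': "z \<in> {..<n} \<rightarrow> carrier M" using z by auto
  show "stab n z \<subseteq> carrier (GL n)" by (auto simp: stab_def GLint_D)
  show "\<one>\<^bsub>GL n\<^esub> \<in> stab n z" using act_one[OF z] GLint_one by (simp add: stab_def)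
  fix s t assume s: "s \<in> stab n z"
  {
    assume t: "t \<in> stab n z"
    have "act n z (s * t) = act n (act n z s) t"
      using s t by (intro act_mult[symmetric] z') (simp_all add: stab_def GLint_D)
    then show "s \<otimes>\<^bsub>GL n\<^esub> t \<in> stab n z" using s t GLint_mult[of s n t] by (simp add: stab_def)
  }
  have sG: "s \<in> GLint n" using s by (simp add: stab_def)
  have "act n (act n z s) (inv\<^bsub>GL n\<^esub> s) = z"
    using GL_inv(3)[OF GLint_D(1)[OF sG]] by (intro act_inverse z GLint_D sG)
  then show "inv\<^bsub>GL n\<^esub> s \<in> stab n z" using s GLint_inv[OF sG] by (simp add: stab_def)
qed

lemma stab_act:
  assumes z: "z \<in> {..<n} \<rightarrow>\<^sub>E carrier M" and g: "g \<in> GLint n"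
  shows "stab n (act n z g) = conj_set n (inv\<^bsub>GL n\<^esub> g) (stab n z)"
proof -
  \<comment> \<open>One inclusion, proved for all tuples and all integral invertible matrices, gives
    both: it is used for \<open>z\<close> with the inverse of \<open>g\<close>, and for the
    translated tuple with \<open>g\<close>.\<close>
  have sub: "\<phi> * s * inv\<^bsub>GL n\<^esub> \<phi> \<in> stab n (act n z (inv\<^bsub>GL n\<^esub> \<phi>))"
    if z: "z \<in> {..<n} \<rightarrow>\<^sub>E carrier M" and p: "\<phi> \<in> GLint n" and s: "s \<in> stab n z" for z \<phi> s
  proof -
    have z': "z \<in> {..<n} \<rightarrow> carrier M" using z by auto
    have sG: "s \<in> GLint n" "act n z s = z" using s by (simp_all add: stab_def)
    note pi = GL_inv[OF GLint_D(1)[OF p]] GLint_inv[OF p]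
    have c: "\<phi> \<in> carrier_mat n n" "inv\<^bsub>GL n\<^esub> \<phi> \<in> carrier_mat n n" "s \<in> carrier_mat n n"
      using GLint_D(4)[OF p] GLint_D(4)[OF pi(4)] GLint_D(4)[OF sG(1)] by simp_all
    have G: "\<phi> * s * inv\<^bsub>GL n\<^esub> \<phi> \<in> GLint n" by (intro GLint_mult p sG pi)
    have "act n (act n z (inv\<^bsub>GL n\<^esub> \<phi>)) (\<phi> * s * inv\<^bsub>GL n\<^esub> \<phi>) = act n z (inv\<^bsub>GL n\<^esub> \<phi> * (\<phi> * s * inv\<^bsub>GL n\<^esub> \<phi>))"
      by (intro act_mult z' GLint_D pi G)
    also have "inv\<^bsub>GL n\<^esub> \<phi> * (\<phi> * s * inv\<^bsub>GL n\<^esub> \<phi>) = (inv\<^bsub>GL n\<^esub> \<phi> * \<phi>) * s * inv\<^bsub>GL n\<^esub> \<phi>"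
      using c by (simp add: assoc_mult_mat[of _ n n _ n _ n])
    also have "\<dots> = s * inv\<^bsub>GL n\<^esub> \<phi>" using c pi by simp
    also have "act n z (s * inv\<^bsub>GL n\<^esub> \<phi>) = act n (act n z s) (inv\<^bsub>GL n\<^esub> \<phi>)"
      by (intro act_mult[symmetric] z' GLint_D pi sG)
    finally show ?thesis using G sG by (simp add: stab_def)
  qed
  have z': "z \<in> {..<n} \<rightarrow> carrier M" using z by auto
  note gi = GL_inv[OF GLint_D(1)[OF g]] GLint_inv[OF g]
  have ii: "inv\<^bsub>GL n\<^esub> (inv\<^bsub>GL n\<^esub> g) = g" using group.inv_inv[OF GL_group GLint_D(1)[OF g]] .
  have ag: "act n z g \<in> {..<n} \<rightarrow>\<^sub>E carrier M" by (rule act_closed[OF z' GLint_D(2)[OF g]])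
  have az: "act n (act n z g) (inv\<^bsub>GL n\<^esub> g) = z" by (intro act_inverse z GLint_D g gi)
  show ?thesis
  proof
    show "conj_set n (inv\<^bsub>GL n\<^esub> g) (stab n z) \<subseteq> stab n (act n z g)"
      using sub[OF z gi(4)] unfolding conj_set_def ii by blast
    show "stab n (act n z g) \<subseteq> conj_set n (inv\<^bsub>GL n\<^esub> g) (stab n z)"
    proof
      fix t assume t: "t \<in> stab n (act n z g)"
      then have "t \<in> carrier_mat n n" by (simp add: stab_def GLint_D)
      from conj_assoc(1)[OF GLint_D(1)[OF g] this]
      have "t = inv\<^bsub>GL n\<^esub> g * (g * t * inv\<^bsub>GL n\<^esub> g) * inv\<^bsub>GL n\<^esub> (inv\<^bsub>GL n\<^esub> g)" unfolding ii ..
      moreover have "g * t * inv\<^bsub>GL n\<^esub> g \<in> stab n z" using sub[OF ag g t] unfolding az .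
      ultimately show "t \<in> conj_set n (inv\<^bsub>GL n\<^esub> g) (stab n z)" unfolding conj_set_def by (rule image_eqI)
    qed
  qed
qed

text \<open>The entries of \<open>Y\<close> kill \<open>M\<close>, so adding \<open>Y\<close> does
  not change the action on \<open>z\<close>. Invertibility over the valuation ring persists because
  \<open>s + Y\<close> is \<open>s\<close> times a matrix congruent to the identity.\<close>

lemma stab_open_step:
  assumes tor: "torsion k" and z: "z \<in> {..<n} \<rightarrow>\<^sub>E carrier M" and s: "s \<in> stab n z"
    and Y: "mat_in (int k) n n Y" "mat_in 1 n n Y"
  shows "s + Y \<in> stab n z"
proof -
  have z': "z \<in> {..<n} \<rightarrow> carrier M" using z by auto
  have sG: "s \<in> GLint n" "act n z s = z" using s by (simp_all add: stab_def)
  note si = GL_inv[OF GLint_D(1)[OF sG(1)]] GLint_inv[OF sG(1)]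
  have c: "s \<in> carrier_mat n n" "inv\<^bsub>GL n\<^esub> s \<in> carrier_mat n n" "Y \<in> carrier_mat n n"
    using GLint_D(4)[OF sG(1)] GLint_D(4)[OF si(4)] Y by (simp_all add: mat_in_def)
  have "mat_in (0 + 1) n n (inv\<^bsub>GL n\<^esub> s * Y)" by (rule mat_in_mult[OF GLint_D(3)[OF sG(1)] Y(2)])
  then have "1\<^sub>m n + inv\<^bsub>GL n\<^esub> s * Y \<in> GLint n" using one_plus_GLint by simp
  then have "s * (1\<^sub>m n + inv\<^bsub>GL n\<^esub> s * Y) \<in> GLint n" by (intro GLint_mult sG)
  moreover have "s * (1\<^sub>m n + inv\<^bsub>GL n\<^esub> s * Y) = s * 1\<^sub>m n + s * (inv\<^bsub>GL n\<^esub> s * Y)"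
    using c by (intro mult_add_distrib_mat[of _ n n]) auto
  moreover have "s * (inv\<^bsub>GL n\<^esub> s * Y) = Y"
    using assoc_mult_mat[OF c(1,2,3)] si(3) c(3) by simp
  ultimately have G: "s + Y \<in> GLint n" using c by simp
  have "act n z (s + Y) b = act n z s b" for b
  proof (cases "b < n")
    case True
    have sO: "s $$ (a, b) \<in> \<O>" and YO: "Y $$ (a, b) \<in> \<O>" "Y $$ (a, b) \<in> frac_ideal v (int k)" if "a < n" for a
      using GLint_D(2)[OF sG(1)] Y(1) True that frac_ideal_mono[of "Y $$ (a, b)" v "int k" 0] by (auto simp: mat_in_def)
    have "comb n (\<lambda>a. (s + Y) $$ (a, b)) z = comb n (\<lambda>a. s $$ (a, b)) z"
      unfolding comb_def
    proof (rule M.finsum_cong')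
      fix a assume "a \<in> {..<n}"
      then have a: "a < n" by simp
      have za: "z a \<in> carrier M" using z' a by auto
      have "(s + Y) $$ (a, b) \<odot>\<^bsub>M\<^esub> z a = (s $$ (a, b) + Y $$ (a, b)) \<odot>\<^bsub>M\<^esub> z a" using c a True by simp
      also have "\<dots> = s $$ (a, b) \<odot>\<^bsub>M\<^esub> z a \<oplus>\<^bsub>M\<^esub> Y $$ (a, b) \<odot>\<^bsub>M\<^esub> z a"
        using smult_l_distr[of "s $$ (a, b)" "Y $$ (a, b)" "z a"] sO[OF a] YO[OF a] za by simp
      also have "Y $$ (a, b) \<odot>\<^bsub>M\<^esub> z a = \<zero>\<^bsub>M\<^esub>" using tor YO(2)[OF a] za by (simp add: torsion_def)
      finally show "(s + Y) $$ (a, b) \<odot>\<^bsub>M\<^esub> z a = s $$ (a, b) \<odot>\<^bsub>M\<^esub> z a"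
        using sO[OF a] za by simp
    qed (use sO z' in auto)
    then show ?thesis using True by (simp add: act_def)
  qed (simp add: act_def)
  then have "act n z (s + Y) = act n z s" ..
  then show ?thesis using G sG by (simp add: stab_def)
qed

text \<open>Openness is what makes functions invariant under \<open>K\<close> smooth. The bounded
  denominators of \<open>\<phi>\<close> and its inverse only shrink the neighbourhoods.\<close>

lemma conj_stab_open:
  assumes tor: "torsion k" and z: "z \<in> {..<n} \<rightarrow>\<^sub>E carrier M" and \<phi>: "\<phi> \<in> carrier (GL n)"
  shows "GL_open v n (conj_set n \<phi> (stab n z))"
  unfolding GL_open_def
proof (intro conjI ballI)
  note i = GL_inv[OF \<phi>]
  have c: "\<phi> \<in> carrier_mat n n" "inv\<^bsub>GL n\<^esub> \<phi> \<in> carrier_mat n n"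
    using GL_carrier_mat[OF \<phi>] GL_carrier_mat[OF i(1)] by simp_all
  have sc: "s \<in> carrier_mat n n" "s \<in> carrier (GL n)" if "s \<in> stab n z" for s using that by (simp_all add: stab_def GLint_D)
  show "conj_set n \<phi> (stab n z) \<subseteq> carrier (GL n)"
    unfolding conj_set_def using sc(2) by (auto intro!: GL_mult_closed \<phi> i)
  fix g assume "g \<in> conj_set n \<phi> (stab n z)"
  then obtain s where s: "s \<in> stab n z" "g = \<phi> * s * inv\<^bsub>GL n\<^esub> \<phi>" unfolding conj_set_def by blast
  obtain m1 m2 where m: "m1 \<le> 0" "mat_in m1 n n \<phi>" "m2 \<le> 0" "mat_in m2 n n (inv\<^bsub>GL n\<^esub> \<phi>)"
    using mat_in_exists[OF c(1)] mat_in_exists[OF c(2)] by blast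
  \<comment> \<open>Conjugating a perturbation with entries of valuation at least \<open>m\<close>
    back to standard position leaves valuation at least \<open>m2 + m + m1\<close>, that is
    \<open>int k + 1\<close>. The extra \<open>1\<close> ensures the congruence to the identity even
    when \<open>k = 0\<close>.\<close>
  define m where "m = int k + 1 - m1 - m2"
  have "h \<in> conj_set n \<phi> (stab n z)"
    if h: "h \<in> carrier (GL n)" and cl: "\<forall>i<n. \<forall>j<n. h $$ (i, j) - g $$ (i, j) \<in> frac_ideal v m" for h
  proof -
    have hc: "h \<in> carrier_mat n n" by (rule GL_carrier_mat[OF h])
    have gc: "g \<in> carrier_mat n n" using s c sc by simp
    define X where "X = h - g"
    have X: "mat_in m n n X" using cl hc gc unfolding mat_in_def X_def by auto
    define Y where "Y = inv\<^bsub>GL n\<^esub> \<phi> * X * \<phi>"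
    have Xc: "X \<in> carrier_mat n n" using X by (simp add: mat_in_def)
    have "mat_in (m2 + m + m1) n n Y" unfolding Y_def by (rule mat_in_mult[OF mat_in_mult[OF m(4) X] m(2)])
    then have Y: "mat_in (int k + 1) n n Y" by (simp add: m_def)
    have "s + Y \<in> stab n z"
      by (rule stab_open_step[OF tor z s(1)]) (rule mat_in_mono[OF Y], simp)+
    moreover have "h = \<phi> * (s + Y) * inv\<^bsub>GL n\<^esub> \<phi>"
    proof -
      have Yc: "Y \<in> carrier_mat n n" using Y by (simp add: mat_in_def)
      have "\<phi> * (s + Y) * inv\<^bsub>GL n\<^esub> \<phi> = (\<phi> * s + \<phi> * Y) * inv\<^bsub>GL n\<^esub> \<phi>"
        using mult_add_distrib_mat[OF c(1) sc(1)[OF s(1)] Yc] by simp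
      also have "\<dots> = \<phi> * s * inv\<^bsub>GL n\<^esub> \<phi> + \<phi> * Y * inv\<^bsub>GL n\<^esub> \<phi>"
        using c Yc sc(1)[OF s(1)] by (intro add_mult_distrib_mat[of _ n n]) auto
      also have "\<phi> * Y * inv\<^bsub>GL n\<^esub> \<phi> = X" unfolding Y_def by (rule conj_assoc(2)[OF \<phi> Xc])
      also have "\<phi> * s * inv\<^bsub>GL n\<^esub> \<phi> + X = h" unfolding s(2)[symmetric] X_def using hc gc by (intro eq_matI) auto
      finally show ?thesis ..
    qed
    ultimately show ?thesis unfolding conj_set_def by (rule image_eqI[rotated])
  qed
  then show "\<exists>m. \<forall>h\<in>carrier (GL n). (\<forall>i<n. \<forall>j<n. h $$ (i, j) - g $$ (i, j) \<in> frac_ideal v m) \<longrightarrow>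
      h \<in> conj_set n \<phi> (stab n z)" by blast
qed

lemma conj_stab_subgroup:
  assumes z: "z \<in> {..<n} \<rightarrow>\<^sub>E carrier M" and \<phi>: "\<phi> \<in> carrier (GL n)"
  shows "subgroup (conj_set n \<phi> (stab n z)) (GL n)"
proof -
  interpret G: group "GL n :: 'f mat monoid" by (rule GL_group)
  interpret S: subgroup "stab n z" "GL n" by (rule stab_subgroup[OF z])
  note i = GL_inv[OF \<phi>]
  have c: "\<phi> \<in> carrier_mat n n" "inv\<^bsub>GL n\<^esub> \<phi> \<in> carrier_mat n n"
    using GL_carrier_mat[OF \<phi>] GL_carrier_mat[OF i(1)] by simp_all
  have sc: "s \<in> carrier_mat n n" "s \<in> carrier (GL n)" if "s \<in> stab n z" for s using that by (simp_all add: stab_def GLint_D)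
  have conjG: "\<phi> * s * inv\<^bsub>GL n\<^esub> \<phi> \<in> carrier (GL n)" if "s \<in> stab n z" for s
    by (rule GL_mult_closed[OF GL_mult_closed[OF \<phi> sc(2)[OF that]] i(1)])
  show ?thesis
  proof (rule G.subgroupI)
    show "conj_set n \<phi> (stab n z) \<subseteq> carrier (GL n)"
      unfolding conj_set_def using conjG by (rule image_subsetI)
    show "conj_set n \<phi> (stab n z) \<noteq> {}" unfolding conj_set_def using S.one_closed by blast
    fix a assume "a \<in> conj_set n \<phi> (stab n z)"
    then obtain s where s: "s \<in> stab n z" "a = \<phi> * s * inv\<^bsub>GL n\<^esub> \<phi>" unfolding conj_set_def by blast
    have sG: "s \<in> carrier (GL n)" by (rule sc(2)[OF s(1)])
    have "inv\<^bsub>GL n\<^esub> a = \<phi> * inv\<^bsub>GL n\<^esub> s * inv\<^bsub>GL n\<^esub> \<phi>"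
    proof (rule GL_I(2))
      have si: "inv\<^bsub>GL n\<^esub> s \<in> carrier_mat n n" "s * inv\<^bsub>GL n\<^esub> s = 1\<^sub>m n"
        using GL_carrier_mat GL_inv[OF sG] by auto
      show "a \<in> carrier_mat n n" "\<phi> * inv\<^bsub>GL n\<^esub> s * inv\<^bsub>GL n\<^esub> \<phi> \<in> carrier_mat n n"
        using c si sc(1)[OF s(1)] s(2) by simp_all
      have "a * (\<phi> * inv\<^bsub>GL n\<^esub> s * inv\<^bsub>GL n\<^esub> \<phi>) = \<phi> * s * (inv\<^bsub>GL n\<^esub> \<phi> * \<phi>) * inv\<^bsub>GL n\<^esub> s * inv\<^bsub>GL n\<^esub> \<phi>"
        unfolding s(2) using c si(1) sc(1)[OF s(1)] by (simp add: assoc_mult_mat[of _ n n _ n _ n])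
      also have "\<dots> = \<phi> * (s * inv\<^bsub>GL n\<^esub> s) * inv\<^bsub>GL n\<^esub> \<phi>"
        using c si(1) sc(1)[OF s(1)] i by (simp add: assoc_mult_mat[of _ n n _ n _ n])
      also have "\<dots> = 1\<^sub>m n" using si i c by simp
      finally show "a * (\<phi> * inv\<^bsub>GL n\<^esub> s * inv\<^bsub>GL n\<^esub> \<phi>) = 1\<^sub>m n" .
    qed
    then show "inv\<^bsub>GL n\<^esub> a \<in> conj_set n \<phi> (stab n z)" unfolding conj_set_def
      using S.m_inv_closed[OF s(1)] by (rule image_eqI)
    fix b assume "b \<in> conj_set n \<phi> (stab n z)"
    then obtain t where t: "t \<in> stab n z" "b = \<phi> * t * inv\<^bsub>GL n\<^esub> \<phi>" unfolding conj_set_def by blast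
    have "a * b = \<phi> * s * (inv\<^bsub>GL n\<^esub> \<phi> * \<phi>) * t * inv\<^bsub>GL n\<^esub> \<phi>"
      unfolding s(2) t(2) using c sc(1)[OF s(1)] sc(1)[OF t(1)] by (simp add: assoc_mult_mat[of _ n n _ n _ n])
    also have "\<dots> = \<phi> * (s * t) * inv\<^bsub>GL n\<^esub> \<phi>"
      using c sc(1)[OF s(1)] sc(1)[OF t(1)] i by (simp add: assoc_mult_mat[of _ n n _ n _ n])
    finally show "a \<otimes>\<^bsub>GL n\<^esub> b \<in> conj_set n \<phi> (stab n z)" unfolding conj_set_def GL_simps
      using S.m_closed[OF s(1) t(1)] unfolding GL_simps by (rule image_eqI)
  qed
qed

text \<open>A choice of a basis of \<open>L1\<close> identifies \<open>L1 \<rightarrow> L1/L2 \<cong> M\<close> with a generating tuple of \<open>M\<close>, and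
  the group of the pair with the stabilizer of the tuple.\<close>

theorem module_groups_stab:
  assumes "K \<in> module_groups v n M"
  obtains \<phi> z k where "\<phi> \<in> carrier (GL n)" "z \<in> tuples n" "K = conj_set n \<phi> (stab n z)" "torsion k"
proof -
  let ?V = "module_vec TYPE('f) n"
  obtain L1 L2 where K: "K = lattice_group n L1 L2" and L: "is_lattice v n L1" "is_lattice v n L2" "L2 \<subseteq> L1"
    and iso: "modules_isomorphic (val_ring v) (quotient_module (?V\<lparr>carrier := L1\<rparr>) L2) M"
    using assms unfolding module_groups_def by blast
  obtain \<phi> where \<phi>: "\<phi> \<in> carrier (GL n)" "L1 = lat n \<phi>" using is_lattice_lat[OF L(1)] .
  obtain \<phi>2 where \<phi>2: "\<phi>2 \<in> carrier (GL n)" "L2 = lat n \<phi>2" using is_lattice_lat[OF L(2)] .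
  note i = GL_inv[OF \<phi>(1)]
  have c: "\<phi> \<in> carrier_mat n n" "inv\<^bsub>GL n\<^esub> \<phi> \<in> carrier_mat n n" "\<phi>2 \<in> carrier_mat n n"
    using GL_carrier_mat[OF \<phi>(1)] GL_carrier_mat[OF i(1)] GL_carrier_mat[OF \<phi>2(1)] by simp_all
  interpret V: Module.module "val_ring v" ?V by (rule vec_module_val_ring)
  have sub1: "submodule (val_ring v) L1 ?V" and sub2: "submodule (val_ring v) L2 ?V"
    using L unfolding is_lattice_def by auto
  interpret S1: submodule "val_ring v" L1 ?V by fact
  interpret S2: submodule "val_ring v" L2 ?V by fact
  let ?N = "?V\<lparr>carrier := L1\<rparr>"
  interpret N: Module.module "val_ring v" ?N by (rule V.submodule_is_module[OF sub1])
  have sub: "submodule (val_ring v) L2 ?N"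
    by (rule submodule.intro[OF N.module_axioms]) (use L(3) S2.m_closed S2.zero_closed S2.smult_closed in auto)
  let ?Q = "quotient_module ?N L2"
  interpret Q: Module.module "val_ring v" ?Q by (rule N.quotient_module_is_module[OF sub])
  obtain \<psi> where \<psi>: "\<psi> \<in> module_hom (val_ring v) ?Q M" "bij_betw \<psi> (carrier ?Q) (carrier M)"
    using iso unfolding modules_isomorphic_def by blast
  \<comment> \<open>The projection from \<open>L1\<close> to \<open>L1 / L2\<close>, followed by the
    isomorphism with \<open>M\<close>. Its kernel is \<open>L2\<close>, which \<open>q_eq\<close>
    states in terms of differences.\<close>
  define q where "q x = \<psi> (L2 +>\<^bsub>?N\<^esub> x)" for x
  have q_hom: "q \<in> module_hom (val_ring v) ?N M"
  proof -
    note h1 = N.quotient_hom[OF sub]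
    note m1 = funcset_mem[OF LinearCombinations.module_hom_closed[OF h1]]
    show ?thesis
      unfolding LinearCombinations.module_hom_def q_def
    proof (intro CollectI conjI allI impI)
      show "(\<lambda>x. \<psi> (L2 +>\<^bsub>?N\<^esub> x)) \<in> carrier ?N \<rightarrow> carrier M"
        using funcset_mem[OF LinearCombinations.module_hom_closed[OF \<psi>(1)] m1] by (rule funcsetI)
      fix x y assume "x \<in> carrier ?N \<and> y \<in> carrier ?N"
      then have xy: "x \<in> carrier ?N" "y \<in> carrier ?N" by simp_all
      show "\<psi> (L2 +>\<^bsub>?N\<^esub> (x \<oplus>\<^bsub>?N\<^esub> y)) = \<psi> (L2 +>\<^bsub>?N\<^esub> x) \<oplus>\<^bsub>M\<^esub> \<psi> (L2 +>\<^bsub>?N\<^esub> y)"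
        unfolding LinearCombinations.module_hom_add[OF h1 xy]
        by (rule LinearCombinations.module_hom_add[OF \<psi>(1) m1[OF xy(1)] m1[OF xy(2)]])
    next
      fix r x assume "r \<in> carrier (val_ring v) \<and> x \<in> carrier ?N"
      then have rx: "r \<in> carrier (val_ring v)" "x \<in> carrier ?N" by simp_all
      show "\<psi> (L2 +>\<^bsub>?N\<^esub> (r \<odot>\<^bsub>?N\<^esub> x)) = r \<odot>\<^bsub>M\<^esub> \<psi> (L2 +>\<^bsub>?N\<^esub> x)"
        unfolding LinearCombinations.module_hom_smult[OF h1 rx]
        by (rule LinearCombinations.module_hom_smult[OF \<psi>(1) rx(1) m1[OF rx(2)]])
    qed
  qed
  have q_eq: "q x = q y \<longleftrightarrow> x - y \<in> L2" if "x \<in> L1" "y \<in> L1" for x y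
  proof -
    have "q x = q y \<longleftrightarrow> L2 +>\<^bsub>?N\<^esub> x = L2 +>\<^bsub>?N\<^esub> y"
      unfolding q_def
    proof (rule inj_on_eq_iff)
      show "inj_on \<psi> (carrier ?Q)" using \<psi>(2) by (rule bij_betw_imp_inj_on)
    qed (simp_all add: N.carrier_quotient_module that)
    also have "\<dots> \<longleftrightarrow> x \<ominus>\<^bsub>?N\<^esub> y \<in> L2" using N.coset_eq_iff[OF sub] that by simp
    also have "x \<ominus>\<^bsub>?N\<^esub> y = x - y"
    proof -
      have xy: "x \<in> carrier_vec n" "y \<in> carrier_vec n" using that S1.subset by (auto simp: module_vec_simps)
      have "- 1 \<cdot>\<^sub>v y = - y" using xy by (intro eq_vecI) auto
      then have "- y \<in> L1" using S1.smult_closed[of "- 1" y] that xy frac_uminus[OF one_int] by (simp add: module_vec_simps)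
      then have "\<ominus>\<^bsub>?N\<^esub> y = - y" using that xy
        by (intro N.M.minus_equality) (simp_all add: module_vec_simps)
      then show ?thesis using xy by (auto simp: a_minus_def module_vec_simps)
    qed
    finally show ?thesis .
  qed
  have q_onto: "\<exists>x\<in>L1. m = q x" if "m \<in> carrier M" for m
  proof -
    have "m \<in> \<psi> ` carrier ?Q" using \<psi>(2) that by (simp add: bij_betw_def)
    then show ?thesis unfolding N.carrier_quotient_module q_def by auto
  qed
  have comb_vec: "N.comb n c (\<lambda>a. col \<phi> a) = \<phi> *\<^sub>v vec n c" if cO: "c \<in> {..<n} \<rightarrow> \<O>" for c
  proof -
    have colL: "col \<phi> a \<in> L1" if "a < n" for a
      unfolding \<phi>(2) lat_def using imageI[OF unit_vec_int[of n a], of "\<lambda>c. \<phi> *\<^sub>v c"] mult_mat_unit_vec[OF c(1) that] by simp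
    \<comment> \<open>Induction on the number of columns in use: the coefficient vector is cut off
      after the first \<open>m\<close> entries while its length stays \<open>n\<close>.\<close>
    have "N.comb m c (\<lambda>a. col \<phi> a) = \<phi> *\<^sub>v vec n (\<lambda>a. if a < m then c a else 0)" if "m \<le> n" for m
      using that
    proof (induction m)
      case 0
      have "\<phi> *\<^sub>v vec n (\<lambda>a. if a < 0 then c a else 0) = 0\<^sub>v n" using c(1) by (intro eq_vecI) (auto simp: scalar_prod_def)
      then show ?case by (simp add: N.comb_def module_vec_simps)
    next
      case (Suc m)
      have "N.comb (Suc m) c (\<lambda>a. col \<phi> a) = c m \<cdot>\<^sub>v col \<phi> m + N.comb m c (\<lambda>a. col \<phi> a)"
        using funcset_mem[OF cO] Suc.prems colL by (subst N.comb_Suc) (auto simp: module_vec_simps)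
      also have "\<dots> = c m \<cdot>\<^sub>v (\<phi> *\<^sub>v unit_vec n m) + \<phi> *\<^sub>v vec n (\<lambda>a. if a < m then c a else 0)"
        using Suc mult_mat_unit_vec[OF c(1), of m] by simp
      also have "\<dots> = \<phi> *\<^sub>v (c m \<cdot>\<^sub>v unit_vec n m + vec n (\<lambda>a. if a < m then c a else 0))"
        using mult_add_distrib_mat_vec[OF c(1), of "c m \<cdot>\<^sub>v unit_vec n m" "vec n (\<lambda>a. if a < m then c a else 0)"]
          mult_mat_vec[OF c(1), of "unit_vec n m" "c m"] by simp
      also have "c m \<cdot>\<^sub>v unit_vec n m + vec n (\<lambda>a. if a < m then c a else 0) = vec n (\<lambda>a. if a < Suc m then c a else 0)"
        by (intro eq_vecI) (auto simp: unit_vec_def less_Suc_eq)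
      finally show ?case .
    qed
    moreover have "vec n (\<lambda>a. if a < n then c a else 0) = vec n c" by (intro eq_vecI) auto
    ultimately show ?thesis using order_refl by metis
  qed
  define z where "z = (\<lambda>a\<in>{..<n}. q (col \<phi> a))"
  have colL: "col \<phi> a \<in> L1" if "a < n" for a
    unfolding \<phi>(2) lat_def using imageI[OF unit_vec_int[of n a], of "\<lambda>c. \<phi> *\<^sub>v c"] mult_mat_unit_vec[OF c(1) that] by simp
  have z: "z \<in> {..<n} \<rightarrow>\<^sub>E carrier M"
    unfolding z_def using LinearCombinations.module_hom_closed[OF q_hom] colL by (simp add: PiE_iff Pi_iff)
  then have z': "z \<in> {..<n} \<rightarrow> carrier M" by (simp add: PiE_iff Pi_iff)
  have zc: "comb n d z = q (\<phi> *\<^sub>v vec n d)" if "d \<in> {..<n} \<rightarrow> \<O>" for d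
  proof -
    have "q (N.comb n d (\<lambda>a. col \<phi> a)) = comb n d (\<lambda>a. q (col \<phi> a))"
      using that colL by (intro N.comb_hom[OF module_axioms q_hom]) auto
    also have "\<dots> = comb n d z" using that z' by (intro comb_cong) (auto simp: z_def)
    finally show ?thesis using comb_vec[OF that] by simp
  qed
  have L1E: "\<exists>c\<in>int_vec n. x = \<phi> *\<^sub>v c" if "x \<in> L1" for x
    using that by (auto simp: \<phi>(2) lat_def)
  have int_vec_eq: "\<exists>d\<in>{..<n} \<rightarrow> \<O>. c = vec n d" if "c \<in> int_vec n" for c
    using that by (intro bexI[of _ "\<lambda>i. c $ i"]) (auto simp: int_vec_def)
  have zt: "z \<in> tuples n"
    unfolding tuples_def generates_def
  proof (intro CollectI conjI ballI z)
    fix m assume "m \<in> carrier M"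
    then obtain x where x: "x \<in> L1" "m = q x" using q_onto by blast
    obtain c where c: "c \<in> int_vec n" "x = \<phi> *\<^sub>v c" using L1E[OF x(1)] by blast
    obtain d where d: "d \<in> {..<n} \<rightarrow> \<O>" "c = vec n d" using int_vec_eq[OF c(1)] by blast
    have "m = comb n d z" unfolding zc[OF d(1)] x(2) c(2) d(2) ..
    then show "\<exists>d\<in>{..<n} \<rightarrow> carrier (val_ring v). m = comb n d z"
      by (intro bexI[of _ d]) (simp_all only: val_ring_simps d(1))
  qed
  have qv: "q (\<phi> *\<^sub>v c) = comb n (\<lambda>i. c $ i) z" if "c \<in> int_vec n" for c
  proof -
    have "vec n (\<lambda>i. c $ i) = c" "(\<lambda>i. c $ i) \<in> {..<n} \<rightarrow> \<O>" using that by (auto simp: int_vec_def)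
    then show ?thesis using zc[of "\<lambda>i. c $ i"] by simp
  qed
  have act_q: "act n z s b = q (\<phi> *\<^sub>v col s b)" if "mat_in 0 n n s" "b < n" for s b
  proof -
    have "col s b \<in> int_vec n" using that by (auto simp: mat_in_def int_vec_def)
    then have "q (\<phi> *\<^sub>v col s b) = comb n (\<lambda>i. col s b $ i) z" by (rule qv)
    also have "\<dots> = comb n (\<lambda>i. s $$ (i, b)) z" using that z' by (intro comb_cong) (auto simp: mat_in_def)
    finally show ?thesis using that(2) by (simp add: act_def)
  qed
  \<comment> \<open>In the basis \<open>\<phi>\<close> the conjugate acts on coordinates by
    \<open>s\<close>. Since \<open>s\<close> fixes the tuple \<open>z\<close> of images of the
    basis, the vectors before and after have the same image under \<open>q\<close>.\<close>
  have stab_diff: "(\<phi> * s * inv\<^bsub>GL n\<^esub> \<phi>) *\<^sub>v x - x \<in> L2" if s: "s \<in> stab n z" and x: "x \<in> L1" for s x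
  proof -
    have sG: "s \<in> GLint n" "act n z s = z" using s by (simp_all add: stab_def)
    have sc: "s \<in> carrier_mat n n" by (rule GLint_D(4)[OF sG(1)])
    obtain d where d: "d \<in> int_vec n" "x = \<phi> *\<^sub>v d" using L1E[OF x] by blast
    have dc: "d \<in> carrier_vec n" using d by (simp add: int_vec_def)
    have sd: "s *\<^sub>v d \<in> int_vec n" by (rule int_vec_mult[OF GLint_D(2)[OF sG(1)] d(1)])
    have "(\<phi> * s * inv\<^bsub>GL n\<^esub> \<phi>) *\<^sub>v x = (\<phi> * s * inv\<^bsub>GL n\<^esub> \<phi> * \<phi>) *\<^sub>v d"
      unfolding d(2) using c sc dc by (intro assoc_mult_mat_vec[symmetric]) auto
    also have "\<phi> * s * inv\<^bsub>GL n\<^esub> \<phi> * \<phi> = \<phi> * s * (inv\<^bsub>GL n\<^esub> \<phi> * \<phi>)"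
      using c sc by (intro assoc_mult_mat) auto
    also have "\<dots> = \<phi> * s" using c sc i by simp
    also have "(\<phi> * s) *\<^sub>v d = \<phi> *\<^sub>v (s *\<^sub>v d)" using c sc dc by (intro assoc_mult_mat_vec) auto
    finally have e: "(\<phi> * s * inv\<^bsub>GL n\<^esub> \<phi>) *\<^sub>v x = \<phi> *\<^sub>v (s *\<^sub>v d)" .
    have dO: "(\<lambda>i. d $ i) \<in> {..<n} \<rightarrow> \<O>" using d by (auto simp: int_vec_def)
    have "q (\<phi> *\<^sub>v (s *\<^sub>v d)) = comb n (\<lambda>a. (s *\<^sub>v d) $ a) z" by (rule qv[OF sd])
    also have "\<dots> = comb n (\<lambda>a. \<Sum>b<n. s $$ (a, b) * d $ b) z"
    proof (rule comb_cong)
      show "(\<lambda>a. \<Sum>b<n. s $$ (a, b) * d $ b) \<in> {..<n} \<rightarrow> carrier (val_ring v)"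
        using GLint_D(2)[OF sG(1)] dO by (auto simp: mat_in_def intro!: frac_sum int_mult)
    qed (use sc dc z' in \<open>auto simp: scalar_prod_def atLeast0LessThan\<close>)
    also have "\<dots> = comb n (\<lambda>i. d $ i) (act n z s)" by (rule comb_act[OF z' GLint_D(2)[OF sG(1)] dO, symmetric])
    also have "\<dots> = q x" unfolding sG(2) d(2) by (rule qv[OF d(1), symmetric])
    finally have "q (\<phi> *\<^sub>v (s *\<^sub>v d)) = q x" .
    then show ?thesis unfolding e using q_eq[of "\<phi> *\<^sub>v (s *\<^sub>v d)" x] x sd unfolding \<phi>(2) lat_def by blast
  qed
  have L2c: "x \<in> carrier_vec n" if "x \<in> L2" for x using S2.subset that by (auto simp: module_vec_simps)
  have L1c: "x \<in> carrier_vec n" if "x \<in> L1" for x using S1.subset that by (auto simp: module_vec_simps)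
  \<comment> \<open>Stability under a matrix and under its inverse turns the inclusion of the image
    into an equality.\<close>
  have G2: "(\<lambda>x. g *\<^sub>v x) ` L = L"
    if "\<And>x. x \<in> L \<Longrightarrow> g *\<^sub>v x \<in> L" "\<And>x. x \<in> L \<Longrightarrow> h *\<^sub>v x \<in> L" "g * h = 1\<^sub>m n" "g \<in> carrier_mat n n" "h \<in> carrier_mat n n" "L \<subseteq> carrier_vec n"
    for g h :: "'f mat" and L
  proof
    show "(\<lambda>x. g *\<^sub>v x) ` L \<subseteq> L" using that(1) by blast
    show "L \<subseteq> (\<lambda>x. g *\<^sub>v x) ` L"
    proof
      fix x assume x: "x \<in> L"
      have xc: "x \<in> carrier_vec n" using x that(6) by blast
      have "g *\<^sub>v (h *\<^sub>v x) = (g * h) *\<^sub>v x" by (rule assoc_mult_mat_vec[OF that(4,5) xc, symmetric])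
      also have "\<dots> = x" unfolding that(3) using xc by simp
      finally have "x = g *\<^sub>v (h *\<^sub>v x)" ..
      then show "x \<in> (\<lambda>x. g *\<^sub>v x) ` L" using that(2)[OF x] by (rule image_eqI)
    qed
  qed
  have "K = conj_set n \<phi> (stab n z)"
  proof
    show "conj_set n \<phi> (stab n z) \<subseteq> K"
    proof
      fix g assume g: "g \<in> conj_set n \<phi> (stab n z)"
      interpret C: subgroup "conj_set n \<phi> (stab n z)" "GL n" by (rule conj_stab_subgroup[OF z \<phi>(1)])
      define h where "h = inv\<^bsub>GL n\<^esub> g"
      have gG: "g \<in> carrier (GL n)" using g C.subset by blast
      have h: "h \<in> conj_set n \<phi> (stab n z)" "h \<in> carrier_mat n n" "g \<in> carrier_mat n n" "g * h = 1\<^sub>m n"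
        using C.m_inv_closed[OF g] GL_inv[OF gG] GL_carrier_mat[OF gG] GL_carrier_mat[OF GL_inv(1)[OF gG]] by (simp_all add: h_def)
      have diff: "g *\<^sub>v x - x \<in> L2" if "g \<in> conj_set n \<phi> (stab n z)" "x \<in> L1" for g x
        using that stab_diff unfolding conj_set_def by blast
      \<comment> \<open>Differences \<open>g x - x\<close> lie in \<open>L2\<close>, which is
        contained in \<open>L1\<close>, so adding \<open>x\<close> back stays within either
        lattice.\<close>
      have keep: "g *\<^sub>v x \<in> L" if "g \<in> conj_set n \<phi> (stab n z)" "x \<in> L" "L = L1 \<or> L = L2" "g \<in> carrier_mat n n" for g x L
      proof -
        have x1: "x \<in> L1" using that L(3) by blast
        have d: "g *\<^sub>v x - x \<in> L" using diff[OF that(1) x1] that(3) L(3) by blast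
        have "(g *\<^sub>v x - x) + x \<in> L" using d that(2,3) S1.m_closed S2.m_closed by (auto simp: module_vec_simps)
        moreover have "(g *\<^sub>v x - x) + x = g *\<^sub>v x" using that(4) L1c[OF x1] by (intro eq_vecI) auto
        ultimately show ?thesis by simp
      qed
      have "(\<lambda>x. g *\<^sub>v x) ` L1 = L1"
        by (rule G2[OF keep[OF g _ _ h(3)] keep[OF h(1) _ _ h(2)] h(4,3,2)]) (use L1c in auto)
      moreover have "(\<lambda>x. g *\<^sub>v x) ` L2 = L2"
        by (rule G2[OF keep[OF g _ _ h(3)] keep[OF h(1) _ _ h(2)] h(4,3,2)]) (use L2c in auto)
      ultimately show "g \<in> K" unfolding K lattice_group_def using gG diff[OF g] by blast
    qed
    show "K \<subseteq> conj_set n \<phi> (stab n z)"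
    proof
      fix g assume "g \<in> K"
      then have gG: "g \<in> carrier (GL n)" and g1: "(\<lambda>x. g *\<^sub>v x) ` L1 = L1" and g2: "\<And>x. x \<in> L1 \<Longrightarrow> g *\<^sub>v x - x \<in> L2"
        unfolding K lattice_group_def by auto
      note gi = GL_inv[OF gG]
      have gc: "g \<in> carrier_mat n n" "inv\<^bsub>GL n\<^esub> g \<in> carrier_mat n n" using GL_carrier_mat[OF gG] GL_carrier_mat[OF gi(1)] by simp_all
      have gphi: "lat n (g * \<phi>) = L1"
      proof -
        have "lat n (g * \<phi>) = (\<lambda>x. g *\<^sub>v x) ` lat n \<phi>"
          unfolding lat_def image_image using gc c
          by (intro image_cong refl) (auto simp: int_vec_def intro!: assoc_mult_mat_vec)
        then show ?thesis using g1 \<phi>(2) by simp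
      qed
      \<comment> \<open>The matrix of \<open>g\<close> in the basis \<open>\<phi>\<close>. It is
        integral with integral inverse because \<open>g\<close> maps \<open>L1\<close> onto
        itself.\<close>
      define s where "s = inv\<^bsub>GL n\<^esub> \<phi> * (g * \<phi>)"
      have gp: "g * \<phi> \<in> carrier (GL n)" by (rule GL_mult_closed[OF gG \<phi>(1)])
      have "s * (inv\<^bsub>GL n\<^esub> (g * \<phi>) * \<phi>) = inv\<^bsub>GL n\<^esub> \<phi> * ((g * \<phi>) * inv\<^bsub>GL n\<^esub> (g * \<phi>)) * \<phi>"
        unfolding s_def using c GL_carrier_mat[OF gp] GL_carrier_mat[OF GL_inv(1)[OF gp]]
        by (simp add: assoc_mult_mat[of _ n n _ n _ n])
      also have "\<dots> = 1\<^sub>m n" using GL_inv(3)[OF gp] i c by simp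
      finally have sG: "s \<in> GLint n"
        using lat_eq_GLint[OF \<phi>(1) gp] lat_eq_GLint[OF gp \<phi>(1)] gphi \<phi>(2) GLint_I(1) unfolding s_def by blast
      have sc: "s \<in> carrier_mat n n" by (rule GLint_D(4)[OF sG])
      have ps: "\<phi> * s = g * \<phi>" unfolding s_def
        unfolding assoc_mult_mat[OF c(1,2) GL_carrier_mat[OF gp], symmetric] i(3)
        by (rule left_mult_one_mat[OF GL_carrier_mat[OF gp]])
      have "act n z s b = z b" for b
      proof (cases "b < n")
        case True
        have e: "\<phi> *\<^sub>v col s b = g *\<^sub>v col \<phi> b"
          using col_mult2[OF c(1) sc True] col_mult2[OF gc(1) c(1) True] ps by simp
        have "act n z s b = q (g *\<^sub>v col \<phi> b)" using act_q[OF GLint_D(2)[OF sG] True] e by simp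
        also have "\<dots> = q (col \<phi> b)"
          using q_eq[of "g *\<^sub>v col \<phi> b" "col \<phi> b"] colL[OF True] g1 g2[OF colL[OF True]] by blast
        finally show ?thesis using True by (simp add: z_def)
      qed (simp add: act_def z_def)
      then have "s \<in> stab n z" using sG by (auto simp: stab_def)
      moreover have "g = \<phi> * s * inv\<^bsub>GL n\<^esub> \<phi>"
        unfolding ps using assoc_mult_mat[OF gc(1) c(1,2)] i(3) gc by simp
      ultimately show "g \<in> conj_set n \<phi> (stab n z)" unfolding conj_set_def by (rule image_eqI[rotated])
    qed
  qed
  moreover obtain k where "torsion k"
  proof -
    obtain m where m: "m \<le> 0" "\<forall>x\<in>L1. \<forall>i<n. x $ i \<in> frac_ideal v m" using lat_bounded[OF c(1)] \<phi>(2) by blast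
    obtain m' where m': "m' \<le> 0" "mat_in m' n n (inv\<^bsub>GL n\<^esub> \<phi>2)"
      using mat_in_exists[OF GL_carrier_mat[OF GL_inv(1)[OF \<phi>2(1)]]] by blast
    \<comment> \<open>Large enough that scalars of valuation at least \<open>k\<close> multiply
      \<open>L1\<close> into \<open>L2\<close>: the exponent absorbs the denominators of
      \<open>L1\<close>, bounded by \<open>m\<close>, and those of the inverse of
      \<open>\<phi>2\<close>, bounded by \<open>m'\<close>.\<close>
    define k where "k = nat (- m - m')"
    have "r \<odot>\<^bsub>M\<^esub> y = \<zero>\<^bsub>M\<^esub>" if r: "r \<in> frac_ideal v (int k)" and y: "y \<in> carrier M" for r y
    proof -
      have rO: "r \<in> \<O>" using frac_ideal_mono[OF r] by simp
      obtain x where x: "x \<in> L1" "y = q x" using q_onto[OF y] by blast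
      have "r \<cdot>\<^sub>v x \<in> L2" unfolding \<phi>2(2)
      proof (rule lat_full[OF \<phi>2(1)])
        show "mat_in (- (int k + m)) n n (inv\<^bsub>GL n\<^esub> \<phi>2)" by (rule mat_in_mono[OF m'(2)]) (use m m' in \<open>simp add: k_def\<close>)
        show "(r \<cdot>\<^sub>v x) $ j \<in> frac_ideal v (int k + m)" if "j < n" for j
          using that L1c[OF x(1)] m(2) x(1) r by (auto intro!: frac_mult)
      qed (use L1c[OF x(1)] in auto)
      moreover have "r \<odot>\<^bsub>M\<^esub> y = q (r \<cdot>\<^sub>v x)"
        using LinearCombinations.module_hom_smult[OF q_hom, of r x] x rO by (simp add: module_vec_simps)
      moreover have "q (r \<cdot>\<^sub>v x) = q (0\<^sub>v n)"
      proof -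
        have "r \<cdot>\<^sub>v x - 0\<^sub>v n = r \<cdot>\<^sub>v x" using L1c[OF x(1)] by (intro eq_vecI) auto
        then show ?thesis
          using q_eq[of "r \<cdot>\<^sub>v x" "0\<^sub>v n"] \<open>r \<cdot>\<^sub>v x \<in> L2\<close> S1.zero_closed L(3) by (auto simp: module_vec_simps)
      qed
      moreover have "q (0\<^sub>v n) = \<zero>\<^bsub>M\<^esub>"
      proof -
        have "q (0 \<cdot>\<^sub>v 0\<^sub>v n) = 0 \<odot>\<^bsub>M\<^esub> q (0\<^sub>v n)"
          using LinearCombinations.module_hom_smult[OF q_hom, of 0 "0\<^sub>v n"] S1.zero_closed by (simp add: module_vec_simps)
        moreover have "q (0\<^sub>v n) \<in> carrier M"
          using LinearCombinations.module_hom_closed[OF q_hom] S1.zero_closed by (auto simp: module_vec_simps)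
        moreover have "(0 :: 'f) \<cdot>\<^sub>v 0\<^sub>v n = 0\<^sub>v n" by (intro eq_vecI) auto
        ultimately show ?thesis by simp
      qed
      ultimately show ?thesis by simp
    qed
    then have "torsion k" by (simp add: torsion_def)
    then show ?thesis using that by blast
  qed
  ultimately show ?thesis using that \<phi>(1) zt by blast
qed

end

section \<open>Parabolic subgroups\<close>

locale parabolic = nonarch_local_field v for v :: "'f::field_char_0 \<Rightarrow> int" +
  fixes ns :: "nat list"
begin

abbreviation "r \<equiv> length ns"
abbreviation "n \<equiv> sum_list ns"
abbreviation "off \<equiv> offset ns"
abbreviation "P \<equiv> (std_parabolic ns :: 'f mat set)"

lemma off_0 [simp]: "off 0 = 0" by (simp add: offset_def)

lemma off_Suc: "i < r \<Longrightarrow> off (Suc i) = off i + ns ! i"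
  by (simp add: offset_def take_Suc_conv_app_nth)

lemma off_r [simp]: "off r = n" by (simp add: offset_def)

lemma off_mono: "i \<le> j \<Longrightarrow> off i \<le> off j"
proof (induction j)
  case (Suc j)
  have "off j \<le> off (Suc j)"
    by (cases "j < r") (simp_all add: off_Suc, simp add: offset_def)
  then show ?case using Suc by (cases "i = Suc j") auto
qed simp

lemma off_le: "i \<le> r \<Longrightarrow> off i \<le> n" using off_mono[of i r] by simp

text \<open>The index of the block that contains row \<open>b\<close>; it has this meaning for
  \<open>b < n\<close> only.\<close>

definition blk :: "nat \<Rightarrow> nat" where "blk b = (LEAST i. b < off (Suc i))"

lemma blk:
  assumes "b < n" shows "blk b < r" "off (blk b) \<le> b" "b < off (Suc (blk b))"
proof -
  obtain k where k: "r = Suc k" using assms by (cases ns) auto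
  have ex: "b < off (Suc k)" using assms k off_r by simp
  show "b < off (Suc (blk b))" unfolding blk_def by (rule LeastI[of _ k]) (rule ex)
  have "blk b \<le> k" unfolding blk_def by (rule Least_le) (rule ex)
  then show "blk b < r" using k by simp
  show "off (blk b) \<le> b"
  proof (cases "blk b")
    case (Suc j)
    then have "\<not> b < off (Suc j)" using not_less_Least[of j "\<lambda>i. b < off (Suc i)"] by (simp add: blk_def)
    then show ?thesis using Suc by simp
  qed simp
qed

lemma blk_eqI: assumes "off i \<le> b" "b < off (Suc i)" "i < r" shows "blk b = i"
proof -
  have b: "b < n" using assms off_le[of "Suc i"] by simp
  note B = blk[OF b]
  have "\<not> blk b < i" using off_mono[of "Suc (blk b)" i] B assms(1) by auto
  moreover have "\<not> i < blk b" using off_mono[of "Suc i" "blk b"] B assms(2) by auto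
  ultimately show ?thesis by simp
qed

lemma blk_off: "i < r \<Longrightarrow> a < ns ! i \<Longrightarrow> blk (off i + a) = i"
  by (rule blk_eqI) (simp_all add: off_Suc)

lemma off_add_less: "i < r \<Longrightarrow> a < ns ! i \<Longrightarrow> off i + a < n"
  using off_le[of "Suc i"] by (simp add: off_Suc)

text \<open>The vanishing condition separated from invertibility, so that it can be stated for
  matrices whose invertibility is still to be shown, as in \<open>block_GLint\<close>.\<close>

definition block_upper :: "'f mat \<Rightarrow> bool" where
  "block_upper p \<longleftrightarrow> (\<forall>i<r. \<forall>a b. off i \<le> a \<and> a < n \<and> b < off i \<longrightarrow> p $$ (a, b) = 0)"

lemma block_upper_D: "block_upper p \<Longrightarrow> i < r \<Longrightarrow> off i \<le> a \<Longrightarrow> a < n \<Longrightarrow> b < off i \<Longrightarrow> p $$ (a, b) = 0"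
  unfolding block_upper_def by blast

lemma P_iff: "p \<in> P \<longleftrightarrow> p \<in> carrier (GL n) \<and> block_upper p"
  unfolding std_parabolic_def block_upper_def by auto

lemma P_D: "p \<in> P \<Longrightarrow> p \<in> carrier (GL n)" "p \<in> P \<Longrightarrow> block_upper p" "p \<in> P \<Longrightarrow> p \<in> carrier_mat n n"
  using GL_carrier_mat by (auto simp: P_iff)

lemma upper_triangular_P:
  assumes "b \<in> carrier (GL n)" "upper_triangular b" shows "b \<in> P"
  using assms GL_carrier_mat[OF assms(1)] unfolding P_iff block_upper_def upper_triangular_def by auto

lemma block_upper_mult:
  assumes "p \<in> carrier_mat n n" "q \<in> carrier_mat n n" "block_upper p" "block_upper q"
  shows "block_upper (p * q)"
  unfolding block_upper_def
proof (intro allI impI)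
  fix i a b assume i: "i < r" and ab: "off i \<le> a \<and> a < n \<and> b < off i"
  have b: "b < n" using ab off_le[of i] i by simp
  have "(p * q) $$ (a, b) = (\<Sum>c<n. p $$ (a, c) * q $$ (c, b))"
    using assms ab b by (simp add: scalar_prod_def atLeast0LessThan)
  also have "\<dots> = 0"
  proof (rule sum.neutral, rule ballI)
    fix c assume "c \<in> {..<n}"
    then show "p $$ (a, c) * q $$ (c, b) = 0"
      using block_upper_D[OF assms(3) i, of a c] block_upper_D[OF assms(4) i, of c b] ab
      by (cases "c < off i") auto
  qed
  finally show "(p * q) $$ (a, b) = 0" .
qed

text \<open>Cut \<open>p\<close> after the row \<open>off i\<close>. Its determinant is the product
  of the determinants of the two diagonal blocks, so the lower right block \<open>D\<close> is
  invertible; it annihilates each column of the lower left part of the inverse, which is therefore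
  zero.\<close>

lemma block_upper_inverse:
  assumes p: "p \<in> P" shows "block_upper (inv\<^bsub>GL n\<^esub> p)"
  unfolding block_upper_def
proof (intro allI impI)
  note pD = P_D[OF p]
  note pi = GL_inv[OF pD(1)]
  define q where "q = inv\<^bsub>GL n\<^esub> p"
  have qc: "q \<in> carrier_mat n n" using GL_carrier_mat[OF pi(1)] by (simp add: q_def)
  fix i a b assume i: "i < r" and ab: "off i \<le> a \<and> a < n \<and> b < off i"
  define d where "d = off i"
  define e where "e = n - d"
  have d: "d + e = n" using off_le[of i] i by (simp add: d_def e_def)
  obtain A B C D where sp: "split_block p d d = (A, B, C, D)" by (metis prod_cases4)
  have dims: "dim_row p = d + e" "dim_col p = d + e" using pD(3) d by auto
  note bl = split_block[OF sp dims]
  have C0: "C = 0\<^sub>m e d"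
  proof (rule eq_matI)
    fix k l assume kl: "k < dim_row (0\<^sub>m e d :: 'f mat)" "l < dim_col (0\<^sub>m e d :: 'f mat)"
    have "C $$ (k, l) = p $$ (d + k, l)" using sp kl dims unfolding split_block_def Let_def by (auto simp: add.commute)
    also have "\<dots> = 0" using kl d by (intro block_upper_D[OF pD(2) i]) (auto simp: d_def)
    finally show "C $$ (k, l) = 0\<^sub>m e d $$ (k, l)" using kl by simp
  qed (use bl in auto)
  have "det p = det A * det D"
    unfolding bl(5) C0 using bl by (intro det_four_block_mat_lower_left_zero) auto
  moreover have "det p \<noteq> 0" using pD(1) by (simp add: GL_det)
  ultimately have detD: "det D \<noteq> 0" by auto
  have Dpc: "D $$ (k, l) = p $$ (d + k, d + l)" if "k < e" "l < e" for k l
    using sp that dims unfolding split_block_def Let_def by (auto simp: add.commute)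
  define w where "w = vec e (\<lambda>k. q $$ (d + k, b))"
  have b: "b < n" using ab off_le[of i] i by simp
  \<comment> \<open>These are rows of the equation \<open>p * q = 1\<close> in a column to the left
    of \<open>D\<close>: there \<open>p\<close> vanishes to the left of \<open>D\<close>, and the
    right-hand side is off the diagonal.\<close>
  have "D *\<^sub>v w = 0\<^sub>v e"
  proof (rule eq_vecI)
    fix k assume "k < dim_vec (0\<^sub>v e :: 'f vec)"
    then have k: "k < e" by simp
    have "(D *\<^sub>v w) $ k = (\<Sum>l<e. p $$ (d + k, d + l) * q $$ (d + l, b))"
      using k bl(4) Dpc by (simp add: scalar_prod_def w_def atLeast0LessThan)
    also have "\<dots> = (\<Sum>c\<in>{d..<d+e}. p $$ (d + k, c) * q $$ (c, b))"
      by (rule sum.reindex_bij_witness[of _ "\<lambda>c. c - d" "\<lambda>l. d + l"]) auto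
    also have "\<dots> = (\<Sum>c<n. p $$ (d + k, c) * q $$ (c, b))"
    proof (rule sum.mono_neutral_left)
      show "\<forall>c\<in>{..<n} - {d..<d + e}. p $$ (d + k, c) * q $$ (c, b) = 0"
      proof
        fix c assume "c \<in> {..<n} - {d..<d + e}"
        then have "c < off i" using d by (auto simp: d_def)
        then have "p $$ (d + k, c) = 0" using k d by (intro block_upper_D[OF pD(2) i]) (auto simp: d_def)
        then show "p $$ (d + k, c) * q $$ (c, b) = 0" by simp
      qed
    qed (use d in auto)
    also have "\<dots> = (p * q) $$ (d + k, b)"
      using pD(3) qc k d b by (simp add: scalar_prod_def atLeast0LessThan)
    also have "\<dots> = 0" using pi(3) ab k d b by (simp add: q_def d_def)
    finally show "(D *\<^sub>v w) $ k = 0\<^sub>v e $ k" using k by simp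
  qed (use bl in auto)
  moreover have "w \<in> carrier_vec e" by (simp add: w_def)
  ultimately have "w = 0\<^sub>v e" using detD det_0_iff_vec_prod_zero_field[OF bl(4)] by blast
  moreover have ad: "a - d < e" "d + (a - d) = a" using ab d by (auto simp: d_def)
  ultimately have "w $ (a - d) = 0" by simp
  then show "(inv\<^bsub>GL n\<^esub> p) $$ (a, b) = 0" using ad by (simp add: w_def q_def)
qed

lemma P_inv: "p \<in> P \<Longrightarrow> inv\<^bsub>GL n\<^esub> p \<in> P"
  using block_upper_inverse[of p] GL_inv(1)[OF P_D(1), of p] by (simp add: P_iff)

lemma P_mult: "p \<in> P \<Longrightarrow> q \<in> P \<Longrightarrow> p * q \<in> P"
  using block_upper_mult[OF P_D(3) P_D(3) P_D(2) P_D(2), of p q] GL_mult_closed[OF P_D(1) P_D(1), of p q]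
  by (simp add: P_iff)

lemma P_one: "1\<^sub>m n \<in> P"
  by (rule upper_triangular_P[OF GL_one_closed]) (auto simp: upper_triangular_def)

section \<open>Levi blocks\<close>

abbreviation "lv \<equiv> levi_block ns"

lemma levi_carrier [simp]: "lv p i \<in> carrier_mat (ns ! i) (ns ! i)"
  by (simp add: levi_block_def)

lemma levi_index: "a < ns ! i \<Longrightarrow> b < ns ! i \<Longrightarrow> lv p i $$ (a, b) = p $$ (off i + a, off i + b)"
  by (simp add: levi_block_def)

text \<open>In a row of block \<open>i\<close> the matrix vanishes to the left of the block, and
  \<open>f\<close> vanishes to the right of it, so that only the indices of the block
  contribute.\<close>

lemma block_sum:
  assumes bu: "block_upper p" and i: "i < r" and a: "a < ns ! i"
    and z: "\<And>c. off (Suc i) \<le> c \<Longrightarrow> c < n \<Longrightarrow> f c = 0"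
  shows "(\<Sum>c<n. p $$ (off i + a, c) * f c) = (\<Sum>c<ns ! i. p $$ (off i + a, off i + c) * f (off i + c))"
proof -
  have "(\<Sum>c<ns ! i. p $$ (off i + a, off i + c) * f (off i + c)) = (\<Sum>c\<in>{off i..<off (Suc i)}. p $$ (off i + a, c) * f c)"
    by (rule sum.reindex_bij_witness[of _ "\<lambda>c. c - off i" "\<lambda>c. off i + c"]) (auto simp: off_Suc[OF i])
  also have "\<dots> = (\<Sum>c<n. p $$ (off i + a, c) * f c)"
  proof (rule sum.mono_neutral_left)
    show "{off i..<off (Suc i)} \<subseteq> {..<n}" using off_le[of "Suc i"] i by auto
    show "\<forall>c\<in>{..<n} - {off i..<off (Suc i)}. p $$ (off i + a, c) * f c = 0"
    proof
      fix c assume c: "c \<in> {..<n} - {off i..<off (Suc i)}"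
      show "p $$ (off i + a, c) * f c = 0"
      proof (cases "c < off i")
        case True
        then have "p $$ (off i + a, c) = 0" using off_add_less[OF i a] by (intro block_upper_D[OF bu i]) auto
        then show ?thesis by simp
      next
        case False then show ?thesis using z[of c] c by auto
      qed
    qed
  qed simp
  finally show ?thesis ..
qed

text \<open>In the columns of block \<open>i\<close> the matrix \<open>q\<close> vanishes below the
  block, and \<open>block_sum\<close> leaves the product of the diagonal blocks.\<close>

lemma levi_mult:
  assumes "p \<in> carrier_mat n n" "q \<in> carrier_mat n n" "block_upper p" "block_upper q" "i < r"
  shows "lv (p * q) i = lv p i * lv q i"
proof (rule eq_matI)
  fix a b assume "a < dim_row (lv p i * lv q i)" "b < dim_col (lv p i * lv q i)"
  then have ab: "a < ns ! i" "b < ns ! i" by (simp_all add: levi_block_def)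
  note lt = off_add_less[OF assms(5)]
  have "lv (p * q) i $$ (a, b) = (p * q) $$ (off i + a, off i + b)" using ab by (rule levi_index)
  also have "\<dots> = (\<Sum>c<n. p $$ (off i + a, c) * q $$ (c, off i + b))"
    using assms(1,2) lt[OF ab(1)] lt[OF ab(2)] by (simp add: scalar_prod_def atLeast0LessThan)
  also have "\<dots> = (\<Sum>c<ns ! i. p $$ (off i + a, off i + c) * q $$ (off i + c, off i + b))"
  proof (rule block_sum[OF assms(3,5) ab(1)])
    fix c assume c: "off (Suc i) \<le> c" "c < n"
    then have "Suc i < r" using off_r assms(5) by (cases "Suc i = r") auto
    then show "q $$ (c, off i + b) = 0" using c ab off_Suc[OF assms(5)] by (intro block_upper_D[OF assms(4)]) auto
  qed
  also have "\<dots> = (lv p i * lv q i) $$ (a, b)"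
    using ab by (simp add: scalar_prod_def levi_block_def atLeast0LessThan)
  finally show "lv (p * q) i $$ (a, b) = (lv p i * lv q i) $$ (a, b)" .
qed (simp_all add: levi_block_def)

lemma levi_one: assumes "i < r" shows "lv (1\<^sub>m n) i = 1\<^sub>m (ns ! i)"
  using off_add_less[OF assms] by (intro eq_matI) (auto simp: levi_block_def)

lemma levi_inverse:
  assumes "p \<in> P" "i < r"
  shows "lv p i * lv (inv\<^bsub>GL n\<^esub> p) i = 1\<^sub>m (ns ! i)"
proof -
  note q = P_inv[OF assms(1)]
  have "lv (p * inv\<^bsub>GL n\<^esub> p) i = lv p i * lv (inv\<^bsub>GL n\<^esub> p) i"
    by (rule levi_mult[OF P_D(3)[OF assms(1)] P_D(3)[OF q] P_D(2)[OF assms(1)] P_D(2)[OF q] assms(2)])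
  then show ?thesis
    unfolding GL_inv(3)[OF P_D(1)[OF assms(1)]] levi_one[OF assms(2)] by (rule sym)
qed

lemma levi_GL: "p \<in> P \<Longrightarrow> i < r \<Longrightarrow> lv p i \<in> carrier (GL (ns ! i))"
  by (rule GL_I(1)[OF levi_carrier levi_carrier levi_inverse])

lemma levi_mat_in: assumes "mat_in m n n p" "i < r" shows "mat_in m (ns ! i) (ns ! i) (lv p i)"
  using assms off_add_less[OF assms(2)] unfolding mat_in_def by (auto simp: levi_block_def)

lemma levi_GLint: assumes "p \<in> P" "p \<in> GLint n" "i < r" shows "lv p i \<in> GLint (ns ! i)"
  by (rule GLint_I(1)[OF levi_mat_in[OF GLint_D(2)[OF assms(2)] assms(3)]
        levi_mat_in[OF GLint_D(3)[OF assms(2)] assms(3)] levi_inverse[OF assms(1,3)]])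

section \<open>The modulus character\<close>

lemma norm_abs_mult: "norm_abs v (x * y) = norm_abs v x * norm_abs v y"
  using card_residue_field
    power_int_add[of "real (card (carrier (residue_field v)))" "- v x" "- v y"]
  by (auto simp: norm_abs_def v_mult)

lemma norm_abs_pos: "x \<noteq> 0 \<Longrightarrow> 0 < norm_abs v x"
  using card_residue_field by (auto simp: norm_abs_def)

lemma modulus_pos: assumes "p \<in> P" shows "0 < modulus_char v ns p"
  unfolding modulus_char_def
proof (intro prod_pos ballI)
  fix j i assume "j \<in> {..<r}" "i \<in> {..<j}"
  then have "i < r" "j < r" by auto
  then have "det (lv p i) \<noteq> 0" "det (lv p j) \<noteq> 0" using levi_GL[OF assms] GL_det by blast+
  then show "0 < norm_abs v (det (lv p i)) ^ (ns ! j) / norm_abs v (det (lv p j)) ^ (ns ! i)"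
    using norm_abs_pos by simp
qed

lemma modulus_mult:
  assumes "p \<in> P" "q \<in> P" shows "modulus_char v ns (p * q) = modulus_char v ns p * modulus_char v ns q"
proof -
  have d: "det (lv (p * q) i) = det (lv p i) * det (lv q i)" if "i < r" for i
    using levi_mult[of p q i] P_D assms that det_mult[OF levi_carrier levi_carrier] by simp
  have "modulus_char v ns (p * q) = (\<Prod>j<r. \<Prod>i<j.
     (norm_abs v (det (lv p i)) ^ (ns ! j) / norm_abs v (det (lv p j)) ^ (ns ! i)) *
     (norm_abs v (det (lv q i)) ^ (ns ! j) / norm_abs v (det (lv q j)) ^ (ns ! i)))"
    unfolding modulus_char_def using d
    by (intro prod.cong refl) (simp add: norm_abs_mult power_mult_distrib)
  then show ?thesis by (simp only: modulus_char_def prod.distrib)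
qed

text \<open>The Levi blocks are invertible over the valuation ring, so each determinant in the
  product has absolute value \<open>1\<close>.\<close>

lemma modulus_int: assumes "p \<in> P" "p \<in> GLint n" shows "modulus_char v ns p = 1"
proof -
  have "norm_abs v (det (lv p i)) = 1" if "i < r" for i
    using GLint_det[OF levi_GLint[OF assms that]] by (simp add: norm_abs_def)
  then show ?thesis unfolding modulus_char_def by (intro prod.neutral ballI) simp
qed

text \<open>The equations \<open>p c = e\<^sub>j\<close> are solved block by block, starting from the last one.\<close>

lemma block_GLint:
  assumes p: "mat_in 0 n n p" "block_upper p" and l: "\<And>i. i < r \<Longrightarrow> lv p i \<in> GLint (ns ! i)"
  shows "p \<in> GLint n" "p \<in> P"
proof -
  have pc: "p \<in> carrier_mat n n" using p by (simp add: mat_in_def)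
  \<comment> \<open>The index \<open>k\<close> counts the initial blocks in which the right-hand
    side \<open>w\<close> may be nonzero; the full statement is the case
    \<open>k = r\<close>.\<close>
  have solve: "\<exists>c\<in>int_vec n. p *\<^sub>v c = w" if "k \<le> r" "w \<in> int_vec n" "\<And>j. off k \<le> j \<Longrightarrow> j < n \<Longrightarrow> w $ j = 0" for k w
    using that
  proof (induction k arbitrary: w)
    case 0
    then have "p *\<^sub>v 0\<^sub>v n = w" using pc by (intro eq_vecI) (auto simp: int_vec_def)
    then show ?case by (intro bexI[of _ "0\<^sub>v n"]) (auto simp: int_vec_def)
  next
    case (Suc k)
    then have k: "k < r" by simp
    note G = l[OF k]
    define m where "m = ns ! k"
    have lc: "lv p k \<in> carrier_mat m m" "inv\<^bsub>GL m\<^esub> (lv p k) \<in> carrier_mat m m"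
      using GLint_D(4)[OF G] GLint_D(4)[OF GLint_inv[OF G]] by (simp_all add: m_def)
    define wk where "wk = vec m (\<lambda>a. w $ (off k + a))"
    have wk: "wk \<in> int_vec m" using Suc.prems off_add_less[OF k] by (auto simp: wk_def m_def int_vec_def)
    define u where "u = inv\<^bsub>GL m\<^esub> (lv p k) *\<^sub>v wk"
    have u: "u \<in> int_vec m" unfolding u_def by (rule int_vec_mult[OF _ wk]) (use GLint_D(3)[OF G] in \<open>simp add: m_def\<close>)
    have lu: "lv p k *\<^sub>v u = wk"
    proof -
      have "lv p k *\<^sub>v u = (lv p k * inv\<^bsub>GL m\<^esub> (lv p k)) *\<^sub>v wk"
        unfolding u_def using lc wk by (intro assoc_mult_mat_vec[symmetric]) (auto simp: int_vec_def)
      also have "\<dots> = wk" using GL_inv(3)[OF GLint_D(1)[OF G]] wk by (simp add: m_def int_vec_def)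
      finally show ?thesis .
    qed
    \<comment> \<open>The solution of the system for the diagonal block \<open>k\<close>, placed in
      that block and extended by zero.\<close>
    define U where "U = vec n (\<lambda>j. if off k \<le> j \<and> j < off (Suc k) then u $ (j - off k) else 0)"
    have U: "U \<in> int_vec n" using u off_Suc[OF k] by (auto simp: U_def int_vec_def m_def)
    have pU: "p *\<^sub>v U \<in> int_vec n" by (rule int_vec_mult[OF p(1) U])
    \<comment> \<open>Subtracting the contribution of \<open>U\<close> clears block \<open>k\<close>
      without disturbing the zeros below it, so the remaining right-hand side lives in the earlier
      blocks.\<close>
    define w' where "w' = w + (- 1) \<cdot>\<^sub>v (p *\<^sub>v U)"
    have wc: "w \<in> carrier_vec n" "p *\<^sub>v U \<in> carrier_vec n" "U \<in> carrier_vec n" using Suc.prems pU U by (simp_all add: int_vec_def)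
    have w': "w' \<in> int_vec n"
      using Suc.prems(2) pU o_closed_int_vec[of n] frac_uminus[OF one_int] by (simp add: w'_def o_closed_def)
    have pUi: "(p *\<^sub>v U) $ j = w $ j" if j: "off k \<le> j" "j < n" for j
    proof -
      have sum: "(p *\<^sub>v U) $ j = (\<Sum>c<n. p $$ (j, c) * U $ c)"
        using j pc wc by (simp add: scalar_prod_def atLeast0LessThan U_def)
      show ?thesis
      proof (cases "j < off (Suc k)")
        case True
        define a where "a = j - off k"
        have a: "a < m" "j = off k + a" using True j off_Suc[OF k] by (auto simp: a_def m_def)
        have "(p *\<^sub>v U) $ j = (\<Sum>c<n. p $$ (off k + a, c) * U $ c)" unfolding sum by (simp only: a(2))
        also have "\<dots> = (\<Sum>c<ns ! k. p $$ (off k + a, off k + c) * U $ (off k + c))"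
          using a(1) by (intro block_sum[OF p(2) k]) (auto simp: m_def U_def)
        also have "\<dots> = (\<Sum>c<m. lv p k $$ (a, c) * u $ c)"
          using off_add_less[OF k] a(1) off_Suc[OF k] by (intro sum.cong) (auto simp: m_def U_def levi_index)
        also have "\<dots> = (lv p k *\<^sub>v u) $ a"
        proof -
          have "dim_row (lv p k) = m" "dim_col (lv p k) = m" "dim_vec u = m" using lc u by (auto simp: int_vec_def)
          then show ?thesis using a(1) by (simp add: scalar_prod_def atLeast0LessThan)
        qed
        also have "\<dots> = w $ j" unfolding lu using a by (simp add: wk_def)
        finally show ?thesis .
      next
        case False
        have "(p *\<^sub>v U) $ j = 0" unfolding sum
        proof (rule sum.neutral, rule ballI)
          fix c assume c: "c \<in> {..<n}"
          show "p $$ (j, c) * U $ c = 0"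
          proof (cases "c < off (Suc k)")
            case True
            have "Suc k < r" using False j(2) off_r k by (cases "Suc k = r") auto
            then have "p $$ (j, c) = 0" using False j True by (intro block_upper_D[OF p(2)]) auto
            then show ?thesis by simp
          next
            case False then show ?thesis using c by (simp add: U_def)
          qed
        qed
        then show ?thesis using Suc.prems(3)[of j] False j by simp
      qed
    qed
    have "\<exists>c\<in>int_vec n. p *\<^sub>v c = w'"
    proof (rule Suc.IH[OF _ w'])
      show "k \<le> r" using k by simp
      show "w' $ j = 0" if "off k \<le> j" "j < n" for j using pUi[OF that] that wc pc by (simp add: w'_def)
    qed
    then obtain c where c: "c \<in> int_vec n" "p *\<^sub>v c = w'" by blast
    have "p *\<^sub>v (c + U) = w' + p *\<^sub>v U" using c wc pc by (simp add: int_vec_def mult_add_distrib_mat_vec)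
    also have "\<dots> = w" using wc pc by (intro eq_vecI) (auto simp: w'_def)
    finally show ?case using c U o_closed_int_vec[of n] by (intro bexI[of _ "c + U"]) (auto simp: o_closed_def)
  qed
  have "\<exists>c. \<forall>j<n. c j \<in> int_vec n \<and> p *\<^sub>v c j = unit_vec n j"
  proof -
    have "\<forall>j. \<exists>c. j < n \<longrightarrow> c \<in> int_vec n \<and> p *\<^sub>v c = unit_vec n j"
      using solve[OF order_refl unit_vec_int] off_r by fastforce
    then show ?thesis by metis
  qed
  then obtain c where c: "\<And>j. j < n \<Longrightarrow> c j \<in> int_vec n" "\<And>j. j < n \<Longrightarrow> p *\<^sub>v c j = unit_vec n j" by blast
  define X where "X = mat n n (\<lambda>(i, j). c j $ i)"
  have Xin: "mat_in 0 n n X" using c(1) by (auto simp: X_def mat_in_def int_vec_def)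
  have "p * X = 1\<^sub>m n"
  proof (rule eq_matI)
    fix i j assume "i < dim_row (1\<^sub>m n :: 'f mat)" "j < dim_col (1\<^sub>m n :: 'f mat)"
    then have ij: "i < n" "j < n" by auto
    have "col X j = c j" using c(1)[OF ij(2)] ij by (intro eq_vecI) (auto simp: X_def int_vec_def)
    then have "(p * X) $$ (i, j) = (p *\<^sub>v c j) $ i" using ij pc by (simp add: X_def)
    then show "(p * X) $$ (i, j) = 1\<^sub>m n $$ (i, j)" using c(2)[OF ij(2)] ij by (simp add: unit_vec_def)
  qed (use pc in \<open>auto simp: X_def\<close>)
  then show G: "p \<in> GLint n" using GLint_I(1)[OF p(1) Xin] by blast
  show "p \<in> P" using GLint_D(1)[OF G] p(2) by (simp add: P_iff)
qed

end

section \<open>Filtrations and generating tuples\<close>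

text \<open>Negation in a record is a description over its carrier, so its agreement after
  restricting the carrier has to be proved.\<close>

lemma (in Module.module) md_minus:
  assumes "submodule R N M" "x \<in> N" "y \<in> N"
  shows "x \<ominus>\<^bsub>md N\<^esub> y = x \<ominus>\<^bsub>M\<^esub> y"
proof -
  interpret N: submodule R N M by fact
  interpret MN: Module.module R "md N" by (rule submodule_is_module[OF assms(1)])
  have my: "\<ominus>\<^bsub>M\<^esub> y \<in> N"
    using submodule_minus_closed[OF assms(1) N.zero_closed assms(3)] subsetD[OF N.subset assms(3)]
    by (simp add: a_minus_def)
  have "\<ominus>\<^bsub>md N\<^esub> y = \<ominus>\<^bsub>M\<^esub> y"
  proof (rule MN.M.minus_equality)
    show "\<ominus>\<^bsub>M\<^esub> y \<oplus>\<^bsub>md N\<^esub> y = \<zero>\<^bsub>md N\<^esub>"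
      using M.l_neg[OF subsetD[OF N.subset assms(3)]] by simp
  qed (simp_all add: my assms(3))
  then show ?thesis by (simp add: a_minus_def)
qed

lemma (in Module.module) submodule_md:
  assumes "submodule R N M" "submodule R N' M" "N \<subseteq> N'"
  shows "submodule R N (md N')"
proof -
  interpret N: submodule R N M by fact
  show ?thesis
    by (rule submodule.intro[OF submodule_is_module[OF assms(2)]])
      (simp_all add: assms(3))
qed

locale filtered = parabolic v ns + val_module v M
  for v :: "'f::field_char_0 \<Rightarrow> int" and ns :: "nat list" and M :: "('f, 'm) module" (structure)
begin

lemma comb_append:
  assumes "c \<in> {..<k + l} \<rightarrow> \<O>" "x \<in> {..<k + l} \<rightarrow> carrier M"
  shows "comb (k + l) c x = comb k c x \<oplus>\<^bsub>M\<^esub> comb l (\<lambda>a. c (k + a)) (\<lambda>a. x (k + a))"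
  using assms
proof (induction l)
  case 0
  then have "comb k c x \<in> carrier M" by (intro comb_closed) simp_all
  then show ?case by (simp add: comb_def)
next
  case (Suc l)
  have c: "c \<in> {..<Suc (k + l)} \<rightarrow> \<O>" "x \<in> {..<Suc (k + l)} \<rightarrow> carrier M"
    "c \<in> {..<k + l} \<rightarrow> \<O>" "x \<in> {..<k + l} \<rightarrow> carrier M"
    "c \<in> {..<k} \<rightarrow> \<O>" "x \<in> {..<k} \<rightarrow> carrier M"
    "(\<lambda>a. c (k + a)) \<in> {..<Suc l} \<rightarrow> \<O>" "(\<lambda>a. x (k + a)) \<in> {..<Suc l} \<rightarrow> carrier M"
    "(\<lambda>a. c (k + a)) \<in> {..<l} \<rightarrow> \<O>" "(\<lambda>a. x (k + a)) \<in> {..<l} \<rightarrow> carrier M"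
    "c (k + l) \<in> \<O>" "x (k + l) \<in> carrier M"
    using Suc.prems by (simp_all add: Pi_iff)
  have "comb (k + Suc l) c x = c (k + l) \<odot>\<^bsub>M\<^esub> x (k + l) \<oplus>\<^bsub>M\<^esub> comb (k + l) c x"
    using comb_Suc[of c "k + l" x] c by simp
  also have "\<dots> = c (k + l) \<odot>\<^bsub>M\<^esub> x (k + l) \<oplus>\<^bsub>M\<^esub> (comb k c x \<oplus>\<^bsub>M\<^esub> comb l (\<lambda>a. c (k + a)) (\<lambda>a. x (k + a)))"
    using Suc.IH c by simp
  also have "\<dots> = comb k c x \<oplus>\<^bsub>M\<^esub> (c (k + l) \<odot>\<^bsub>M\<^esub> x (k + l) \<oplus>\<^bsub>M\<^esub> comb l (\<lambda>a. c (k + a)) (\<lambda>a. x (k + a)))"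
    using c by (intro M.a_lcomm) (simp_all add: comb_closed)
  also have "\<dots> = comb k c x \<oplus>\<^bsub>M\<^esub> comb (Suc l) (\<lambda>a. c (k + a)) (\<lambda>a. x (k + a))"
    using comb_Suc[of "\<lambda>a. c (k + a)" l "\<lambda>a. x (k + a)"] c by simp
  finally show ?case .
qed

lemma comb_all_zero:
  assumes "x \<in> {..<l} \<rightarrow> carrier M" "\<And>a. a < l \<Longrightarrow> c a = 0"
  shows "comb l c x = \<zero>\<^bsub>M\<^esub>"
proof -
  have "comb l c x = comb l (\<lambda>_. \<zero>\<^bsub>val_ring v\<^esub>) x"
    using assms by (intro comb_cong) simp_all
  then show ?thesis using comb_zero_left[OF assms(1)] by simp
qed

lemma comb_trunc:
  assumes "c \<in> {..<l} \<rightarrow> \<O>" "x \<in> {..<l} \<rightarrow> carrier M" "k \<le> l" "\<And>a. k \<le> a \<Longrightarrow> a < l \<Longrightarrow> c a = 0"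
  shows "comb l c x = comb k c x"
proof -
  obtain m where m: "l = k + m" using assms(3) le_Suc_ex by blast
  have "comb (k + m) c x = comb k c x \<oplus>\<^bsub>M\<^esub> comb m (\<lambda>a. c (k + a)) (\<lambda>a. x (k + a))"
    using assms m by (intro comb_append) simp_all
  also have "comb m (\<lambda>a. c (k + a)) (\<lambda>a. x (k + a)) = \<zero>\<^bsub>M\<^esub>"
    using assms m by (intro comb_all_zero) (simp_all add: Pi_iff)
  finally show ?thesis using assms m comb_closed[of c k x] by (simp add: Pi_iff)
qed

lemma comb_block:
  assumes i: "i < r" and c: "c \<in> {..<n} \<rightarrow> \<O>" and x: "x \<in> {..<n} \<rightarrow> carrier M"
    and z: "\<And>a. off (Suc i) \<le> a \<Longrightarrow> a < n \<Longrightarrow> c a = 0"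
  shows "comb n c x = comb (off i) c x \<oplus>\<^bsub>M\<^esub> comb (ns ! i) (\<lambda>a. c (off i + a)) (\<lambda>a. x (off i + a))"
proof -
  have le: "off (Suc i) \<le> n" using i by (intro off_le) simp
  have "comb n c x = comb (off (Suc i)) c x" by (rule comb_trunc[OF c x le z])
  also have "\<dots> = comb (off i + ns ! i) c x" by (simp add: off_Suc[OF i])
  also have "\<dots> = comb (off i) c x \<oplus>\<^bsub>M\<^esub> comb (ns ! i) (\<lambda>a. c (off i + a)) (\<lambda>a. x (off i + a))"
    using c x le off_Suc[OF i] by (intro comb_append) (simp_all add: Pi_iff)
  finally show ?thesis .
qed

lemma comb_span_mono:
  assumes "k \<le> l" "x \<in> {..<l} \<rightarrow> carrier M" shows "comb_span k x \<subseteq> comb_span l x"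
proof (rule comb_span_subset[OF comb_span_submodule[OF assms(2)]])
  show "x \<in> {..<k} \<rightarrow> comb_span l x"
  proof
    fix b assume "b \<in> {..<k}"
    then show "x b \<in> comb_span l x" using assms(1) by (intro comb_span_mem[OF assms(2)]) simp
  qed
qed

section \<open>Filtrations by initial segments and graded tuples\<close>

definition Fil :: "(nat \<Rightarrow> 'm) \<Rightarrow> 'm set list" where
  "Fil x = map (\<lambda>i. comb_span (off i) x) [0..<Suc r]"

lemma Fil_nth: "i \<le> r \<Longrightarrow> Fil x ! i = comb_span (off i) x"
  unfolding Fil_def by (subst nth_map_upt) simp_all

lemma length_Fil [simp]: "length (Fil x) = Suc r" by (simp add: Fil_def)

text \<open>What makes the graded pieces modules. It holds for \<open>Fil x\<close> even if the
  entries of \<open>x\<close> do not generate \<open>M\<close>, see \<open>Fil_filt\<close>.\<close>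

definition filt :: "'m set list \<Rightarrow> bool" where
  "filt F \<longleftrightarrow> length F = Suc r \<and> (\<forall>i\<le>r. submodule (val_ring v) (F ! i) M) \<and> (\<forall>i<r. F ! i \<subseteq> F ! Suc i)"

lemma filt_D:
  assumes "filt F"
  shows "i \<le> r \<Longrightarrow> submodule (val_ring v) (F ! i) M" "i < r \<Longrightarrow> F ! i \<subseteq> F ! Suc i"
    "i < r \<Longrightarrow> submodule (val_ring v) (F ! Suc i) M"
  using assms unfolding filt_def by simp_all

lemma admissible_filt: "admissible_filtration v ns M F \<Longrightarrow> filt F"
  unfolding admissible_filtration_def filt_def by blast

lemma tuple_restrict: "x \<in> {..<n} \<rightarrow> carrier M \<Longrightarrow> i \<le> r \<Longrightarrow> x \<in> {..<off i} \<rightarrow> carrier M"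
  using off_le[of i] by (simp add: Pi_iff)

lemma Fil_filt: assumes x: "x \<in> {..<n} \<rightarrow> carrier M" shows "filt (Fil x)"
  unfolding filt_def
proof (intro conjI allI impI)
  show "submodule (val_ring v) (Fil x ! i) M" if "i \<le> r" for i
    unfolding Fil_nth[OF that] by (rule comb_span_submodule[OF tuple_restrict[OF x that]])
  show "Fil x ! i \<subseteq> Fil x ! Suc i" if "i < r" for i
  proof -
    have "comb_span (off i) x \<subseteq> comb_span (off (Suc i)) x"
      using that by (intro comb_span_mono off_mono tuple_restrict[OF x]) simp_all
    then show ?thesis using that by (simp add: Fil_nth)
  qed
qed simp

text \<open>The class of \<open>u\<close> in the graded piece; the coset is formed in the restricted
  record so as to match \<open>graded_piece\<close> literally.\<close>

abbreviation cs :: "'m set list \<Rightarrow> nat \<Rightarrow> 'm \<Rightarrow> 'm set" where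
  "cs F i u \<equiv> F ! i +>\<^bsub>M\<lparr>carrier := F ! Suc i\<rparr>\<^esub> u"

lemma piece_sub:
  assumes "filt F" "i < r"
  shows "Module.module (val_ring v) (M\<lparr>carrier := F ! Suc i\<rparr>)"
    "submodule (val_ring v) (F ! i) (M\<lparr>carrier := F ! Suc i\<rparr>)"
  using submodule_is_module[OF filt_D(3)[OF assms]]
    submodule_md[OF filt_D(1)[OF assms(1)] filt_D(3)[OF assms] filt_D(2)[OF assms]] assms(2) by simp_all

lemma piece_module:
  assumes "filt F" "i < r"
  shows "Module.module (val_ring v) (graded_piece M F i)"
  unfolding graded_piece_def by (rule module.quotient_module_is_module[OF piece_sub[OF assms]])

lemma piece_val_module:
  assumes "filt F" "i < r" shows "val_module v (graded_piece M F i)"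
  by (intro val_module.intro nonarch_local_field_axioms piece_module[OF assms])

lemma piece_carrier:
  assumes "filt F" "i < r" shows "carrier (graded_piece M F i) = cs F i ` (F ! Suc i)"
  unfolding graded_piece_def using module.carrier_quotient_module[OF piece_sub(1)[OF assms], of "F ! i"] by simp

lemma cs_eq_iff:
  assumes "filt F" "i < r" "u \<in> F ! Suc i" "w \<in> F ! Suc i"
  shows "cs F i u = cs F i w \<longleftrightarrow> u \<ominus>\<^bsub>M\<^esub> w \<in> F ! i"
  using module.coset_eq_iff[OF piece_sub[OF assms(1,2)], of u w] assms(3,4)
    md_minus[OF filt_D(3)[OF assms(1,2)] assms(3,4)] by simp

lemma cs_add_left:
  assumes F: "filt F" "i < r" and u: "u \<in> F ! i" and w: "w \<in> F ! Suc i"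
  shows "cs F i (u \<oplus>\<^bsub>M\<^esub> w) = cs F i w"
proof -
  interpret S: submodule "val_ring v" "F ! Suc i" M by (rule filt_D(3)[OF F])
  have u1: "u \<in> F ! Suc i" using u filt_D(2)[OF F] by blast
  have c: "u \<in> carrier M" "w \<in> carrier M" using u1 w S.subset by blast+
  have "(u \<oplus>\<^bsub>M\<^esub> w) \<ominus>\<^bsub>M\<^esub> w = u"
    unfolding a_minus_def using c by (simp add: M.a_assoc M.r_neg)
  then show ?thesis using cs_eq_iff[OF F S.m_closed[OF u1 w] w] u by simp
qed

lemma piece_comb:
  assumes F: "filt F" "i < r" and c: "c \<in> {..<m} \<rightarrow> \<O>" and y: "y \<in> {..<m} \<rightarrow> F ! Suc i"
  shows "module.comb (graded_piece M F i) m c (\<lambda>a. cs F i (y a)) = cs F i (comb m c y)"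
proof -
  interpret N: Module.module "val_ring v" "M\<lparr>carrier := F ! Suc i\<rparr>" by (rule piece_sub(1)[OF F])
  have "cs F i (N.comb m c y) = module.comb (graded_piece M F i) m c (\<lambda>a. cs F i (y a))"
    using c y unfolding graded_piece_def
    by (intro N.comb_hom N.quotient_module_is_module[OF piece_sub(2)[OF F]] N.quotient_hom[OF piece_sub(2)[OF F]]) simp_all
  moreover have "N.comb m c y = comb m c y"
    using c y by (intro comb_md[OF filt_D(3)[OF F]]) simp_all
  ultimately show ?thesis by simp
qed

text \<open>The block \<open>i\<close> of the tuple, read in the graded piece. \<open>F\<close> is
  an argument of its own so that two tuples with the same filtration, or a tuple and its translate,
  are compared in one and the same quotient.\<close>

definition gr :: "'m set list \<Rightarrow> (nat \<Rightarrow> 'm) \<Rightarrow> nat \<Rightarrow> nat \<Rightarrow> 'm set" where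
  "gr F x i = (\<lambda>a\<in>{..<ns ! i}. cs F i (x (off i + a)))"

lemma piece_comb_gr:
  assumes F: "filt F" "i < r" and c: "c \<in> {..<ns ! i} \<rightarrow> \<O>" and y: "(\<lambda>a. x (off i + a)) \<in> {..<ns ! i} \<rightarrow> F ! Suc i"
  shows "module.comb (graded_piece M F i) (ns ! i) c (gr F x i) = cs F i (comb (ns ! i) c (\<lambda>a. x (off i + a)))"
proof -
  interpret G: Module.module "val_ring v" "graded_piece M F i" by (rule piece_module[OF F])
  have "G.comb (ns ! i) c (gr F x i) = G.comb (ns ! i) c (\<lambda>a. cs F i (x (off i + a)))"
    using c y by (intro G.comb_cong) (simp_all add: gr_def Pi_iff piece_carrier[OF F])
  then show ?thesis using piece_comb[OF F c y] by simp
qed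

lemma Fil_shift:
  assumes x: "x \<in> {..<n} \<rightarrow> carrier M" and i: "i < r"
  shows "(\<lambda>a. x (off i + a)) \<in> {..<ns ! i} \<rightarrow> Fil x ! Suc i"
proof
  fix a assume "a \<in> {..<ns ! i}"
  then have "off i + a < off (Suc i)" using off_Suc[OF i] by simp
  moreover have "x \<in> {..<off (Suc i)} \<rightarrow> carrier M" using i by (intro tuple_restrict[OF x]) simp
  ultimately have "x (off i + a) \<in> comb_span (off (Suc i)) x" by (intro comb_span_mem)
  then show "x (off i + a) \<in> Fil x ! Suc i" using i by (simp add: Fil_nth)
qed

text \<open>In a combination of the first \<open>off (Suc i)\<close> entries, those before block
  \<open>i\<close> lie in the smaller step of the filtration and vanish in the quotient, so the
  block alone generates it.\<close>

lemma gr_tuple: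
  assumes x: "x \<in> {..<n} \<rightarrow> carrier M" and i: "i < r"
  shows "gr (Fil x) x i \<in> val_module.tuples v (graded_piece M (Fil x) i) (ns ! i)"
proof -
  note F = Fil_filt[OF x] i
  interpret G: val_module v "graded_piece M (Fil x) i" by (rule piece_val_module[OF F])
  note sh = Fil_shift[OF x i]
  have "gr (Fil x) x i \<in> {..<ns ! i} \<rightarrow>\<^sub>E carrier (graded_piece M (Fil x) i)"
    unfolding gr_def piece_carrier[OF F] using sh by (simp add: PiE_iff Pi_iff)
  moreover have "\<exists>c\<in>{..<ns ! i} \<rightarrow> \<O>. m = G.comb (ns ! i) c (gr (Fil x) x i)"
    if m: "m \<in> carrier (graded_piece M (Fil x) i)" for m
  proof -
    obtain u where u: "m = cs (Fil x) i u" "u \<in> Fil x ! Suc i" using m unfolding piece_carrier[OF F] by (rule imageE)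
    have "u \<in> comb_span (off (Suc i)) x" using u(2) i by (simp add: Fil_nth)
    then obtain c where c: "c \<in> {..<off i + ns ! i} \<rightarrow> \<O>" "u = comb (off i + ns ! i) c x"
      unfolding comb_span_def by (auto simp: off_Suc[OF i])
    have xx: "x \<in> {..<off i + ns ! i} \<rightarrow> carrier M"
      using tuple_restrict[OF x, of "Suc i"] i by (simp add: off_Suc[OF i])
    define c' where "c' a = c (off i + a)" for a
    have c': "c' \<in> {..<ns ! i} \<rightarrow> \<O>" using c(1) by (simp add: c'_def Pi_iff)
    have u': "u = comb (off i) c x \<oplus>\<^bsub>M\<^esub> comb (ns ! i) c' (\<lambda>a. x (off i + a))"
      unfolding c(2) c'_def by (rule comb_append[OF c(1) xx])
    have "comb (off i) c x \<in> Fil x ! i"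
      using comb_spanI[of c "off i" x] c(1) i by (simp add: Fil_nth Pi_iff)
    moreover have "comb (ns ! i) c' (\<lambda>a. x (off i + a)) \<in> Fil x ! Suc i"
      using c' sh by (intro comb_in_submodule[OF filt_D(3)[OF F]]) simp_all
    ultimately have "m = cs (Fil x) i (comb (ns ! i) c' (\<lambda>a. x (off i + a)))"
      unfolding u(1) u' by (rule cs_add_left[OF F])
    then have "m = G.comb (ns ! i) c' (gr (Fil x) x i)" using piece_comb_gr[OF F c' sh] by simp
    then show ?thesis using c' by (rule bexI)
  qed
  ultimately show ?thesis by (simp add: G.tuples_def G.generates_def)
qed

lemma Fil_admissible:
  assumes x: "x \<in> tuples n" shows "admissible_filtration v ns M (Fil x)"
proof -
  note xD = tuples_D(2)[OF x]
  note F = Fil_filt[OF xD]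
  have "comb_span 0 x = {\<zero>\<^bsub>M\<^esub>}" unfolding comb_span_def comb_def by simp
  then have "Fil x ! 0 = {\<zero>\<^bsub>M\<^esub>}" by (simp add: Fil_nth)
  moreover have "Fil x ! r = carrier M"
    using x generates_iff_comb_span[OF xD] by (simp add: Fil_nth tuples_def)
  moreover have "generated_by_at_most (val_ring v) (graded_piece M (Fil x) i) (ns ! i)" if i: "i < r" for i
  proof -
    interpret G: val_module v "graded_piece M (Fil x) i" by (rule piece_val_module[OF F i])
    have "gr (Fil x) x i \<in> G.tuples (ns ! i)" by (rule gr_tuple[OF xD i])
    then show ?thesis unfolding G.generated_by_at_most_iff
      using G.tuples_D(2) by (intro bexI[of _ "gr (Fil x) x i"]) (simp_all add: G.tuples_def)
  qed
  ultimately show ?thesis using F unfolding admissible_filtration_def filt_def by simp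
qed

text \<open>Generators of the graded pieces are lifted to the steps of \<open>F\<close> and
  concatenated block by block. That initial segments span the steps follows by induction along the
  filtration.\<close>

lemma adapted_tuple:
  assumes A: "admissible_filtration v ns M F"
  obtains x where "x \<in> tuples n" "Fil x = F"
proof -
  note F = admissible_filt[OF A]
  have "\<exists>y. y \<in> {..<ns ! i} \<rightarrow> F ! Suc i \<and>
      (\<forall>u\<in>F ! Suc i. \<exists>c\<in>{..<ns ! i} \<rightarrow> \<O>. cs F i u = cs F i (comb (ns ! i) c y))" if i: "i < r" for i
  proof -
    interpret G: val_module v "graded_piece M F i" by (rule piece_val_module[OF F i])
    have "generated_by_at_most (val_ring v) (graded_piece M F i) (ns ! i)"
      using A i unfolding admissible_filtration_def by simp
    then obtain z where z: "z \<in> {..<ns ! i} \<rightarrow> carrier (graded_piece M F i)" "G.generates (ns ! i) z"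
      unfolding G.generated_by_at_most_iff by blast
    have "\<forall>a. \<exists>u. a < ns ! i \<longrightarrow> u \<in> F ! Suc i \<and> z a = cs F i u"
      using z(1) unfolding piece_carrier[OF F i] by (auto simp: Pi_iff image_iff)
    then obtain y where y: "\<And>a. a < ns ! i \<Longrightarrow> y a \<in> F ! Suc i" "\<And>a. a < ns ! i \<Longrightarrow> z a = cs F i (y a)" by metis
    have yP: "y \<in> {..<ns ! i} \<rightarrow> F ! Suc i" using y(1) by (simp add: Pi_iff)
    moreover have "\<exists>c\<in>{..<ns ! i} \<rightarrow> \<O>. cs F i u = cs F i (comb (ns ! i) c y)" if u: "u \<in> F ! Suc i" for u
    proof -
      have "cs F i u \<in> carrier (graded_piece M F i)" using u by (simp add: piece_carrier[OF F i])
      then obtain c where c: "c \<in> {..<ns ! i} \<rightarrow> \<O>" "cs F i u = G.comb (ns ! i) c z"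
        using z(2) unfolding G.generates_def by auto
      have "G.comb (ns ! i) c z = G.comb (ns ! i) c (\<lambda>a. cs F i (y a))"
        using c(1) y by (intro G.comb_cong) (simp_all add: piece_carrier[OF F i])
      also have "\<dots> = cs F i (comb (ns ! i) c y)" by (rule piece_comb[OF F i c(1) yP])
      finally show ?thesis using c by (intro bexI[of _ c]) simp_all
    qed
    ultimately show ?thesis by blast
  qed
  then obtain Y where Y: "\<And>i. i < r \<Longrightarrow> Y i \<in> {..<ns ! i} \<rightarrow> F ! Suc i"
    "\<And>i u. i < r \<Longrightarrow> u \<in> F ! Suc i \<Longrightarrow> \<exists>c\<in>{..<ns ! i} \<rightarrow> \<O>. cs F i u = cs F i (comb (ns ! i) c (Y i))"
    by metis
  \<comment> \<open>The difference \<open>b - off (blk b)\<close> is the position of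
    \<open>b\<close> within its block.\<close>
  define x where "x = (\<lambda>b\<in>{..<n}. Y (blk b) (b - off (blk b)))"
  have xY: "x (off i + a) = Y i a" if "i < r" "a < ns ! i" for i a
    using that off_add_less[OF that] by (simp add: x_def blk_off)
  have xF: "x b \<in> F ! Suc (blk b)" if "b < n" for b
    using Y(1)[OF blk(1)[OF that]] blk[OF that] off_Suc[OF blk(1)[OF that]] that by (simp add: x_def Pi_iff)
  have Fc: "F ! i \<subseteq> carrier M" if "i \<le> r" for i using filt_D(1)[OF F that] by (simp add: submodule_def)
  have x: "x \<in> {..<n} \<rightarrow>\<^sub>E carrier M"
  proof
    fix b assume b: "b \<in> {..<n}"
    then show "x b \<in> carrier M" using xF[of b] Fc[of "Suc (blk b)"] blk(1)[of b] by auto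
  qed (simp add: x_def)
  then have x': "x \<in> {..<n} \<rightarrow> carrier M" by (simp add: PiE_iff Pi_iff)
  have Fmono: "F ! i \<subseteq> F ! j" if "i \<le> j" "j \<le> r" for i j
    using that
  proof (induction j)
    case (Suc j) then show ?case using filt_D(2)[OF F, of j] by (cases "i = Suc j") auto
  qed simp
  have span: "comb_span (off i) x = F ! i" if "i \<le> r" for i
    using that
  proof (induction i)
    case 0
    have "comb_span 0 x = {\<zero>\<^bsub>M\<^esub>}" unfolding comb_span_def comb_def by simp
    then show ?case using A by (simp add: admissible_filtration_def)
  next
    case (Suc i)
    then have i: "i < r" by simp
    have xi: "x \<in> {..<off (Suc i)} \<rightarrow> carrier M" using Suc.prems by (intro tuple_restrict[OF x'])
    show ?case
    proof
      show "comb_span (off (Suc i)) x \<subseteq> F ! Suc i"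
      proof (rule comb_span_subset[OF filt_D(3)[OF F i]])
        show "x \<in> {..<off (Suc i)} \<rightarrow> F ! Suc i"
        proof
          fix b assume "b \<in> {..<off (Suc i)}"
          then have b: "b < off (Suc i)" "b < n" using off_le[of "Suc i"] i by simp_all
          have "\<not> Suc i \<le> blk b" using off_mono[of "Suc i" "blk b"] blk(2)[OF b(2)] b(1) by auto
          then have "F ! Suc (blk b) \<subseteq> F ! Suc i" using Suc.prems by (intro Fmono) simp_all
          then show "x b \<in> F ! Suc i" using xF[OF b(2)] by blast
        qed
      qed
      show "F ! Suc i \<subseteq> comb_span (off (Suc i)) x"
      proof
        fix u assume u: "u \<in> F ! Suc i"
        obtain c where c: "c \<in> {..<ns ! i} \<rightarrow> \<O>" "cs F i u = cs F i (comb (ns ! i) c (Y i))" using Y(2)[OF i u] by blast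
        define w where "w = comb (ns ! i) c (Y i)"
        have w: "w \<in> F ! Suc i" unfolding w_def using c(1) Y(1)[OF i] by (intro comb_in_submodule[OF filt_D(3)[OF F i]]) simp_all
        interpret S: submodule "val_ring v" "comb_span (off (Suc i)) x" M by (rule comb_span_submodule[OF xi])
        \<comment> \<open>Modulo the previous step \<open>u\<close> is a combination of the new
          block, and the remainder is spanned by the earlier blocks by induction.\<close>
        have "u \<ominus>\<^bsub>M\<^esub> w \<in> F ! i" using c(2) cs_eq_iff[OF F i u w] by (simp add: w_def)
        then have "u \<ominus>\<^bsub>M\<^esub> w \<in> comb_span (off i) x" using Suc by simp
        then have 1: "u \<ominus>\<^bsub>M\<^esub> w \<in> comb_span (off (Suc i)) x"
          using comb_span_mono[OF off_mono[of i "Suc i"] xi] by auto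
        have 2: "w \<in> comb_span (off (Suc i)) x" unfolding w_def
        proof (rule comb_in_submodule[OF comb_span_submodule[OF xi]])
          show "Y i \<in> {..<ns ! i} \<rightarrow> comb_span (off (Suc i)) x"
          proof
            fix a assume "a \<in> {..<ns ! i}"
            then show "Y i a \<in> comb_span (off (Suc i)) x"
              using xY[OF i, of a] comb_span_mem[OF xi, of "off i + a"] off_Suc[OF i] by simp
          qed
        qed (use c in simp)
        have uw: "u \<in> carrier M" "w \<in> carrier M" using u w Fc[OF Suc.prems] by blast+
        have "(u \<ominus>\<^bsub>M\<^esub> w) \<oplus>\<^bsub>M\<^esub> w = u" unfolding a_minus_def using uw by (simp add: M.a_assoc M.l_neg)
        then show "u \<in> comb_span (off (Suc i)) x" using S.m_closed[OF 1 2] by simp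
      qed
    qed
  qed
  have "Fil x = F"
  proof (rule nth_equalityI)
    show "length (Fil x) = length F" using F by (simp add: filt_def)
    show "Fil x ! i = F ! i" if "i < length (Fil x)" for i using that span[of i] by (simp add: Fil_nth)
  qed
  moreover have "x \<in> tuples n"
    using span[of r] A x generates_iff_comb_span[OF x'] by (simp add: tuples_def admissible_filtration_def)
  ultimately show ?thesis using that by blast
qed

lemma act_in_span:
  assumes x: "x \<in> {..<n} \<rightarrow> carrier M" and p: "mat_in 0 n n p" "block_upper p" and i: "i \<le> r" and b: "b < off i"
  shows "act n x p b \<in> comb_span (off i) x"
proof -
  have bn: "b < n" using b off_le[OF i] by simp
  have pO: "(\<lambda>a. p $$ (a, b)) \<in> {..<n} \<rightarrow> \<O>" using p(1) bn by (simp add: mat_in_def Pi_iff)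
  have "comb n (\<lambda>a. p $$ (a, b)) x = comb (off i) (\<lambda>a. p $$ (a, b)) x"
  proof (rule comb_trunc[OF pO x off_le[OF i]])
    fix a assume a: "off i \<le> a" "a < n"
    then have "i < r" using off_r i by (cases "i = r") auto
    then show "p $$ (a, b) = 0" using block_upper_D[OF p(2)] a b by blast
  qed
  moreover have "\<dots> \<in> comb_span (off i) x" using pO off_le[OF i] by (intro comb_spanI) (simp add: Pi_iff)
  ultimately show ?thesis using bn by (simp add: act_def)
qed

text \<open>Block triangularity gives one inclusion of spans; the other one comes from the inverse
  of \<open>p\<close>, which is again integral and in \<open>P\<close>.\<close>

lemma Fil_act:
  assumes x: "x \<in> {..<n} \<rightarrow>\<^sub>E carrier M" and p: "p \<in> P" "p \<in> GLint n"
  shows "Fil (act n x p) = Fil x"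
proof -
  have sub: "comb_span (off i) (act n x p) \<subseteq> comb_span (off i) x"
    if x: "x \<in> {..<n} \<rightarrow> carrier M" and p: "p \<in> P" "p \<in> GLint n" and i: "i \<le> r" for x p i
  proof (rule comb_span_subset[OF comb_span_submodule[OF tuple_restrict[OF x i]]])
    show "act n x p \<in> {..<off i} \<rightarrow> comb_span (off i) x"
      using act_in_span[OF x GLint_D(2)[OF p(2)] P_D(2)[OF p(1)] i] by (simp add: Pi_iff)
  qed
  have x': "x \<in> {..<n} \<rightarrow> carrier M" using x by (simp add: PiE_iff Pi_iff)
  have ax: "act n x p \<in> {..<n} \<rightarrow> carrier M" using act_closed[OF x' GLint_D(2)[OF p(2)]] by (simp add: PiE_iff Pi_iff)
  have "act n (act n x p) (inv\<^bsub>GL n\<^esub> p) = x"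
    by (rule act_inverse[OF x GLint_D(2)[OF p(2)] GLint_D(3)[OF p(2)] GL_inv(3)[OF P_D(1)[OF p(1)]]])
  then have "comb_span (off i) (act n x p) = comb_span (off i) x" if "i \<le> r" for i
    using sub[OF x' p that] sub[OF ax P_inv[OF p(1)] GLint_inv[OF p(2)] that] by simp
  then show ?thesis by (intro nth_equalityI) (simp_all add: Fil_nth)
qed

text \<open>The entries of \<open>p\<close> above the diagonal block only add elements of the
  smaller step of the filtration, so the graded tuple sees nothing but the Levi block.\<close>

lemma gr_act:
  assumes x: "x \<in> {..<n} \<rightarrow> carrier M" and p: "mat_in 0 n n p" "block_upper p" and i: "i < r"
  shows "gr (Fil x) (act n x p) i = val_module.act (graded_piece M (Fil x) i) (ns ! i) (gr (Fil x) x i) (lv p i)"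
proof
  note F = Fil_filt[OF x] i
  note sh = Fil_shift[OF x i]
  interpret G: val_module v "graded_piece M (Fil x) i" by (rule piece_val_module[OF F])
  fix b
  show "gr (Fil x) (act n x p) i b = G.act (ns ! i) (gr (Fil x) x i) (lv p i) b"
  proof (cases "b < ns ! i")
    case True
    define c where "c a = p $$ (a, off i + b)" for a
    define c' where "c' a = lv p i $$ (a, b)" for a
    have bn: "off i + b < n" by (rule off_add_less[OF i True])
    have c: "c \<in> {..<n} \<rightarrow> \<O>" using p(1) bn by (simp add: mat_in_def Pi_iff c_def)
    have c': "c' \<in> {..<ns ! i} \<rightarrow> \<O>" using levi_mat_in[OF p(1) i] True by (simp add: mat_in_def Pi_iff c'_def)
    have "act n x p (off i + b) = comb n c x" using bn by (simp add: act_def c_def[abs_def])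
    also have "\<dots> = comb (off i) c x \<oplus>\<^bsub>M\<^esub> comb (ns ! i) (\<lambda>a. c (off i + a)) (\<lambda>a. x (off i + a))"
    proof (rule comb_block[OF i c x])
      fix a assume a: "off (Suc i) \<le> a" "a < n"
      then have "Suc i < r" using off_r i by (cases "Suc i = r") auto
      then show "c a = 0" unfolding c_def using a True off_Suc[OF i] by (intro block_upper_D[OF p(2)]) auto
    qed
    also have "comb (ns ! i) (\<lambda>a. c (off i + a)) (\<lambda>a. x (off i + a)) = comb (ns ! i) c' (\<lambda>a. x (off i + a))"
      using c' sh filt_D(3)[OF F] True
      by (intro comb_cong) (auto simp: c_def c'_def levi_index Pi_iff submodule_def)
    finally have e: "act n x p (off i + b) = comb (off i) c x \<oplus>\<^bsub>M\<^esub> comb (ns ! i) c' (\<lambda>a. x (off i + a))" .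
    have "comb (off i) c x \<in> Fil x ! i"
      using comb_spanI[of c "off i" x] c off_le[of i] i by (simp add: Fil_nth Pi_iff)
    moreover have "comb (ns ! i) c' (\<lambda>a. x (off i + a)) \<in> Fil x ! Suc i"
      using c' sh by (intro comb_in_submodule[OF filt_D(3)[OF F]]) simp_all
    ultimately have "cs (Fil x) i (act n x p (off i + b)) = cs (Fil x) i (comb (ns ! i) c' (\<lambda>a. x (off i + a)))"
      unfolding e by (rule cs_add_left[OF F])
    also have "\<dots> = G.comb (ns ! i) c' (gr (Fil x) x i)" by (rule piece_comb_gr[OF F c' sh, symmetric])
    finally show ?thesis using True by (simp add: gr_def G.act_def c'_def[abs_def])
  qed (simp add: gr_def G.act_def)
qed

text \<open>The diagonal blocks of \<open>p\<close> are prescribed by \<open>h\<close>. What is then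
  missing from an entry of \<open>y\<close> in block \<open>i\<close> lies in
  \<open>Fil x ! i\<close>, hence is a combination of the earlier entries of \<open>x\<close>, and
  its coefficients fill the part above the diagonal. With \<open>x = y\<close> the statement says
  that the stabilizer of \<open>x\<close> in \<open>P\<close> maps onto the product of the
  stabilizers of the graded tuples.\<close>

theorem lift_blocks:
  assumes x: "x \<in> {..<n} \<rightarrow>\<^sub>E carrier M" and y: "y \<in> {..<n} \<rightarrow>\<^sub>E carrier M" and xy: "Fil x = Fil y"
    and h: "\<And>i. i < r \<Longrightarrow> h i \<in> GLint (ns ! i)"
    and hxy: "\<And>i. i < r \<Longrightarrow> val_module.act (graded_piece M (Fil x) i) (ns ! i) (gr (Fil x) x i) (h i) = gr (Fil x) y i"
  obtains p where "p \<in> P" "p \<in> GLint n" "act n x p = y" "\<And>i. i < r \<Longrightarrow> lv p i = h i"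
proof -
  have x': "x \<in> {..<n} \<rightarrow> carrier M" and y': "y \<in> {..<n} \<rightarrow> carrier M" using x y by (simp_all add: PiE_iff Pi_iff)
  have ex: "\<exists>d\<in>{..<off i} \<rightarrow> \<O>. y (off i + b) = comb (off i) d x \<oplus>\<^bsub>M\<^esub> comb (ns ! i) (\<lambda>a. h i $$ (a, b)) (\<lambda>a. x (off i + a))"
    if i: "i < r" and b: "b < ns ! i" for i b
  proof -
    note F = Fil_filt[OF x'] i
    note sh = Fil_shift[OF x' i]
    interpret G: val_module v "graded_piece M (Fil x) i" by (rule piece_val_module[OF F])
    define c' where "c' a = h i $$ (a, b)" for a
    have c': "c' \<in> {..<ns ! i} \<rightarrow> \<O>" using GLint_D(2)[OF h[OF i]] b by (simp add: mat_in_def Pi_iff c'_def)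
    define w where "w = comb (ns ! i) c' (\<lambda>a. x (off i + a))"
    have w: "w \<in> Fil x ! Suc i" unfolding w_def
      using c' sh by (intro comb_in_submodule[OF filt_D(3)[OF F]]) simp_all
    have yb: "y (off i + b) \<in> Fil x ! Suc i" using Fil_shift[OF y' i] b unfolding xy by (simp add: Pi_iff)
    have "cs (Fil x) i (y (off i + b)) = gr (Fil x) y i b" using b by (simp add: gr_def)
    also have "\<dots> = G.comb (ns ! i) c' (gr (Fil x) x i)" unfolding hxy[OF i, symmetric] using b by (simp add: G.act_def c'_def[abs_def])
    also have "\<dots> = cs (Fil x) i w" unfolding w_def by (rule piece_comb_gr[OF F c' sh])
    finally have "y (off i + b) \<ominus>\<^bsub>M\<^esub> w \<in> Fil x ! i" using cs_eq_iff[OF F yb w] by simp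
    then have "y (off i + b) \<ominus>\<^bsub>M\<^esub> w \<in> comb_span (off i) x" using i by (simp add: Fil_nth)
    then obtain d where d: "d \<in> {..<off i} \<rightarrow> \<O>" "y (off i + b) \<ominus>\<^bsub>M\<^esub> w = comb (off i) d x"
      unfolding comb_span_def by auto
    have c: "y (off i + b) \<in> carrier M" "w \<in> carrier M" using yb w filt_D(3)[OF F] by (auto simp: submodule_def)
    have "y (off i + b) = (y (off i + b) \<ominus>\<^bsub>M\<^esub> w) \<oplus>\<^bsub>M\<^esub> w"
      unfolding a_minus_def using c by (simp add: M.a_assoc M.l_neg)
    then have "y (off i + b) = comb (off i) d x \<oplus>\<^bsub>M\<^esub> comb (ns ! i) (\<lambda>a. h i $$ (a, b)) (\<lambda>a. x (off i + a))"
      unfolding d(2) unfolding w_def c'_def[abs_def] .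
    then show ?thesis using d(1) by (rule bexI)
  qed
  define d where "d i b = (SOME d. d \<in> {..<off i} \<rightarrow> \<O> \<and> y (off i + b) =
      comb (off i) d x \<oplus>\<^bsub>M\<^esub> comb (ns ! i) (\<lambda>a. h i $$ (a, b)) (\<lambda>a. x (off i + a)))" for i b
  have dd: "d i b \<in> {..<off i} \<rightarrow> \<O> \<and> y (off i + b) =
      comb (off i) (d i b) x \<oplus>\<^bsub>M\<^esub> comb (ns ! i) (\<lambda>a. h i $$ (a, b)) (\<lambda>a. x (off i + a))"
    if "i < r" "b < ns ! i" for i b
    unfolding d_def by (rule someI_ex[OF ex[OF that, unfolded Bex_def]])
  note d = conjunct1[OF dd] conjunct2[OF dd]
  \<comment> \<open>The column of \<open>p\<close> at position \<open>b\<close> of block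
    \<open>i\<close>: correction coefficients above the block, the column of \<open>h i\<close>
    inside it, and zero below.\<close>
  define e where "e i b a = (if a < off i then d i b a else if a < off (Suc i) then h i $$ (a - off i, b) else 0)" for i b a
  define p where "p = mat n n (\<lambda>(a, b). e (blk b) (b - off (blk b)) a)"
  have pe: "p $$ (a, off i + b) = e i b a" if "i < r" "b < ns ! i" "a < n" for a i b
    using that off_add_less[OF that(1,2)] by (simp add: p_def blk_off)
  have eO: "e i b a \<in> \<O>" if i: "i < r" and b: "b < ns ! i" for i b a
  proof -
    have "h i $$ (a - off i, b) \<in> \<O>" if "\<not> a < off i" "a < off (Suc i)"
      using GLint_D(2)[OF h[OF i]] b that off_Suc[OF i] by (simp add: mat_in_def)
    moreover have "d i b a \<in> \<O>" if "a < off i" using funcset_mem[OF d(1)[OF i b]] that by simp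
    ultimately show ?thesis by (simp add: e_def)
  qed
  have bl: "b = off (blk b) + (b - off (blk b))" "b - off (blk b) < ns ! blk b" if "b < n" for b
    using blk[OF that] off_Suc[OF blk(1)[OF that]] by simp_all
  have pin: "mat_in 0 n n p"
    unfolding mat_in_def using eO blk(1) bl(2) by (simp add: p_def)
  have bu: "block_upper p"
    unfolding block_upper_def
  proof (intro allI impI)
    fix i a b assume i: "i < r" and ab: "off i \<le> a \<and> a < n \<and> b < off i"
    have bn: "b < n" using ab off_le[of i] i by simp
    have "\<not> i \<le> blk b" using off_mono[of i "blk b"] blk(2)[OF bn] ab by auto
    then have "off (Suc (blk b)) \<le> off i" by (intro off_mono) simp
    then have "e (blk b) (b - off (blk b)) a = 0" using ab off_mono[of "blk b" "Suc (blk b)"] by (simp add: e_def)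
    then show "p $$ (a, b) = 0" using ab bn by (simp add: p_def)
  qed
  have lvp: "lv p i = h i" if i: "i < r" for i
  proof (rule eq_matI)
    have hc: "h i \<in> carrier_mat (ns ! i) (ns ! i)" by (rule GLint_D(4)[OF h[OF i]])
    show "dim_row (lv p i) = dim_row (h i)" "dim_col (lv p i) = dim_col (h i)" using hc by (simp_all add: levi_block_def)
    fix a b assume "a < dim_row (h i)" "b < dim_col (h i)"
    then have ab: "a < ns ! i" "b < ns ! i" using hc by auto
    have "lv p i $$ (a, b) = e i b (off i + a)" using ab pe[OF i ab(2) off_add_less[OF i ab(1)]] by (simp add: levi_index)
    then show "lv p i $$ (a, b) = h i $$ (a, b)" using ab off_Suc[OF i] by (simp add: e_def)
  qed
  have G: "p \<in> GLint n" "p \<in> P" using block_GLint[OF pin bu] h lvp by simp_all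
  have "act n x p b = y b" for b
  proof (cases "b < n")
    case True
    define i where "i = blk b"
    define b' where "b' = b - off i"
    have i: "i < r" and b': "b' < ns ! i" and b: "b = off i + b'" using blk(1)[OF True] bl[OF True] by (simp_all add: i_def b'_def)
    have xO: "x \<in> {..<off i} \<rightarrow> carrier M" using i by (intro tuple_restrict[OF x']) simp
    have xs: "(\<lambda>a. x (off i + a)) \<in> {..<ns ! i} \<rightarrow> carrier M" using x' off_add_less[OF i] by (simp add: Pi_iff)
    have "act n x p b = comb n (\<lambda>a. p $$ (a, b)) x" using True by (simp add: act_def)
    also have "\<dots> = comb n (e i b') x"
      using x' eO[OF i b'] pe[OF i b'] unfolding b by (intro comb_cong) (simp_all add: Pi_iff)
    also have "\<dots> = comb (off i) (e i b') x \<oplus>\<^bsub>M\<^esub> comb (ns ! i) (\<lambda>a. e i b' (off i + a)) (\<lambda>a. x (off i + a))"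
      using eO[OF i b'] off_mono[of i "Suc i"] by (intro comb_block[OF i _ x']) (simp_all add: e_def Pi_iff)
    also have "comb (off i) (e i b') x = comb (off i) (d i b') x"
      using d(1)[OF i b'] xO by (intro comb_cong) (simp_all add: e_def)
    also have "comb (ns ! i) (\<lambda>a. e i b' (off i + a)) (\<lambda>a. x (off i + a)) = comb (ns ! i) (\<lambda>a. h i $$ (a, b')) (\<lambda>a. x (off i + a))"
      using GLint_D(2)[OF h[OF i]] b' xs off_Suc[OF i] by (intro comb_cong) (simp_all add: e_def mat_in_def Pi_iff)
    also have "comb (off i) (d i b') x \<oplus>\<^bsub>M\<^esub> comb (ns ! i) (\<lambda>a. h i $$ (a, b')) (\<lambda>a. x (off i + a)) = y b"
      unfolding b by (rule d(2)[OF i b', symmetric])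
    finally show ?thesis .
  next
    case False
    then show ?thesis using y by (simp add: act_def PiE_iff extensional_def)
  qed
  then have "act n x p = y" ..
  then show ?thesis by (rule that[OF G(2,1) _ lvp])
qed

end

section \<open>Complex vector spaces with coordinates\<close>

lemma module_hom_I:
  assumes "\<And>x. x \<in> carrier A \<Longrightarrow> f x \<in> carrier B"
    "\<And>x y. x \<in> carrier A \<Longrightarrow> y \<in> carrier A \<Longrightarrow> f (x \<oplus>\<^bsub>A\<^esub> y) = f x \<oplus>\<^bsub>B\<^esub> f y"
    "\<And>r x. r \<in> carrier R \<Longrightarrow> x \<in> carrier A \<Longrightarrow> f (r \<odot>\<^bsub>A\<^esub> x) = r \<odot>\<^bsub>B\<^esub> f x"
  shows "f \<in> module_hom R A B"
  using assms unfolding LinearCombinations.module_hom_def by blast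

lemma module_hom_D:
  assumes "f \<in> module_hom R A B"
  shows "x \<in> carrier A \<Longrightarrow> f x \<in> carrier B"
    "x \<in> carrier A \<Longrightarrow> y \<in> carrier A \<Longrightarrow> f (x \<oplus>\<^bsub>A\<^esub> y) = f x \<oplus>\<^bsub>B\<^esub> f y"
    "r \<in> carrier R \<Longrightarrow> x \<in> carrier A \<Longrightarrow> f (r \<odot>\<^bsub>A\<^esub> x) = r \<odot>\<^bsub>B\<^esub> f x"
  using assms unfolding LinearCombinations.module_hom_def by blast+

lemma module_hom_comp:
  assumes "f \<in> module_hom R A B" "g \<in> module_hom R B C"
  shows "(\<lambda>x. g (f x)) \<in> module_hom R A C"
  by (rule module_hom_I) (simp_all add: module_hom_D[OF assms(1)] module_hom_D[OF assms(2)])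

text \<open>Serves to prove identities between linear maps by checking them on generators.\<close>

lemma equalizer_submodule:
  assumes A: "Module.module R A" and B: "Module.module R B"
    and f: "f \<in> module_hom R A B" and g: "g \<in> module_hom R A B"
  shows "submodule R {x \<in> carrier A. f x = g x} A"
proof -
  interpret A: Module.module R A by fact
  interpret B: Module.module R B by fact
  interpret f: mod_hom R A B f by (intro mod_hom.intro mod_hom_axioms.intro A B f)
  interpret g: mod_hom R A B g by (intro mod_hom.intro mod_hom_axioms.intro A B g)
  show ?thesis
    by (rule submodule.intro[OF A]) (auto simp: f.f0_is_0 g.f0_is_0)
qed

lemma hom_zero:
  assumes "Module.module R A" "Module.module R B" "f \<in> module_hom R A B"
  shows "f \<zero>\<^bsub>A\<^esub> = \<zero>\<^bsub>B\<^esub>"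
proof -
  interpret f: mod_hom R A B f by (intro mod_hom.intro mod_hom_axioms.intro assms)
  show ?thesis by (rule f.f0_is_0)
qed

section \<open>Free spaces and linear extension\<close>

lemma free_space_simps [simp]:
  "f \<in> carrier (free_space S) \<longleftrightarrow> finite {x. f x \<noteq> 0} \<and> {x. f x \<noteq> 0} \<subseteq> S"
  "\<zero>\<^bsub>free_space S\<^esub> = (\<lambda>x. 0)" "f \<oplus>\<^bsub>free_space S\<^esub> g = (\<lambda>x. f x + g x)"
  "c \<odot>\<^bsub>free_space S\<^esub> f = (\<lambda>x. c * f x)"
  by (simp_all add: free_space_def)

lemma free_add_closed:
  assumes "f \<in> carrier (free_space S)" "g \<in> carrier (free_space S)"
  shows "(\<lambda>x. f x + g x) \<in> carrier (free_space S)"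
proof -
  have "{x. f x + g x \<noteq> 0} \<subseteq> {x. f x \<noteq> 0} \<union> {x. g x \<noteq> 0}" by auto
  then show ?thesis using assms by (simp, meson finite_UnI finite_subset le_sup_iff subset_trans)
qed

lemma free_smult_closed:
  assumes "f \<in> carrier (free_space S)" shows "(\<lambda>x. c * f x) \<in> carrier (free_space S)"
proof -
  have "{x. c * f x \<noteq> 0} \<subseteq> {x. f x \<noteq> 0}" by auto
  then show ?thesis using assms by (simp, meson finite_subset subset_trans)
qed

lemma free_space_module: "Module.module class_ring (free_space S)"
proof (rule module_criteria)
  show "cring (class_ring :: complex ring)" by (rule class_cring.cring_axioms)
  show "\<forall>f\<in>carrier (free_space S). \<exists>g\<in>carrier (free_space S). f \<oplus>\<^bsub>free_space S\<^esub> g = \<zero>\<^bsub>free_space S\<^esub>"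
  proof
    fix f assume "f \<in> carrier (free_space S)"
    then have "(\<lambda>x. (- 1) * f x) \<in> carrier (free_space S)" by (rule free_smult_closed)
    then show "\<exists>g\<in>carrier (free_space S). f \<oplus>\<^bsub>free_space S\<^esub> g = \<zero>\<^bsub>free_space S\<^esub>"
      by (intro bexI[of _ "\<lambda>x. (- 1) * f x"]) simp_all
  qed
  show "\<forall>f g. f \<in> carrier (free_space S) \<and> g \<in> carrier (free_space S) \<longrightarrow>
      f \<oplus>\<^bsub>free_space S\<^esub> g \<in> carrier (free_space S)"
    using free_add_closed[of _ S] by (simp del: free_space_simps(1))
  show "\<forall>c f. c \<in> carrier class_ring \<and> f \<in> carrier (free_space S) \<longrightarrow>
      c \<odot>\<^bsub>free_space S\<^esub> f \<in> carrier (free_space S)"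
    using free_smult_closed[of _ S] by (simp del: free_space_simps(1))
qed (auto simp: algebra_simps)

lemma delta_in_free [simp]: "s \<in> S \<Longrightarrow> delta s \<in> carrier (free_space S)"
  by (auto simp: delta_def)

text \<open>Induction on a finite set containing the support; one point \<open>a\<close> at a time
  is split off as a multiple of \<open>delta a\<close>.\<close>

lemma free_induct:
  assumes "submodule class_ring U (free_space S)" "\<And>s. s \<in> S \<Longrightarrow> delta s \<in> U"
  shows "U = carrier (free_space S)"
proof -
  interpret U: submodule class_ring U "free_space S" by fact
  have sup: "f \<in> U" if "finite A" "{x. f x \<noteq> 0} \<subseteq> A" "A \<subseteq> S" for A and f :: "'a \<Rightarrow> complex"
    using that
  proof (induction A arbitrary: f rule: finite_induct)
    case empty
    then have "f = (\<lambda>x. 0)" by auto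
    then show ?case using U.zero_closed by simp
  next
    case (insert a A)
    define g where "g = (\<lambda>x. if x = a then 0 else f x)"
    have "g \<in> U" using insert.prems by (intro insert.IH) (auto simp: g_def)
    moreover have "(\<lambda>x. f a * delta a x) \<in> U"
      using U.smult_closed[of "f a" "delta a"] assms(2)[of a] insert.prems by simp
    ultimately have "(\<lambda>x. g x + f a * delta a x) \<in> U"
      using U.m_closed[of g "\<lambda>x. f a * delta a x"] by simp
    moreover have "(\<lambda>x. g x + f a * delta a x) = f" by (rule ext) (simp add: g_def delta_def)
    ultimately show ?case by simp
  qed
  then have "f \<in> U" if "f \<in> carrier (free_space S)" for f
  proof -
    have "finite {x. f x \<noteq> 0}" "{x. f x \<noteq> 0} \<subseteq> S" using that by simp_all
    then show ?thesis by (rule sup[OF _ order_refl])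
  qed
  then show ?thesis using U.subset by blast
qed

lemma hom_ext_free:
  assumes "Module.module class_ring X" "f \<in> module_hom class_ring (free_space S) X" "g \<in> module_hom class_ring (free_space S) X"
    and "\<And>s. s \<in> S \<Longrightarrow> f (delta s) = g (delta s)" and "u \<in> carrier (free_space S)"
  shows "f u = g u"
proof -
  have "{x \<in> carrier (free_space S). f x = g x} = carrier (free_space S)"
    by (rule free_induct[OF equalizer_submodule[OF free_space_module assms(1-3)]])
      (unfold mem_Collect_eq, intro conjI delta_in_free assms(4))
  then show ?thesis using assms(5) by blast
qed

text \<open>The universal property of the free space: the linear map that sends
  \<open>delta a\<close> to \<open>w a\<close>.\<close>

definition lin_ext :: "(complex, 'x) module \<Rightarrow> ('a \<Rightarrow> 'x) \<Rightarrow> ('a \<Rightarrow> complex) \<Rightarrow> 'x" where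
  "lin_ext X w f = finsum X (\<lambda>a. f a \<odot>\<^bsub>X\<^esub> w a) {a. f a \<noteq> 0}"

context
  fixes X :: "(complex, 'x) module" and w :: "'a \<Rightarrow> 'x" and S :: "'a set"
  assumes X: "Module.module class_ring X" and w: "\<And>s. s \<in> S \<Longrightarrow> w s \<in> carrier X"
begin

interpretation X: Module.module class_ring X by (rule X)

lemma smult_zero_X: "x \<in> carrier X \<Longrightarrow> 0 \<odot>\<^bsub>X\<^esub> x = \<zero>\<^bsub>X\<^esub>"
  using X.smult_l_null[of x] by simp

text \<open>Sums for different functions run over different supports; to add them they are extended
  by zero terms to a common finite set.\<close>

lemma lin_ext_superset:
  assumes "finite A" "A \<subseteq> S" "{a. f a \<noteq> 0} \<subseteq> A"
  shows "lin_ext X w f = finsum X (\<lambda>a. f a \<odot>\<^bsub>X\<^esub> w a) A"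
proof -
  have "0 \<odot>\<^bsub>X\<^esub> w a = \<zero>\<^bsub>X\<^esub>" if "a \<in> A" for a
    using smult_zero_X[OF w] that assms(2) by (simp add: subset_iff)
  moreover have "(\<lambda>a. f a \<odot>\<^bsub>X\<^esub> w a) \<in> A \<rightarrow> carrier X"
    using w assms(2) X.smult_closed by (simp add: Pi_iff subset_iff)
  ultimately show ?thesis
    unfolding lin_ext_def by (intro X.M.add.finprod_mono_neutral_cong_left[OF assms(1,3)]) simp_all
qed

lemma lin_ext_hom: "lin_ext X w \<in> module_hom class_ring (free_space S) X"
proof (rule module_hom_I)
  have cl: "(\<lambda>a. f a \<odot>\<^bsub>X\<^esub> w a) \<in> A \<rightarrow> carrier X" if "A \<subseteq> S" for A f
    using w that X.smult_closed by (simp add: Pi_iff subset_iff)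
  show "lin_ext X w f \<in> carrier X" if "f \<in> carrier (free_space S)" for f
    unfolding lin_ext_def using that by (intro X.M.finsum_closed cl) simp
  show "lin_ext X w (f \<oplus>\<^bsub>free_space S\<^esub> g) = lin_ext X w f \<oplus>\<^bsub>X\<^esub> lin_ext X w g"
    if f: "f \<in> carrier (free_space S)" and g: "g \<in> carrier (free_space S)" for f g
  proof -
    let ?A = "{x. f x \<noteq> 0} \<union> {x. g x \<noteq> 0}"
    have A: "finite ?A" "?A \<subseteq> S" using f g by simp_all
    have "lin_ext X w (\<lambda>x. f x + g x) = finsum X (\<lambda>a. (f a + g a) \<odot>\<^bsub>X\<^esub> w a) ?A"
      by (rule lin_ext_superset[OF A]) auto
    also have "\<dots> = finsum X (\<lambda>a. f a \<odot>\<^bsub>X\<^esub> w a \<oplus>\<^bsub>X\<^esub> g a \<odot>\<^bsub>X\<^esub> w a) ?A"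
    proof (rule X.M.finsum_cong'[OF refl])
      show "(\<lambda>a. f a \<odot>\<^bsub>X\<^esub> w a \<oplus>\<^bsub>X\<^esub> g a \<odot>\<^bsub>X\<^esub> w a) \<in> ?A \<rightarrow> carrier X"
        using cl[OF A(2), of f] cl[OF A(2), of g] by (simp add: Pi_iff)
      fix a assume "a \<in> ?A"
      then have "w a \<in> carrier X" using A(2) w by blast
      then show "(f a + g a) \<odot>\<^bsub>X\<^esub> w a = f a \<odot>\<^bsub>X\<^esub> w a \<oplus>\<^bsub>X\<^esub> g a \<odot>\<^bsub>X\<^esub> w a"
        using X.smult_l_distr[of "f a" "g a" "w a"] by simp
    qed
    also have "\<dots> = finsum X (\<lambda>a. f a \<odot>\<^bsub>X\<^esub> w a) ?A \<oplus>\<^bsub>X\<^esub> finsum X (\<lambda>a. g a \<odot>\<^bsub>X\<^esub> w a) ?A"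
      by (rule X.M.finsum_addf[OF cl[OF A(2)] cl[OF A(2)]])
    also have "\<dots> = lin_ext X w f \<oplus>\<^bsub>X\<^esub> lin_ext X w g"
      using lin_ext_superset[OF A, of f] lin_ext_superset[OF A, of g] by simp
    finally show ?thesis by simp
  qed
  show "lin_ext X w (c \<odot>\<^bsub>free_space S\<^esub> f) = c \<odot>\<^bsub>X\<^esub> lin_ext X w f"
    if f: "f \<in> carrier (free_space S)" for c f
  proof -
    have A: "finite {x. f x \<noteq> 0}" "{x. f x \<noteq> 0} \<subseteq> S" using f by simp_all
    have "lin_ext X w (\<lambda>x. c * f x) = finsum X (\<lambda>a. (c * f a) \<odot>\<^bsub>X\<^esub> w a) {x. f x \<noteq> 0}"
      by (rule lin_ext_superset[OF A]) auto
    also have "\<dots> = finsum X (\<lambda>a. c \<odot>\<^bsub>X\<^esub> (f a \<odot>\<^bsub>X\<^esub> w a)) {x. f x \<noteq> 0}"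
    proof (rule X.M.finsum_cong'[OF refl])
      show "(\<lambda>a. c \<odot>\<^bsub>X\<^esub> (f a \<odot>\<^bsub>X\<^esub> w a)) \<in> {x. f x \<noteq> 0} \<rightarrow> carrier X"
        using cl[OF A(2), of f] X.smult_closed[of c] by (simp add: Pi_iff)
      fix a assume "a \<in> {x. f x \<noteq> 0}"
      then have "w a \<in> carrier X" using A(2) w by blast
      then show "(c * f a) \<odot>\<^bsub>X\<^esub> w a = c \<odot>\<^bsub>X\<^esub> (f a \<odot>\<^bsub>X\<^esub> w a)" using X.smult_assoc1[of c "f a" "w a"] by simp
    qed
    also have "\<dots> = c \<odot>\<^bsub>X\<^esub> lin_ext X w f"
      unfolding lin_ext_def by (rule X.finsum_smult_ldistr[OF A(1) _ cl[OF A(2)], symmetric]) simp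
    finally show ?thesis by simp
  qed
qed

lemma lin_ext_delta: assumes "s \<in> S" shows "lin_ext X w (delta s) = w s"
proof -
  have "lin_ext X w (delta s) = finsum X (\<lambda>a. delta s a \<odot>\<^bsub>X\<^esub> w a) {s}"
    by (rule lin_ext_superset) (use assms in \<open>auto simp: delta_def\<close>)
  also have "\<dots> = delta s s \<odot>\<^bsub>X\<^esub> w s"
    using w[OF assms] by simp
  also have "\<dots> = w s" using X.smult_one[OF w[OF assms]] by (simp add: delta_def)
  finally show ?thesis .
qed

end

text \<open>Coordinates with respect to a basis indexed by \<open>B\<close>.\<close>

definition coords :: "(complex, 'v) module \<Rightarrow> 'b set \<Rightarrow> ('v \<Rightarrow> 'b \<Rightarrow> complex) \<Rightarrow> bool" where
  "coords V B c \<longleftrightarrow> Module.module class_ring V \<and> c \<in> module_hom class_ring V (free_space B) \<and>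
    bij_betw c (carrier V) (carrier (free_space B))"

text \<open>The image of \<open>U\<close> under the coordinates is a submodule that contains each
  \<open>delta b\<close>, so it is everything, and the coordinates are injective.\<close>

lemma coords_submodule_top:
  assumes c: "coords V B c" and U: "submodule class_ring U V"
    and e: "\<And>b. b \<in> B \<Longrightarrow> \<exists>x\<in>U. c x = delta b"
  shows "U = carrier V"
proof -
  have V: "Module.module class_ring V" and ch: "c \<in> module_hom class_ring V (free_space B)"
    and cb: "bij_betw c (carrier V) (carrier (free_space B))" using c by (simp_all add: coords_def)
  interpret U: submodule class_ring U V by fact
  have UV: "x \<in> carrier V" if "x \<in> U" for x using U.subset that by blast
  have "submodule class_ring (c ` U) (free_space B)"
  proof (rule submodule.intro[OF free_space_module])
    show "c ` U \<subseteq> carrier (free_space B)" using module_hom_D(1)[OF ch] UV by blast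
    show "\<zero>\<^bsub>free_space B\<^esub> \<in> c ` U"
      using imageI[OF U.zero_closed, of c] hom_zero[OF V free_space_module ch] by simp
    show "f \<oplus>\<^bsub>free_space B\<^esub> g \<in> c ` U" if f: "f \<in> c ` U" and g: "g \<in> c ` U" for f g
    proof -
      obtain x y where "x \<in> U" "f = c x" "y \<in> U" "g = c y" using f g by blast
      then have "f \<oplus>\<^bsub>free_space B\<^esub> g = c (x \<oplus>\<^bsub>V\<^esub> y)" "x \<oplus>\<^bsub>V\<^esub> y \<in> U"
        using module_hom_D(2)[OF ch UV UV, of x y] by simp_all
      then show ?thesis by blast
    qed
    show "a \<odot>\<^bsub>free_space B\<^esub> f \<in> c ` U" if f: "f \<in> c ` U" and a: "a \<in> carrier class_ring" for a f
    proof -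
      obtain x where "x \<in> U" "f = c x" using f by blast
      then have "a \<odot>\<^bsub>free_space B\<^esub> f = c (a \<odot>\<^bsub>V\<^esub> x)" "a \<odot>\<^bsub>V\<^esub> x \<in> U"
        using module_hom_D(3)[OF ch a UV, of x] a by simp_all
      then show ?thesis by blast
    qed
  qed
  then have "c ` U = carrier (free_space B)"
    by (rule free_induct) (metis e imageI)
  have "x \<in> U" if x: "x \<in> carrier V" for x
  proof -
    have "c x \<in> c ` U" unfolding \<open>c ` U = _\<close> by (rule module_hom_D(1)[OF ch x])
    then obtain y where y: "y \<in> U" "c x = c y" by blast
    then have "x = y" using inj_onD[OF bij_betw_imp_inj_on[OF cb], of x y] x UV by blast
    then show ?thesis using y by simp
  qed
  then show ?thesis using UV by blast
qed

text \<open>Zorn's lemma, the dimension being arbitrary: a maximal independent set between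
  \<open>A\<close> and \<open>U\<close> generates \<open>U\<close>, since any further vector of
  \<open>U\<close> would be dependent on it.\<close>

lemma (in vectorspace) extend_to_generating:
  assumes A: "A \<subseteq> U" "lin_indpt A" and U: "U \<subseteq> carrier V"
  obtains B where "A \<subseteq> B" "B \<subseteq> U" "lin_indpt B" "U \<subseteq> span B"
proof -
  let ?F = "{B. A \<subseteq> B \<and> B \<subseteq> U \<and> lin_indpt B}"
  have "\<exists>M\<in>?F. \<forall>X\<in>?F. M \<subseteq> X \<longrightarrow> X = M"
  proof (rule subset_Zorn_nonempty)
    have "A \<in> ?F" using A by simp
    then show "?F \<noteq> {}" by force
    fix C assume C: "C \<noteq> {}" "subset.chain ?F C"
    have mem: "A \<subseteq> B \<and> B \<subseteq> U \<and> lin_indpt B" if "B \<in> C" for B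
      using C(2) that unfolding subset.chain_def by blast
    have "lin_indpt (\<Union>C)"
    proof
      assume "lin_dep (\<Union>C)"
      then obtain D a u where D: "finite D" "D \<subseteq> \<Union>C" "a \<in> D \<rightarrow> carrier K" "lincomb a D = \<zero>\<^bsub>V\<^esub>" "u \<in> D" "a u \<noteq> \<zero>\<^bsub>K\<^esub>"
        unfolding lin_dep_def by blast
      \<comment> \<open>A linear dependence involves finitely many vectors, and these lie in a
        single member of the chain.\<close>
      obtain B where B: "B \<in> C" "D \<subseteq> B" using finite_subset_Union_chain[OF D(1,2) C] by blast
      have "lin_dep B" unfolding lin_dep_def using D B by blast
      then show False using mem[OF B(1)] by blast
    qed
    then show "\<Union>C \<in> ?F" using mem C(1) by blast
  qed
  then obtain B where B0: "B \<in> ?F" and max: "\<forall>X\<in>?F. B \<subseteq> X \<longrightarrow> X = B" by (rule bexE)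
  have B: "A \<subseteq> B" "B \<subseteq> U" "lin_indpt B" using B0 by simp_all
  have "u \<in> span B" if u: "u \<in> U" for u
  proof (cases "u \<in> B")
    case True
    have "B \<subseteq> carrier V" using B(2) U by blast
    then show ?thesis using in_own_span True by blast
  next
    case False
    have Bc: "B \<subseteq> carrier V" "u \<in> carrier V" using B(2) U u by blast+
    have "lin_dep (B \<union> {u})"
    proof (rule ccontr)
      assume "\<not> lin_dep (B \<union> {u})"
      moreover have "A \<subseteq> B \<union> {u}" "B \<union> {u} \<subseteq> U" using B(1,2) u by auto
      ultimately have "B \<union> {u} \<in> ?F" by simp
      from bspec[OF max this] have "B \<union> {u} = B" by (rule mp) (rule Un_upper1)
      then show False using False by blast
    qed
    then show ?thesis using lin_dep_iff_in_span[OF Bc(1) B(3) Bc(2) False] by blast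
  qed
  then have "U \<subseteq> span B" by (rule subsetI)
  then show ?thesis by (rule that[OF B])
qed

text \<open>A basis \<open>B'\<close> of \<open>W\<close> is extended to a basis \<open>B\<close> of
  \<open>V\<close>. Membership in \<open>W\<close> can then be read off the support of the
  coordinates, which avoids complements and dimensions.\<close>

lemma adapted_coords:
  fixes V :: "(complex, 'v) module"
  assumes V: "vectorspace class_ring V" and W: "submodule class_ring W V"
  obtains B B' :: "'v set" and c where "coords V B c" "B' \<subseteq> B"
    "\<And>x. x \<in> carrier V \<Longrightarrow> x \<in> W \<longleftrightarrow> {b. c x b \<noteq> 0} \<subseteq> B'"
proof -
  interpret V: vectorspace class_ring V by fact
  interpret W: submodule class_ring W V by fact
  have VM: "Module.module class_ring V" by (rule V.module_axioms)
  have "V.lin_indpt {}" unfolding V.lin_dep_def by auto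
  then obtain B' where B': "B' \<subseteq> W" "V.lin_indpt B'" "W \<subseteq> V.span B'"
    using V.extend_to_generating[of "{}" W] W.subset by auto
  have "B' \<subseteq> carrier V" using B'(1) W.subset by (rule subset_trans)
  then obtain B where B: "B' \<subseteq> B" "B \<subseteq> carrier V" "V.lin_indpt B" "carrier V \<subseteq> V.span B"
    by (rule V.extend_to_generating[OF _ B'(2) order_refl])
  \<comment> \<open>The map from coordinates to vectors. Independence of \<open>B\<close> makes it
    injective, generation makes it surjective, and the coordinates \<open>c\<close> are its
    inverse.\<close>
  define L where "L = lin_ext V (\<lambda>b::'v. b)"
  have Lh: "L \<in> module_hom class_ring (free_space B) V"
    unfolding L_def using B(2) by (intro lin_ext_hom VM) blast
  have Ldef: "L f = V.lincomb f {b. f b \<noteq> 0}" for f by (simp add: L_def lin_ext_def V.lincomb_def)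
  have Lcomb: "L (\<lambda>b. if b \<in> A then a b else 0) = V.lincomb a A" if A: "finite A" "A \<subseteq> B" for a A
  proof -
    have Ac: "A \<subseteq> carrier V" using A(2) B(2) by blast
    have "L (\<lambda>b. if b \<in> A then a b else 0) = finsum V (\<lambda>b. (if b \<in> A then a b else 0) \<odot>\<^bsub>V\<^esub> b) A"
      unfolding L_def using A B(2) by (intro lin_ext_superset[OF VM, of B]) auto
    also have "\<dots> = V.lincomb a A"
      unfolding V.lincomb_def using Ac by (intro V.M.finsum_cong') (auto simp: subset_iff Pi_iff)
    finally show ?thesis .
  qed
  have Lin: "(\<lambda>b. if b \<in> A then a b else 0) \<in> carrier (free_space B)" if A: "finite A" "A \<subseteq> B" for a A
    using A by (auto intro: finite_subset[of _ A])
  have kerL: "f = (\<lambda>x. 0)" if f: "f \<in> carrier (free_space B)" "L f = \<zero>\<^bsub>V\<^esub>" for f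
  proof (rule ccontr)
    assume "f \<noteq> (\<lambda>x. 0)"
    then obtain b where b: "f b \<noteq> 0" by auto
    have "V.lin_dep B"
      using f b unfolding Ldef by (intro V.lin_dep_crit[of "{b. f b \<noteq> 0}" B f b]) simp_all
    then show False using B(3) by blast
  qed
  have inj: "inj_on L (carrier (free_space B))"
  proof (rule inj_onI)
    fix f g assume f: "f \<in> carrier (free_space B)" and g: "g \<in> carrier (free_space B)" and eq: "L f = L g"
    define h where "h = (\<lambda>x. f x + (- 1) * g x)"
    have g': "(\<lambda>x. (- 1) * g x) \<in> carrier (free_space B)" by (rule free_smult_closed[OF g])
    have "h \<in> carrier (free_space B)" unfolding h_def by (rule free_add_closed[OF f g'])
    moreover have "L h = \<zero>\<^bsub>V\<^esub>"
    proof -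
      have "L h = L f \<oplus>\<^bsub>V\<^esub> L (\<lambda>x. (- 1) * g x)"
        using module_hom_D(2)[OF Lh f g'] by (simp add: h_def)
      also have "L (\<lambda>x. (- 1) * g x) = (- 1) \<odot>\<^bsub>V\<^esub> L g"
        using module_hom_D(3)[OF Lh _ g, of "- 1"] by simp
      also have "\<dots> = \<ominus>\<^bsub>V\<^esub> L g"
        using V.smult_minus_1[OF module_hom_D(1)[OF Lh g]] by (simp add: class_ring_simps)
      finally show ?thesis using eq V.M.r_neg[OF module_hom_D(1)[OF Lh g]] by simp
    qed
    ultimately have "h = (\<lambda>x. 0)" by (rule kerL)
    then show "f = g" unfolding h_def fun_eq_iff by simp
  qed
  have onto: "L ` carrier (free_space B) = carrier V"
  proof
    show "L ` carrier (free_space B) \<subseteq> carrier V" using module_hom_D(1)[OF Lh] by blast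
    show "carrier V \<subseteq> L ` carrier (free_space B)"
    proof
      fix x assume "x \<in> carrier V"
      then have "x \<in> V.span B" using B(4) by blast
      then obtain a A where A: "x = V.lincomb a A" "finite A" "A \<subseteq> B" unfolding V.span_def by blast
      have "x = L (\<lambda>b. if b \<in> A then a b else 0)" unfolding A(1) by (rule Lcomb[OF A(2,3), symmetric])
      then show "x \<in> L ` carrier (free_space B)" using Lin[OF A(2,3)] by (rule image_eqI)
    qed
  qed
  have bij: "bij_betw L (carrier (free_space B)) (carrier V)" using inj onto by (simp add: bij_betw_def)
  define c where "c = the_inv_into (carrier (free_space B)) L"
  have cb: "bij_betw c (carrier V) (carrier (free_space B))" unfolding c_def by (rule bij_betw_the_inv_into[OF bij])
  have cL: "c (L f) = f" if "f \<in> carrier (free_space B)" for f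
    unfolding c_def by (rule the_inv_into_f_f[OF inj that])
  have Lc: "L (c x) = x" "c x \<in> carrier (free_space B)" if "x \<in> carrier V" for x
    using f_the_inv_into_f_bij_betw[OF bij] that bij_betw_apply[OF cb that] by (simp_all add: c_def)
  interpret FS: Module.module class_ring "free_space B :: (complex, 'v \<Rightarrow> complex) module" by (rule free_space_module)
  have ch: "c \<in> module_hom class_ring V (free_space B)"
  proof (rule module_hom_I)
    show "c x \<in> carrier (free_space B)" if "x \<in> carrier V" for x by (rule Lc(2)[OF that])
    show "c (x \<oplus>\<^bsub>V\<^esub> y) = c x \<oplus>\<^bsub>free_space B\<^esub> c y" if "x \<in> carrier V" "y \<in> carrier V" for x y
    proof -
      have "x \<oplus>\<^bsub>V\<^esub> y = L (c x \<oplus>\<^bsub>free_space B\<^esub> c y)"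
        using module_hom_D(2)[OF Lh Lc(2)[OF that(1)] Lc(2)[OF that(2)]] Lc(1)[OF that(1)] Lc(1)[OF that(2)] by simp
      then show ?thesis using cL[OF FS.M.a_closed[OF Lc(2)[OF that(1)] Lc(2)[OF that(2)]]] by simp
    qed
    show "c (r \<odot>\<^bsub>V\<^esub> x) = r \<odot>\<^bsub>free_space B\<^esub> c x" if "r \<in> carrier class_ring" "x \<in> carrier V" for r x
    proof -
      have "r \<odot>\<^bsub>V\<^esub> x = L (r \<odot>\<^bsub>free_space B\<^esub> c x)"
        using module_hom_D(3)[OF Lh that(1) Lc(2)[OF that(2)]] Lc(1)[OF that(2)] by simp
      then show ?thesis using cL[OF FS.smult_closed[OF that(1) Lc(2)[OF that(2)]]] by simp
    qed
  qed
  have iff: "x \<in> W \<longleftrightarrow> {b. c x b \<noteq> 0} \<subseteq> B'" if x: "x \<in> carrier V" for x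
  proof
    assume "x \<in> W"
    then have "x \<in> V.span B'" using B'(3) by blast
    then obtain a A where A: "x = V.lincomb a A" "finite A" "A \<subseteq> B'" unfolding V.span_def by blast
    have AB: "A \<subseteq> B" using A(3) B(1) by blast
    have "c x = (\<lambda>b. if b \<in> A then a b else 0)"
      unfolding A(1) Lcomb[OF A(2) AB, symmetric] by (rule cL[OF Lin[OF A(2) AB]])
    then show "{b. c x b \<noteq> 0} \<subseteq> B'" using A(3) by auto
  next
    assume s: "{b. c x b \<noteq> 0} \<subseteq> B'"
    have "x = V.lincomb (c x) {b. c x b \<noteq> 0}" using Lc(1)[OF x] by (simp add: Ldef)
    also have "\<dots> \<in> W" unfolding V.lincomb_def
      by (rule V.finsum_in_submodule[OF W]) (use s B'(1) in auto)
    finally show "x \<in> W" .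
  qed
  have "coords V B c" unfolding coords_def using VM ch cb by simp
  then show ?thesis by (rule that[OF _ B(1) iff])
qed

section \<open>Tensor products\<close>

text \<open>Turns a description of fixed vectors by the support of their coordinates into
  coordinates on the space of fixed vectors.\<close>

lemma coords_restrict:
  assumes c: "coords V B c" and B': "B' \<subseteq> B"
    and U: "\<And>x. x \<in> U \<longleftrightarrow> x \<in> carrier V \<and> {b. c x b \<noteq> 0} \<subseteq> B'"
  shows "submodule class_ring U V" "coords (V\<lparr>carrier := U\<rparr>) B' c"
proof -
  have V: "Module.module class_ring V" and ch: "c \<in> module_hom class_ring V (free_space B)"
    and cb: "bij_betw c (carrier V) (carrier (free_space B))" using c by (simp_all add: coords_def)
  interpret V: Module.module class_ring V by (rule V)
  have c0: "c \<zero>\<^bsub>V\<^esub> = (\<lambda>b. 0)" using hom_zero[OF V free_space_module ch] by simp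
  have ca: "c (x \<oplus>\<^bsub>V\<^esub> y) = (\<lambda>b. c x b + c y b)" if "x \<in> carrier V" "y \<in> carrier V" for x y
    using module_hom_D(2)[OF ch that] by simp
  have cm: "c (a \<odot>\<^bsub>V\<^esub> x) = (\<lambda>b. a * c x b)" if "x \<in> carrier V" for a x
    using module_hom_D(3)[OF ch _ that, of a] by simp
  show sub: "submodule class_ring U V"
  proof (rule submodule.intro[OF V])
    show "U \<subseteq> carrier V" using U by blast
    show "\<zero>\<^bsub>V\<^esub> \<in> U" unfolding U c0 by simp
    show "x \<oplus>\<^bsub>V\<^esub> y \<in> U" if "x \<in> U" "y \<in> U" for x y
    proof -
      have x: "x \<in> carrier V" "y \<in> carrier V" "{b. c x b \<noteq> 0} \<subseteq> B'" "{b. c y b \<noteq> 0} \<subseteq> B'" using that unfolding U by simp_all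
      have "{b. c x b + c y b \<noteq> 0} \<subseteq> {b. c x b \<noteq> 0} \<union> {b. c y b \<noteq> 0}" by auto
      then have "{b. c x b + c y b \<noteq> 0} \<subseteq> B'" using x(3,4) by blast
      then show ?thesis unfolding U ca[OF x(1,2)] using x(1,2) by simp
    qed
    show "a \<odot>\<^bsub>V\<^esub> x \<in> U" if "a \<in> carrier class_ring" "x \<in> U" for a x
    proof -
      have x: "x \<in> carrier V" "{b. c x b \<noteq> 0} \<subseteq> B'" using that unfolding U by simp_all
      have "{b. a * c x b \<noteq> 0} \<subseteq> B'" using x(2) by auto
      then show ?thesis unfolding U cm[OF x(1)] using x(1) by simp
    qed
  qed
  have "c \<in> module_hom class_ring (V\<lparr>carrier := U\<rparr>) (free_space B')"
  proof (rule module_hom_I)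
    show "c x \<in> carrier (free_space B')" if "x \<in> carrier (V\<lparr>carrier := U\<rparr>)" for x
      using that module_hom_D(1)[OF ch, of x] by (simp add: U)
    show "c (x \<oplus>\<^bsub>V\<lparr>carrier := U\<rparr>\<^esub> y) = c x \<oplus>\<^bsub>free_space B'\<^esub> c y"
      if "x \<in> carrier (V\<lparr>carrier := U\<rparr>)" "y \<in> carrier (V\<lparr>carrier := U\<rparr>)" for x y
      using that ca[of x y] by (simp add: U)
    show "c (a \<odot>\<^bsub>V\<lparr>carrier := U\<rparr>\<^esub> x) = a \<odot>\<^bsub>free_space B'\<^esub> c x"
      if "x \<in> carrier (V\<lparr>carrier := U\<rparr>)" for a x
      using that cm[of x a] by (simp add: U)
  qed
  moreover have "bij_betw c U (carrier (free_space B'))"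
    unfolding bij_betw_def
  proof
    have UV: "U \<subseteq> carrier V" using U by blast
    show "inj_on c U" by (rule inj_on_subset[OF bij_betw_imp_inj_on[OF cb] UV])
    show "c ` U = carrier (free_space B')"
    proof
      show "c ` U \<subseteq> carrier (free_space B')"
      proof
        fix f assume "f \<in> c ` U"
        then obtain x where x: "x \<in> U" "f = c x" by blast
        then show "f \<in> carrier (free_space B')" using module_hom_D(1)[OF ch, of x] unfolding U by simp
      qed
      show "carrier (free_space B') \<subseteq> c ` U"
      proof
        fix f assume f: "f \<in> carrier (free_space B')"
        then have "f \<in> carrier (free_space B)" using B' by auto
        then have "f \<in> c ` carrier V" using cb by (simp add: bij_betw_def)
        then obtain x where x: "x \<in> carrier V" "f = c x" by blast
        then have "x \<in> U" unfolding U using f by simp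
        then show "f \<in> c ` U" using x(2) by blast
      qed
    qed
  qed
  ultimately show "coords (V\<lparr>carrier := U\<rparr>) B' c"
    unfolding coords_def using V.submodule_is_module[OF sub] by simp
qed

text \<open>This is how the isomorphism between fixed tensors and the tensor product of fixed spaces
  is produced: both are compared with the free space on one index set.\<close>

lemma coords_isomorphic:
  assumes "coords V B c" "coords W B d" shows "modules_isomorphic class_ring V W"
proof -
  have "modules_isomorphic class_ring V (free_space B)" "modules_isomorphic class_ring W (free_space B)"
    using assms unfolding coords_def modules_isomorphic_def by blast+
  moreover have "Module.module class_ring W" using assms by (simp add: coords_def)
  ultimately show ?thesis using modules_isomorphic_sym modules_isomorphic_trans by blast
qed

lemma finsum_free:
  assumes "finite A" "\<And>a. a \<in> A \<Longrightarrow> g a \<in> carrier (free_space S)"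
  shows "finsum (free_space S) g A = (\<lambda>y. \<Sum>a\<in>A. g a y)"
  using assms
proof (induction A rule: finite_induct)
  interpret F: Module.module class_ring "free_space S" by (rule free_space_module)
  case empty show ?case by simp
next
  interpret F: Module.module class_ring "free_space S" by (rule free_space_module)
  case (insert a A)
  have "finsum (free_space S) g (insert a A) = g a \<oplus>\<^bsub>free_space S\<^esub> finsum (free_space S) g A"
    by (rule F.M.finsum_insert[OF insert.hyps]) (simp_all add: Pi_iff insert.prems del: free_space_simps(1))
  also have "\<dots> = (\<lambda>y. \<Sum>a\<in>insert a A. g a y)"
    using insert.IH insert.prems insert.hyps by (simp del: free_space_simps(1))
  finally show ?case .
qed

lemma free_diff_closed:
  assumes "f \<in> carrier (free_space S)" "g \<in> carrier (free_space S)"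
  shows "(\<lambda>x. f x - g x) \<in> carrier (free_space S)"
  using free_add_closed[OF assms(1) free_smult_closed[OF assms(2), of "- 1"]] by (simp del: free_space_simps(1))

lemma hom_diff_free:
  assumes X: "Module.module class_ring X" and h: "h \<in> module_hom class_ring (free_space S) X"
    and f: "f \<in> carrier (free_space S)" and g: "g \<in> carrier (free_space S)"
  shows "h (\<lambda>x. f x - g x) = h f \<oplus>\<^bsub>X\<^esub> (- 1) \<odot>\<^bsub>X\<^esub> h g"
proof -
  have "h (\<lambda>x. f x - g x) = h (f \<oplus>\<^bsub>free_space S\<^esub> (- 1) \<odot>\<^bsub>free_space S\<^esub> g)" by simp
  also have "\<dots> = h f \<oplus>\<^bsub>X\<^esub> h ((- 1) \<odot>\<^bsub>free_space S\<^esub> g)"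
    using f free_smult_closed[OF g, of "- 1"] by (intro module_hom_D(2)[OF h]) simp_all
  also have "h ((- 1) \<odot>\<^bsub>free_space S\<^esub> g) = (- 1) \<odot>\<^bsub>X\<^esub> h g"
    by (rule module_hom_D(3)[OF h _ g]) simp
  finally show ?thesis .
qed

lemma preimage_submodule:
  assumes A: "Module.module R A" and B: "Module.module R B" and f: "f \<in> module_hom R A B" and N: "submodule R N B"
  shows "submodule R {x \<in> carrier A. f x \<in> N} A"
proof -
  interpret A: Module.module R A by fact
  interpret N: submodule R N B by fact
  have "f \<zero>\<^bsub>A\<^esub> = \<zero>\<^bsub>B\<^esub>" by (rule hom_zero[OF A B f])
  then show ?thesis
    by (intro submodule.intro[OF A]) (auto simp: module_hom_D[OF f])
qed

section \<open>Tensor products of families of spaces\<close>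

locale tensor_family =
  fixes I :: "'i set" and V :: "'i \<Rightarrow> (complex, 'v) module"
  assumes fin: "finite I" and mod: "\<And>i. i \<in> I \<Longrightarrow> Module.module class_ring (V i)"
begin

abbreviation "C \<equiv> (\<Pi>\<^sub>E i\<in>I. carrier (V i))"
abbreviation "T0 \<equiv> tensor_free I V"
abbreviation "N \<equiv> tensor_null I V"
abbreviation "T \<equiv> tensor_product I V"

lemma T0: "T0 = free_space C" by (simp add: tensor_free_def)

lemma T0_module: "Module.module class_ring T0" unfolding T0 by (rule free_space_module)

lemma upd_in_C: "x \<in> C \<Longrightarrow> i \<in> I \<Longrightarrow> a \<in> carrier (V i) \<Longrightarrow> x(i := a) \<in> C"
  by (auto simp: PiE_iff extensional_def)

lemma C_D: "x \<in> C \<Longrightarrow> i \<in> I \<Longrightarrow> x i \<in> carrier (V i)"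
  by (simp add: PiE_iff)

lemma slot_closed:
  assumes "i \<in> I" "a \<in> carrier (V i)"
  shows "b \<in> carrier (V i) \<Longrightarrow> a \<oplus>\<^bsub>V i\<^esub> b \<in> carrier (V i)" "c \<odot>\<^bsub>V i\<^esub> a \<in> carrier (V i)"
proof -
  interpret Vi: Module.module class_ring "V i" by (rule mod[OF assms(1)])
  show "b \<in> carrier (V i) \<Longrightarrow> a \<oplus>\<^bsub>V i\<^esub> b \<in> carrier (V i)" using assms(2) by (rule Vi.M.a_closed)
  show "c \<odot>\<^bsub>V i\<^esub> a \<in> carrier (V i)" using Vi.smult_closed[of c a] assms(2) by simp
qed

lemma delta_T0: "x \<in> C \<Longrightarrow> delta x \<in> carrier (free_space C)" by (rule delta_in_free)

lemma relation_cases: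
  assumes f: "f \<in> tensor_relations I V"
    and 1: "\<And>x i a b. x \<in> C \<Longrightarrow> i \<in> I \<Longrightarrow> a \<in> carrier (V i) \<Longrightarrow> b \<in> carrier (V i) \<Longrightarrow>
      R (\<lambda>y. (delta (x(i := a \<oplus>\<^bsub>V i\<^esub> b)) y - delta (x(i := a)) y) - delta (x(i := b)) y)"
    and 2: "\<And>x i c a. x \<in> C \<Longrightarrow> i \<in> I \<Longrightarrow> a \<in> carrier (V i) \<Longrightarrow>
      R (\<lambda>y. delta (x(i := c \<odot>\<^bsub>V i\<^esub> a)) y - c * delta (x(i := a)) y)"
  shows "R f"
  using f unfolding tensor_relations_def by (auto intro: 1 2)

lemma relations_closed: "tensor_relations I V \<subseteq> carrier T0"
proof
  fix f assume "f \<in> tensor_relations I V"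
  then show "f \<in> carrier T0" unfolding T0
    by (rule relation_cases)
      (intro free_diff_closed free_smult_closed delta_T0 upd_in_C slot_closed, assumption+)+
qed

lemma N_submodule: "submodule class_ring N T0"
  unfolding tensor_null_def by (rule module.span_is_submodule[OF T0_module relations_closed])

lemma relation_in_N: "f \<in> tensor_relations I V \<Longrightarrow> f \<in> N"
  unfolding tensor_null_def using module.in_own_span[OF T0_module relations_closed] by blast

lemma N_least:
  assumes "submodule class_ring U T0" "\<And>f. f \<in> tensor_relations I V \<Longrightarrow> f \<in> U" shows "N \<subseteq> U"
  unfolding tensor_null_def
  by (rule module.span_is_subset[OF T0_module _ assms(1)]) (rule subsetI, rule assms(2))

lemma T_module: "Module.module class_ring T"
  unfolding tensor_product_def by (rule module.quotient_module_is_module[OF T0_module N_submodule])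

abbreviation cl :: "(('i \<Rightarrow> 'v) \<Rightarrow> complex) \<Rightarrow> (('i \<Rightarrow> 'v) \<Rightarrow> complex) set" where
  "cl f \<equiv> N +>\<^bsub>T0\<^esub> f"

lemma cl_hom: "(\<lambda>f. cl f) \<in> module_hom class_ring T0 T"
  unfolding tensor_product_def by (rule module.quotient_hom[OF T0_module N_submodule])

lemma T_cases:
  assumes "t \<in> carrier T" obtains f where "f \<in> carrier T0" "t = cl f"
  using assms module.carrier_quotient_module[OF T0_module, of N] unfolding tensor_product_def by auto

lemma cl_zero: "f \<in> N \<Longrightarrow> cl f = \<zero>\<^bsub>T\<^esub>"
  using module.coset_eq_self_iff[OF T0_module N_submodule, of f] module.quotient_zero[OF T0_module, of N]
    submodule.subset[OF N_submodule] by (auto simp: tensor_product_def)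

text \<open>Multilinearity modulo \<open>N\<close>, in the form that allows one slot to vary over a
  whole space once it has been treated on generators.\<close>

lemma slot_submodule:
  assumes Q: "submodule class_ring Q T0" "N \<subseteq> Q" and x: "x \<in> C" and i: "i \<in> I"
  shows "submodule class_ring {a \<in> carrier (V i). delta (x(i := a)) \<in> Q} (V i)"
proof -
  interpret Vi: Module.module class_ring "V i" by (rule mod[OF i])
  interpret Q: submodule class_ring Q T0 by (rule Q(1))
  have Qa: "(\<lambda>y. f y + g y) \<in> Q" if "f \<in> Q" "g \<in> Q" for f g
    using Q.m_closed[OF that] by (simp add: T0)
  have Qm: "(\<lambda>y. c * f y) \<in> Q" if "f \<in> Q" for c f
    using Q.smult_closed[OF _ that, of c] by (simp add: T0)
  have add: "delta (x(i := a \<oplus>\<^bsub>V i\<^esub> b)) \<in> Q"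
    if ab: "a \<in> carrier (V i)" "b \<in> carrier (V i)" and d: "delta (x(i := a)) \<in> Q" "delta (x(i := b)) \<in> Q" for a b
  proof -
    have "(\<lambda>y. delta (x(i := a \<oplus>\<^bsub>V i\<^esub> b)) y - delta (x(i := a)) y - delta (x(i := b)) y) \<in> tensor_relations I V"
      unfolding tensor_relations_def using x i ab by blast
    then have "(\<lambda>y. delta (x(i := a \<oplus>\<^bsub>V i\<^esub> b)) y - delta (x(i := a)) y - delta (x(i := b)) y) \<in> Q"
      using Q(2) relation_in_N by blast
    from Qa[OF Qa[OF this d(1)] d(2)] show ?thesis by simp
  qed
  have mul: "delta (x(i := c \<odot>\<^bsub>V i\<^esub> a)) \<in> Q" if a: "a \<in> carrier (V i)" and d: "(\<lambda>y. c * delta (x(i := a)) y) \<in> Q" for a c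
  proof -
    have "(\<lambda>y. delta (x(i := c \<odot>\<^bsub>V i\<^esub> a)) y - c * delta (x(i := a)) y) \<in> tensor_relations I V"
      unfolding tensor_relations_def using x i a by blast
    then have "(\<lambda>y. delta (x(i := c \<odot>\<^bsub>V i\<^esub> a)) y - c * delta (x(i := a)) y) \<in> Q"
      using Q(2) relation_in_N by blast
    from Qa[OF this d] show ?thesis by simp
  qed
  have zero: "delta (x(i := \<zero>\<^bsub>V i\<^esub>)) \<in> Q"
  proof -
    have "(\<lambda>y. 0 * delta (x(i := \<zero>\<^bsub>V i\<^esub>)) y) \<in> Q" using Q.zero_closed by (simp add: T0)
    from mul[OF Vi.M.zero_closed this] show ?thesis using Vi.smult_l_null[OF Vi.M.zero_closed] by simp
  qed
  show ?thesis
    by (rule submodule.intro[OF mod[OF i]])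
      (use zero add mul Qm in \<open>simp_all add: subset_iff slot_closed[OF i]\<close>)
qed

section \<open>Endomorphisms of tensor products\<close>

definition tuple_map :: "('i \<Rightarrow> 'v \<Rightarrow> 'v) \<Rightarrow> ('i \<Rightarrow> 'v) \<Rightarrow> 'i \<Rightarrow> 'v" where
  "tuple_map \<phi> x = (\<lambda>i\<in>I. \<phi> i (x i))"

definition endos :: "('i \<Rightarrow> 'v \<Rightarrow> 'v) \<Rightarrow> bool" where
  "endos \<phi> \<longleftrightarrow> (\<forall>i\<in>I. \<phi> i \<in> module_hom class_ring (V i) (V i))"

lemma endos_D: "endos \<phi> \<Longrightarrow> i \<in> I \<Longrightarrow> \<phi> i \<in> module_hom class_ring (V i) (V i)"
  by (simp add: endos_def)

lemma tuple_map_closed: "endos \<phi> \<Longrightarrow> x \<in> C \<Longrightarrow> tuple_map \<phi> x \<in> C"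
  unfolding tuple_map_def by (simp add: PiE_iff module_hom_D(1)[OF endos_D])

lemma tuple_map_upd:
  "i \<in> I \<Longrightarrow> tuple_map \<phi> (x(i := a)) = (tuple_map \<phi> x)(i := \<phi> i a)"
  by (auto simp: tuple_map_def)

text \<open>On the free space the push-forward is a linear extension, from which it inherits
  linearity and its values on the basis \<open>delta x\<close>.\<close>

lemma push_eq_lin_ext:
  assumes \<phi>: "endos \<phi>" and f: "f \<in> carrier T0"
  shows "tensor_push I \<phi> f = lin_ext T0 (\<lambda>x. delta (tuple_map \<phi> x)) f"
proof
  fix y
  have fs: "finite {x. f x \<noteq> 0}" "{x. f x \<noteq> 0} \<subseteq> C" using f by (simp_all add: T0)
  have "lin_ext T0 (\<lambda>x. delta (tuple_map \<phi> x)) f = (\<lambda>y. \<Sum>x\<in>{x. f x \<noteq> 0}. f x * delta (tuple_map \<phi> x) y)"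
    unfolding lin_ext_def T0
  proof (subst finsum_free[OF fs(1)])
    fix x assume "x \<in> {x. f x \<noteq> 0}"
    then have "tuple_map \<phi> x \<in> C" using fs(2) by (intro tuple_map_closed[OF \<phi>]) blast
    then show "f x \<odot>\<^bsub>free_space C\<^esub> delta (tuple_map \<phi> x) \<in> carrier (free_space C)"
      using free_smult_closed[OF delta_T0, of "tuple_map \<phi> x" "f x"] by simp
  qed simp
  moreover have "(\<Sum>x\<in>{x. f x \<noteq> 0}. f x * delta (tuple_map \<phi> x) y) = (\<Sum>x\<in>{x. f x \<noteq> 0}. if tuple_map \<phi> x = y then f x else 0)"
    by (intro sum.cong refl) (auto simp: delta_def)
  moreover have "\<dots> = (\<Sum>x | f x \<noteq> 0 \<and> tuple_map \<phi> x = y. f x)"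
    using sum.inter_filter[OF fs(1), of f "\<lambda>x. tuple_map \<phi> x = y"] by simp
  ultimately show "tensor_push I \<phi> f y = lin_ext T0 (\<lambda>x. delta (tuple_map \<phi> x)) f y"
    by (simp add: tensor_push_def tuple_map_def)
qed

lemma push_hom:
  assumes \<phi>: "endos \<phi>" shows "tensor_push I \<phi> \<in> module_hom class_ring T0 T0"
proof -
  interpret F: Module.module class_ring T0 by (rule T0_module)
  have h: "lin_ext T0 (\<lambda>x. delta (tuple_map \<phi> x)) \<in> module_hom class_ring T0 T0"
    unfolding T0 by (intro lin_ext_hom free_space_module delta_T0 tuple_map_closed[OF \<phi>])
  show ?thesis
  proof (rule module_hom_I)
    show "tensor_push I \<phi> f \<in> carrier T0" if "f \<in> carrier T0" for f
      unfolding push_eq_lin_ext[OF \<phi> that] by (rule module_hom_D(1)[OF h that])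
    show "tensor_push I \<phi> (f \<oplus>\<^bsub>T0\<^esub> g) = tensor_push I \<phi> f \<oplus>\<^bsub>T0\<^esub> tensor_push I \<phi> g"
      if "f \<in> carrier T0" "g \<in> carrier T0" for f g
      unfolding push_eq_lin_ext[OF \<phi> that(1)] push_eq_lin_ext[OF \<phi> that(2)] push_eq_lin_ext[OF \<phi> F.M.a_closed[OF that]]
      by (rule module_hom_D(2)[OF h that])
    show "tensor_push I \<phi> (r \<odot>\<^bsub>T0\<^esub> f) = r \<odot>\<^bsub>T0\<^esub> tensor_push I \<phi> f"
      if "r \<in> carrier class_ring" "f \<in> carrier T0" for r f
      unfolding push_eq_lin_ext[OF \<phi> that(2)] push_eq_lin_ext[OF \<phi> F.smult_closed[OF that]]
      by (rule module_hom_D(3)[OF h that])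
  qed
qed

lemma push_delta:
  assumes "endos \<phi>" "x \<in> C" shows "tensor_push I \<phi> (delta x) = delta (tuple_map \<phi> x)"
proof -
  have "delta x \<in> carrier T0" using delta_T0[OF assms(2)] by (simp only: T0)
  then have "tensor_push I \<phi> (delta x) = lin_ext (free_space C) (\<lambda>x. delta (tuple_map \<phi> x)) (delta x)"
    using push_eq_lin_ext[OF assms(1)] by (simp only: T0)
  also have "\<dots> = delta (tuple_map \<phi> x)"
    by (rule lin_ext_delta[of "free_space C" C, OF free_space_module _ assms(2)])
      (intro delta_T0 tuple_map_closed[OF assms(1)])
  finally show ?thesis .
qed

lemma push_diff:
  assumes \<phi>: "endos \<phi>" and "f \<in> carrier (free_space C)" "g \<in> carrier (free_space C)"
  shows "tensor_push I \<phi> (\<lambda>x. f x - g x) = (\<lambda>x. tensor_push I \<phi> f x - tensor_push I \<phi> g x)"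
  using hom_diff_free[OF free_space_module push_hom[OF \<phi>, unfolded T0] assms(2,3)] by simp

lemma push_smult:
  assumes \<phi>: "endos \<phi>" and "f \<in> carrier (free_space C)"
  shows "tensor_push I \<phi> (\<lambda>x. c * f x) = (\<lambda>x. c * tensor_push I \<phi> f x)"
  using module_hom_D(3)[OF push_hom[OF \<phi>, unfolded T0] _ assms(2), of c] by simp

text \<open>Linearity of each \<open>\<phi> i\<close> maps a multilinearity relation to a relation
  of the same kind, based at the image tuple.\<close>

lemma push_N:
  assumes \<phi>: "endos \<phi>" and f: "f \<in> N" shows "tensor_push I \<phi> f \<in> N"
proof -
  have "N \<subseteq> {f \<in> carrier T0. tensor_push I \<phi> f \<in> N}"
  proof (rule N_least[OF preimage_submodule[OF T0_module T0_module push_hom[OF \<phi>] N_submodule]])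
    fix g assume g: "g \<in> tensor_relations I V"
    have gT: "g \<in> carrier T0" using g relations_closed by blast
    from g have "tensor_push I \<phi> g \<in> tensor_relations I V"
    proof (rule relation_cases)
      fix x i a b assume x: "x \<in> C" and i: "i \<in> I" and ab: "a \<in> carrier (V i)" "b \<in> carrier (V i)"
      note d = delta_T0[OF upd_in_C[OF x i]]
      note p = push_delta[OF \<phi> upd_in_C[OF x i], unfolded tuple_map_upd[OF i]]
      note hi = endos_D[OF \<phi> i]
      have "tensor_push I \<phi> (\<lambda>y. (delta (x(i := a \<oplus>\<^bsub>V i\<^esub> b)) y - delta (x(i := a)) y) - delta (x(i := b)) y) =
        (\<lambda>y. delta ((tuple_map \<phi> x)(i := \<phi> i a \<oplus>\<^bsub>V i\<^esub> \<phi> i b)) y - delta ((tuple_map \<phi> x)(i := \<phi> i a)) y - delta ((tuple_map \<phi> x)(i := \<phi> i b)) y)"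
        unfolding push_diff[OF \<phi> free_diff_closed[OF d[OF slot_closed(1)[OF i ab]] d[OF ab(1)]] d[OF ab(2)]]
          push_diff[OF \<phi> d[OF slot_closed(1)[OF i ab]] d[OF ab(1)]]
          p[OF slot_closed(1)[OF i ab]] p[OF ab(1)] p[OF ab(2)] module_hom_D(2)[OF hi ab] ..
      then show "tensor_push I \<phi> (\<lambda>y. (delta (x(i := a \<oplus>\<^bsub>V i\<^esub> b)) y - delta (x(i := a)) y) - delta (x(i := b)) y) \<in> tensor_relations I V"
        unfolding tensor_relations_def
        using tuple_map_closed[OF \<phi> x] i module_hom_D(1)[OF hi ab(1)] module_hom_D(1)[OF hi ab(2)] by blast
    next
      fix x i c a assume x: "x \<in> C" and i: "i \<in> I" and a: "a \<in> carrier (V i)"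
      note d = delta_T0[OF upd_in_C[OF x i]]
      note p = push_delta[OF \<phi> upd_in_C[OF x i], unfolded tuple_map_upd[OF i]]
      note hi = endos_D[OF \<phi> i]
      have ca: "\<phi> i (c \<odot>\<^bsub>V i\<^esub> a) = c \<odot>\<^bsub>V i\<^esub> \<phi> i a" using module_hom_D(3)[OF hi _ a, of c] by simp
      have "tensor_push I \<phi> (\<lambda>y. delta (x(i := c \<odot>\<^bsub>V i\<^esub> a)) y - c * delta (x(i := a)) y) =
        (\<lambda>y. delta ((tuple_map \<phi> x)(i := c \<odot>\<^bsub>V i\<^esub> \<phi> i a)) y - c * delta ((tuple_map \<phi> x)(i := \<phi> i a)) y)"
        unfolding push_diff[OF \<phi> d[OF slot_closed(2)[OF i a]] free_smult_closed[OF d[OF a]]]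
          push_smult[OF \<phi> d[OF a]] p[OF slot_closed(2)[OF i a]] p[OF a] ca ..
      then show "tensor_push I \<phi> (\<lambda>y. delta (x(i := c \<odot>\<^bsub>V i\<^esub> a)) y - c * delta (x(i := a)) y) \<in> tensor_relations I V"
        unfolding tensor_relations_def
        using tuple_map_closed[OF \<phi> x] i module_hom_D(1)[OF hi a] by blast
    qed
    then show "g \<in> {f \<in> carrier T0. tensor_push I \<phi> f \<in> N}" using gT relation_in_N by simp
  qed
  then show ?thesis using f by blast
qed

text \<open>By \<open>push_N\<close> the push-forwards of two representatives differ by an element
  of \<open>N\<close>, so the union in \<open>tensor_map\<close> consists of a single class.\<close>

lemma tensor_map_cl:
  assumes \<phi>: "endos \<phi>" and f: "f \<in> carrier T0"
  shows "tensor_map I V \<phi> (cl f) = cl (tensor_push I \<phi> f)"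
proof -
  interpret F: Module.module class_ring T0 by (rule T0_module)
  interpret A: abelian_subgroup N T0 by (rule F.submodule_abelian_subgroup[OF N_submodule])
  interpret h: mod_hom class_ring T0 T0 "tensor_push I \<phi>"
    by (intro mod_hom.intro mod_hom_axioms.intro T0_module push_hom[OF \<phi>])
  have "cl (tensor_push I \<phi> g) = cl (tensor_push I \<phi> f)" if g: "g \<in> cl f" for g
  proof -
    note m = F.mem_coset[OF N_submodule f g]
    have "tensor_push I \<phi> g \<ominus>\<^bsub>T0\<^esub> tensor_push I \<phi> f = tensor_push I \<phi> (g \<ominus>\<^bsub>T0\<^esub> f)"
      by (rule h.f_minus[OF m(1) f, symmetric])
    also have "\<dots> \<in> N" by (rule push_N[OF \<phi> m(2)])
    finally show ?thesis
      using F.coset_eq_iff[OF N_submodule module_hom_D(1)[OF push_hom[OF \<phi>] m(1)] module_hom_D(1)[OF push_hom[OF \<phi>] f]] by simp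
  qed
  moreover have "f \<in> cl f" by (rule A.a_rcos_self[OF f])
  ultimately show ?thesis unfolding tensor_map_def by blast
qed

lemma tensor_map_hom:
  assumes \<phi>: "endos \<phi>" shows "tensor_map I V \<phi> \<in> module_hom class_ring T T"
proof -
  interpret F: Module.module class_ring T0 by (rule T0_module)
  note ph = push_hom[OF \<phi>]
  note c = tensor_map_cl[OF \<phi>]
  show ?thesis
  proof (rule module_hom_I)
    fix t assume "t \<in> carrier T"
    then obtain f where f: "f \<in> carrier T0" "t = cl f" by (rule T_cases)
    show "tensor_map I V \<phi> t \<in> carrier T"
      unfolding f(2) c[OF f(1)] by (rule module_hom_D(1)[OF cl_hom module_hom_D(1)[OF ph f(1)]])
    {
      fix u assume "u \<in> carrier T"
      then obtain g where g: "g \<in> carrier T0" "u = cl g" by (rule T_cases)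
      show "tensor_map I V \<phi> (t \<oplus>\<^bsub>T\<^esub> u) = tensor_map I V \<phi> t \<oplus>\<^bsub>T\<^esub> tensor_map I V \<phi> u"
        unfolding f(2) g(2) module_hom_D(2)[OF cl_hom f(1) g(1), symmetric] c[OF f(1)] c[OF g(1)]
          c[OF F.M.a_closed[OF f(1) g(1)]] module_hom_D(2)[OF ph f(1) g(1)]
        by (rule module_hom_D(2)[OF cl_hom module_hom_D(1)[OF ph f(1)] module_hom_D(1)[OF ph g(1)]])
    }
    fix r :: complex assume r: "r \<in> carrier class_ring"
    show "tensor_map I V \<phi> (r \<odot>\<^bsub>T\<^esub> t) = r \<odot>\<^bsub>T\<^esub> tensor_map I V \<phi> t"
      unfolding f(2) module_hom_D(3)[OF cl_hom r f(1), symmetric] c[OF f(1)]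
        c[OF F.smult_closed[OF r f(1)]] module_hom_D(3)[OF ph r f(1)]
      by (rule module_hom_D(3)[OF cl_hom r module_hom_D(1)[OF ph f(1)]])
  qed
qed

text \<open>Checked on the basis \<open>delta x\<close>. The factorization of \<open>\<chi>\<close>
  is asked for on the carriers, where the laws of a representation hold.\<close>

lemma tensor_map_comp:
  assumes \<phi>: "endos \<phi>" and \<psi>: "endos \<psi>" and \<chi>: "endos \<chi>"
    and eq: "\<And>i x. i \<in> I \<Longrightarrow> x \<in> carrier (V i) \<Longrightarrow> \<chi> i x = \<phi> i (\<psi> i x)" and t: "t \<in> carrier T"
  shows "tensor_map I V \<chi> t = tensor_map I V \<phi> (tensor_map I V \<psi> t)"
proof -
  obtain f where f: "f \<in> carrier T0" "t = cl f" using t by (rule T_cases)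
  have "tensor_push I \<chi> f = tensor_push I \<phi> (tensor_push I \<psi> f)"
  proof (rule hom_ext_free[where X = T0 and S = C and f = "tensor_push I \<chi>"
        and g = "\<lambda>f. tensor_push I \<phi> (tensor_push I \<psi> f)"])
    show "Module.module class_ring T0" by (rule T0_module)
    show "tensor_push I \<chi> \<in> module_hom class_ring (free_space C) T0" using push_hom[OF \<chi>] by (simp only: T0)
    show "(\<lambda>f. tensor_push I \<phi> (tensor_push I \<psi> f)) \<in> module_hom class_ring (free_space C) T0"
      using module_hom_comp[OF push_hom[OF \<psi>] push_hom[OF \<phi>]] by (simp only: T0)
    show "f \<in> carrier (free_space C)" using f by (simp only: T0)
    fix x assume x: "x \<in> C"
    have "tuple_map \<chi> x = tuple_map \<phi> (tuple_map \<psi> x)"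
      using eq C_D[OF x] by (auto simp: tuple_map_def)
    then show "tensor_push I \<chi> (delta x) = tensor_push I \<phi> (tensor_push I \<psi> (delta x))"
      using push_delta[OF \<chi> x] push_delta[OF \<psi> x] push_delta[OF \<phi> tuple_map_closed[OF \<psi> x]] by simp
  qed
  then show ?thesis
    unfolding f(2) tensor_map_cl[OF \<chi> f(1)] tensor_map_cl[OF \<psi> f(1)]
      tensor_map_cl[OF \<phi> module_hom_D(1)[OF push_hom[OF \<psi>] f(1)]] by simp
qed

end

section \<open>The product basis of a tensor product\<close>

locale tensor_coords = tensor_family I V
  for I :: "'i set" and V :: "'i \<Rightarrow> (complex, 'v) module" +
  fixes B :: "'i \<Rightarrow> 'b set" and c :: "'i \<Rightarrow> 'v \<Rightarrow> 'b \<Rightarrow> complex"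
  assumes crd: "\<And>i. i \<in> I \<Longrightarrow> coords (V i) (B i) (c i)"
begin

abbreviation "BB \<equiv> PiE I B"

lemma c_hom: "i \<in> I \<Longrightarrow> c i \<in> module_hom class_ring (V i) (free_space (B i))"
  and c_bij: "i \<in> I \<Longrightarrow> bij_betw (c i) (carrier (V i)) (carrier (free_space (B i)))"
  using crd by (simp_all add: coords_def)

text \<open>The basis vector of \<open>V i\<close> that belongs to the index
  \<open>b\<close>.\<close>

definition e :: "'i \<Rightarrow> 'b \<Rightarrow> 'v" where "e i b = inv_into (carrier (V i)) (c i) (delta b)"

lemma e: assumes "i \<in> I" "b \<in> B i" shows "e i b \<in> carrier (V i)" "c i (e i b) = delta b"
proof -
  have "delta b \<in> c i ` carrier (V i)"
    using c_bij[OF assms(1)] delta_in_free[OF assms(2)] unfolding bij_betw_def by simp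
  then show "e i b \<in> carrier (V i)" "c i (e i b) = delta b"
    unfolding e_def by (rule inv_into_into, rule f_inv_into_f)
qed

definition E :: "('i \<Rightarrow> 'b) \<Rightarrow> 'i \<Rightarrow> 'v" where "E b = (\<lambda>i\<in>I. e i (b i))"

lemma E_in_C: "b \<in> BB \<Longrightarrow> E b \<in> C"
  unfolding E_def by (simp add: PiE_iff e)

text \<open>Induction on the set \<open>J\<close> of slots in which \<open>x\<close> may be
  arbitrary, the others holding basis vectors. By \<open>slot_submodule\<close> the vectors allowed
  in slot \<open>j\<close> form a submodule, and containing the basis it is the whole of
  \<open>V j\<close>.\<close>

lemma T0_generated:
  assumes Q: "submodule class_ring Q T0" "N \<subseteq> Q" and b: "\<And>b. b \<in> BB \<Longrightarrow> delta (E b) \<in> Q"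
  shows "Q = carrier T0"
proof -
  have "delta x \<in> Q" if "finite J" "J \<subseteq> I" "x \<in> C" "\<And>i. i \<in> I \<Longrightarrow> i \<notin> J \<Longrightarrow> x i \<in> e i ` B i" for J x
    using that
  proof (induction J arbitrary: x rule: finite_induct)
    case empty
    have "\<exists>b. \<forall>i\<in>I. b i \<in> B i \<and> x i = e i (b i)"
      using empty(3) by (intro bchoice) (simp add: image_iff Bex_def)
    then obtain b0 where b0: "\<And>i. i \<in> I \<Longrightarrow> b0 i \<in> B i" "\<And>i. i \<in> I \<Longrightarrow> x i = e i (b0 i)" by blast
    have "restrict b0 I \<in> BB" using b0(1) by simp
    moreover have "E (restrict b0 I) = x"
    proof
      fix i show "E (restrict b0 I) i = x i"
        using b0(2)[of i] empty(2) by (cases "i \<in> I") (simp_all add: E_def PiE_iff extensional_def)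
    qed
    ultimately show ?case using b[of "restrict b0 I"] by simp
  next
    case (insert j J)
    have j: "j \<in> I" using insert.prems by simp
    define U where "U = {a \<in> carrier (V j). delta (x(j := a)) \<in> Q}"
    have "U = carrier (V j)"
    proof (rule coords_submodule_top[OF crd[OF j]])
      show "submodule class_ring U (V j)" unfolding U_def by (rule slot_submodule[OF Q insert.prems(2) j])
      fix d assume d: "d \<in> B j"
      have "delta (x(j := e j d)) \<in> Q"
      proof (rule insert.IH)
        show "J \<subseteq> I" using insert.prems by simp
        show "x(j := e j d) \<in> C" by (rule upd_in_C[OF insert.prems(2) j e(1)[OF j d]])
        show "(x(j := e j d)) i \<in> e i ` B i" if "i \<in> I" "i \<notin> J" for i
          using that insert.prems(3)[of i] d by (cases "i = j") simp_all
      qed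
      then show "\<exists>a\<in>U. c j a = delta d" using e[OF j d] by (intro bexI[of _ "e j d"]) (simp_all add: U_def)
    qed
    then have "x j \<in> U" using C_D[OF insert.prems(2) j] by simp
    then show ?case by (simp add: U_def)
  qed
  from this[OF fin order_refl] have "\<And>x. x \<in> C \<Longrightarrow> delta x \<in> Q" by simp
  then show ?thesis using free_induct[of Q C] Q(1) unfolding T0 by simp
qed

text \<open>The coordinates of the pure tensor of \<open>x\<close> in the product basis.\<close>

definition w :: "('i \<Rightarrow> 'v) \<Rightarrow> ('i \<Rightarrow> 'b) \<Rightarrow> complex" where
  "w x b = (if b \<in> BB then \<Prod>i\<in>I. c i (x i) (b i) else 0)"

lemma c_finite: "i \<in> I \<Longrightarrow> a \<in> carrier (V i) \<Longrightarrow> finite {d. c i a d \<noteq> 0}"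
  "i \<in> I \<Longrightarrow> a \<in> carrier (V i) \<Longrightarrow> {d. c i a d \<noteq> 0} \<subseteq> B i"
  using module_hom_D(1)[OF c_hom] by simp_all

lemma w_closed: assumes x: "x \<in> C" shows "w x \<in> carrier (free_space BB)"
proof -
  have "{b. w x b \<noteq> 0} \<subseteq> PiE I (\<lambda>i. {d. c i (x i) d \<noteq> 0})"
  proof
    fix b assume "b \<in> {b. w x b \<noteq> 0}"
    then have b: "b \<in> BB" "(\<Prod>i\<in>I. c i (x i) (b i)) \<noteq> 0" by (simp_all add: w_def split: if_splits)
    have "\<And>i. i \<in> I \<Longrightarrow> c i (x i) (b i) \<noteq> 0" using b(2) fin by (metis prod_zero)
    then show "b \<in> PiE I (\<lambda>i. {d. c i (x i) d \<noteq> 0})" using b(1) by (simp add: PiE_iff)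
  qed
  moreover have "finite (PiE I (\<lambda>i. {d. c i (x i) d \<noteq> 0}))"
    using c_finite(1) C_D[OF x] fin by (intro finite_PiE) simp_all
  ultimately have "finite {b. w x b \<noteq> 0}" by (rule finite_subset)
  moreover have "{b. w x b \<noteq> 0} \<subseteq> BB" by (auto simp: w_def)
  ultimately show ?thesis by simp
qed

text \<open>The factor of \<open>w x b\<close> that is left when slot \<open>i\<close> is split off;
  it does not depend on \<open>x i\<close> or \<open>b i\<close>.\<close>

definition K :: "'i \<Rightarrow> ('i \<Rightarrow> 'v) \<Rightarrow> ('i \<Rightarrow> 'b) \<Rightarrow> complex" where
  "K i x b = (\<Prod>j\<in>I - {i}. c j (x j) (b j))"

lemma w_slot: "i \<in> I \<Longrightarrow> b \<in> BB \<Longrightarrow> w (x(i := a)) b = c i a (b i) * K i x b"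
  unfolding w_def K_def using fin by (simp add: prod.remove)

lemma w_E: assumes b: "b \<in> BB" shows "w (E b) = delta b"
proof
  fix d
  show "w (E b) d = delta b d"
  proof (cases "d \<in> BB")
    case True
    have "w (E b) d = (\<Prod>i\<in>I. delta (b i) (d i))"
      unfolding w_def using True b e(2) by (simp add: E_def PiE_iff)
    also have "\<dots> = delta b d"
    proof (cases "d = b")
      case True then show ?thesis by (simp add: delta_def)
    next
      case False
      have "\<exists>i\<in>I. d i \<noteq> b i"
      proof (rule ccontr)
        assume "\<not> (\<exists>i\<in>I. d i \<noteq> b i)"
        then have "d = b" by (intro PiE_ext[OF True b]) simp
        then show False using False by simp
      qed
      then obtain i where i: "i \<in> I" "d i \<noteq> b i" by blast
      then have "(\<Prod>i\<in>I. delta (b i) (d i)) = 0" using fin by (intro prod_zero bexI[of _ i]) (simp_all add: delta_def)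
      then show ?thesis using False by (simp add: delta_def)
    qed
    finally show ?thesis .
  next
    case False
    then have "d \<noteq> b" using b by auto
    then show ?thesis using False by (simp add: w_def delta_def)
  qed
qed

definition Phi :: "(('i \<Rightarrow> 'v) \<Rightarrow> complex) \<Rightarrow> ('i \<Rightarrow> 'b) \<Rightarrow> complex" where
  "Phi = lin_ext (free_space BB) w"

lemma Phi_hom: "Phi \<in> module_hom class_ring (free_space C) (free_space BB)"
  unfolding Phi_def by (intro lin_ext_hom free_space_module w_closed)

lemma Phi_delta: "x \<in> C \<Longrightarrow> Phi (delta x) = w x"
  unfolding Phi_def by (rule lin_ext_delta[of "free_space BB" C, OF free_space_module]) (rule w_closed)

lemma Phi_diff:
  "f \<in> carrier (free_space C) \<Longrightarrow> g \<in> carrier (free_space C) \<Longrightarrow> Phi (\<lambda>x. f x - g x) = (\<lambda>x. Phi f x - Phi g x)"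
  using hom_diff_free[OF free_space_module Phi_hom] by simp

lemma Phi_smult: "f \<in> carrier (free_space C) \<Longrightarrow> Phi (\<lambda>x. a * f x) = (\<lambda>x. a * Phi f x)"
  using module_hom_D(3)[OF Phi_hom, of a f] by simp

lemma w_off: "b \<notin> BB \<Longrightarrow> w x b = 0" by (simp add: w_def)

text \<open>By \<open>w_slot\<close> the coordinates of a pure tensor are linear in each slot, so
  every multilinearity relation is mapped to zero.\<close>

lemma Phi_N: assumes "f \<in> N" shows "Phi f = (\<lambda>b. 0)"
proof -
  have s0: "submodule class_ring {\<lambda>b. 0} (free_space BB)"
    by (rule submodule.intro[OF free_space_module]) simp_all
  have "N \<subseteq> {f \<in> carrier T0. Phi f \<in> {\<lambda>b. 0}}"
  proof (rule N_least)
    show "submodule class_ring {f \<in> carrier T0. Phi f \<in> {\<lambda>b. 0}} T0"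
      unfolding T0 by (rule preimage_submodule[OF free_space_module free_space_module Phi_hom s0])
    fix g assume g: "g \<in> tensor_relations I V"
    have gT: "g \<in> carrier T0" using g relations_closed by blast
    from g have "Phi g = (\<lambda>b. 0)"
    proof (rule relation_cases)
      fix x i a b assume x: "x \<in> C" and i: "i \<in> I" and ab: "a \<in> carrier (V i)" "b \<in> carrier (V i)"
      note u = upd_in_C[OF x i]
      note d = delta_T0[OF u]
      have "c i (a \<oplus>\<^bsub>V i\<^esub> b) = (\<lambda>d. c i a d + c i b d)" using module_hom_D(2)[OF c_hom[OF i] ab] by simp
      then have "w (x(i := a \<oplus>\<^bsub>V i\<^esub> b)) y - w (x(i := a)) y - w (x(i := b)) y = 0" for y
        using w_slot[OF i, of y x] w_off[of y] by (cases "y \<in> BB") (simp_all add: algebra_simps)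
      then show "Phi (\<lambda>y. (delta (x(i := a \<oplus>\<^bsub>V i\<^esub> b)) y - delta (x(i := a)) y) - delta (x(i := b)) y) = (\<lambda>b. 0)"
        unfolding Phi_diff[OF free_diff_closed[OF d[OF slot_closed(1)[OF i ab]] d[OF ab(1)]] d[OF ab(2)]]
          Phi_diff[OF d[OF slot_closed(1)[OF i ab]] d[OF ab(1)]]
          Phi_delta[OF u[OF slot_closed(1)[OF i ab]]] Phi_delta[OF u[OF ab(1)]] Phi_delta[OF u[OF ab(2)]] by simp
    next
      fix x i and r :: complex and a assume x: "x \<in> C" and i: "i \<in> I" and a: "a \<in> carrier (V i)"
      note u = upd_in_C[OF x i]
      note d = delta_T0[OF u]
      have "c i (r \<odot>\<^bsub>V i\<^esub> a) = (\<lambda>d. r * c i a d)" using module_hom_D(3)[OF c_hom[OF i] _ a, of r] by simp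
      then have "w (x(i := r \<odot>\<^bsub>V i\<^esub> a)) y - r * w (x(i := a)) y = 0" for y
        using w_slot[OF i, of y x] w_off[of y] by (cases "y \<in> BB") (simp_all add: algebra_simps)
      then show "Phi (\<lambda>y. delta (x(i := r \<odot>\<^bsub>V i\<^esub> a)) y - r * delta (x(i := a)) y) = (\<lambda>b. 0)"
        unfolding Phi_diff[OF d[OF slot_closed(2)[OF i a]] free_smult_closed[OF d[OF a]]] Phi_smult[OF d[OF a]]
          Phi_delta[OF u[OF slot_closed(2)[OF i a]]] Phi_delta[OF u[OF a]] by simp
    qed
    then show "g \<in> {f \<in> carrier T0. Phi f \<in> {\<lambda>b. 0}}" using gT by simp
  qed
  then show ?thesis using assms by blast
qed

text \<open>A section of \<open>Phi\<close>: a family of coordinates is sent to the corresponding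
  combination of the pure tensors of basis vectors.\<close>

definition Rm :: "(('i \<Rightarrow> 'b) \<Rightarrow> complex) \<Rightarrow> ('i \<Rightarrow> 'v) \<Rightarrow> complex" where
  "Rm = lin_ext (free_space C) (\<lambda>b. delta (E b))"

lemma Rm_hom: "S \<subseteq> BB \<Longrightarrow> Rm \<in> module_hom class_ring (free_space S) (free_space C)"
  unfolding Rm_def by (intro lin_ext_hom free_space_module delta_T0 E_in_C) blast

lemma Rm_delta: "b \<in> BB \<Longrightarrow> Rm (delta b) = delta (E b)"
  unfolding Rm_def by (rule lin_ext_delta[of "free_space C" BB, OF free_space_module]) (rule delta_T0[OF E_in_C])

lemma Phi_Rm: assumes "u \<in> carrier (free_space BB)" shows "Phi (Rm u) = u"
proof (rule hom_ext_free[OF free_space_module _ _ _ assms])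
  show "(\<lambda>u. Phi (Rm u)) \<in> module_hom class_ring (free_space BB) (free_space BB)"
    by (rule module_hom_comp[OF Rm_hom[OF order_refl] Phi_hom])
  show "(\<lambda>u. u) \<in> module_hom class_ring (free_space BB) (free_space BB)"
    by (intro module_hom_I refl)
  show "Phi (Rm (delta b)) = delta b" if "b \<in> BB" for b
    using Rm_delta[OF that] Phi_delta[OF E_in_C[OF that]] w_E[OF that] by simp
qed

text \<open>Both sides are linear in \<open>f\<close> and vanish on \<open>N\<close>, and they agree
  on the pure tensors \<open>E b\<close>; by \<open>T0_generated\<close> this determines
  them.\<close>

lemma cl_Rm_Phi: assumes "f \<in> carrier T0" shows "cl (Rm (Phi f)) = cl f"
proof -
  have h: "(\<lambda>f. cl (Rm (Phi f))) \<in> module_hom class_ring T0 T"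
    using module_hom_comp[OF module_hom_comp[OF Phi_hom Rm_hom[OF order_refl]] cl_hom[unfolded T0]]
    by (simp only: T0)
  have "{f \<in> carrier T0. cl (Rm (Phi f)) = cl f} = carrier T0"
  proof (rule T0_generated)
    show "submodule class_ring {f \<in> carrier T0. cl (Rm (Phi f)) = cl f} T0"
      by (rule equalizer_submodule[OF T0_module T_module h cl_hom])
    show "N \<subseteq> {f \<in> carrier T0. cl (Rm (Phi f)) = cl f}"
    proof
      fix f assume f: "f \<in> N"
      have "Rm (\<lambda>b. 0) = (\<lambda>x. 0)" using hom_zero[OF free_space_module free_space_module Rm_hom[OF order_refl]] by simp
      moreover have "(\<lambda>x. 0) \<in> N" using submodule.zero_closed[OF N_submodule] by (simp add: T0)
      ultimately have "cl (Rm (Phi f)) = cl f" using cl_zero f Phi_N[OF f] by simp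
      then show "f \<in> {f \<in> carrier T0. cl (Rm (Phi f)) = cl f}" using f submodule.subset[OF N_submodule] by blast
    qed
    fix b assume b: "b \<in> BB"
    have "delta (E b) \<in> carrier T0" using delta_T0[OF E_in_C[OF b]] by (simp only: T0)
    moreover have "Rm (Phi (delta (E b))) = delta (E b)"
      using Phi_delta[OF E_in_C[OF b]] w_E[OF b] Rm_delta[OF b] by simp
    ultimately show "delta (E b) \<in> {f \<in> carrier T0. cl (Rm (Phi f)) = cl f}" by simp
  qed
  then show ?thesis using assms by blast
qed

lemma cl_eq_iff:
  assumes f: "f \<in> carrier T0" and g: "g \<in> carrier T0"
  shows "cl f = cl g \<longleftrightarrow> Phi f = Phi g"
proof
  interpret F: Module.module class_ring T0 by (rule T0_module)
  assume "Phi f = Phi g"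
  then show "cl f = cl g" using cl_Rm_Phi[OF f] cl_Rm_Phi[OF g] by simp
next
  interpret F: Module.module class_ring T0 by (rule T0_module)
  interpret h: mod_hom class_ring T0 "free_space BB" Phi
    by (intro mod_hom.intro mod_hom_axioms.intro T0_module free_space_module) (use Phi_hom in \<open>simp only: T0\<close>)
  assume "cl f = cl g"
  then have "f \<ominus>\<^bsub>T0\<^esub> g \<in> N" using F.coset_eq_iff[OF N_submodule f g] by simp
  then have "Phi (f \<ominus>\<^bsub>T0\<^esub> g) = \<zero>\<^bsub>free_space BB\<^esub>" using Phi_N by simp
  then have *: "Phi f \<ominus>\<^bsub>free_space BB\<^esub> Phi g = \<zero>\<^bsub>free_space BB\<^esub>" using h.f_minus[OF f g] by simp
  have "Phi f = (Phi f \<ominus>\<^bsub>free_space BB\<^esub> Phi g) \<oplus>\<^bsub>free_space BB\<^esub> Phi g"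
    unfolding a_minus_def using h.f_im[OF f] h.f_im[OF g] h.N.M.a_assoc h.N.M.l_neg h.N.M.r_zero
    by (simp del: free_space_simps)
  also have "\<dots> = Phi g" unfolding * by simp
  finally show "Phi f = Phi g" .
qed

text \<open>The map that \<open>Phi\<close> induces on classes; \<open>cl_eq_iff\<close> makes it
  independent of the chosen representative.\<close>

definition Psi :: "(('i \<Rightarrow> 'v) \<Rightarrow> complex) set \<Rightarrow> ('i \<Rightarrow> 'b) \<Rightarrow> complex" where
  "Psi t = Phi (SOME f. f \<in> carrier T0 \<and> t = cl f)"

lemma Psi_cl: assumes f: "f \<in> carrier T0" shows "Psi (cl f) = Phi f"
proof -
  let ?g = "SOME g. g \<in> carrier T0 \<and> cl f = cl g"
  have "?g \<in> carrier T0 \<and> cl f = cl ?g" by (rule someI[of _ f]) (simp add: f)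
  then have g: "?g \<in> carrier T0" "cl f = cl ?g" by (rule conjunct1, rule conjunct2)
  show ?thesis unfolding Psi_def using cl_eq_iff[OF f g(1)] g(2) by (rule iffD1[THEN sym])
qed

theorem Psi_coords: "coords T BB Psi"
  unfolding coords_def
proof (intro conjI)
  interpret F: Module.module class_ring T0 by (rule T0_module)
  note Ph = Phi_hom[folded T0]
  show "Module.module class_ring T" by (rule T_module)
  show "Psi \<in> module_hom class_ring T (free_space BB)"
  proof (rule module_hom_I)
    fix t assume "t \<in> carrier T"
    then obtain f where f: "f \<in> carrier T0" "t = cl f" by (rule T_cases)
    show "Psi t \<in> carrier (free_space BB)" unfolding f(2) Psi_cl[OF f(1)] by (rule module_hom_D(1)[OF Ph f(1)])
    {
      fix u assume "u \<in> carrier T"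
      then obtain g where g: "g \<in> carrier T0" "u = cl g" by (rule T_cases)
      show "Psi (t \<oplus>\<^bsub>T\<^esub> u) = Psi t \<oplus>\<^bsub>free_space BB\<^esub> Psi u"
        unfolding f(2) g(2) module_hom_D(2)[OF cl_hom f(1) g(1), symmetric] Psi_cl[OF f(1)] Psi_cl[OF g(1)]
          Psi_cl[OF F.M.a_closed[OF f(1) g(1)]] by (rule module_hom_D(2)[OF Ph f(1) g(1)])
    }
    fix r :: complex assume r: "r \<in> carrier class_ring"
    show "Psi (r \<odot>\<^bsub>T\<^esub> t) = r \<odot>\<^bsub>free_space BB\<^esub> Psi t"
      unfolding f(2) module_hom_D(3)[OF cl_hom r f(1), symmetric] Psi_cl[OF f(1)]
        Psi_cl[OF F.smult_closed[OF r f(1)]] by (rule module_hom_D(3)[OF Ph r f(1)])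
  qed
  show "bij_betw Psi (carrier T) (carrier (free_space BB))"
    unfolding bij_betw_def
  proof
    show "inj_on Psi (carrier T)"
    proof (rule inj_onI)
      fix t u assume t: "t \<in> carrier T" and u: "u \<in> carrier T" and eq: "Psi t = Psi u"
      obtain f where f: "f \<in> carrier T0" "t = cl f" using t by (rule T_cases)
      obtain g where g: "g \<in> carrier T0" "u = cl g" using u by (rule T_cases)
      show "t = u" using eq unfolding f(2) g(2) Psi_cl[OF f(1)] Psi_cl[OF g(1)] cl_eq_iff[OF f(1) g(1)] .
    qed
    show "Psi ` carrier T = carrier (free_space BB)"
    proof
      show "Psi ` carrier T \<subseteq> carrier (free_space BB)"
      proof
        fix y assume "y \<in> Psi ` carrier T"
        then obtain t where t: "t \<in> carrier T" "y = Psi t" by blast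
        obtain f where f: "f \<in> carrier T0" "t = cl f" using t(1) by (rule T_cases)
        show "y \<in> carrier (free_space BB)" unfolding t(2) f(2) Psi_cl[OF f(1)] by (rule module_hom_D(1)[OF Ph f(1)])
      qed
      show "carrier (free_space BB) \<subseteq> Psi ` carrier T"
      proof
        fix u assume u: "u \<in> carrier (free_space BB)"
        have r: "Rm u \<in> carrier T0" using module_hom_D(1)[OF Rm_hom[OF order_refl] u] by (simp only: T0)
        have "u = Psi (cl (Rm u))" unfolding Psi_cl[OF r] by (rule Phi_Rm[OF u, symmetric])
        then show "u \<in> Psi ` carrier T" using module_hom_D(1)[OF cl_hom r] by (rule image_eqI)
      qed
    qed
  qed
qed

end

context tensor_coords
begin

text \<open>The contraction of all slots but \<open>i\<close> commutes with the operators acting on the slot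
  \<open>i\<close> only, and thereby reduces the invariants of the tensor product
  to those of the factors.\<close>

definition contract :: "'i \<Rightarrow> ('i \<Rightarrow> 'b) \<Rightarrow> (('i \<Rightarrow> 'v) \<Rightarrow> complex) \<Rightarrow> 'v" where
  "contract i b = lin_ext (V i) (\<lambda>x. K i x b \<odot>\<^bsub>V i\<^esub> x i)"

lemma contract_hom: assumes "i \<in> I" shows "contract i b \<in> module_hom class_ring (free_space C) (V i)"
  unfolding contract_def by (intro lin_ext_hom mod[OF assms] slot_closed(2)[OF assms] C_D assms)

lemma contract_delta:
  assumes "i \<in> I" "x \<in> C" shows "contract i b (delta x) = K i x b \<odot>\<^bsub>V i\<^esub> x i"
  unfolding contract_def
  by (rule lin_ext_delta[of "V i" C "\<lambda>x. K i x b \<odot>\<^bsub>V i\<^esub> x i", OF mod[OF assms(1)] _ assms(2)])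
    (intro slot_closed(2)[OF assms(1)] C_D assms)

text \<open>The contraction is the slice of the array of coordinates through \<open>b\<close> in the
  direction \<open>i\<close>. Both sides are linear in \<open>f\<close>, so pure tensors
  suffice.\<close>

lemma coord_contract:
  assumes i: "i \<in> I" and b: "b \<in> BB" and d: "d \<in> B i" and f: "f \<in> carrier (free_space C)"
  shows "c i (contract i b f) d = Phi f (b(i := d))"
proof -
  have b': "b(i := d) \<in> BB" using b i d by (auto simp: PiE_iff extensional_def)
  \<comment> \<open>A space of dimension one, so that a scalar-valued functional is a homomorphism
    into a free space and \<open>hom_ext_free\<close> applies.\<close>
  let ?X = "free_space (UNIV :: unit set)"
  have fu: "finite {x :: unit. g x \<noteq> 0}" for g :: "unit \<Rightarrow> complex" by (rule finite_subset[of _ UNIV]) simp_all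
  note ci = c_hom[OF i] and ch = contract_hom[OF i, of b]
  have "(\<lambda>_ :: unit. c i (contract i b f) d) = (\<lambda>_. Phi f (b(i := d)))"
  proof (rule hom_ext_free[where X = ?X and S = C and f = "\<lambda>f _. c i (contract i b f) d"
        and g = "\<lambda>f _. Phi f (b(i := d))"])
    show "(\<lambda>f _. c i (contract i b f) d) \<in> module_hom class_ring (free_space C) ?X"
    proof (rule module_hom_I)
      show "(\<lambda>_. c i (contract i b (f \<oplus>\<^bsub>free_space C\<^esub> g)) d) =
          (\<lambda>_. c i (contract i b f) d) \<oplus>\<^bsub>?X\<^esub> (\<lambda>_. c i (contract i b g) d)"
        if "f \<in> carrier (free_space C)" "g \<in> carrier (free_space C)" for f g
        unfolding module_hom_D(2)[OF ch that]
          module_hom_D(2)[OF ci module_hom_D(1)[OF ch that(1)] module_hom_D(1)[OF ch that(2)]] by simp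
      show "(\<lambda>_. c i (contract i b (r \<odot>\<^bsub>free_space C\<^esub> f)) d) = r \<odot>\<^bsub>?X\<^esub> (\<lambda>_. c i (contract i b f) d)"
        if "r \<in> carrier class_ring" "f \<in> carrier (free_space C)" for r f
        unfolding module_hom_D(3)[OF ch that] module_hom_D(3)[OF ci that(1) module_hom_D(1)[OF ch that(2)]] by simp
    qed (simp add: fu)
    show "(\<lambda>f _. Phi f (b(i := d))) \<in> module_hom class_ring (free_space C) ?X"
    proof (rule module_hom_I)
      show "(\<lambda>_. Phi (f \<oplus>\<^bsub>free_space C\<^esub> g) (b(i := d))) = (\<lambda>_. Phi f (b(i := d))) \<oplus>\<^bsub>?X\<^esub> (\<lambda>_. Phi g (b(i := d)))"
        if "f \<in> carrier (free_space C)" "g \<in> carrier (free_space C)" for f g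
        unfolding module_hom_D(2)[OF Phi_hom that] by simp
      show "(\<lambda>_. Phi (r \<odot>\<^bsub>free_space C\<^esub> f) (b(i := d))) = r \<odot>\<^bsub>?X\<^esub> (\<lambda>_. Phi f (b(i := d)))"
        if "r \<in> carrier class_ring" "f \<in> carrier (free_space C)" for r f
        unfolding module_hom_D(3)[OF Phi_hom that] by simp
    qed (simp add: fu)
    fix x assume x: "x \<in> C"
    have "c i (contract i b (delta x)) d = K i x b * c i (x i) d"
      unfolding contract_delta[OF i x] using module_hom_D(3)[OF ci _ C_D[OF x i], of "K i x b"] by simp
    moreover have "w x (b(i := d)) = c i (x i) d * K i x (b(i := d))"
      using w_slot[OF i b', of x "x i"] by simp
    moreover have "K i x (b(i := d)) = K i x b" unfolding K_def by (intro prod.cong) simp_all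
    ultimately show "(\<lambda>_ :: unit. c i (contract i b (delta x)) d) = (\<lambda>_. Phi (delta x) (b(i := d)))"
      using Phi_delta[OF x] by (simp add: mult.commute)
  qed (rule free_space_module, rule f)
  then show ?thesis by (rule fun_cong)
qed

text \<open>Operators that are trivial in the other slots leave the coefficient
  \<open>K i x b\<close> unchanged, and \<open>\<phi> i\<close> is linear.\<close>

lemma contract_push:
  assumes i: "i \<in> I" and \<phi>: "endos \<phi>" and id: "\<forall>j\<in>I - {i}. \<forall>y\<in>carrier (V j). \<phi> j y = y"
    and f: "f \<in> carrier (free_space C)"
  shows "contract i b (tensor_push I \<phi> f) = \<phi> i (contract i b f)"
proof (rule hom_ext_free[where X = "V i" and S = C and f = "\<lambda>f. contract i b (tensor_push I \<phi> f)"
      and g = "\<lambda>f. \<phi> i (contract i b f)", OF mod[OF i] _ _ _ f])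
  note ch = contract_hom[OF i, of b]
  show "(\<lambda>f. contract i b (tensor_push I \<phi> f)) \<in> module_hom class_ring (free_space C) (V i)"
    by (rule module_hom_comp[OF push_hom[OF \<phi>, unfolded T0] ch])
  show "(\<lambda>f. \<phi> i (contract i b f)) \<in> module_hom class_ring (free_space C) (V i)"
    by (rule module_hom_comp[OF ch endos_D[OF \<phi> i]])
  fix x assume x: "x \<in> C"
  have "K i (tuple_map \<phi> x) b = K i x b"
    unfolding K_def using id C_D[OF x] by (intro prod.cong) (simp_all add: tuple_map_def)
  moreover have "tuple_map \<phi> x i = \<phi> i (x i)" using i by (simp add: tuple_map_def)
  moreover have "\<phi> i (K i x b \<odot>\<^bsub>V i\<^esub> x i) = K i x b \<odot>\<^bsub>V i\<^esub> \<phi> i (x i)"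
    using module_hom_D(3)[OF endos_D[OF \<phi> i] _ C_D[OF x i], of "K i x b"] by simp
  ultimately show "contract i b (tensor_push I \<phi> (delta x)) = \<phi> i (contract i b (delta x))"
    unfolding push_delta[OF \<phi> x] contract_delta[OF i x] contract_delta[OF i tuple_map_closed[OF \<phi> x]] by simp
qed

text \<open>The slices of an invariant tensor in direction \<open>i\<close> are fixed by the
  operators concentrated in slot \<open>i\<close>; by \<open>ample\<close> they lie in
  \<open>W i\<close>, which confines the support in that direction to \<open>B' i\<close>.
  Conversely, a tensor with such support is a combination of pure tensors all of whose factors are
  fixed.\<close>

theorem tensor_invariants:
  assumes B': "\<And>i. i \<in> I \<Longrightarrow> B' i \<subseteq> B i"
    and W: "\<And>i x. i \<in> I \<Longrightarrow> x \<in> carrier (V i) \<Longrightarrow> x \<in> W i \<longleftrightarrow> {b. c i x b \<noteq> 0} \<subseteq> B' i"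
    and endo: "\<And>\<phi>. \<phi> \<in> Q \<Longrightarrow> endos \<phi>"
    and fixW: "\<And>\<phi> i x. \<phi> \<in> Q \<Longrightarrow> i \<in> I \<Longrightarrow> x \<in> carrier (V i) \<Longrightarrow> x \<in> W i \<Longrightarrow> \<phi> i x = x"
    and ample: "\<And>i x. i \<in> I \<Longrightarrow> x \<in> carrier (V i) \<Longrightarrow>
      (\<And>\<phi>. \<phi> \<in> Q \<Longrightarrow> \<forall>j\<in>I - {i}. \<forall>y\<in>carrier (V j). \<phi> j y = y \<Longrightarrow> \<phi> i x = x) \<Longrightarrow> x \<in> W i"
    and t: "t \<in> carrier T"
  shows "(\<forall>\<phi>\<in>Q. tensor_map I V \<phi> t = t) \<longleftrightarrow> {b. Psi t b \<noteq> 0} \<subseteq> PiE I B'"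
proof
  obtain f where f: "f \<in> carrier T0" "t = cl f" using t by (rule T_cases)
  have f': "f \<in> carrier (free_space C)" using f(1) by (simp only: T0)
  assume inv: "\<forall>\<phi>\<in>Q. tensor_map I V \<phi> t = t"
  show "{b. Psi t b \<noteq> 0} \<subseteq> PiE I B'"
  proof
    fix b assume "b \<in> {b. Psi t b \<noteq> 0}"
    then have bnz: "Phi f b \<noteq> 0" unfolding f(2) Psi_cl[OF f(1)] by simp
    have bB: "b \<in> BB" using module_hom_D(1)[OF Phi_hom f'] bnz by auto
    have "b i \<in> B' i" if i: "i \<in> I" for i
    proof -
      define u where "u = contract i b f"
      have u: "u \<in> carrier (V i)" unfolding u_def by (rule module_hom_D(1)[OF contract_hom[OF i] f'])
      have "u \<in> W i"
      proof (rule ample[OF i u])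
        fix \<phi> assume \<phi>: "\<phi> \<in> Q" and id: "\<forall>j\<in>I - {i}. \<forall>y\<in>carrier (V j). \<phi> j y = y"
        note en = endo[OF \<phi>]
        have pT: "tensor_push I \<phi> f \<in> carrier T0" by (rule module_hom_D(1)[OF push_hom[OF en] f(1)])
        have "cl (tensor_push I \<phi> f) = cl f"
          using inv \<phi> unfolding f(2) tensor_map_cl[OF en f(1), symmetric] by simp
        then have eq: "Phi (tensor_push I \<phi> f) = Phi f" using cl_eq_iff[OF pT f(1)] by simp
        have pu: "\<phi> i u \<in> carrier (V i)" by (rule module_hom_D(1)[OF endos_D[OF en i] u])
        \<comment> \<open>Vectors are compared through their coordinates: on \<open>B i\<close>
          these are values of \<open>Phi\<close>, which the invariance of \<open>t\<close>
          preserves, and elsewhere both sides vanish.\<close>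
        have "c i (\<phi> i u) d = c i u d" for d
        proof (cases "d \<in> B i")
          case True
          have "c i (\<phi> i u) d = Phi (tensor_push I \<phi> f) (b(i := d))"
            unfolding u_def contract_push[OF i en id f', symmetric]
            by (rule coord_contract[OF i bB True]) (use pT in \<open>simp only: T0\<close>)
          also have "\<dots> = c i u d" unfolding eq u_def by (rule coord_contract[OF i bB True f', symmetric])
          finally show ?thesis .
        next
          case False
          then show ?thesis using c_finite(2)[OF i pu] c_finite(2)[OF i u] by (metis (mono_tags) mem_Collect_eq subsetD)
        qed
        then have "c i (\<phi> i u) = c i u" by (rule ext)
        then show "\<phi> i u = u" by (rule inj_onD[OF bij_betw_imp_inj_on[OF c_bij[OF i]] _ pu u])
      qed
      then have "{d. c i u d \<noteq> 0} \<subseteq> B' i" using W[OF i u] by simp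
      moreover have "b i \<in> B i" using bB i by (simp add: PiE_iff)
      then have "c i u (b i) = Phi f b" unfolding u_def using coord_contract[OF i bB _ f', of "b i"] by simp
      ultimately show ?thesis using bnz by auto
    qed
    then show "b \<in> PiE I B'" using bB by (simp add: PiE_iff)
  qed
next
  assume supp: "{b. Psi t b \<noteq> 0} \<subseteq> PiE I B'"
  obtain f where f: "f \<in> carrier T0" "t = cl f" using t by (rule T_cases)
  have f': "f \<in> carrier (free_space C)" using f(1) by (simp only: T0)
  have sub: "PiE I B' \<subseteq> BB" by (rule PiE_mono[OF B'])
  \<comment> \<open>Recovering \<open>t\<close> from its coordinates by \<open>Rm\<close> exhibits
    it as a combination of the tensors \<open>E b\<close> with \<open>b\<close> in the smaller
    product.\<close>
  define u where "u = Phi f"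
  have u: "u \<in> carrier (free_space (PiE I B'))"
    using module_hom_D(1)[OF Phi_hom f'] supp unfolding f(2) Psi_cl[OF f(1)] u_def by simp
  have tu: "t = cl (Rm u)" unfolding f(2) u_def by (rule cl_Rm_Phi[OF f(1), symmetric])
  note Rh = Rm_hom[OF sub]
  show "\<forall>\<phi>\<in>Q. tensor_map I V \<phi> t = t"
  proof
    fix \<phi> assume \<phi>: "\<phi> \<in> Q"
    note en = endo[OF \<phi>]
    have "tensor_push I \<phi> (Rm u) = Rm u"
    proof (rule hom_ext_free[where X = "free_space C" and S = "PiE I B'" and f = "\<lambda>u. tensor_push I \<phi> (Rm u)"
          and g = Rm, OF free_space_module _ Rh _ u])
      show "(\<lambda>u. tensor_push I \<phi> (Rm u)) \<in> module_hom class_ring (free_space (PiE I B')) (free_space C)"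
        by (rule module_hom_comp[OF Rh push_hom[OF en, unfolded T0]])
      fix b assume b: "b \<in> PiE I B'"
      then have bB: "b \<in> BB" using sub by blast
      have "\<phi> i (e i (b i)) = e i (b i)" if i: "i \<in> I" for i
      proof -
        have bi: "b i \<in> B' i" "b i \<in> B i" using b bB i by (simp_all add: PiE_iff)
        have "{d. c i (e i (b i)) d \<noteq> 0} \<subseteq> B' i" unfolding e(2)[OF i bi(2)] using bi(1) by (auto simp: delta_def)
        then have "e i (b i) \<in> W i" using W[OF i e(1)[OF i bi(2)]] by simp
        then show ?thesis by (rule fixW[OF \<phi> i e(1)[OF i bi(2)]])
      qed
      then have "tuple_map \<phi> (E b) = E b" by (auto simp: tuple_map_def E_def)
      then show "tensor_push I \<phi> (Rm (delta b)) = Rm (delta b)"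
        unfolding Rm_delta[OF bB] push_delta[OF en E_in_C[OF bB]] by simp
    qed
    moreover have "Rm u \<in> carrier T0" using module_hom_D(1)[OF Rh u] by (simp only: T0)
    ultimately show "tensor_map I V \<phi> t = t" unfolding tu using tensor_map_cl[OF en] by simp
  qed
qed

end

section \<open>Direct sums and functions on double cosets\<close>

lemma direct_sum_isomorphic:
  assumes A: "finite A" and iso: "\<And>F. F \<in> A \<Longrightarrow> modules_isomorphic R (W F) (W' F)"
  shows "modules_isomorphic R (direct_sum_family A W) (direct_sum_family A W')"
proof -
  have "\<forall>F. \<exists>f. F \<in> A \<longrightarrow> f \<in> module_hom R (W F) (W' F) \<and> bij_betw f (carrier (W F)) (carrier (W' F))"
    using iso unfolding modules_isomorphic_def by blast
  then obtain f where "\<forall>F. F \<in> A \<longrightarrow> f F \<in> module_hom R (W F) (W' F) \<and> bij_betw (f F) (carrier (W F)) (carrier (W' F))"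
    by (rule choice[THEN exE])
  then have f: "\<And>F. F \<in> A \<Longrightarrow> f F \<in> module_hom R (W F) (W' F)" "\<And>F. F \<in> A \<Longrightarrow> bij_betw (f F) (carrier (W F)) (carrier (W' F))"
    by simp_all
  \<comment> \<open>For a finite index set the condition of finite support in
    \<open>direct_sum_family\<close> is automatic.\<close>
  have c: "carrier (direct_sum_family A W) = (\<Pi>\<^sub>E F\<in>A. carrier (W F))" for W :: "'a \<Rightarrow> ('r, 'x) module"
    using A by (simp add: direct_sum_family_def)
  define h where "h x = (\<lambda>F\<in>A. f F (x F))" for x
  have "h \<in> module_hom R (direct_sum_family A W) (direct_sum_family A W')"
  proof (rule module_hom_I)
    show "h x \<in> carrier (direct_sum_family A W')" if "x \<in> carrier (direct_sum_family A W)" for x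
      using that unfolding c h_def by (simp add: PiE_iff module_hom_D(1)[OF f(1)])
    show "h (x \<oplus>\<^bsub>direct_sum_family A W\<^esub> y) = h x \<oplus>\<^bsub>direct_sum_family A W'\<^esub> h y"
      if "x \<in> carrier (direct_sum_family A W)" "y \<in> carrier (direct_sum_family A W)" for x y
      using that unfolding c
      by (intro ext) (simp add: direct_sum_family_def h_def PiE_iff module_hom_D(2)[OF f(1)])
    show "h (r \<odot>\<^bsub>direct_sum_family A W\<^esub> x) = r \<odot>\<^bsub>direct_sum_family A W'\<^esub> h x"
      if "r \<in> carrier R" "x \<in> carrier (direct_sum_family A W)" for r x
      using that unfolding c
      by (intro ext) (simp add: direct_sum_family_def h_def PiE_iff module_hom_D(3)[OF f(1)])
  qed
  moreover have "bij_betw h (carrier (direct_sum_family A W)) (carrier (direct_sum_family A W'))"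
    unfolding c
  proof (rule bij_betw_imageI)
    show "inj_on h (\<Pi>\<^sub>E F\<in>A. carrier (W F))"
    proof (rule inj_onI)
      fix x y assume x: "x \<in> (\<Pi>\<^sub>E F\<in>A. carrier (W F))" and y: "y \<in> (\<Pi>\<^sub>E F\<in>A. carrier (W F))" and eq: "h x = h y"
      show "x = y"
      proof (rule PiE_ext[OF x y])
        fix F assume F: "F \<in> A"
        have "f F (x F) = f F (y F)" using fun_cong[OF eq, of F] F by (simp add: h_def)
        then show "x F = y F"
          using inj_onD[OF bij_betw_imp_inj_on[OF f(2)[OF F]], of "x F" "y F"] x y F by (simp add: PiE_iff)
      qed
    qed
    show "h ` (\<Pi>\<^sub>E F\<in>A. carrier (W F)) = (\<Pi>\<^sub>E F\<in>A. carrier (W' F))"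
    proof
      show "h ` (\<Pi>\<^sub>E F\<in>A. carrier (W F)) \<subseteq> (\<Pi>\<^sub>E F\<in>A. carrier (W' F))"
        by (rule image_subsetI) (simp add: h_def PiE_iff module_hom_D(1)[OF f(1)])
      show "(\<Pi>\<^sub>E F\<in>A. carrier (W' F)) \<subseteq> h ` (\<Pi>\<^sub>E F\<in>A. carrier (W F))"
      proof
        fix y assume y: "y \<in> (\<Pi>\<^sub>E F\<in>A. carrier (W' F))"
        define x where "x = (\<lambda>F\<in>A. inv_into (carrier (W F)) (f F) (y F))"
        have im: "y F \<in> f F ` carrier (W F)" if "F \<in> A" for F
          using f(2)[OF that] y that by (simp add: bij_betw_def PiE_iff)
        have x: "x \<in> (\<Pi>\<^sub>E F\<in>A. carrier (W F))" using inv_into_into[OF im] by (simp add: x_def PiE_iff)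
        have yx: "y = h x"
        proof
          fix F show "y F = h x F"
            using f_inv_into_f[OF im, of F] y by (cases "F \<in> A") (simp_all add: h_def x_def PiE_iff extensional_def)
        qed
        show "y \<in> h ` (\<Pi>\<^sub>E F\<in>A. carrier (W F))" unfolding yx by (rule imageI[OF x])
      qed
    qed
  qed
  ultimately show ?thesis unfolding modules_isomorphic_def by blast
qed

text \<open>Evaluation at representatives of the double cosets \<open>P \ G / K\<close>.\<close>

lemma mackey_bij:
  fixes G :: "('g, 'z) monoid_scheme" (structure)
  assumes G: "group G" and P: "subgroup P G" and K: "subgroup K G"
    and \<sigma>c: "\<And>p t. p \<in> P \<Longrightarrow> t \<in> T \<Longrightarrow> \<sigma> p t \<in> T"
    and \<sigma>m: "\<And>p q t. p \<in> P \<Longrightarrow> q \<in> P \<Longrightarrow> t \<in> T \<Longrightarrow> \<sigma> (p \<otimes> q) t = \<sigma> p (\<sigma> q t)"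
    and \<sigma>1: "\<And>t. t \<in> T \<Longrightarrow> \<sigma> \<one> t = t"
    and g: "\<And>F. F \<in> A \<Longrightarrow> g F \<in> carrier G"
    and cover: "\<And>x. x \<in> carrier G \<Longrightarrow> \<exists>F\<in>A. \<exists>p\<in>P. \<exists>k\<in>K. x = p \<otimes> g F \<otimes> k"
    and unique: "\<And>F F' p k. F \<in> A \<Longrightarrow> F' \<in> A \<Longrightarrow> p \<in> P \<Longrightarrow> k \<in> K \<Longrightarrow> p \<otimes> g F \<otimes> k = g F' \<Longrightarrow> F = F'"
  shows "bij_betw (\<lambda>f. \<lambda>F\<in>A. f (g F))
    {f \<in> carrier G \<rightarrow>\<^sub>E T. (\<forall>p\<in>P. \<forall>x\<in>carrier G. f (p \<otimes> x) = \<sigma> p (f x)) \<and>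
      (\<forall>x\<in>carrier G. \<forall>k\<in>K. f (x \<otimes> k) = f x)}
    (\<Pi>\<^sub>E F\<in>A. {t \<in> T. \<forall>p\<in>P. \<forall>k\<in>K. p \<otimes> g F = g F \<otimes> k \<longrightarrow> \<sigma> p t = t})"
    (is "bij_betw ?ev ?Fn (\<Pi>\<^sub>E F\<in>A. ?TF F)")
proof (rule bij_betw_imageI)
  interpret G: group G by (rule G)
  interpret P: subgroup P G by (rule P)
  interpret K: subgroup K G by (rule K)
  have Pc: "p \<in> carrier G" if "p \<in> P" for p using P.subset that by blast
  have Kc: "k \<in> carrier G" if "k \<in> K" for k using K.subset that by blast
  have cover_cases: thesis if "x \<in> carrier G" "\<And>F p k. F \<in> A \<Longrightarrow> p \<in> P \<Longrightarrow> k \<in> K \<Longrightarrow> x = p \<otimes> g F \<otimes> k \<Longrightarrow> thesis" for x thesis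
    using cover[OF that(1)] that(2) by (elim bexE)
  have can: "inv x \<otimes> (x \<otimes> y) = y" "x \<otimes> (inv x \<otimes> y) = y" if "x \<in> carrier G" "y \<in> carrier G" for x y
    using that by (simp_all flip: G.m_assoc)
  have val: "f (p \<otimes> g F \<otimes> k) = \<sigma> p (f (g F))" if f: "f \<in> ?Fn" and "F \<in> A" "p \<in> P" "k \<in> K" for f F p k
  proof -
    have "f (p \<otimes> g F \<otimes> k) = f (p \<otimes> g F)" using f G.m_closed[OF Pc[OF that(3)] g[OF that(2)]] that(4) by blast
    also have "\<dots> = \<sigma> p (f (g F))" using f that(3) g[OF that(2)] by blast
    finally show ?thesis .
  qed
  show "inj_on ?ev ?Fn"
  proof (rule inj_onI)
    fix f f' assume f: "f \<in> ?Fn" and f': "f' \<in> ?Fn" and eq: "?ev f = ?ev f'"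
    have fE: "f \<in> carrier G \<rightarrow>\<^sub>E T" "f' \<in> carrier G \<rightarrow>\<^sub>E T" using f f' by simp_all
    show "f = f'"
    proof (rule PiE_ext[OF fE])
      fix x assume "x \<in> carrier G"
      then obtain F p k where x: "F \<in> A" "p \<in> P" "k \<in> K" "x = p \<otimes> g F \<otimes> k"
        by (rule cover_cases)
      have "f (g F) = f' (g F)" using fun_cong[OF eq, of F] x(1) by simp
      then show "f x = f' x" unfolding x(4) val[OF f x(1-3)] val[OF f' x(1-3)] by simp
    qed
  qed
  show "?ev ` ?Fn = (\<Pi>\<^sub>E F\<in>A. ?TF F)"
  proof
    show "?ev ` ?Fn \<subseteq> (\<Pi>\<^sub>E F\<in>A. ?TF F)"
    proof (rule image_subsetI)
      fix f assume f: "f \<in> ?Fn"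
      have "f (g F) \<in> ?TF F" if F: "F \<in> A" for F
      proof -
        have "f (g F) \<in> T" using f g[OF F] by (simp add: PiE_iff)
        moreover have "\<sigma> p (f (g F)) = f (g F)" if "p \<in> P" "k \<in> K" "p \<otimes> g F = g F \<otimes> k" for p k
        proof -
          have "\<sigma> p (f (g F)) = f (p \<otimes> g F)" using f that(1) g[OF F] by simp
          also have "\<dots> = f (g F)" unfolding that(3) using f that(2) g[OF F] by simp
          finally show ?thesis .
        qed
        ultimately show ?thesis by blast
      qed
      then show "?ev f \<in> (\<Pi>\<^sub>E F\<in>A. ?TF F)" by (simp only: restrict_PiE_iff) blast
    qed
    show "(\<Pi>\<^sub>E F\<in>A. ?TF F) \<subseteq> ?ev ` ?Fn"
    proof
      fix h assume h: "h \<in> (\<Pi>\<^sub>E F\<in>A. ?TF F)"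
      have hT: "h F \<in> T" and hfix: "\<And>p k. p \<in> P \<Longrightarrow> k \<in> K \<Longrightarrow> p \<otimes> g F = g F \<otimes> k \<Longrightarrow> \<sigma> p (h F) = h F" if "F \<in> A" for F
        using PiE_mem[OF h that] by blast+
      \<comment> \<open>Two presentations of one element have the same index by
        \<open>unique\<close>. The elements of \<open>P\<close> then differ by a \<open>q\<close>
        that can be moved across \<open>g F\<close> into \<open>K\<close>, and such a
        \<open>q\<close> fixes \<open>h F\<close>.\<close>
      have wd: "\<sigma> p (h F) = \<sigma> p' (h F')"
        if a: "F \<in> A" "p \<in> P" "k \<in> K" and b: "F' \<in> A" "p' \<in> P" "k' \<in> K" and eq: "p \<otimes> g F \<otimes> k = p' \<otimes> g F' \<otimes> k'" for F p k F' p' k'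
      proof -
        note c = Pc[OF a(2)] Kc[OF a(3)] Pc[OF b(2)] Kc[OF b(3)] g[OF a(1)] g[OF b(1)]
        define q where "q = inv p' \<otimes> p"
        define l where "l = k \<otimes> inv k'"
        have q: "q \<in> P" and l: "l \<in> K" unfolding q_def l_def using a b by simp_all
        have "q \<otimes> g F \<otimes> l = inv p' \<otimes> (p \<otimes> g F \<otimes> k) \<otimes> inv k'"
          unfolding q_def l_def using c by (simp add: G.m_assoc)
        also have "\<dots> = g F'" unfolding eq using c by (simp add: G.m_assoc can)
        finally have e: "q \<otimes> g F \<otimes> l = g F'" .
        have F: "F = F'" by (rule unique[OF a(1) b(1) q l e])
        have "q \<otimes> g F = (q \<otimes> g F \<otimes> l) \<otimes> inv l" using c Pc[OF q] Kc[OF l] by (simp add: G.m_assoc)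
        also have "\<dots> = g F \<otimes> inv l" unfolding e by (simp only: F)
        finally have "\<sigma> q (h F) = h F" by (rule hfix[OF a(1) q K.m_inv_closed[OF l]])
        moreover have "p = p' \<otimes> q" unfolding q_def using c by (simp add: can)
        ultimately show ?thesis using \<sigma>m[OF b(2) q hT[OF a(1)]] F by simp
      qed
      \<comment> \<open>The value is prescribed by any presentation of \<open>x\<close>;
        \<open>cover\<close> provides one, and by \<open>wd\<close> the choice does not
        matter.\<close>
      define f where "f = (\<lambda>x\<in>carrier G. SOME y. \<exists>F\<in>A. \<exists>p\<in>P. \<exists>k\<in>K. x = p \<otimes> g F \<otimes> k \<and> y = \<sigma> p (h F))"
      have fv: "f (p \<otimes> g F \<otimes> k) = \<sigma> p (h F)" if a: "F \<in> A" "p \<in> P" "k \<in> K" for F p k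
      proof -
        let ?x = "p \<otimes> g F \<otimes> k"
        have x: "?x \<in> carrier G" using Pc[OF a(2)] Kc[OF a(3)] g[OF a(1)] by simp
        have "(SOME y. \<exists>F\<in>A. \<exists>p\<in>P. \<exists>k\<in>K. ?x = p \<otimes> g F \<otimes> k \<and> y = \<sigma> p (h F)) = \<sigma> p (h F)"
        proof (rule some_equality)
          show "\<exists>F'\<in>A. \<exists>p'\<in>P. \<exists>k'\<in>K. ?x = p' \<otimes> g F' \<otimes> k' \<and> \<sigma> p (h F) = \<sigma> p' (h F')"
            by (intro bexI[OF _ a(1)] bexI[OF _ a(2)] bexI[OF _ a(3)] conjI refl)
          fix y assume "\<exists>F'\<in>A. \<exists>p'\<in>P. \<exists>k'\<in>K. ?x = p' \<otimes> g F' \<otimes> k' \<and> y = \<sigma> p' (h F')"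
          then obtain F' p' k' where b: "F' \<in> A" "p' \<in> P" "k' \<in> K" "?x = p' \<otimes> g F' \<otimes> k'" "y = \<sigma> p' (h F')"
            by (elim bexE conjE) (rule that)
          show "y = \<sigma> p (h F)" unfolding b(5) by (rule wd[OF a b(1-4), symmetric])
        qed
        then show ?thesis using x by (simp add: f_def)
      qed
      have fF: "f \<in> ?Fn"
      proof (intro CollectI conjI ballI)
        show "f \<in> carrier G \<rightarrow>\<^sub>E T"
        proof
          fix x assume "x \<in> carrier G"
          then obtain F p k where x: "F \<in> A" "p \<in> P" "k \<in> K" "x = p \<otimes> g F \<otimes> k"
        by (rule cover_cases)
          show "f x \<in> T" unfolding x(4) fv[OF x(1-3)] by (rule \<sigma>c[OF x(2) hT[OF x(1)]])
        qed (simp add: f_def)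
        fix x assume "x \<in> carrier G"
        then obtain F p k where x: "F \<in> A" "p \<in> P" "k \<in> K" "x = p \<otimes> g F \<otimes> k"
        by (rule cover_cases)
        note c = Pc[OF x(2)] Kc[OF x(3)] g[OF x(1)]
        {
          fix q assume q: "q \<in> P"
          have "q \<otimes> x = (q \<otimes> p) \<otimes> g F \<otimes> k" unfolding x(4) using c Pc[OF q] by (simp add: G.m_assoc)
          then have "f (q \<otimes> x) = \<sigma> (q \<otimes> p) (h F)" using fv[OF x(1) P.m_closed[OF q x(2)] x(3)] by simp
          then show "f (q \<otimes> x) = \<sigma> q (f x)"
            unfolding x(4) fv[OF x(1-3)] using \<sigma>m[OF q x(2) hT[OF x(1)]] by simp
        }
        fix l assume l: "l \<in> K"
        have "x \<otimes> l = p \<otimes> g F \<otimes> (k \<otimes> l)" unfolding x(4) using c Kc[OF l] by (simp add: G.m_assoc)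
        then have "f (x \<otimes> l) = \<sigma> p (h F)" using fv[OF x(1,2) K.m_closed[OF x(3) l]] by simp
        then show "f (x \<otimes> l) = f x" unfolding x(4) fv[OF x(1-3)] .
      qed
      have hf: "h = ?ev f"
      proof
        fix F show "h F = ?ev f F"
        proof (cases "F \<in> A")
          case True
          have "f (\<one> \<otimes> g F \<otimes> \<one>) = \<sigma> \<one> (h F)" by (rule fv[OF True P.one_closed K.one_closed])
          then show ?thesis using True g[OF True] \<sigma>1[OF hT[OF True]] by simp
        next
          case False
          then show ?thesis using PiE_arb[OF h False] by simp
        qed
      qed
      show "h \<in> ?ev ` ?Fn" by (subst hf) (rule imageI[OF fF])
    qed
  qed
qed

section \<open>Double cosets\<close>

text \<open>An abstract form of the situation, with \<open>C\<close> for \<open>GLint n\<close>,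
  \<open>X\<close> for the generating tuples and \<open>fil\<close> for \<open>Fil\<close>, so that
  double cosets are computed from the group laws alone. The last two assumptions say that
  \<open>fil\<close> classifies the orbits of the elements of \<open>P\<close> in
  \<open>C\<close>.\<close>

locale orbit_filtration = G: group G + P: subgroup P G + C: subgroup C G
  for G :: "('g, 'z) monoid_scheme" (structure) and P C :: "'g set" +
  fixes X :: "'x set" and a :: "'x \<Rightarrow> 'g \<Rightarrow> 'x" and fil :: "'x \<Rightarrow> 'k"
  assumes decomp: "g \<in> carrier G \<Longrightarrow> \<exists>p\<in>P. \<exists>k\<in>C. g = p \<otimes> k"
    and a_closed: "x \<in> X \<Longrightarrow> g \<in> C \<Longrightarrow> a x g \<in> X"
    and a_mult: "x \<in> X \<Longrightarrow> g \<in> C \<Longrightarrow> h \<in> C \<Longrightarrow> a (a x g) h = a x (g \<otimes> h)"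
    and a_one: "x \<in> X \<Longrightarrow> a x \<one> = x"
    and fil_a: "x \<in> X \<Longrightarrow> p \<in> P \<Longrightarrow> p \<in> C \<Longrightarrow> fil (a x p) = fil x"
    and fil_eq: "x \<in> X \<Longrightarrow> y \<in> X \<Longrightarrow> fil x = fil y \<Longrightarrow> \<exists>p\<in>P. p \<in> C \<and> a x p = y"
begin

lemma Pc: "p \<in> P \<Longrightarrow> p \<in> carrier G" and Cc: "k \<in> C \<Longrightarrow> k \<in> carrier G"
  using P.subset C.subset by blast+

lemma cancel: "x \<in> carrier G \<Longrightarrow> y \<in> carrier G \<Longrightarrow> inv x \<otimes> (x \<otimes> y) = y"
    "x \<in> carrier G \<Longrightarrow> y \<in> carrier G \<Longrightarrow> x \<otimes> (inv x \<otimes> y) = y"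
  by (simp_all flip: G.m_assoc)

lemma a_inv: "x \<in> X \<Longrightarrow> g \<in> C \<Longrightarrow> a x g = y \<Longrightarrow> a y (inv g) = x"
  using a_mult[of x g "inv g"] a_one Cc[of g] C.m_inv_closed by simp

lemma a_mult3:
  assumes "x \<in> X" "g \<in> C" "h \<in> C" "k \<in> C"
  shows "a x (g \<otimes> h \<otimes> k) = a (a (a x g) h) k"
  by (simp only: a_mult[OF assms(1-3)] a_mult[OF assms(1) C.m_closed[OF assms(2,3)] assms(4)])

context
  fixes \<phi> \<kappa> and z x y :: 'x
  assumes \<phi>: "\<phi> \<in> carrier G" and z: "z \<in> X" and x: "x \<in> X" and \<kappa>: "\<kappa> \<in> C" "a x \<kappa> = z"
begin

text \<open>The conjugate stabilizer found in \<open>module_groups_stab\<close>. Since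
  \<open>\<kappa>\<close> carries the tuple \<open>x\<close> to \<open>z\<close>, the element
  \<open>\<kappa> \<otimes> inv \<phi>\<close> represents the double coset that belongs to the
  filtration of \<open>x\<close>.\<close>

abbreviation "K \<equiv> (\<lambda>s. \<phi> \<otimes> s \<otimes> inv \<phi>) ` {s \<in> C. a z s = z}"

text \<open>Equal filtrations provide an element \<open>q\<close> of \<open>P\<close> and
  \<open>C\<close> that moves \<open>x\<close> to the translate of \<open>z\<close> by
  \<open>inv k\<close>. Going from \<open>z\<close> back to \<open>x\<close> by
  \<open>inv \<kappa>\<close>, then along \<open>q\<close> and \<open>k\<close>, returns to
  \<open>z\<close>, which gives the stabilizing element \<open>s\<close>.\<close>

lemma coset_exists:
  assumes g: "g \<in> carrier G" and p: "p \<in> P" and k: "k \<in> C" and gpk: "g \<otimes> \<phi> = p \<otimes> k" and fx: "fil x = fil (a z (inv k))"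
  shows "\<exists>p\<in>P. \<exists>k\<in>K. g = p \<otimes> (\<kappa> \<otimes> inv \<phi>) \<otimes> k"
proof -
  have ki: "inv k \<in> C" "inv \<kappa> \<in> C" using k \<kappa> by simp_all
  obtain q where q: "q \<in> P" "q \<in> C" "a x q = a z (inv k)" using fil_eq[OF x a_closed[OF z ki(1)] fx] by blast
  define s where "s = inv \<kappa> \<otimes> (q \<otimes> k)"
  have s: "s \<in> C" unfolding s_def using ki q k by simp
  have "a z s = a x (q \<otimes> k)" unfolding s_def
    using a_mult[OF z ki(2), of "q \<otimes> k"] a_inv[OF x \<kappa>] q k by simp
  also have "\<dots> = a (a z (inv k)) k" using a_mult[OF x q(2) k] q(3) by simp
  also have "\<dots> = z" using a_inv[OF z ki(1) refl] Cc[OF k] by simp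
  finally have "\<phi> \<otimes> s \<otimes> inv \<phi> \<in> K" using s by blast
  moreover have "g = (g \<otimes> \<phi>) \<otimes> inv \<phi>" using g \<phi> by (simp add: G.m_assoc)
  then have "g = (p \<otimes> inv q) \<otimes> (\<kappa> \<otimes> inv \<phi>) \<otimes> (\<phi> \<otimes> s \<otimes> inv \<phi>)"
    unfolding gpk s_def using Pc[OF p] Cc[OF k] Cc[OF q(2)] Cc[OF \<kappa>(1)] \<phi> by (simp add: G.m_assoc cancel)
  moreover have "p \<otimes> inv q \<in> P" using p q by simp
  ultimately show ?thesis by blast
qed

text \<open>The factors \<open>\<phi>\<close> cancel, so the left-hand side says that
  \<open>p\<close> is the conjugate by \<open>\<kappa>\<close> of an element stabilizing
  \<open>z\<close>; conjugation by \<open>\<kappa>\<close> turns the stabilizer of \<open>z\<close>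
  into that of \<open>x\<close>.\<close>

lemma coset_stabilizer:
  assumes p: "p \<in> P"
  shows "(\<exists>k\<in>K. p \<otimes> (\<kappa> \<otimes> inv \<phi>) = (\<kappa> \<otimes> inv \<phi>) \<otimes> k) \<longleftrightarrow> p \<in> C \<and> a x p = x"
proof
  assume "\<exists>k\<in>K. p \<otimes> (\<kappa> \<otimes> inv \<phi>) = (\<kappa> \<otimes> inv \<phi>) \<otimes> k"
  then obtain s where s: "s \<in> C" "a z s = z"
    and eq: "p \<otimes> (\<kappa> \<otimes> inv \<phi>) = (\<kappa> \<otimes> inv \<phi>) \<otimes> (\<phi> \<otimes> s \<otimes> inv \<phi>)" by blast
  note c = Pc[OF p] Cc[OF s(1)] Cc[OF \<kappa>(1)] \<phi>
  have "p = (p \<otimes> (\<kappa> \<otimes> inv \<phi>)) \<otimes> (\<phi> \<otimes> inv \<kappa>)" using c by (simp add: G.m_assoc cancel)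
  also have "\<dots> = \<kappa> \<otimes> s \<otimes> inv \<kappa>" unfolding eq using c by (simp add: G.m_assoc cancel)
  finally have pk: "p = \<kappa> \<otimes> s \<otimes> inv \<kappa>" .
  have "a x p = a (a (a x \<kappa>) s) (inv \<kappa>)"
    unfolding pk by (rule a_mult3[OF x \<kappa>(1) s(1) C.m_inv_closed[OF \<kappa>(1)]])
  then show "p \<in> C \<and> a x p = x" using pk \<kappa> s a_inv[OF x \<kappa>] by simp
next
  assume "p \<in> C \<and> a x p = x"
  then have pC: "p \<in> C" "a x p = x" by simp_all
  note c = Pc[OF p] Cc[OF \<kappa>(1)] \<phi>
  define s where "s = inv \<kappa> \<otimes> p \<otimes> \<kappa>"
  have "a z s = a (a (a z (inv \<kappa>)) p) \<kappa>"
    unfolding s_def by (rule a_mult3[OF z C.m_inv_closed[OF \<kappa>(1)] pC(1) \<kappa>(1)])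
  then have "a z s = z" using a_inv[OF x \<kappa>] pC \<kappa> by simp
  moreover have "s \<in> C" unfolding s_def using pC \<kappa> by simp
  moreover have "p \<otimes> (\<kappa> \<otimes> inv \<phi>) = (\<kappa> \<otimes> inv \<phi>) \<otimes> (\<phi> \<otimes> s \<otimes> inv \<phi>)"
    unfolding s_def using c by (simp add: G.m_assoc cancel)
  ultimately show "\<exists>k\<in>K. p \<otimes> (\<kappa> \<otimes> inv \<phi>) = (\<kappa> \<otimes> inv \<phi>) \<otimes> k" by blast
qed

text \<open>Solving the equation for \<open>p\<close> shows that \<open>p\<close> lies in
  \<open>C\<close> and moves \<open>y\<close> through \<open>z\<close> to \<open>x\<close>, and
  elements of \<open>P\<close> in \<open>C\<close> preserve \<open>fil\<close>.\<close>

lemma coset_unique: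
  assumes y: "y \<in> X" and \<mu>': "\<mu> \<in> C" "a y \<mu> = z" and p: "p \<in> P" and k: "k \<in> K"
    and eq: "p \<otimes> (\<kappa> \<otimes> inv \<phi>) \<otimes> k = \<mu> \<otimes> inv \<phi>"
  shows "fil x = fil y"
proof -
  obtain s where s: "s \<in> C" "a z s = z" "k = \<phi> \<otimes> s \<otimes> inv \<phi>" using k by blast
  note c = Pc[OF p] Cc[OF s(1)] Cc[OF \<kappa>(1)] \<phi> Cc[OF \<mu>'(1)]
  have "p = (p \<otimes> (\<kappa> \<otimes> inv \<phi>) \<otimes> k) \<otimes> \<phi> \<otimes> inv s \<otimes> inv \<kappa>"
    unfolding s(3) using c by (simp add: G.m_assoc cancel)
  also have "\<dots> = \<mu> \<otimes> inv s \<otimes> inv \<kappa>" unfolding eq using c by (simp add: G.m_assoc cancel)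
  finally have pl: "p = \<mu> \<otimes> inv s \<otimes> inv \<kappa>" .
  then have pC: "p \<in> C"
    using C.m_closed[OF C.m_closed[OF \<mu>'(1) C.m_inv_closed[OF s(1)]] C.m_inv_closed[OF \<kappa>(1)]] by (simp only:)
  have "a y p = a (a (a y \<mu>) (inv s)) (inv \<kappa>)"
    unfolding pl by (rule a_mult3[OF y \<mu>'(1) C.m_inv_closed[OF s(1)] C.m_inv_closed[OF \<kappa>(1)]])
  also have "\<dots> = x" by (simp only: \<mu>'(2) a_inv[OF z s(1,2)] a_inv[OF x \<kappa>])
  finally have "a y p = x" .
  then show ?thesis by (rule subst) (rule fil_a[OF y p pC])
qed

end

end

section \<open>Finiteness of the module and of its filtrations\<close>

text \<open>Coefficients matter only up to elements of valuation at least \<open>k\<close>, so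
  finitely many coefficient tuples already produce all of \<open>M\<close>.\<close>

lemma (in val_module) finite_carrier:
  assumes tor: "torsion k" and x: "x \<in> tuples n" shows "finite (carrier M)"
proof -
  obtain R where R: "finite R" "R \<subseteq> \<O>" "\<forall>x\<in>\<O>. \<exists>r\<in>R. x - r \<in> frac_ideal v (int k)"
    using finite_residues_power[of k] by (elim exE conjE) (rule that)
  have xc: "x \<in> {..<n} \<rightarrow> carrier M" by (rule tuples_D(2)[OF x])
  have "carrier M \<subseteq> (\<lambda>d. comb n d x) ` ({..<n} \<rightarrow>\<^sub>E R)"
  proof
    fix m assume "m \<in> carrier M"
    moreover have "generates n x" using x unfolding tuples_def by (rule CollectE) (rule conjunct2)
    ultimately have "\<exists>c\<in>{..<n} \<rightarrow> \<O>. m = comb n c x" unfolding generates_def val_ring_simps by (rule bspec[rotated])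
    then obtain c where c: "c \<in> {..<n} \<rightarrow> \<O>" "m = comb n c x" by (rule bexE)
    have "\<forall>a\<in>{..<n}. \<exists>r. r \<in> R \<and> c a - r \<in> frac_ideal v (int k)"
      using R(3)[rule_format, OF Pi_mem[OF c(1)]] by (intro ballI) (simp only: Bex_def)
    then obtain d where "\<forall>a\<in>{..<n}. d a \<in> R \<and> c a - d a \<in> frac_ideal v (int k)"
      by (rule bchoice[THEN exE])
    then have d: "d a \<in> R" "c a - d a \<in> frac_ideal v (int k)" if "a < n" for a using that by simp_all
    have ca: "c a \<odot>\<^bsub>M\<^esub> x a = d a \<odot>\<^bsub>M\<^esub> x a" if a: "a < n" for a
    proof -
      have xa: "x a \<in> carrier M" using xc a by blast
      have cd: "c a \<in> \<O>" "d a \<in> \<O>" "c a - d a \<in> \<O>"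
        using c(1) a d[OF a] R(2) frac_ideal_mono[OF d(2)[OF a], of 0] by auto
      have "c a \<odot>\<^bsub>M\<^esub> x a = (d a + (c a - d a)) \<odot>\<^bsub>M\<^esub> x a" by simp
      also have "\<dots> = d a \<odot>\<^bsub>M\<^esub> x a \<oplus>\<^bsub>M\<^esub> (c a - d a) \<odot>\<^bsub>M\<^esub> x a"
        using smult_l_distr[of "d a" "c a - d a" "x a"] cd xa by simp
      also have "\<dots> = d a \<odot>\<^bsub>M\<^esub> x a"
        using tor d(2)[OF a] xa smult_closed[of "d a" "x a"] cd by (simp add: torsion_def)
      finally show ?thesis .
    qed
    have dc: "d \<in> {..<n} \<rightarrow> \<O>" using d(1) R(2) by blast
    with ca have "comb n c x = comb n (restrict d {..<n}) x"
      unfolding comb_def using xc by (intro M.finsum_cong') (auto intro!: smult_closed)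
    then have m: "m = comb n (restrict d {..<n}) x" by (simp only: c(2))
    have "restrict d {..<n} \<in> {..<n} \<rightarrow>\<^sub>E R" using d(1) by simp
    then show "m \<in> (\<lambda>d. comb n d x) ` ({..<n} \<rightarrow>\<^sub>E R)" unfolding m by (rule imageI)
  qed
  then show ?thesis by (rule finite_subset) (intro finite_imageI finite_PiE finite_lessThan R(1))
qed

text \<open>A filtration is a list of fixed length of subsets of a finite set.\<close>

lemma (in filtered) finite_admissible:
  assumes "finite (carrier M)" shows "finite {F. admissible_filtration v ns M F}"
proof (rule finite_subset)
  show "{F. admissible_filtration v ns M F} \<subseteq> {F. set F \<subseteq> Pow (carrier M) \<and> length F = Suc r}"
  proof (intro subsetI CollectI conjI)
    fix F assume "F \<in> {F. admissible_filtration v ns M F}"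
    then have F: "length F = Suc r" "\<And>i. i \<le> r \<Longrightarrow> submodule (val_ring v) (F ! i) M"
      by (simp_all add: admissible_filtration_def)
    show "length F = Suc r" by (rule F(1))
    show "S \<in> Pow (carrier M)" if S: "S \<in> set F" for S
    proof -
      obtain i where "i < Suc r" "S = F ! i" using S by (auto simp: in_set_conv_nth F(1))
      then show ?thesis using submodule.subset[OF F(2)[of i]] by simp
    qed
  qed
  show "finite {F. set F \<subseteq> Pow (carrier M) \<and> length F = Suc r}"
    by (rule finite_lists_length_eq) (simp add: assms)
qed

section \<open>Fixed vectors of conjugate subgroups\<close>

lemma GL_rep_D:
  fixes \<rho> :: "'f::field mat \<Rightarrow> 'v \<Rightarrow> 'v"
  assumes "GL_rep m V \<rho>"
  shows "vectorspace class_ring V" "Module.module class_ring V"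
    "g \<in> carrier (GL m) \<Longrightarrow> \<rho> g \<in> module_hom class_ring V V"
    "x \<in> carrier V \<Longrightarrow> \<rho> (1\<^sub>m m) x = x"
    "g \<in> carrier (GL m) \<Longrightarrow> h \<in> carrier (GL m) \<Longrightarrow> x \<in> carrier V \<Longrightarrow> \<rho> (g * h) x = \<rho> g (\<rho> h x)"
  using assms unfolding GL_rep_def by (simp_all add: vectorspace.axioms(1))

lemma invariants_submodule:
  assumes rep: "GL_rep m V \<rho>" and H: "H \<subseteq> carrier (GL m)"
  shows "submodule class_ring {x \<in> carrier V. \<forall>h\<in>H. \<rho> h x = x} V"
proof -
  interpret V: Module.module class_ring V by (rule GL_rep_D(2)[OF rep])
  note hD = module_hom_D[OF GL_rep_D(3)[OF rep subsetD[OF H]]]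
  have h0: "\<rho> h \<zero>\<^bsub>V\<^esub> = \<zero>\<^bsub>V\<^esub>" if "h \<in> H" for h
    by (rule hom_zero[OF V.module_axioms V.module_axioms GL_rep_D(3)[OF rep subsetD[OF H that]]])
  show ?thesis
    by (rule submodule.intro[OF V.module_axioms]) (auto simp: hD h0)
qed

text \<open>A vector is fixed by the conjugate of \<open>H\<close> iff its translate by the inverse
  of \<open>\<psi>\<close> is fixed by \<open>H\<close>. Composing the coordinates with this
  translation therefore keeps the index set \<open>B'\<close>.\<close>

lemma (in nonarch_local_field) coords_conj:
  assumes rep: "GL_rep m V \<rho>" and H: "H \<subseteq> carrier (GL m)" and \<psi>: "\<psi> \<in> carrier (GL m)"
    and c: "coords V B c" and B': "B' \<subseteq> B"
    and W: "\<And>x. x \<in> carrier V \<Longrightarrow> (\<forall>h\<in>H. \<rho> h x = x) \<longleftrightarrow> {b. c x b \<noteq> 0} \<subseteq> B'"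
  shows "coords (invariants V \<rho> (conj_set m \<psi> H)) B' (\<lambda>x. c (\<rho> (inv\<^bsub>GL m\<^esub> \<psi>) x))"
proof -
  note i = GL_inv[OF \<psi>] and R = GL_rep_D[OF rep]
  note ih = module_hom_D(1)[OF R(3)[OF i(1)]] and ph = module_hom_D(1)[OF R(3)[OF \<psi>]]
  have cancel: "\<rho> \<psi> (\<rho> (inv\<^bsub>GL m\<^esub> \<psi>) x) = x" "\<rho> (inv\<^bsub>GL m\<^esub> \<psi>) (\<rho> \<psi> x) = x" if "x \<in> carrier V" for x
    using R(5)[OF \<psi> i(1) that] R(5)[OF i(1) \<psi> that] R(4)[OF that] i by simp_all
  have bij: "bij_betw (\<rho> (inv\<^bsub>GL m\<^esub> \<psi>)) (carrier V) (carrier V)"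
    by (rule bij_betw_byWitness[of _ "\<rho> \<psi>"]) (use cancel ih ph in \<open>auto\<close>)
  have c': "coords V B (\<lambda>x. c (\<rho> (inv\<^bsub>GL m\<^esub> \<psi>) x))"
    using c bij_betw_trans[OF bij, of c "carrier (free_space B)"]
      module_hom_comp[OF R(3)[OF i(1)], of c "free_space B"]
    unfolding coords_def by (simp add: comp_def)
  show ?thesis unfolding invariants_def
  proof (rule coords_restrict(2)[OF c' B'])
    fix x
    show "x \<in> {x \<in> carrier V. \<forall>k\<in>conj_set m \<psi> H. \<rho> k x = x} \<longleftrightarrow>
        x \<in> carrier V \<and> {b. c (\<rho> (inv\<^bsub>GL m\<^esub> \<psi>) x) b \<noteq> 0} \<subseteq> B'"
    proof (cases "x \<in> carrier V")
      case True
      have "\<rho> (\<psi> * h * inv\<^bsub>GL m\<^esub> \<psi>) x = x \<longleftrightarrow> \<rho> h (\<rho> (inv\<^bsub>GL m\<^esub> \<psi>) x) = \<rho> (inv\<^bsub>GL m\<^esub> \<psi>) x" if h: "h \<in> H" for h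
      proof -
        have hG: "h \<in> carrier (GL m)" using H h by blast
        note hc = module_hom_D(1)[OF R(3)[OF hG]]
        have "\<rho> (\<psi> * h * inv\<^bsub>GL m\<^esub> \<psi>) x = \<rho> \<psi> (\<rho> h (\<rho> (inv\<^bsub>GL m\<^esub> \<psi>) x))"
          using R(5)[OF GL_mult_closed[OF \<psi> hG] i(1) True] R(5)[OF \<psi> hG ih[OF True]] by simp
        then show ?thesis using cancel(1)[OF True] cancel(2)[OF hc[OF ih[OF True]]] by metis
      qed
      then show ?thesis using True W[OF ih[OF True]] by (simp add: conj_set_def)
    qed simp
  qed
qed

lemma (in nonarch_local_field) conj_set_comp:
  assumes \<phi>: "\<phi> \<in> carrier (GL m)" and \<psi>: "\<psi> \<in> carrier (GL m)" and S: "S \<subseteq> carrier (GL m)"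
  shows "conj_set m \<phi> (conj_set m \<psi> S) = conj_set m (\<phi> * \<psi>) S"
proof -
  interpret G: group "GL m :: 'f mat monoid" by (rule GL_group)
  have "\<phi> * (\<psi> * s * inv\<^bsub>GL m\<^esub> \<psi>) * inv\<^bsub>GL m\<^esub> \<phi> = \<phi> * \<psi> * s * inv\<^bsub>GL m\<^esub> (\<phi> * \<psi>)" if "s \<in> S" for s
  proof -
    have s: "s \<in> carrier (GL m)" using S that by blast
    have "\<phi> \<otimes>\<^bsub>GL m\<^esub> (\<psi> \<otimes>\<^bsub>GL m\<^esub> s \<otimes>\<^bsub>GL m\<^esub> inv\<^bsub>GL m\<^esub> \<psi>) \<otimes>\<^bsub>GL m\<^esub> inv\<^bsub>GL m\<^esub> \<phi> =
        \<phi> \<otimes>\<^bsub>GL m\<^esub> \<psi> \<otimes>\<^bsub>GL m\<^esub> s \<otimes>\<^bsub>GL m\<^esub> inv\<^bsub>GL m\<^esub> (\<phi> \<otimes>\<^bsub>GL m\<^esub> \<psi>)"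
      using \<phi> \<psi> s by (simp add: G.m_assoc G.inv_mult_group del: GL_simps)
    then show ?thesis by simp
  qed
  then show ?thesis unfolding conj_set_def image_image by (intro image_cong refl)
qed

context filtered
begin

text \<open>The group is a conjugate of the stabilizer of some generating tuple of the graded piece.
  Transitivity replaces that tuple by the graded tuple of \<open>x\<close> at the cost of a further
  conjugation.\<close>

lemma piece_group:
  assumes x: "x \<in> tuples n" and i: "i < r"
    and K: "K \<in> module_groups v (ns ! i) (graded_piece M (Fil x) i)"
  shows "\<exists>\<psi>\<in>carrier (GL (ns ! i)).
    K = conj_set (ns ! i) \<psi> (val_module.stab v (graded_piece M (Fil x) i) (ns ! i) (gr (Fil x) x i))"
proof -
  interpret G: val_module v "graded_piece M (Fil x) i"
    by (rule piece_val_module[OF Fil_filt[OF tuples_D(2)[OF x]] i])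
  obtain \<phi> z k where K': "\<phi> \<in> carrier (GL (ns ! i))" "z \<in> G.tuples (ns ! i)"
      "K = conj_set (ns ! i) \<phi> (G.stab (ns ! i) z)" "G.torsion k"
    using K by (rule G.module_groups_stab)
  note y = gr_tuple[OF tuples_D(2)[OF x] i]
  obtain g where g: "g \<in> GLint (ns ! i)" "G.act (ns ! i) (gr (Fil x) x i) g = z"
    using G.tuples_transitive[OF K'(4) y K'(2)] .
  have st: "G.stab (ns ! i) (gr (Fil x) x i) \<subseteq> carrier (GL (ns ! i))"
    by (rule subgroup.subset[OF G.stab_subgroup[OF G.tuples_D(1)[OF y]]])
  note gi = GL_inv(1)[OF GLint_D(1)[OF g(1)]]
  have "K = conj_set (ns ! i) (\<phi> * inv\<^bsub>GL (ns ! i)\<^esub> g) (G.stab (ns ! i) (gr (Fil x) x i))"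
    unfolding K'(3) g(2)[symmetric] G.stab_act[OF G.tuples_D(1)[OF y] g(1)]
    by (rule conj_set_comp[OF K'(1) gi st])
  then show ?thesis by (rule bexI) (rule GL_mult_closed[OF K'(1) gi])
qed

lemma Fil_transitive:
  assumes x: "x \<in> tuples n" and y: "y \<in> tuples n" and xy: "Fil x = Fil y"
    and tor: "\<And>i. i < r \<Longrightarrow> \<exists>k. val_module.torsion v (graded_piece M (Fil x) i) k"
  shows "\<exists>p\<in>P. p \<in> GLint n \<and> act n x p = y"
proof -
  have "\<exists>g. g \<in> GLint (ns ! i) \<and> val_module.act (graded_piece M (Fil x) i) (ns ! i) (gr (Fil x) x i) g = gr (Fil x) y i"
    if i: "i \<in> {..<r}" for i
  proof -
    have i: "i < r" using i by simp
    interpret G: val_module v "graded_piece M (Fil x) i"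
      by (rule piece_val_module[OF Fil_filt[OF tuples_D(2)[OF x]] i])
    obtain k where k: "G.torsion k" using tor[OF i] by (rule exE)
    obtain g where "g \<in> GLint (ns ! i)" "G.act (ns ! i) (gr (Fil x) x i) g = gr (Fil x) y i"
      by (rule G.tuples_transitive[OF k gr_tuple[OF tuples_D(2)[OF x] i] gr_tuple[OF tuples_D(2)[OF y] i, folded xy]])
    then show ?thesis by (intro exI conjI)
  qed
  then obtain h where h: "\<forall>i\<in>{..<r}. h i \<in> GLint (ns ! i) \<and>
      val_module.act (graded_piece M (Fil x) i) (ns ! i) (gr (Fil x) x i) (h i) = gr (Fil x) y i"
    by (rule bchoice[OF ballI, THEN exE])
  have "h i \<in> GLint (ns ! i)"
      "val_module.act (graded_piece M (Fil x) i) (ns ! i) (gr (Fil x) x i) (h i) = gr (Fil x) y i" if "i < r" for i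
    using h that by simp_all
  then obtain p where "p \<in> P" "p \<in> GLint n" "act n x p = y"
    by (rule lift_blocks[OF tuples_D(1)[OF x] tuples_D(1)[OF y] xy])
  then show ?thesis by (intro bexI conjI)
qed

text \<open>The group \<open>L i\<close> is conjugate to the stabilizer \<open>H i\<close> of the
  graded tuple, so one index set \<open>B' i\<close> serves for the invariants of both. The two
  sides of the isomorphism thereby acquire coordinates on the same product of the
  \<open>B' i\<close>.\<close>

theorem fixed_isomorphic:
  fixes V :: "nat \<Rightarrow> (complex, 'v) module" and \<pi> :: "nat \<Rightarrow> 'f mat \<Rightarrow> 'v \<Rightarrow> 'v"
  assumes rep: "\<And>i. i < r \<Longrightarrow> GL_rep (ns ! i) (V i) (\<pi> i)" and x: "x \<in> tuples n"
    and L: "\<And>i. i < r \<Longrightarrow> L i \<in> module_groups v (ns ! i) (graded_piece M (Fil x) i)"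
  shows "modules_isomorphic class_ring
    ((tensor_product {..<r} V)\<lparr>carrier := {t \<in> carrier (tensor_product {..<r} V).
      \<forall>p\<in>P. p \<in> GLint n \<and> act n x p = x \<longrightarrow> tensor_map {..<r} V (\<lambda>i. \<pi> i (lv p i)) t = t}\<rparr>)
    (tensor_product {..<r} (\<lambda>i. invariants (V i) (\<pi> i) (L i)))"
    (is "modules_isomorphic _ (?T\<lparr>carrier := ?U\<rparr>) (tensor_product _ ?V')")
proof -
  note xD = tuples_D[OF x]
  note piece = piece_val_module[OF Fil_filt[OF xD(2)]]
  define H where "H i = val_module.stab v (graded_piece M (Fil x) i) (ns ! i) (gr (Fil x) x i)" for i
  have HD: "h \<in> H i \<longleftrightarrow> h \<in> GLint (ns ! i) \<and>
      val_module.act (graded_piece M (Fil x) i) (ns ! i) (gr (Fil x) x i) h = gr (Fil x) x i" if "i < r" for h i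
    unfolding H_def val_module.stab_def[OF piece[OF that]] by (rule mem_Collect_eq)
  have HG: "H i \<subseteq> carrier (GL (ns ! i))" if "i < r" for i
    using HD[OF that] GLint_D(1) by (intro subsetI) blast
  define W where "W i = {y \<in> carrier (V i). \<forall>h\<in>H i. \<pi> i h y = y}" for i
  \<comment> \<open>The basis, its adapted part and the coordinates are packed into a triple, so
    that they are chosen together for all \<open>i\<close>.\<close>
  have "\<forall>i\<in>{..<r}. \<exists>b :: 'v set \<times> 'v set \<times> ('v \<Rightarrow> 'v \<Rightarrow> complex).
      coords (V i) (fst b) (snd (snd b)) \<and> fst (snd b) \<subseteq> fst b \<and>
      (\<forall>y\<in>carrier (V i). y \<in> W i \<longleftrightarrow> {d. snd (snd b) y d \<noteq> 0} \<subseteq> fst (snd b))"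
  proof
    fix i assume "i \<in> {..<r}"
    then have i: "i < r" by simp
    obtain B B' :: "'v set" and c where "coords (V i) B c" "B' \<subseteq> B"
        "\<And>y. y \<in> carrier (V i) \<Longrightarrow> y \<in> W i \<longleftrightarrow> {b. c y b \<noteq> 0} \<subseteq> B'"
      by (rule adapted_coords[OF GL_rep_D(1)[OF rep[OF i]]
          invariants_submodule[OF rep[OF i] HG[OF i], folded W_def]]) (rule that, assumption+)
    then show "\<exists>b :: 'v set \<times> 'v set \<times> ('v \<Rightarrow> 'v \<Rightarrow> complex).
      coords (V i) (fst b) (snd (snd b)) \<and> fst (snd b) \<subseteq> fst b \<and>
      (\<forall>y\<in>carrier (V i). y \<in> W i \<longleftrightarrow> {d. snd (snd b) y d \<noteq> 0} \<subseteq> fst (snd b))"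
      by (intro exI[of _ "(B, B', c)"]) simp
  qed
  then obtain b :: "nat \<Rightarrow> 'v set \<times> 'v set \<times> ('v \<Rightarrow> 'v \<Rightarrow> complex)" where
    b: "\<forall>i\<in>{..<r}. coords (V i) (fst (b i)) (snd (snd (b i))) \<and> fst (snd (b i)) \<subseteq> fst (b i) \<and>
      (\<forall>y\<in>carrier (V i). y \<in> W i \<longleftrightarrow> {d. snd (snd (b i)) y d \<noteq> 0} \<subseteq> fst (snd (b i)))"
    by (rule bchoice[THEN exE])
  define B where "B i = fst (b i)" for i
  define B' where "B' i = fst (snd (b i))" for i
  define c where "c i = snd (snd (b i))" for i
  have crd: "coords (V i) (B i) (c i)" and BB: "B' i \<subseteq> B i"
    and Wc: "\<And>y. y \<in> carrier (V i) \<Longrightarrow> y \<in> W i \<longleftrightarrow> {d. c i y d \<noteq> 0} \<subseteq> B' i" if "i < r" for i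
    using b that unfolding B_def B'_def c_def by simp_all
  interpret TC: tensor_coords "{..<r}" V B c
    by (intro tensor_coords.intro tensor_family.intro tensor_coords_axioms.intro)
      (simp_all add: crd GL_rep_D(2)[OF rep])
  \<comment> \<open>The families of operators through which the stabilizer of \<open>x\<close> in
    \<open>P\<close> acts on the factors; by \<open>lvH\<close> the component in slot
    \<open>i\<close> comes from \<open>H i\<close>.\<close>
  define Q where "Q = (\<lambda>p i. \<pi> i (lv p i)) ` {p \<in> P. p \<in> GLint n \<and> act n x p = x}"
  have lvH: "lv p i \<in> H i" if p: "p \<in> P" "p \<in> GLint n" "act n x p = x" and i: "i < r" for p i
    unfolding HD[OF i] using levi_GLint[OF p(1,2) i] gr_act[OF xD(2) GLint_D(2)[OF p(2)] P_D(2)[OF p(1)] i]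
    unfolding p(3) by (intro conjI) (assumption, rule sym)
  have inv: "(\<forall>\<phi>\<in>Q. tensor_map {..<r} V \<phi> t = t) \<longleftrightarrow> {d. TC.Psi t d \<noteq> 0} \<subseteq> PiE {..<r} B'"
    if t: "t \<in> carrier ?T" for t
  proof (rule TC.tensor_invariants[where Q = Q and W = W and B' = B'])
    show "B' i \<subseteq> B i" if "i \<in> {..<r}" for i using BB that by simp
    show "y \<in> W i \<longleftrightarrow> {d. c i y d \<noteq> 0} \<subseteq> B' i" if "i \<in> {..<r}" "y \<in> carrier (V i)" for i y
      using Wc[OF _ that(2)] that(1) by simp
    show "TC.endos \<phi>" if "\<phi> \<in> Q" for \<phi>
    proof -
      obtain p where p: "p \<in> P" "\<phi> = (\<lambda>i. \<pi> i (lv p i))" using \<open>\<phi> \<in> Q\<close> unfolding Q_def by blast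
      show ?thesis unfolding TC.endos_def p(2)
        using GL_rep_D(3)[OF rep levi_GL[OF p(1)]] by simp
    qed
    show "\<phi> i y = y" if a: "\<phi> \<in> Q" "i \<in> {..<r}" "y \<in> carrier (V i)" "y \<in> W i" for \<phi> i y
    proof -
      obtain p where p: "p \<in> P" "p \<in> GLint n" "act n x p = x" "\<phi> = (\<lambda>i. \<pi> i (lv p i))"
        using a(1) unfolding Q_def by blast
      have "lv p i \<in> H i" using lvH[OF p(1-3)] a(2) by simp
      then show ?thesis using a(4) unfolding p(4) W_def by simp
    qed
    show "y \<in> W i" if i: "i \<in> {..<r}" and y: "y \<in> carrier (V i)"
      and fix': "\<And>\<phi>. \<phi> \<in> Q \<Longrightarrow> \<forall>j\<in>{..<r} - {i}. \<forall>y\<in>carrier (V j). \<phi> j y = y \<Longrightarrow> \<phi> i y = y" for i y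
    proof -
      have i': "i < r" using i by simp
      have "\<pi> i h y = y" if h: "h \<in> H i" for h
      proof -
        \<comment> \<open>The block \<open>h\<close> in slot \<open>i\<close> and identity blocks
          elsewhere stabilize all graded tuples, so they lift to the stabilizer of \<open>x\<close>.
          The lift acts in slot \<open>i\<close> alone, as \<open>ample\<close> demands.\<close>
        define hh where "hh j = (if j = i then h else 1\<^sub>m (ns ! j))" for j
        have h1: "hh j \<in> GLint (ns ! j)" for j
          using h unfolding hh_def HD[OF i'] by (cases "j = i") (simp_all add: GLint_one)
        have h2: "val_module.act (graded_piece M (Fil x) j) (ns ! j) (gr (Fil x) x j) (hh j) = gr (Fil x) x j"
          if j: "j < r" for j
        proof (cases "j = i")
          case True
          then show ?thesis using h unfolding hh_def HD[OF i'] by simp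
        next
          case False
          interpret G: val_module v "graded_piece M (Fil x) j" by (rule piece[OF j])
          show ?thesis unfolding hh_def using False G.act_one[OF G.tuples_D(1)[OF gr_tuple[OF xD(2) j]]] by simp
        qed
        obtain p where p: "p \<in> P" "p \<in> GLint n" "act n x p = x" "\<And>j. j < r \<Longrightarrow> lv p j = hh j"
          by (rule lift_blocks[OF xD(1) xD(1) refl h1 h2]) (assumption, rule that, assumption+)
        have "(\<lambda>i. \<pi> i (lv p i)) \<in> Q" unfolding Q_def using p(1-3) by blast
        then have "\<pi> i (lv p i) y = y"
        proof (rule fix', intro ballI)
          fix j y assume "j \<in> {..<r} - {i}" and y: "y \<in> carrier (V j)"
          then have j: "j < r" "j \<noteq> i" by simp_all
          then show "\<pi> j (lv p j) y = y"
            using GL_rep_D(4)[OF rep[OF j(1)] y] unfolding p(4)[OF j(1)] hh_def by simp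
        qed
        then show ?thesis unfolding p(4)[OF i'] hh_def by simp
      qed
      then show ?thesis using y unfolding W_def by simp
    qed
    show "t \<in> carrier ?T" by (rule t)
  qed
  have cT: "coords (?T\<lparr>carrier := ?U\<rparr>) (PiE {..<r} B') TC.Psi"
  proof (rule coords_restrict(2)[OF TC.Psi_coords])
    show "PiE {..<r} B' \<subseteq> PiE {..<r} B" by (rule PiE_mono) (simp add: BB)
    show "t \<in> ?U \<longleftrightarrow> t \<in> carrier ?T \<and> {d. TC.Psi t d \<noteq> 0} \<subseteq> PiE {..<r} B'" for t
    proof (cases "t \<in> carrier ?T")
      case True
      have "t \<in> ?U \<longleftrightarrow> (\<forall>\<phi>\<in>Q. tensor_map {..<r} V \<phi> t = t)" using True unfolding Q_def by blast
      then show ?thesis using inv[OF True] True by simp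
    qed simp
  qed
  have "\<forall>i\<in>{..<r}. \<exists>\<psi>. \<psi> \<in> carrier (GL (ns ! i)) \<and> L i = conj_set (ns ! i) \<psi> (H i)"
    using piece_group[OF x _ L] unfolding H_def Bex_def by simp
  then obtain \<psi> where \<psi>: "\<forall>i\<in>{..<r}. \<psi> i \<in> carrier (GL (ns ! i)) \<and> L i = conj_set (ns ! i) (\<psi> i) (H i)"
    by (rule bchoice[THEN exE])
  define c' where "c' i y = c i (\<pi> i (inv\<^bsub>GL (ns ! i)\<^esub> (\<psi> i)) y)" for i y
  have crd': "coords (?V' i) (B' i) (c' i)" if i: "i < r" for i
  proof -
    have p: "\<psi> i \<in> carrier (GL (ns ! i))" "L i = conj_set (ns ! i) (\<psi> i) (H i)" using \<psi> i by simp_all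
    have "(\<forall>h\<in>H i. \<pi> i h y = y) \<longleftrightarrow> {d. c i y d \<noteq> 0} \<subseteq> B' i" if "y \<in> carrier (V i)" for y
      using Wc[OF i that] that unfolding W_def by simp
    then show ?thesis unfolding p(2) c'_def[abs_def]
      by (rule coords_conj[OF rep[OF i] HG[OF i] p(1) crd[OF i] BB[OF i]])
  qed
  interpret TD: tensor_coords "{..<r}" ?V' B' c'
    by (intro tensor_coords.intro tensor_family.intro tensor_coords_axioms.intro)
      (use crd' in \<open>simp_all add: coords_def\<close>)
  show ?thesis by (rule coords_isomorphic[OF cT TD.Psi_coords])
qed

end

lemma (in tensor_family) tensor_map_id:
  assumes \<phi>: "endos \<phi>" and id: "\<And>i x. i \<in> I \<Longrightarrow> x \<in> carrier (V i) \<Longrightarrow> \<phi> i x = x" and t: "t \<in> carrier T"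
  shows "tensor_map I V \<phi> t = t"
proof -
  obtain f where f: "f \<in> carrier T0" "t = cl f" using t by (rule T_cases)
  have "tensor_push I \<phi> f = f"
  proof (rule hom_ext_free[where X = T0 and S = C and f = "tensor_push I \<phi>" and g = "\<lambda>f. f", OF T0_module])
    show "tensor_push I \<phi> \<in> module_hom class_ring (free_space C) T0" using push_hom[OF \<phi>] by (simp only: T0)
    show "(\<lambda>f. f) \<in> module_hom class_ring (free_space C) T0" unfolding T0 by (intro module_hom_I refl)
    show "f \<in> carrier (free_space C)" using f(1) by (simp only: T0)
    fix x assume x: "x \<in> C"
    have "tuple_map \<phi> x = x"
    proof
      fix i show "tuple_map \<phi> x i = x i"
        using id[OF _ C_D[OF x]] PiE_arb[OF x] by (cases "i \<in> I") (simp_all add: tuple_map_def)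
    qed
    then show "tensor_push I \<phi> (delta x) = delta x" unfolding push_delta[OF \<phi> x] by simp
  qed
  then show ?thesis unfolding f(2) tensor_map_cl[OF \<phi> f(1)] by simp
qed

section \<open>The invariants of the induced representation\<close>

context filtered
begin

lemma P_subgroup: "subgroup P (GL n)"
  by (rule subgroup.intro, rule subsetI, erule P_D(1))
    (simp_all only: GL_simps P_mult P_one P_inv)

theorem parabolic_invariants:
  fixes V :: "nat \<Rightarrow> (complex, 'v) module" and \<pi> :: "nat \<Rightarrow> 'f mat \<Rightarrow> 'v \<Rightarrow> 'v"
  assumes rep: "\<And>i. i < r \<Longrightarrow> GL_rep (ns ! i) (V i) (\<pi> i)" and K: "K \<in> module_groups v n M"
    and KGr: "\<And>F i. admissible_filtration v ns M F \<Longrightarrow> i < r \<Longrightarrow>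
      KGr F i \<in> module_groups v (ns ! i) (graded_piece M F i)"
  shows "modules_isomorphic class_ring (invariants (par_ind v s ns V \<pi>) (right_translation n) K)
    (direct_sum_family {F. admissible_filtration v ns M F}
      (\<lambda>F. tensor_product {..<r} (\<lambda>i. invariants (V i) (\<pi> i) (KGr F i))))"
proof -
  define A where "A = {F. admissible_filtration v ns M F}"
  define T where "T = tensor_product {..<r} V"
  obtain \<phi> z k where \<phi>: "\<phi> \<in> carrier (GL n)" and z: "z \<in> tuples n"
    and Keq: "K = conj_set n \<phi> (stab n z)" and tor: "torsion k"
    using K by (rule module_groups_stab)
  have finA: "finite A" unfolding A_def by (rule finite_admissible[OF finite_carrier[OF tor z]])
  have Ksub: "subgroup K (GL n)" unfolding Keq by (rule conj_stab_subgroup[OF tuples_D(1)[OF z] \<phi>])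
  have Kopen: "GL_open v n K" unfolding Keq by (rule conj_stab_open[OF tor tuples_D(1)[OF z] \<phi>])
  have "\<forall>F\<in>A. \<exists>x. x \<in> tuples n \<and> Fil x = F"
  proof
    fix F assume "F \<in> A"
    then have "admissible_filtration v ns M F" unfolding A_def by (rule CollectD)
    then obtain x where "x \<in> tuples n" "Fil x = F" by (rule adapted_tuple)
    then show "\<exists>x. x \<in> tuples n \<and> Fil x = F" by (intro exI conjI)
  qed
  then obtain X where "\<forall>F\<in>A. X F \<in> tuples n \<and> Fil (X F) = F" by (rule bchoice[THEN exE])
  then have X: "X F \<in> tuples n" "Fil (X F) = F" if "F \<in> A" for F using that by simp_all
  have "\<forall>F\<in>A. \<exists>g. g \<in> GLint n \<and> act n (X F) g = z"
  proof
    fix F assume F: "F \<in> A"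
    obtain g where "g \<in> GLint n" "act n (X F) g = z" by (rule tuples_transitive[OF tor X(1)[OF F] z])
    then show "\<exists>g. g \<in> GLint n \<and> act n (X F) g = z" by (intro exI conjI)
  qed
  then obtain \<kappa> where "\<forall>F\<in>A. \<kappa> F \<in> GLint n \<and> act n (X F) (\<kappa> F) = z" by (rule bchoice[THEN exE])
  then have \<kappa>: "\<kappa> F \<in> GLint n" "act n (X F) (\<kappa> F) = z" if "F \<in> A" for F using that by simp_all
  \<comment> \<open>The representative of the double coset attached to \<open>F\<close>: it passes
    from the adapted tuple \<open>X F\<close> to \<open>z\<close> and then undoes the conjugation in
    \<open>K\<close>.\<close>
  define g where "g F = \<kappa> F \<otimes>\<^bsub>GL n\<^esub> inv\<^bsub>GL n\<^esub> \<phi>" for F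
  interpret O: orbit_filtration "GL n" P "GLint n" "tuples n" "act n" Fil
  proof (intro orbit_filtration.intro orbit_filtration_axioms.intro GL_group P_subgroup GLint_subgroup)
    show "\<exists>p\<in>P. \<exists>k\<in>GLint n. g = p \<otimes>\<^bsub>GL n\<^esub> k" if g: "g \<in> carrier (GL n)" for g
    proof -
      obtain b k where b: "b \<in> carrier (GL n)" "upper_triangular b" "k \<in> GLint n" "g = b * k"
        using g by (rule iwasawa)
      show ?thesis
        by (rule bexI[OF _ upper_triangular_P[OF b(1,2)]], rule bexI[OF _ b(3)]) (simp add: b(4))
    qed
    show "act n x g \<in> tuples n" if "x \<in> tuples n" "g \<in> GLint n" for x g by (rule act_tuples[OF that])
    show "act n (act n x g) h = act n x (g \<otimes>\<^bsub>GL n\<^esub> h)" if "x \<in> tuples n" "g \<in> GLint n" "h \<in> GLint n" for x g h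
      using act_mult[OF tuples_D(2)[OF that(1)] GLint_D(2)[OF that(2)] GLint_D(2)[OF that(3)]] by simp
    show "act n x \<one>\<^bsub>GL n\<^esub> = x" if "x \<in> tuples n" for x using act_one[OF tuples_D(1)[OF that]] by simp
    show "Fil (act n x p) = Fil x" if "x \<in> tuples n" "p \<in> P" "p \<in> GLint n" for x p
      by (rule Fil_act[OF tuples_D(1)[OF that(1)] that(2,3)])
    show "\<exists>p\<in>P. p \<in> GLint n \<and> act n x p = y" if a: "x \<in> tuples n" "y \<in> tuples n" "Fil x = Fil y" for x y
    proof (rule Fil_transitive[OF a])
      fix i assume i: "i < r"
      interpret G: val_module v "graded_piece M (Fil x) i"
        by (rule piece_val_module[OF Fil_filt[OF tuples_D(2)[OF a(1)]] i])
      \<comment> \<open>A power of the uniformizer that kills the graded piece is supplied by the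
        pair of lattices behind \<open>KGr\<close>.\<close>
      obtain k where "G.torsion k" using KGr[OF Fil_admissible[OF a(1)] i] by (rule G.module_groups_stab)
      then show "\<exists>k. G.torsion k" by (rule exI)
    qed
  qed
  have KO: "K = (\<lambda>s. \<phi> \<otimes>\<^bsub>GL n\<^esub> s \<otimes>\<^bsub>GL n\<^esub> inv\<^bsub>GL n\<^esub> \<phi>) ` {s \<in> GLint n. act n z s = z}"
    unfolding Keq conj_set_def stab_def by simp
  interpret TF: tensor_family "{..<r}" V
    by (rule tensor_family.intro) (simp_all add: GL_rep_D(2)[OF rep])
  interpret Tm: Module.module class_ring T unfolding T_def by (rule TF.T_module)
  define \<tau> where "\<tau> p = tensor_map {..<r} V (\<lambda>i. \<pi> i (lv p i))" for p
  define \<sigma> where "\<sigma> p t = complex_of_real (modulus_char v ns p powr s) \<odot>\<^bsub>T\<^esub> \<tau> p t" for p t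
  have endo: "TF.endos (\<lambda>i. \<pi> i (lv p i))" if "p \<in> P" for p
    unfolding TF.endos_def using GL_rep_D(3)[OF rep levi_GL[OF that]] by simp
  have \<tau>h: "\<tau> p \<in> module_hom class_ring T T" if "p \<in> P" for p
    unfolding \<tau>_def T_def by (rule TF.tensor_map_hom[OF endo[OF that]])
  note \<tau>D = module_hom_D[OF \<tau>h]
  have \<tau>m: "\<tau> (p * q) t = \<tau> p (\<tau> q t)" if a: "p \<in> P" "q \<in> P" and t: "t \<in> carrier T" for p q t
    unfolding \<tau>_def
  proof (rule TF.tensor_map_comp[OF endo[OF a(1)] endo[OF a(2)] endo[OF P_mult[OF a]]])
    fix i x assume "i \<in> {..<r}" and x: "x \<in> carrier (V i)"
    then have i: "i < r" by simp
    show "\<pi> i (lv (p * q) i) x = \<pi> i (lv p i) (\<pi> i (lv q i) x)"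
      unfolding levi_mult[OF P_D(3)[OF a(1)] P_D(3)[OF a(2)] P_D(2)[OF a(1)] P_D(2)[OF a(2)] i]
      by (rule GL_rep_D(5)[OF rep[OF i] levi_GL[OF a(1) i] levi_GL[OF a(2) i] x])
  qed (use t in \<open>simp only: T_def\<close>)
  have \<tau>1: "\<tau> (1\<^sub>m n) t = t" if t: "t \<in> carrier T" for t
    unfolding \<tau>_def
  proof (rule TF.tensor_map_id[OF endo[OF P_one]])
    fix i x assume "i \<in> {..<r}" and x: "x \<in> carrier (V i)"
    then have i: "i < r" by simp
    show "\<pi> i (lv (1\<^sub>m n) i) x = x" unfolding levi_one[OF i] by (rule GL_rep_D(4)[OF rep[OF i] x])
  qed (use t in \<open>simp only: T_def\<close>)
  have smult1: "1 \<odot>\<^bsub>T\<^esub> t = t" if "t \<in> carrier T" for t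
    using Tm.smult_one[OF that] by (simp only: class_ring_simps)
  \<comment> \<open>The elements of \<open>P\<close> in the relevant stabilizers are integral, so
    the modulus character drops out whatever the exponent \<open>s\<close>.\<close>
  have \<sigma>int: "\<sigma> p t = \<tau> p t" if "p \<in> P" "p \<in> GLint n" "t \<in> carrier T" for p t
    unfolding \<sigma>_def modulus_int[OF that(1,2)] using smult1[OF \<tau>D(1)[OF that(1,3)]] by simp
  have \<sigma>c: "\<sigma> p t \<in> carrier T" if "p \<in> P" "t \<in> carrier T" for p t
    unfolding \<sigma>_def by (rule Tm.smult_closed[OF _ \<tau>D(1)[OF that]]) simp
  have \<sigma>m: "\<sigma> (p * q) t = \<sigma> p (\<sigma> q t)" if a: "p \<in> P" "q \<in> P" and t: "t \<in> carrier T" for p q t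
  proof -
    define x y where "x = complex_of_real (modulus_char v ns p powr s)"
      and "y = complex_of_real (modulus_char v ns q powr s)"
    \<comment> \<open>Multiplicativity of \<open>powr\<close> is applied to positive reals, which is
      what \<open>modulus_pos\<close> supplies.\<close>
    have xy: "complex_of_real (modulus_char v ns (p * q) powr s) = x * y"
      unfolding modulus_mult[OF a] x_def y_def
      using powr_mult[of "modulus_char v ns p" "modulus_char v ns q" s] modulus_pos[OF a(1)] modulus_pos[OF a(2)] by simp
    note q = \<tau>D(1)[OF a(2) t] and pq = \<tau>D(1)[OF a(1) \<tau>D(1)[OF a(2) t]]
    have "\<sigma> (p * q) t = (x * y) \<odot>\<^bsub>T\<^esub> \<tau> p (\<tau> q t)" unfolding \<sigma>_def xy \<tau>m[OF a t] ..
    also have "\<dots> = x \<odot>\<^bsub>T\<^esub> (y \<odot>\<^bsub>T\<^esub> \<tau> p (\<tau> q t))"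
      using Tm.smult_assoc1[OF _ _ pq, of x y] by simp
    also have "y \<odot>\<^bsub>T\<^esub> \<tau> p (\<tau> q t) = \<tau> p (y \<odot>\<^bsub>T\<^esub> \<tau> q t)"
      using \<tau>D(3)[OF a(1) _ q, of y] by simp
    finally show ?thesis unfolding \<sigma>_def x_def y_def .
  qed
  have \<sigma>1: "\<sigma> (1\<^sub>m n) t = t" if "t \<in> carrier T" for t
    unfolding \<sigma>int[OF P_one GLint_one that] by (rule \<tau>1[OF that])
  define U where "U F = {t \<in> carrier T. \<forall>p\<in>P. p \<in> GLint n \<and> act n (X F) p = X F \<longrightarrow> \<tau> p t = t}" for F
  have Ueq: "{t \<in> carrier T. \<forall>p\<in>P. \<forall>k\<in>K. p \<otimes>\<^bsub>GL n\<^esub> g F = g F \<otimes>\<^bsub>GL n\<^esub> k \<longrightarrow> \<sigma> p t = t} = U F"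
    if F: "F \<in> A" for F
  proof -
    note st = O.coset_stabilizer[OF \<phi> z X(1)[OF F] \<kappa>[OF F], folded KO g_def]
    have "(\<forall>k\<in>K. p \<otimes>\<^bsub>GL n\<^esub> g F = g F \<otimes>\<^bsub>GL n\<^esub> k \<longrightarrow> \<sigma> p t = t) \<longleftrightarrow>
        (p \<in> GLint n \<and> act n (X F) p = X F \<longrightarrow> \<tau> p t = t)" if "p \<in> P" "t \<in> carrier T" for p t
    proof -
      have "(\<forall>k\<in>K. p \<otimes>\<^bsub>GL n\<^esub> g F = g F \<otimes>\<^bsub>GL n\<^esub> k \<longrightarrow> \<sigma> p t = t) \<longleftrightarrow>
          ((\<exists>k\<in>K. p \<otimes>\<^bsub>GL n\<^esub> g F = g F \<otimes>\<^bsub>GL n\<^esub> k) \<longrightarrow> \<sigma> p t = t)" by blast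
      then show ?thesis using st[OF that(1)] \<sigma>int[OF that(1) _ that(2)] by simp
    qed
    then show ?thesis unfolding U_def by (intro Collect_cong conj_cong refl ball_cong)
  qed
  define Fn where "Fn = {f \<in> carrier (GL n) \<rightarrow>\<^sub>E carrier T.
    (\<forall>p\<in>P. \<forall>x\<in>carrier (GL n). f (p \<otimes>\<^bsub>GL n\<^esub> x) = \<sigma> p (f x)) \<and>
    (\<forall>x\<in>carrier (GL n). \<forall>k\<in>K. f (x \<otimes>\<^bsub>GL n\<^esub> k) = f x)}"
  have gG: "g F \<in> carrier (GL n)" if "F \<in> A" for F
    unfolding g_def using GL_mult_closed[OF GLint_D(1)[OF \<kappa>(1)[OF that]] GL_inv(1)[OF \<phi>]] by simp
  have mackey: "bij_betw (\<lambda>f. \<lambda>F\<in>A. f (g F)) Fn (\<Pi>\<^sub>E F\<in>A. U F)"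
  proof -
    have "bij_betw (\<lambda>f. \<lambda>F\<in>A. f (g F)) Fn
      (\<Pi>\<^sub>E F\<in>A. {t \<in> carrier T. \<forall>p\<in>P. \<forall>k\<in>K. p \<otimes>\<^bsub>GL n\<^esub> g F = g F \<otimes>\<^bsub>GL n\<^esub> k \<longrightarrow> \<sigma> p t = t})"
      unfolding Fn_def
    proof (rule mackey_bij[OF GL_group P_subgroup Ksub])
      show "\<exists>F\<in>A. \<exists>p\<in>P. \<exists>k\<in>K. x = p \<otimes>\<^bsub>GL n\<^esub> g F \<otimes>\<^bsub>GL n\<^esub> k" if x: "x \<in> carrier (GL n)" for x
      proof -
        have "x \<otimes>\<^bsub>GL n\<^esub> \<phi> \<in> carrier (GL n)" using GL_mult_closed[OF x \<phi>] by simp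
        from O.decomp[OF this] obtain b k where b: "b \<in> P" "k \<in> GLint n" "x \<otimes>\<^bsub>GL n\<^esub> \<phi> = b \<otimes>\<^bsub>GL n\<^esub> k"
          by (elim bexE)
        \<comment> \<open>After the Iwasawa decomposition of \<open>x\<close> times
          \<open>\<phi>\<close>, the filtration of this translate of \<open>z\<close> is the index
          of the double coset of \<open>x\<close>.\<close>
        define y where "y = act n z (inv\<^bsub>GL n\<^esub> k)"
        have y: "y \<in> tuples n" unfolding y_def by (rule act_tuples[OF z GLint_inv[OF b(2)]])
        have F: "Fil y \<in> A" unfolding A_def by (rule CollectI, rule Fil_admissible[OF y])
        have "Fil (X (Fil y)) = Fil (act n z (inv\<^bsub>GL n\<^esub> k))" unfolding X(2)[OF F] unfolding y_def ..
        then have "\<exists>p\<in>P. \<exists>k\<in>K. x = p \<otimes>\<^bsub>GL n\<^esub> g (Fil y) \<otimes>\<^bsub>GL n\<^esub> k"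
          by (rule O.coset_exists[OF \<phi> z X(1)[OF F] \<kappa>[OF F] x b, folded KO g_def])
        then show ?thesis by (rule bexI[where x = "Fil y", OF _ F])
      qed
      show "F = F'" if a: "F \<in> A" "F' \<in> A" "p \<in> P" "k \<in> K" "p \<otimes>\<^bsub>GL n\<^esub> g F \<otimes>\<^bsub>GL n\<^esub> k = g F'" for F F' p k
        using O.coset_unique[OF \<phi> z X(1)[OF a(1)] \<kappa>[OF a(1)] X(1)[OF a(2)] \<kappa>[OF a(2)] a(3), folded KO g_def, OF a(4,5)]
        unfolding X(2)[OF a(1)] X(2)[OF a(2)] .
    qed (simp_all add: \<sigma>c \<sigma>m \<sigma>1 gG)
    then show ?thesis using Ueq by (simp only: cong: PiE_cong)
  qed
  let ?I = "invariants (par_ind v s ns V \<pi>) (right_translation n) K"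
  have carI: "carrier ?I = Fn"
  proof -
    \<comment> \<open>Elements of the induced space are extensional functions, so equality with a
      translate has to be tested on the group only.\<close>
    have tr: "(\<forall>k\<in>K. right_translation n k f = f) \<longleftrightarrow> (\<forall>x\<in>carrier (GL n). \<forall>k\<in>K. f (x \<otimes>\<^bsub>GL n\<^esub> k) = f x)"
      if f: "f \<in> carrier (GL n) \<rightarrow>\<^sub>E carrier T" for f
    proof -
      have "right_translation n k f = f \<longleftrightarrow> (\<forall>x\<in>carrier (GL n). f (x \<otimes>\<^bsub>GL n\<^esub> k) = f x)" for k
      proof
        assume e: "right_translation n k f = f"
        show "\<forall>x\<in>carrier (GL n). f (x \<otimes>\<^bsub>GL n\<^esub> k) = f x"
        proof
          fix x :: "'f mat" assume "x \<in> carrier (GL n)"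
          then show "f (x \<otimes>\<^bsub>GL n\<^esub> k) = f x"
            using fun_cong[OF e, of x] unfolding right_translation_def by simp
        qed
      next
        assume "\<forall>x\<in>carrier (GL n). f (x \<otimes>\<^bsub>GL n\<^esub> k) = f x"
        then show "right_translation n k f = f"
          unfolding right_translation_def by (intro ext) (simp add: restrict_def PiE_arb[OF f])
      qed
      then show ?thesis by blast
    qed
    show ?thesis
    proof (rule Set.set_eqI)
      fix f :: "'f mat \<Rightarrow> ((nat \<Rightarrow> 'v) \<Rightarrow> complex) set"
      let ?equiv = "\<forall>p\<in>P. \<forall>x\<in>carrier (GL n). f (p \<otimes>\<^bsub>GL n\<^esub> x) = \<sigma> p (f x)"
      let ?smooth = "\<lambda>U. subgroup U (GL n) \<and> GL_open v n U \<and> (\<forall>g\<in>carrier (GL n). \<forall>k\<in>U. f (g \<otimes>\<^bsub>GL n\<^esub> k) = f g)"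
      have mem: "f \<in> carrier ?I \<longleftrightarrow> (f \<in> carrier (GL n) \<rightarrow>\<^sub>E carrier T \<and> ?equiv \<and> (\<exists>U. ?smooth U)) \<and>
          (\<forall>k\<in>K. right_translation n k f = f)"
        unfolding invariants_def par_ind_def Let_def \<sigma>_def \<tau>_def T_def
        by (simp only: partial_object.simps partial_object.select_convs partial_object.update_convs mem_Collect_eq)
      have Fn: "f \<in> Fn \<longleftrightarrow> f \<in> carrier (GL n) \<rightarrow>\<^sub>E carrier T \<and> ?equiv \<and>
          (\<forall>x\<in>carrier (GL n). \<forall>k\<in>K. f (x \<otimes>\<^bsub>GL n\<^esub> k) = f x)"
        unfolding Fn_def by (rule mem_Collect_eq)
      show "f \<in> carrier ?I \<longleftrightarrow> f \<in> Fn"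
      proof
        assume "f \<in> carrier ?I"
        then have f: "f \<in> carrier (GL n) \<rightarrow>\<^sub>E carrier T" "?equiv" "\<forall>k\<in>K. right_translation n k f = f"
          unfolding mem by blast+
        show "f \<in> Fn" unfolding Fn by (intro conjI f(1,2) tr[OF f(1), THEN iffD1, OF f(3)])
      next
        assume "f \<in> Fn"
        then have f: "f \<in> carrier (GL n) \<rightarrow>\<^sub>E carrier T" "?equiv" "\<forall>x\<in>carrier (GL n). \<forall>k\<in>K. f (x \<otimes>\<^bsub>GL n\<^esub> k) = f x"
          unfolding Fn by blast+
        \<comment> \<open>The group \<open>K\<close> is itself an open subgroup, so invariance under
          \<open>K\<close> already implies the smoothness required in
          \<open>par_ind\<close>.\<close>
        have "?smooth K" by (intro conjI Ksub Kopen f(3))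
        then have "\<exists>U. ?smooth U" by (rule exI[where x = K])
        then show "f \<in> carrier ?I" unfolding mem by (intro conjI f(1,2) tr[OF f(1), THEN iffD2, OF f(3)])
      qed
    qed
  qed
  define TU where "TU F = T\<lparr>carrier := U F\<rparr>" for F
  have cS: "carrier (direct_sum_family A TU) = (\<Pi>\<^sub>E F\<in>A. U F)"
    using finA by (simp add: direct_sum_family_def TU_def)
  have hom: "(\<lambda>f. \<lambda>F\<in>A. f (g F)) \<in> module_hom class_ring ?I (direct_sum_family A TU)"
  proof (rule module_hom_I)
    show "(\<lambda>F\<in>A. f (g F)) \<in> carrier (direct_sum_family A TU)" if "f \<in> carrier ?I" for f
      using bij_betwE[OF mackey] that unfolding carI cS by blast
    show "(\<lambda>F\<in>A. (f \<oplus>\<^bsub>?I\<^esub> f') (g F)) = (\<lambda>F\<in>A. f (g F)) \<oplus>\<^bsub>direct_sum_family A TU\<^esub> (\<lambda>F\<in>A. f' (g F))" for f f'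
      by (intro ext) (simp add: invariants_def par_ind_def Let_def direct_sum_family_def TU_def gG T_def)
    show "(\<lambda>F\<in>A. (c \<odot>\<^bsub>?I\<^esub> f) (g F)) = c \<odot>\<^bsub>direct_sum_family A TU\<^esub> (\<lambda>F\<in>A. f (g F))" for c f
      by (intro ext) (simp add: invariants_def par_ind_def Let_def direct_sum_family_def TU_def gG T_def)
  qed
  have "modules_isomorphic class_ring ?I (direct_sum_family A TU)"
    unfolding modules_isomorphic_def by (rule bexI[OF _ hom]) (rule mackey[folded carI cS])
  moreover have "modules_isomorphic class_ring (direct_sum_family A TU)
      (direct_sum_family A (\<lambda>F. tensor_product {..<r} (\<lambda>i. invariants (V i) (\<pi> i) (KGr F i))))"
  proof (rule direct_sum_isomorphic[OF finA])
    fix F assume F: "F \<in> A"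
    have L: "KGr F i \<in> module_groups v (ns ! i) (graded_piece M (Fil (X F)) i)" if "i < r" for i
      unfolding X(2)[OF F] using KGr[OF _ that] F unfolding A_def by simp
    show "modules_isomorphic class_ring (TU F) (tensor_product {..<r} (\<lambda>i. invariants (V i) (\<pi> i) (KGr F i)))"
      unfolding TU_def U_def T_def \<tau>_def by (rule fixed_isomorphic[OF rep X(1)[OF F] L])
  qed
  ultimately show ?thesis unfolding A_def by (rule modules_isomorphic_trans)
qed

end

text \<open>Normalized and unnormalized induction are treated at once, since the twist is trivial on
  the integral elements of \<open>P\<close>. The sets \<open>K\<close> and \<open>KGr\<close> stand
  for arbitrary choices in the conjugacy classes attached to \<open>M\<close> and to the graded
  pieces.\<close>

theorem proposition5p2:
  fixes v :: "'f::field_char_0 \<Rightarrow> int"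
    and n :: nat and ns :: "nat list"
    and V :: "nat \<Rightarrow> (complex, 'v) module"
    and \<pi> :: "nat \<Rightarrow> 'f mat \<Rightarrow> 'v \<Rightarrow> 'v"
    and M :: "('f, 'm) module"
    and K :: "'f mat set"
    and KGr :: "'m set list \<Rightarrow> nat \<Rightarrow> 'f mat set"
    and s :: real
  assumes "nonarch_local_field v"
    and "n \<ge> 1" and "n = sum_list ns" and "\<forall>m\<in>set ns. m \<ge> 1"
    and "\<And>i. i < length ns \<Longrightarrow> finite_length_rep v (ns ! i) (V i) (\<pi> i)"
    and "finite_length_module (val_ring v) M"
    and "generated_by_at_most (val_ring v) M n"
    and "K \<in> module_groups v n M"
    and "\<And>F i. admissible_filtration v ns M F \<Longrightarrow> i < length ns \<Longrightarrow>
      KGr F i \<in> module_groups v (ns ! i) (graded_piece M F i)"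
    and "s = 1/2 \<or> s = 0"
  shows "modules_isomorphic class_ring
    (invariants (par_ind v s ns V \<pi>) (right_translation n) K)
    (direct_sum_family {F. admissible_filtration v ns M F}
      (\<lambda>F. tensor_product {..<length ns} (\<lambda>i. invariants (V i) (\<pi> i) (KGr F i))))"
proof -
  have M: "Module.module (val_ring v) M" using assms(6) by (simp add: finite_length_module_def)
  interpret filtered v ns M
    by (intro filtered.intro parabolic.intro val_module.intro assms(1) M)
  have "GL_rep (ns ! i) (V i) (\<pi> i)" if "i < length ns" for i
    using assms(5)[OF that] by (simp add: finite_length_rep_def smooth_rep_def)
  then show ?thesis
    unfolding assms(3) by (rule parabolic_invariants[OF _ assms(8)[unfolded assms(3)] assms(9)])
qed

end
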